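(* Let $\Omega\subset\mathbb R^3$ be an arbitrary (possibly unbounded) open set. Coefficients: let $a_0,a_1\in]0,\infty[$ and $a_{ij}=a_{ji}\in L^\infty(\Omega)$ ($i,j=1,2,3$) satisfy $a_0|\xi|^2\le\sum_{i,j=1}^3a_{ij}(x)\xi_i\xi_j\le a_1|\xi|^2$ for all $\xi\in\mathbb R^3$ and a.e. $x\in\Omega$; put $A(x)=(a_{ij}(x))_{i,j}$. Let $\beta\colon\Omega\to\mathbb R$ be measurable such that (a) for every $\nu>0$ there is $C_\nu>0$ with $\int_\Omega|\beta||u|^2\,dx\le\nu\int_\Omega|\nabla u|^2\,dx+C_\nu\int_\Omega|u|^2\,dx$ for all $u\in H^1_0(\Omega)$; (b) there is $\lambda_1>0$ with $\int_\Omega A\nabla u\cdot\nabla u\,dx+\int_\Omega\beta|u|^2\,dx\ge\lambda_1\int_\Omega|u|^2\,dx$ for all $u\in H^1_0(\Omega)$. Nonlinearity: let $f\colon\Omega\times\mathbb R\to\mathbb R$ be such that $f(\cdot,u)$ is measurable for every $u\in\mathbb R$, $f(\cdot,0)\in L^2(\Omega)$, for a.e. $x\in\Omega$ the function $f(x,\cdot)$ is of class $C^2$, $\partial_uf(\cdot,0)\in L^\infty(\Omega)$, $\partial_{uu}f(\cdot,0)\in L^\infty(\Omega)$, and there is a constant $C>0$ such that $|\partial_{uu}f(x,u_1)-\partial_{uu}f(x,u_2)|\le C|u_1-u_2|$ for a.e. $x\in\Omega$ and all $u_1,u_2\in\mathbb R$. For every $\epsilon\in]0,1]$ let $(\bar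 u_\epsilon(\cdot),\bar v_\epsilon(\cdot))\colon\mathbb R\to Z_0$ be a bounded full solution of the damped wave equation with parameter $\epsilon$ (see context) such that $\sup_{t\in\mathbb R}(\|\bar u_\epsilon(t)\|_{H^1_0}^2+\epsilon\|\bar v_\epsilon(t)\|_{L^2}^2)\le R$, with $R$ independent of $\epsilon$. Assume that for every $\epsilon\in]0,1]$ the first component $\bar u_\epsilon(\cdot)\colon\mathbb R\to H^1_0(\Omega)$ is uniformly continuous. Then there exists a constant $\tilde R>0$ such that for every $\epsilon\in]0,1]$ $$\sup_{t\in\mathbb R}\big(\|\mathbf A_0\bar u_\epsilon(t)\|_{L^2}^2+\|\bar v_\epsilon(t)\|_{H^1_0}^2+\epsilon\|(\partial_t\mid H_0)\bar v_\epsilon(t)\|_{L^2}^2\big)\le\tilde R$$ (in particular all the quantities on the left are well defined). The constant $\tilde R$ depends only on $R$ and on the constants in the assumptions on the coefficients and on the nonlinearity (i.e. $a_0,a_1,\lambda_1$, the map $\nu\mapsto C_\nu$, $C$, $\|f(\cdot,0)\|_{L^2}$, $\|\partial_uf(\cdot,0)\|_{L^\infty}$, $\|\partial_{uu}f(\cdot,0)\|_{L^\infty}$).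
   Context: The equation with parameter $\epsilon$ is $\epsilon u_{tt}+u_t+\beta(x)u-\sum_{ij}(a_{ij}(x)u_{x_j})_{x_i}=f(x,u)$ in $\Omega$, with $u=0$ on $\partial\Omega$. Spaces and operators. $H^1_0(\Omega)$ carries the scalar product $\langle u,v\rangle_{H^1_0}=\int_\Omega A\nabla u\cdot\nabla v\,dx+\int_\Omega\beta uv\,dx$ (equivalent to the usual one), with norm $\|\cdot\|_{H^1_0}$. $\mathbf A=\mathbf A_0$ is the positive selfadjoint operator on $H_0:=L^2(\Omega)$ defined by this form (i.e. by $u\mapsto\beta u-\sum_{ij}(a_{ij}u_{x_j})_{x_i}$). $Z_0=H^1_0(\Omega)\times L^2(\Omega)$, $Z_1=D(\mathbf A)\times H^1_0(\Omega)$, and $\mathbf B_{\epsilon,0}\colon Z_1\to Z_0$, $\mathbf B_{\epsilon,0}(u,v)=(v,-(1/\epsilon)(v+\mathbf Au))$, generates a $C^0$-semigroup $\mathbf T_{\epsilon,0}(t)$, $t\ge0$, on $Z_0$. $\hat f(u)(x):=f(x,u(x))$; under the assumptions $\hat f$ maps $H^1_0(\Omega)$ into $L^2(\Omega)$ and is $C^1$. A full solution (for the parameter $\epsilon$) is a function $(u,v)\colon\mathbb R\to Z_0$ such that for all $s\le t$ in $\mathbb R$, $(u(t),v(t))=\mathbf T_{\epsilon,0}(t-s)(u(s),v(s))+\int_s^t\mathbf T_{\epsilon,0}(t-p)(0,(1/\epsilon)\hat f(u(p)))\,dp$ (integral in $Z_0$). $(\partial_t\mid H_0)$ denotes the $t$-derivative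 of a function regarded as taking values in $L^2(\Omega)$. *)

theory Defs
  imports "HOL-Analysis.Analysis" "HOL-Probability.Essential_Supremum"
begin

section \<open>The Hilbert space \<open>L\<^sup>2\<close> over three-dimensional space\<close>

type_synonym R3 = "real^3"

definition square_integrable :: "'a measure \<Rightarrow> ('a \<Rightarrow> real) \<Rightarrow> bool" where
  "square_integrable M f \<longleftrightarrow> f \<in> borel_measurable M \<and> integrable M (\<lambda>x. (f x)\<^sup>2)"

lemma square_integrable_mult:
  assumes "square_integrable M f" "square_integrable M g"
  shows "integrable M (\<lambda>x. f x * g x)"
proof (rule Bochner_Integration.integrable_bound)
  show "integrable M (\<lambda>x. (f x)\<^sup>2 + (g x)\<^sup>2)"
    using assms by (auto simp: square_integrable_def)
  show "(\<lambda>x. f x * g x) \<in> borel_measurable M"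
    using assms by (auto simp: square_integrable_def)
  have "\<bar>a * b\<bar> \<le> a\<^sup>2 + b\<^sup>2" for a b :: real
  proof -
    have "2 * \<bar>a\<bar> * \<bar>b\<bar> \<le> a\<^sup>2 + b\<^sup>2"
      using sum_squares_bound[of "\<bar>a\<bar>" "\<bar>b\<bar>"] by simp
    moreover have "0 \<le> \<bar>a\<bar> * \<bar>b\<bar>" by simp
    ultimately show ?thesis unfolding abs_mult by linarith
  qed
  then show "AE x in M. norm (f x * g x) \<le> norm ((f x)\<^sup>2 + (g x)\<^sup>2)"
    by (simp add: abs_mult)
qed

lemma square_integrable_add:
  assumes "square_integrable M f" "square_integrable M g"
  shows "square_integrable M (\<lambda>x. f x + g x)"
proof -
  have "integrable M (\<lambda>x. (f x)\<^sup>2 + (g x)\<^sup>2 + 2 * (f x * g x))"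
    using assms square_integrable_mult[OF assms] by (auto simp: square_integrable_def)
  moreover have "(\<lambda>x. (f x)\<^sup>2 + (g x)\<^sup>2 + 2 * (f x * g x)) = (\<lambda>x. (f x + g x)\<^sup>2)"
    by (auto simp: power2_sum)
  ultimately show ?thesis using assms by (auto simp: square_integrable_def)
qed

lemma square_integrable_scale:
  "square_integrable M f \<Longrightarrow> square_integrable M (\<lambda>x. c * f x)"
  by (auto simp: square_integrable_def power_mult_distrib)

lemma square_integrable_zero: "square_integrable M (\<lambda>x. 0)"
  by (auto simp: square_integrable_def)

quotient_type l2 = "R3 \<Rightarrow> real" / partial:
  "\<lambda>f g. square_integrable lebesgue f \<and> square_integrable lebesgue g \<and>
     (AE x in lebesgue. f x = g x)"
proof (rule part_equivpI)
  show "\<exists>f :: R3 \<Rightarrow> real. square_integrable lebesgue f \<and> square_integrable lebesgue f \<and>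
     (AE x in lebesgue. f x = f x)"
    by (intro exI[of _ "\<lambda>x. 0"]) (simp add: square_integrable_zero)
  show "symp (\<lambda>f (g :: R3 \<Rightarrow> real). square_integrable lebesgue f \<and> square_integrable lebesgue g \<and>
     (AE x in lebesgue. f x = g x))"
    by (auto simp: symp_def elim: eventually_mono)
  show "transp (\<lambda>f (g :: R3 \<Rightarrow> real). square_integrable lebesgue f \<and> square_integrable lebesgue g \<and>
     (AE x in lebesgue. f x = g x))"
    by (auto simp: transp_def elim: eventually_elim2)
qed

instantiation l2 :: real_inner
begin

lift_definition zero_l2 :: l2 is "\<lambda>x. 0"
  by (simp add: square_integrable_zero)

lift_definition plus_l2 :: "l2 \<Rightarrow> l2 \<Rightarrow> l2" is "\<lambda>f g x. f x + g x"
  by (auto intro: square_integrable_add elim: eventually_elim2)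

lift_definition scaleR_l2 :: "real \<Rightarrow> l2 \<Rightarrow> l2" is "\<lambda>c f x. c * f x"
  by (auto intro: square_integrable_scale elim: eventually_mono)

lift_definition inner_l2 :: "l2 \<Rightarrow> l2 \<Rightarrow> real" is "\<lambda>f g. LINT x|lebesgue. f x * g x"
proof -
  fix f f' g g' :: "R3 \<Rightarrow> real"
  assume "square_integrable lebesgue f \<and> square_integrable lebesgue f' \<and> (AE x in lebesgue. f x = f' x)"
    and "square_integrable lebesgue g \<and> square_integrable lebesgue g' \<and> (AE x in lebesgue. g x = g' x)"
  then show "(LINT x|lebesgue. f x * g x) = (LINT x|lebesgue. f' x * g' x)"
    by (intro integral_cong_AE) (auto simp: square_integrable_def elim: eventually_elim2)
qed

definition "uminus (u :: l2) = (-1) *\<^sub>R u"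
definition "u - (v :: l2) = u + (-1) *\<^sub>R v"
definition "norm (u :: l2) = sqrt (inner u u)"
definition "sgn (u :: l2) = inverse (norm u) *\<^sub>R u"
definition "dist u (v :: l2) = norm (u - v)"
definition "(uniformity :: (l2 \<times> l2) filter) = (INF e\<in>{0<..}. principal {(x, y). dist x y < e})"
definition "open (U :: l2 set) = (\<forall>x\<in>U. \<forall>\<^sub>F (x', y) in uniformity. x' = x \<longrightarrow> y \<in> U)"

instance
proof
  fix u v w :: l2 and c d :: real
  show "u + v + w = u + (v + w)"
    by transfer (auto intro!: square_integrable_add)
  show "u + v = v + u"
    by transfer (auto intro!: square_integrable_add simp: add.commute)
  show "0 + u = u"
    by transfer (auto intro!: square_integrable_add square_integrable_zero)
  show "- u + u = 0"
    unfolding uminus_l2_def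
    by transfer (auto intro!: square_integrable_add square_integrable_scale square_integrable_zero dest: square_integrable_scale[where c = "-1"])
  show "u - v = u + - v" by (simp add: uminus_l2_def minus_l2_def)
  show "c *\<^sub>R (u + v) = c *\<^sub>R u + c *\<^sub>R v"
    by transfer (auto intro!: square_integrable_add square_integrable_scale
      simp: algebra_simps)
  show "(c + d) *\<^sub>R u = c *\<^sub>R u + d *\<^sub>R u"
    by transfer (auto intro!: square_integrable_add square_integrable_scale
      simp: algebra_simps)
  show "c *\<^sub>R d *\<^sub>R u = (c * d) *\<^sub>R u"
    by transfer (auto intro!: square_integrable_scale simp: algebra_simps)
  show "1 *\<^sub>R u = u" by transfer (auto)
  show "dist u v = norm (u - v)" "sgn u = inverse (norm u) *\<^sub>R u"
    "norm u = sqrt (inner u u)"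
    by (simp_all add: dist_l2_def sgn_l2_def norm_l2_def)
  show "(uniformity :: (l2 \<times> l2) filter) = (INF e\<in>{0<..}. principal {(x, y). dist x y < e})"
    by (simp add: uniformity_l2_def)
  show "open U = (\<forall>x\<in>U. \<forall>\<^sub>F (x', y) in uniformity. x' = x \<longrightarrow> y \<in> U)" for U :: "l2 set"
    by (simp add: open_l2_def)
  show "inner u v = inner v u" by transfer (simp add: mult.commute)
  show "inner (u + v) w = inner u w + inner v w"
    by transfer (simp add: distrib_right square_integrable_mult)
  show "inner (c *\<^sub>R u) v = c * inner u v" by transfer (simp add: mult.assoc)
  show "0 \<le> inner u u" by transfer simp
  show "(inner u u = 0) = (u = 0)"
  proof (transfer, goal_cases)
    case (1 f)
    then have "(LINT x|lebesgue. f x * f x) = 0 \<longleftrightarrow> (AE x in lebesgue. f x * f x = 0)"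
      by (intro integral_nonneg_eq_0_iff_AE) (auto intro: square_integrable_mult)
    with 1 show ?case by (auto simp: square_integrable_zero)
  qed
qed

end

text \<open>\<^const>\<open>rep_l2\<close> picks a representative of a class; \<open>mk_l2\<close> is only meaningful on
  square-integrable functions.\<close>

definition mk_l2 :: "(R3 \<Rightarrow> real) \<Rightarrow> l2" where
  "mk_l2 f = (if square_integrable lebesgue f then abs_l2 f else 0)"

lemma mk_l2_rep: "square_integrable lebesgue (rep_l2 u)" "mk_l2 (rep_l2 u) = u"
  using Quotient_rep_reflp[OF Quotient_l2, of u] Quotient_abs_rep[OF Quotient_l2, of u]
  by (auto simp: mk_l2_def)

lemma rep_mk_l2:
  assumes "square_integrable lebesgue f"
  shows "AE x in lebesgue. rep_l2 (mk_l2 f) x = f x"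
  using rep_abs_rsp_left[OF Quotient3_l2, of f f] assms by (simp add: mk_l2_def)

text \<open>\<open>L\<^sup>2(\<Omega>)\<close> is identified, through extension by zero, with the closed subspace of
  classes vanishing almost everywhere outside \<open>\<Omega>\<close>.\<close>

definition L2 :: "R3 set \<Rightarrow> l2 set" where
  "L2 \<Omega> = {u. AE x in lebesgue. x \<notin> \<Omega> \<longrightarrow> rep_l2 u x = 0}"


section \<open>Sobolev spaces\<close>

definition partial_deriv :: "3 \<Rightarrow> (R3 \<Rightarrow> real) \<Rightarrow> R3 \<Rightarrow> real" where
  "partial_deriv i \<phi> x = frechet_derivative \<phi> (at x) (axis i 1)"

fun C_k :: "nat \<Rightarrow> (R3 \<Rightarrow> real) \<Rightarrow> bool" where
  "C_k 0 \<phi> \<longleftrightarrow> continuous_on UNIV \<phi>"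
| "C_k (Suc k) \<phi> \<longleftrightarrow> (\<forall>x. \<phi> differentiable (at x)) \<and> (\<forall>i. C_k k (partial_deriv i \<phi>))"

definition test_function :: "R3 set \<Rightarrow> (R3 \<Rightarrow> real) \<Rightarrow> bool" where
  "test_function \<Omega> \<phi> \<longleftrightarrow> (\<forall>k. C_k k \<phi>) \<and>
     compact (closure {x. \<phi> x \<noteq> 0}) \<and> closure {x. \<phi> x \<noteq> 0} \<subseteq> \<Omega>"

text \<open>\<open>H\<^sup>1(\<real>\<^sup>3)\<close>: an element carries its function and its weak gradient.\<close>

typedef h1 = "{(u :: l2, g :: l2^3). \<forall>i \<phi>. test_function UNIV \<phi> \<longrightarrow>
    inner (g $ i) (mk_l2 \<phi>) = - inner u (mk_l2 (partial_deriv i \<phi>))}"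
  by (rule exI[of _ "(0, 0)"]) simp

lifting_forget l2.lifting
setup_lifting type_definition_h1

lift_definition h1_l2 :: "h1 \<Rightarrow> l2" is fst .
lift_definition grad :: "h1 \<Rightarrow> l2^3" is snd .

instantiation h1 :: real_inner
begin

lift_definition zero_h1 :: h1 is "(0, 0)" by simp
lift_definition plus_h1 :: "h1 \<Rightarrow> h1 \<Rightarrow> h1" is "(+)"
  by (auto simp: inner_add_left)
lift_definition minus_h1 :: "h1 \<Rightarrow> h1 \<Rightarrow> h1" is "(-)"
  by (auto simp: inner_diff_left)
lift_definition uminus_h1 :: "h1 \<Rightarrow> h1" is "uminus"
  by auto
lift_definition scaleR_h1 :: "real \<Rightarrow> h1 \<Rightarrow> h1" is "(*\<^sub>R)"
  by auto
lift_definition inner_h1 :: "h1 \<Rightarrow> h1 \<Rightarrow> real" is inner .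

definition "norm (u :: h1) = sqrt (inner u u)"
definition "sgn (u :: h1) = inverse (norm u) *\<^sub>R u"
definition "dist u (v :: h1) = norm (u - v)"
definition "(uniformity :: (h1 \<times> h1) filter) = (INF e\<in>{0<..}. principal {(x, y). dist x y < e})"
definition "open (U :: h1 set) = (\<forall>x\<in>U. \<forall>\<^sub>F (x', y) in uniformity. x' = x \<longrightarrow> y \<in> U)"

instance
proof
  fix u v w :: h1 and c d :: real
  show "u + v + w = u + (v + w)" by transfer auto
  show "u + v = v + u" by transfer auto
  show "0 + u = u" by transfer (auto simp: zero_prod_def)
  show "- u + u = 0" by transfer (auto simp: zero_prod_def)
  show "u - v = u + - v" by transfer auto
  show "c *\<^sub>R (u + v) = c *\<^sub>R u + c *\<^sub>R v" by transfer (simp only: scaleR_right_distrib)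
  show "(c + d) *\<^sub>R u = c *\<^sub>R u + d *\<^sub>R u" by transfer (simp only: scaleR_left_distrib)
  show "c *\<^sub>R d *\<^sub>R u = (c * d) *\<^sub>R u" by transfer (simp only: scaleR_scaleR)
  show "1 *\<^sub>R u = u" by transfer (simp only: scaleR_one)
  show "dist u v = norm (u - v)" "sgn u = inverse (norm u) *\<^sub>R u"
    "norm u = sqrt (inner u u)"
    by (simp_all add: dist_h1_def sgn_h1_def norm_h1_def)
  show "(uniformity :: (h1 \<times> h1) filter) = (INF e\<in>{0<..}. principal {(x, y). dist x y < e})"
    by (simp add: uniformity_h1_def)
  show "open U = (\<forall>x\<in>U. \<forall>\<^sub>F (x', y) in uniformity. x' = x \<longrightarrow> y \<in> U)" for U :: "h1 set"
    by (simp add: open_h1_def)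
  show "inner u v = inner v u" by transfer (simp only: inner_commute)
  show "inner (u + v) w = inner u w + inner v w" by transfer (simp only: inner_add_left)
  show "inner (c *\<^sub>R u) v = c * inner u v" by transfer (simp only: inner_scaleR_left)
  show "0 \<le> inner u u" by transfer (simp only: inner_ge_zero)
  show "(inner u u = 0) = (u = 0)"
    by transfer (simp only: inner_eq_zero_iff zero_prod_def)
qed

end

lemma norm_h1_eq: "(norm u)\<^sup>2 = (norm (h1_l2 u))\<^sup>2 + (\<Sum>i\<in>UNIV. (norm (grad u $ i))\<^sup>2)"
proof -
  have "inner u u = inner (h1_l2 u) (h1_l2 u) + inner (grad u) (grad u)"
    by transfer (auto simp: inner_prod_def)
  then show ?thesis
    by (simp add: power2_norm_eq_inner inner_vec_def)
qed

abbreviation h1_fun :: "h1 \<Rightarrow> R3 \<Rightarrow> real" where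
  "h1_fun u \<equiv> rep_l2 (h1_l2 u)"

definition grad_fun :: "h1 \<Rightarrow> R3 \<Rightarrow> R3" where
  "grad_fun u x = (\<chi> i. rep_l2 (grad u $ i) x)"

text \<open>The closure of the test functions on \<open>\<Omega>\<close> in the \<open>H\<^sup>1\<close> norm, again with functions on
  \<open>\<Omega>\<close> extended by zero.\<close>

definition H10 :: "R3 set \<Rightarrow> h1 set" where
  "H10 \<Omega> = closure {u. \<exists>\<phi>. test_function \<Omega> \<phi> \<and> h1_l2 u = mk_l2 \<phi>}"


section \<open>The form and its selfadjoint operator\<close>

definition form :: "R3 set \<Rightarrow> (R3 \<Rightarrow> real^3^3) \<Rightarrow> (R3 \<Rightarrow> real) \<Rightarrow> h1 \<Rightarrow> h1 \<Rightarrow> real" where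
  "form \<Omega> a \<beta> u w =
     (LINT x|lebesgue_on \<Omega>. (a x *v grad_fun u x) \<bullet> grad_fun w x) +
     (LINT x|lebesgue_on \<Omega>. \<beta> x * h1_fun u x * h1_fun w x)"

definition dom_A :: "R3 set \<Rightarrow> (R3 \<Rightarrow> real^3^3) \<Rightarrow> (R3 \<Rightarrow> real) \<Rightarrow> h1 set" where
  "dom_A \<Omega> a \<beta> = {u \<in> H10 \<Omega>. \<exists>w\<in>L2 \<Omega>. \<forall>\<phi>\<in>H10 \<Omega>. form \<Omega> a \<beta> u \<phi> = w \<bullet> h1_l2 \<phi>}"

definition op_A :: "R3 set \<Rightarrow> (R3 \<Rightarrow> real^3^3) \<Rightarrow> (R3 \<Rightarrow> real) \<Rightarrow> h1 \<Rightarrow> l2" where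
  "op_A \<Omega> a \<beta> u = (THE w. w \<in> L2 \<Omega> \<and> (\<forall>\<phi>\<in>H10 \<Omega>. form \<Omega> a \<beta> u \<phi> = w \<bullet> h1_l2 \<phi>))"


section \<open>Strongly continuous semigroups\<close>

definition C0_semigroup_on :: "'a::real_normed_vector set \<Rightarrow> (real \<Rightarrow> 'a \<Rightarrow> 'a) \<Rightarrow> bool" where
  "C0_semigroup_on X T \<longleftrightarrow>
     (\<forall>t\<ge>0. (\<forall>x\<in>X. T t x \<in> X) \<and>
        (\<forall>x\<in>X. \<forall>y\<in>X. T t (x + y) = T t x + T t y) \<and>
        (\<forall>c. \<forall>x\<in>X. T t (c *\<^sub>R x) = c *\<^sub>R T t x) \<and>
        (\<exists>K. \<forall>x\<in>X. norm (T t x) \<le> K * norm x)) \<and>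
     (\<forall>x\<in>X. T 0 x = x) \<and>
     (\<forall>s\<ge>0. \<forall>t\<ge>0. \<forall>x\<in>X. T (s + t) x = T s (T t x)) \<and>
     (\<forall>x\<in>X. ((\<lambda>t. T t x) \<longlongrightarrow> x) (at_right 0))"

text \<open>Unbounded operators are represented by their graphs.\<close>

definition generator :: "'a::real_normed_vector set \<Rightarrow> (real \<Rightarrow> 'a \<Rightarrow> 'a) \<Rightarrow> ('a \<times> 'a) set" where
  "generator X T = {(x, y). x \<in> X \<and> y \<in> X \<and>
     ((\<lambda>h. (T h x - x) /\<^sub>R h) \<longlongrightarrow> y) (at_right 0)}"


section \<open>The damped wave equation\<close>

definition Z0 :: "R3 set \<Rightarrow> (h1 \<times> l2) set" where
  "Z0 \<Omega> = H10 \<Omega> \<times> L2 \<Omega>"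

definition op_B :: "R3 set \<Rightarrow> (R3 \<Rightarrow> real^3^3) \<Rightarrow> (R3 \<Rightarrow> real) \<Rightarrow> real
    \<Rightarrow> ((h1 \<times> l2) \<times> (h1 \<times> l2)) set" where
  "op_B \<Omega> a \<beta> \<epsilon> =
     {((u, h1_l2 v), (v, - (1 / \<epsilon>) *\<^sub>R (h1_l2 v + op_A \<Omega> a \<beta> u))) | u v.
        u \<in> dom_A \<Omega> a \<beta> \<and> v \<in> H10 \<Omega>}"

definition nemytskii :: "R3 set \<Rightarrow> (R3 \<Rightarrow> real \<Rightarrow> real) \<Rightarrow> h1 \<Rightarrow> l2" where
  "nemytskii \<Omega> f u = mk_l2 (\<lambda>x. if x \<in> \<Omega> then f x (h1_fun u x) else 0)"

text \<open>The Henstock--Kurzweil integral is taken in the product norm of \<open>H\<^sup>1 \<times> L\<^sup>2\<close>, which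
  on \<open>Z\<^sub>0\<close> is equivalent to the norm induced by \<^const>\<open>form\<close>; for continuous \<open>u\<close> the
  integrand is continuous, so that it agrees with the Riemann and Bochner integrals.\<close>

definition full_solution :: "R3 set \<Rightarrow> (R3 \<Rightarrow> real \<Rightarrow> real) \<Rightarrow> real
    \<Rightarrow> (real \<Rightarrow> h1 \<times> l2 \<Rightarrow> h1 \<times> l2) \<Rightarrow> (real \<Rightarrow> h1) \<Rightarrow> (real \<Rightarrow> l2) \<Rightarrow> bool" where
  "full_solution \<Omega> f \<epsilon> T u v \<longleftrightarrow>
     (\<forall>t. (u t, v t) \<in> Z0 \<Omega>) \<and>
     (\<forall>s t. s \<le> t \<longrightarrow>
        (\<lambda>p. T (t - p) (0, (1 / \<epsilon>) *\<^sub>R nemytskii \<Omega> f (u p))) integrable_on {s..t} \<and>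
        (u t, v t) = T (t - s) (u s, v s) +
          integral {s..t} (\<lambda>p. T (t - p) (0, (1 / \<epsilon>) *\<^sub>R nemytskii \<Omega> f (u p))))"


section \<open>Assumptions on the coefficients and the nonlinearity\<close>

text \<open>Taking values in \<^typ>\<open>ennreal\<close> makes the norm \<open>0\<close> when \<open>\<Omega>\<close> is empty.\<close>

definition Linf_norm :: "R3 set \<Rightarrow> (R3 \<Rightarrow> real) \<Rightarrow> ennreal" where
  "Linf_norm \<Omega> g = esssup (lebesgue_on \<Omega>) (\<lambda>x. ennreal \<bar>g x\<bar>)"

definition Linf :: "R3 set \<Rightarrow> (R3 \<Rightarrow> real) set" where
  "Linf \<Omega> = {g. g \<in> borel_measurable (lebesgue_on \<Omega>) \<and> Linf_norm \<Omega> g < \<infinity>}"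

definition elliptic_coefficients :: "R3 set \<Rightarrow> real \<Rightarrow> real \<Rightarrow> (R3 \<Rightarrow> real^3^3) \<Rightarrow> bool" where
  "elliptic_coefficients \<Omega> a0 a1 a \<longleftrightarrow>
     (\<forall>i j. (\<lambda>x. a x $ i $ j) \<in> Linf \<Omega>) \<and>
     (\<forall>i j. AE x in lebesgue_on \<Omega>. a x $ i $ j = a x $ j $ i) \<and>
     (AE x in lebesgue_on \<Omega>. \<forall>\<xi>.
        a0 * (norm \<xi>)\<^sup>2 \<le> (\<Sum>i\<in>UNIV. \<Sum>j\<in>UNIV. a x $ i $ j * \<xi> $ i * \<xi> $ j) \<and>
        (\<Sum>i\<in>UNIV. \<Sum>j\<in>UNIV. a x $ i $ j * \<xi> $ i * \<xi> $ j) \<le> a1 * (norm \<xi>)\<^sup>2)"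

definition admissible_potential :: "R3 set \<Rightarrow> (real \<Rightarrow> real) \<Rightarrow> real \<Rightarrow> (R3 \<Rightarrow> real^3^3)
    \<Rightarrow> (R3 \<Rightarrow> real) \<Rightarrow> bool" where
  "admissible_potential \<Omega> Cn lam a \<beta> \<longleftrightarrow>
     \<beta> \<in> borel_measurable (lebesgue_on \<Omega>) \<and>
     (\<forall>\<nu>>0. \<forall>u\<in>H10 \<Omega>.
        integrable (lebesgue_on \<Omega>) (\<lambda>x. \<bar>\<beta> x\<bar> * (h1_fun u x)\<^sup>2) \<and>
        (LINT x|lebesgue_on \<Omega>. \<bar>\<beta> x\<bar> * (h1_fun u x)\<^sup>2) \<le>
          \<nu> * (LINT x|lebesgue_on \<Omega>. (norm (grad_fun u x))\<^sup>2) +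
          Cn \<nu> * (LINT x|lebesgue_on \<Omega>. (h1_fun u x)\<^sup>2)) \<and>
     (\<forall>u\<in>H10 \<Omega>. form \<Omega> a \<beta> u u \<ge> lam * (LINT x|lebesgue_on \<Omega>. (h1_fun u x)\<^sup>2))"

definition C2 :: "(real \<Rightarrow> real) \<Rightarrow> bool" where
  "C2 g \<longleftrightarrow> (\<forall>s. g field_differentiable at s) \<and> (\<forall>s. deriv g field_differentiable at s) \<and>
     continuous_on UNIV (deriv (deriv g))"

text \<open>\<open>K0\<close>, \<open>K1\<close>, \<open>K2\<close> are the values of \<open>\<parallel>f(\<cdot>,0)\<parallel>\<close> in \<open>L\<^sup>2\<close> and of
  \<open>\<parallel>\<partial>\<^sub>uf(\<cdot>,0)\<parallel>\<close>, \<open>\<parallel>\<partial>\<^sub>u\<^sub>uf(\<cdot>,0)\<parallel>\<close> in \<open>L\<^sup>\<infinity>\<close>.\<close>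

definition admissible_nonlinearity :: "R3 set \<Rightarrow> real \<Rightarrow> real \<Rightarrow> real \<Rightarrow> real
    \<Rightarrow> (R3 \<Rightarrow> real \<Rightarrow> real) \<Rightarrow> bool" where
  "admissible_nonlinearity \<Omega> C K0 K1 K2 f \<longleftrightarrow>
     (\<forall>s. (\<lambda>x. f x s) \<in> borel_measurable (lebesgue_on \<Omega>)) \<and>
     square_integrable (lebesgue_on \<Omega>) (\<lambda>x. f x 0) \<and>
     sqrt (LINT x|lebesgue_on \<Omega>. (f x 0)\<^sup>2) = K0 \<and>
     (AE x in lebesgue_on \<Omega>. C2 (f x)) \<and>
     (\<lambda>x. deriv (f x) 0) \<in> Linf \<Omega> \<and>
     Linf_norm \<Omega> (\<lambda>x. deriv (f x) 0) = ennreal K1 \<and>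
     (\<lambda>x. deriv (deriv (f x)) 0) \<in> Linf \<Omega> \<and>
     Linf_norm \<Omega> (\<lambda>x. deriv (deriv (f x)) 0) = ennreal K2 \<and>
     (AE x in lebesgue_on \<Omega>. \<forall>s1 s2.
        \<bar>deriv (deriv (f x)) s1 - deriv (deriv (f x)) s2\<bar> \<le> C * \<bar>s1 - s2\<bar>)"

end

theory Submission
  imports Defs
begin

text \<open>The a priori estimates are carried out for \<open>\<epsilon> u'' + u' + A u = f(u)\<close> in a pair of
  Hilbert spaces, where \<open>f\<close> has a formal derivative \<open>P\<close> that is symmetric and obeys the bounds
  which the Sobolev inequality \<open>H\<^sup>1 \<subseteq> L\<^sup>6\<close> provides for a cubic nonlinearity.

  For fixed \<open>\<epsilon>\<close>, a difference quotient \<open>(w, y)\<close> of \<open>(u, u')\<close> solves the linearised equation up to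
  a small error. With \<open>c = u(t\<^sub>0)\<close> frozen, the energy
  \<open>\<epsilon> \<bar>y\<bar>\<^sup>2 + \<langle>A w, w\<rangle> - \<langle>P(c) w, w\<rangle> + (2 \<epsilon> \<langle>w, y\<rangle> + \<bar>w\<bar>\<^sup>2) / 4\<close> decays, up to a bounded term, during a time
  fixed by the modulus of continuity of \<open>u\<close>. Hence difference quotients are bounded over all of
  \<open>\<real>\<close>, \<open>u\<close> takes values in the domain of \<open>A\<close>, and \<open>(u', u'')\<close> is a bounded solution of the
  linearised equation; the bound still depends on \<open>\<epsilon>\<close>.

  Symmetry of \<open>P\<close> makes \<open>f\<close> a gradient, so \<open>\<integral> \<bar>u'\<bar>\<^sup>2 \<le> D\<close> over \<open>\<real>\<close> with \<open>D\<close> independent of \<open>\<epsilon>\<close>. The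
  energy \<open>E\<close> of \<open>(u', u'')\<close> satisfies \<open>E' \<le> - E / 5 + (c + 4 L\<^sup>2 E) \<bar>u'\<bar>\<^sup>2\<close>; since \<open>E\<close> is bounded near
  \<open>- \<infinity>\<close>, Gronwall's inequality bounds it by \<open>exp (4 L\<^sup>2 D) c D\<close>.\<close>

section \<open>Hilbert space preliminaries\<close>

text \<open>The assumed bound controls \<open>u'\<close> only with a factor
  \<open>\<epsilon>\<close>. What is uniform in \<open>\<epsilon>\<close> is an integral over time,
  and it measures \<open>u'\<close> in \<open>L^2\<close> rather than in the energy norm. Hence the
  drift of \<open>P(u(t))\<close> must be paid for with the \<open>L^2\<close> norm of the increment
  of \<open>u\<close> and two energy norms of \<open>w\<close>; in dimension three, cubic growth and
  the embedding into \<open>L^6\<close> allow exactly this. As \<open>P\<close> is only known to be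
  Lipschitz in its base point, the final energy is handled through upper bounds on right difference
  quotients. The uniform argument starts at minus infinity and presupposes that \<open>u'\<close>
  takes values in the energy space and is bounded there; the estimate for fixed
  \<open>\<epsilon>\<close> serves to supply this. Elements of \<open>H^1_0\<close> are pairs of a
  function and a weak gradient. That such a pair is determined by its function, and that these
  functions are dense in \<open>L^2(\<Omega>)\<close>, is extracted from the semigroup, whose
  generator is single valued and densely defined.\<close>

lemma hilbert_weak_cluster_point:
  fixes x :: "nat \<Rightarrow> 'a::{real_inner,complete_space}"
  assumes bound: "\<And>n. norm (x n) \<le> B"
  obtains z where
    "\<And>S. closed S \<Longrightarrow> convex S \<Longrightarrow> eventually (\<lambda>n. x n \<in> S) sequentially \<Longrightarrow> z \<in> S"
proof -
  \<comment> \<open>Weak compactness by convexity: \<open>z\<close> will be the limit of almost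
    minimal points of the closed convex hulls of the tails, which decrease with \<open>n\<close>. It
    lies in all of them, hence in every closed convex set that contains a tail.\<close>
  define C where "C n = closure (convex hull (x ` {n..}))" for n
  define d where "d n = (INF c\<in>C n. norm c)" for n
  have C_convex: "convex (C n)" for n unfolding C_def by (intro convex_closure convex_convex_hull)
  have C_closed: "closed (C n)" for n unfolding C_def by simp
  have x_in: "x m \<in> C n" if "n \<le> m" for m n
    unfolding C_def using that by (intro subsetD[OF closure_subset] hull_inc) auto
  have C_min: "C n \<subseteq> S" if "closed S" "convex S" "x ` {n..} \<subseteq> S" for n S
    unfolding C_def using that by (intro closure_minimal hull_minimal)
  have C_anti: "C m \<subseteq> C n" if "n \<le> m" for m n
    using that x_in by (intro C_min C_closed C_convex) auto
  have bdd: "bdd_below (norm ` C n)" for n by (rule bdd_belowI[of _ 0]) auto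
  have d_le: "d n \<le> norm c" if "c \<in> C n" for c n
    unfolding d_def using that bdd by (intro cINF_lower)
  have ne: "C n \<noteq> {}" for n using x_in[of n n] by auto
  have d_mono: "d n \<le> d m" if "n \<le> m" for m n
    unfolding d_def using that C_anti bdd ne by (intro cINF_superset_mono) auto
  have d0: "0 \<le> d n" for n unfolding d_def using ne by (intro cINF_greatest) auto
  have dB: "d n \<le> B" for n using d_le[OF x_in[of n n]] bound[of n] by simp
  have "convergent d" using d_mono d0 dB
    by (intro Bseq_mono_convergent) (auto intro!: BseqI'[of _ B])
  then obtain D where D: "d \<longlonglongrightarrow> D" by (auto simp: convergent_def)
  have dD: "d n \<le> D" for n
    by (rule LIMSEQ_le_const[OF D]) (use d_mono in auto)
  have "\<exists>y. y \<in> C n \<and> norm y < d n + 1 / (Suc n)" for n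
  proof -
    have "(INF c\<in>C n. norm c) < d n + 1 / Suc n" by (simp add: d_def)
    then show ?thesis using cINF_less_iff[OF ne bdd] by blast
  qed
  then obtain y where y: "\<And>n. y n \<in> C n" "\<And>n. norm (y n) < d n + 1 / (Suc n)" by metis
  \<comment> \<open>Parallelogram law: the midpoint of two almost minimal points stays in
    \<open>C N\<close>, so its norm is at least \<open>d N\<close>, which leaves little room for
    their distance.\<close>
  have est: "(norm (y m - y n))\<^sup>2 \<le> 4 * ((D + 1 / Suc N)\<^sup>2 - (d N)\<^sup>2)" if "N \<le> m" "N \<le> n" for m n N
  proof -
    have in_CN: "y k \<in> C N" if "N \<le> k" for k using C_anti[OF that] y(1) by auto
    have "(1/2) *\<^sub>R y m + (1/2) *\<^sub>R y n \<in> C N"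
      using C_convex[of N] in_CN that by (intro convexD) auto
    then have "d N \<le> norm ((1/2) *\<^sub>R (y m + y n))" using d_le by (simp add: scaleR_right_distrib)
    then have "2 * d N \<le> norm (y m + y n)" by simp
    then have 1: "(2 * d N)\<^sup>2 \<le> (norm (y m + y n))\<^sup>2" using d0[of N] by (intro power_mono) auto
    have 2: "(norm (y k))\<^sup>2 \<le> (D + 1 / Suc N)\<^sup>2" if "N \<le> k" for k
    proof (rule power_mono)
      have "norm (y k) \<le> d k + 1 / Suc k" using y(2)[of k] by simp
      also have "\<dots> \<le> D + 1 / Suc N" using dD[of k] that by (intro add_mono) (auto simp: field_simps)
      finally show "norm (y k) \<le> D + 1 / Suc N" .
    qed auto
    have "(norm (y m - y n))\<^sup>2 = 2 * (norm (y m))\<^sup>2 + 2 * (norm (y n))\<^sup>2 - (norm (y m + y n))\<^sup>2"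
      by (simp add: power2_norm_eq_inner inner_simps inner_commute)
    then show ?thesis using 1 2[OF that(1)] 2[OF that(2)] by (simp add: power_mult_distrib)
  qed
  have "(\<lambda>N. 4 * ((D + 1 / Suc N)\<^sup>2 - (d N)\<^sup>2)) \<longlonglongrightarrow> 4 * ((D + 0)\<^sup>2 - D\<^sup>2)"
    using LIMSEQ_inverse_real_of_nat
    by (intro tendsto_intros D) (auto simp: inverse_eq_divide)
  then have lim0: "(\<lambda>N. 4 * ((D + 1 / Suc N)\<^sup>2 - (d N)\<^sup>2)) \<longlonglongrightarrow> 0" by simp
  have "Cauchy y"
  proof (rule metric_CauchyI)
    fix e :: real assume e: "0 < e"
    from order_tendstoD(2)[OF lim0, of "e\<^sup>2"] e
    obtain N where N: "4 * ((D + 1 / Suc N)\<^sup>2 - (d N)\<^sup>2) < e\<^sup>2"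
      by (auto simp: eventually_sequentially)
    have "dist (y m) (y n) < e" if "m \<ge> N" "n \<ge> N" for m n
      using est[OF that] N e by (auto simp: dist_norm intro: power_less_imp_less_base[of _ 2])
    then show "\<exists>M. \<forall>m\<ge>M. \<forall>n\<ge>M. dist (y m) (y n) < e" by blast
  qed
  then obtain z where z: "y \<longlonglongrightarrow> z" by (auto simp: Cauchy_convergent_iff convergent_def)
  have zC: "z \<in> C n" for n
    by (rule Lim_in_closed_set[OF C_closed _ _ z])
      (use C_anti y(1) in \<open>auto simp: eventually_sequentially intro!: exI[of _ n]\<close>)
  show ?thesis
  proof (rule that)
    fix S :: "'a set" assume S: "closed S" "convex S" "eventually (\<lambda>n. x n \<in> S) sequentially"
    then obtain N where "x ` {N..} \<subseteq> S" by (auto simp: eventually_sequentially)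
    then show "z \<in> S" using C_min[OF S(1,2)] zC by blast
  qed
qed

text \<open>The preimage of a ball around \<open>l\<close> is closed and convex and contains a tail
  of \<open>x\<close>, hence contains \<open>z\<close>. Strong convergence of an image thus
  identifies the image of the weak limit.\<close>

lemma bounded_linear_weak_cluster:
  fixes l :: "'b::real_normed_vector"
  assumes z: "\<And>S. closed S \<Longrightarrow> convex S \<Longrightarrow> eventually (\<lambda>n. x n \<in> S) sequentially \<Longrightarrow> z \<in> S"
    and f: "bounded_linear f" and lim: "(\<lambda>n. f (x n)) \<longlonglongrightarrow> l"
  shows "f z = l"
proof -
  have "dist (f z) l \<le> e" if "e > 0" for e
  proof -
    have "z \<in> f -` cball l e"
    proof (rule z)
      show "closed (f -` cball l e)"
        by (intro closed_vimage closed_cball linear_continuous_on f continuous_at_imp_continuous_on ballI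
            linear_continuous_at)
      show "convex (f -` cball l e)"
        by (intro convex_linear_vimage bounded_linear.linear f convex_cball)
      show "eventually (\<lambda>n. x n \<in> f -` cball l e) sequentially"
        using tendstoD[OF lim that] by (auto elim!: eventually_mono simp: dist_commute)
    qed
    then show ?thesis by (simp add: dist_commute)
  qed
  then have "dist (f z) l \<le> 0" by (rule field_le_epsilon[where y=0, simplified])
  then show ?thesis by simp
qed

text \<open>All Riemann sums lie in \<open>S\<close>. The function spaces on \<open>\<Omega>\<close>
  are subsets of types, so membership of an integral has to be proved.\<close>

lemma has_integral_mem_closed_subspace:
  fixes f :: "real \<Rightarrow> 'a::real_normed_vector"
  assumes "subspace S" "closed S" "(f has_integral y) {s..t}" "\<And>r. r \<in> {s..t} \<Longrightarrow> f r \<in> S"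
  shows "y \<in> S"
proof -
  have "y \<in> closure S"
  proof (subst closure_approachable, intro allI impI)
    fix e :: real assume "0 < e"
    with assms(3) obtain \<gamma> where g: "gauge \<gamma>" "\<And>D. D tagged_division_of (cbox s t) \<Longrightarrow> \<gamma> fine D \<Longrightarrow>
        norm ((\<Sum>(x,k)\<in>D. measure lborel k *\<^sub>R f x) - y) < e"
      unfolding has_integral[of f y s t, folded box_real] box_real(2)[symmetric] by metis
    obtain D where D: "D tagged_division_of (cbox s t)" "\<gamma> fine D"
      using fine_division_exists[OF g(1)] by blast
    have "(\<Sum>(x,k)\<in>D. measure lborel k *\<^sub>R f x) \<in> S"
      by (rule subspace_sum[OF assms(1)])
        (use assms(1,4) tag_in_interval[OF D(1)] in \<open>auto intro!: subspace_scale\<close>)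
    with g(2)[OF D] show "\<exists>y'\<in>S. dist y' y < e" by (auto simp: dist_norm)
  qed
  then show ?thesis using assms(2) by simp
qed

lemma linear_on_sum:
  fixes L :: "'a::real_vector \<Rightarrow> 'b::real_vector"
  assumes S: "subspace S" and add: "\<And>x y. x \<in> S \<Longrightarrow> y \<in> S \<Longrightarrow> L (x + y) = L x + L y"
    and scale: "\<And>c x. x \<in> S \<Longrightarrow> L (c *\<^sub>R x) = c *\<^sub>R L x" and g: "\<And>i. i \<in> I \<Longrightarrow> g i \<in> S"
  shows "L (\<Sum>i\<in>I. g i) = (\<Sum>i\<in>I. L (g i))"
proof -
  have L0: "L 0 = 0" using scale[OF subspace_0[OF S], of 0] by simp
  show ?thesis
    using g
  proof (induction I rule: infinite_finite_induct)
    case (insert i I)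
    then have "(\<Sum>i\<in>I. g i) \<in> S" by (intro subspace_sum[OF S]) auto
    with insert show ?case by (simp add: add)
  qed (auto simp: L0)
qed

text \<open>The semigroup operators are linear and bounded on a subspace only; the interchange is
  therefore made on Riemann sums, which stay in \<open>S\<close>.\<close>

lemma has_integral_linear_on:
  fixes f :: "real \<Rightarrow> 'a::real_normed_vector" and L :: "'a \<Rightarrow> 'b::real_normed_vector"
  assumes S: "subspace S" "closed S" and f: "(f has_integral y) {s..t}" "\<And>r. r \<in> {s..t} \<Longrightarrow> f r \<in> S"
    and add: "\<And>x y. x \<in> S \<Longrightarrow> y \<in> S \<Longrightarrow> L (x + y) = L x + L y"
    and scale: "\<And>c x. x \<in> S \<Longrightarrow> L (c *\<^sub>R x) = c *\<^sub>R L x"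
    and bound: "\<And>x. x \<in> S \<Longrightarrow> norm (L x) \<le> K * norm x"
  shows "((\<lambda>r. L (f r)) has_integral L y) {s..t}"
proof -
  have y: "y \<in> S" by (rule has_integral_mem_closed_subspace[OF S f])
  have diff: "L (x - y) = L x - L y" if "x \<in> S" "y \<in> S" for x y
    using add[of x "(-1) *\<^sub>R y"] scale[of y "-1"] that subspace_scale[OF S(1), of y "-1"] by simp
  show ?thesis
    unfolding box_real(2)[symmetric] has_integral
  proof (intro allI impI)
    fix e :: real assume e: "0 < e"
    \<comment> \<open>\<open>K\<close> may be zero or negative, while \<open>K'\<close> is a
      positive bound.\<close>
    define K' where "K' = \<bar>K\<bar> + 1"
    have "0 < e / K'" using e by (simp add: K'_def)
    with f(1) obtain \<gamma> where g: "gauge \<gamma>" "\<And>D. D tagged_division_of (cbox s t) \<Longrightarrow> \<gamma> fine D \<Longrightarrow>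
        norm ((\<Sum>(x,k)\<in>D. measure lborel k *\<^sub>R f x) - y) < e / K'"
      unfolding has_integral[of f y s t, folded box_real] box_real(2)[symmetric] by metis
    show "\<exists>\<gamma>. gauge \<gamma> \<and> (\<forall>D. D tagged_division_of cbox s t \<and> \<gamma> fine D \<longrightarrow>
        norm ((\<Sum>(x,k)\<in>D. measure lborel k *\<^sub>R L (f x)) - L y) < e)"
    proof (intro exI[of _ \<gamma>] conjI g allI impI)
      fix D assume D: "D tagged_division_of cbox s t \<and> \<gamma> fine D"
      let ?s = "\<Sum>(x,k)\<in>D. measure lborel k *\<^sub>R f x"
      have mem: "f x \<in> S" if "(x,k) \<in> D" for x k
        using f(2) tag_in_interval[OF conjunct1[OF D] that] by (simp add: cbox_interval)
      have sS: "?s \<in> S"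
        by (rule subspace_sum[OF S(1)]) (use S mem in \<open>auto intro!: subspace_scale\<close>)
      have "L ?s = (\<Sum>p\<in>D. L (case p of (x,k) \<Rightarrow> measure lborel k *\<^sub>R f x))"
        by (rule linear_on_sum[OF S(1) add scale])
          (use S mem in \<open>auto intro!: subspace_scale\<close>)
      also have "\<dots> = (\<Sum>(x,k)\<in>D. measure lborel k *\<^sub>R L (f x))"
        by (rule sum.cong) (use mem in \<open>auto simp: scale\<close>)
      finally have "norm ((\<Sum>(x,k)\<in>D. measure lborel k *\<^sub>R L (f x)) - L y) = norm (L (?s - y))"
        using diff[OF sS y] by simp
      also have "\<dots> \<le> K * norm (?s - y)" by (intro bound subspace_diff S sS y)
      also have "\<dots> \<le> K' * norm (?s - y)" by (intro mult_right_mono) (auto simp: K'_def)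
      also have "\<dots> < K' * (e / K')" using g(2)[of D] D by (intro mult_strict_left_mono) (auto simp: K'_def)
      also have "\<dots> = e" by (simp add: K'_def)
      finally show "norm ((\<Sum>(x,k)\<in>D. measure lborel k *\<^sub>R L (f x)) - L y) < e" .
    qed
  qed
qed

text \<open>\<open>r h\<close> bounds the right difference quotient, so its limit \<open>l\<close>
  bounds the upper right Dini derivative. For the energy of \<open>(u', u'')\<close> such a bound is
  all that will be available.\<close>

lemma dini_nonincreasing:
  fixes g :: "real \<Rightarrow> real"
  assumes cont: "continuous_on {a..b} g" and ab: "a \<le> b"
    and dini: "\<And>t. a \<le> t \<Longrightarrow> t < b \<Longrightarrow>
      \<exists>r l. l \<le> 0 \<and> (r \<longlongrightarrow> l) (at_right 0) \<and> (\<forall>\<^sub>F h in at_right 0. g (t + h) \<le> g t + h * r h)"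
  shows "g b \<le> g a"
proof -
  have "g b \<le> g a + \<eta> * (b - a)" if \<eta>: "\<eta> > 0" for \<eta>
  proof -
    \<comment> \<open>Continuous induction: the last point at which \<open>g\<close> lies below the
      line of slope \<open>\<eta>\<close> cannot be smaller than \<open>b\<close>, since
      \<open>r h < \<eta>\<close> carries the inequality a little further.\<close>
    define S where "S = {t \<in> {a..b}. g t \<le> g a + \<eta> * (t - a)}"
    have "closed S" unfolding S_def
      by (intro continuous_on_closed_Collect_le cont continuous_intros closed_atLeastAtMost)
    moreover have "a \<in> S" using ab by (auto simp: S_def)
    moreover have bdd: "bdd_above S" by (rule bdd_aboveI[of _ b]) (auto simp: S_def)
    ultimately have c: "Sup S \<in> S" using closed_contains_Sup[of S] by auto
    have "Sup S = b"
    proof (rule ccontr)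
      assume "Sup S \<noteq> b"
      with c have lt: "a \<le> Sup S" "Sup S < b" by (auto simp: S_def)
      from dini[OF this] obtain r l where r: "l \<le> 0" "(r \<longlongrightarrow> l) (at_right 0)"
        "\<forall>\<^sub>F h in at_right 0. g (Sup S + h) \<le> g (Sup S) + h * r h" by blast
      have "\<forall>\<^sub>F h in at_right 0. r h < \<eta>" using order_tendstoD(2)[OF r(2), of \<eta>] r(1) \<eta> by simp
      moreover have "\<forall>\<^sub>F h in at_right 0. h < b - Sup S"
        using lt by (auto simp: eventually_at_right_field intro!: exI[of _ "b - Sup S"])
      moreover have "\<forall>\<^sub>F h in at_right (0::real). 0 < h" by (simp add: eventually_at_right_less)
      ultimately have "\<forall>\<^sub>F h in at_right 0. r h < \<eta> \<and> h < b - Sup S \<and> 0 < h \<and>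
          g (Sup S + h) \<le> g (Sup S) + h * r h"
        using r(3) by eventually_elim auto
      then obtain h where h: "r h < \<eta>" "h < b - Sup S" "0 < h" "g (Sup S + h) \<le> g (Sup S) + h * r h"
        by (metis (mono_tags, lifting) eventually_happens trivial_limit_at_right_real)
      have "h * r h \<le> h * \<eta>" using h by (intro mult_left_mono) auto
      then have le: "g (Sup S + h) \<le> g (Sup S) + \<eta> * h" using h(4) by (simp add: mult.commute)
      have "g (Sup S) \<le> g a + \<eta> * (Sup S - a)" using c unfolding S_def by blast
      with le have "g (Sup S + h) \<le> g a + \<eta> * (Sup S + h - a)" by (simp add: algebra_simps)
      moreover have "Sup S + h \<in> {a..b}" using h lt by simp
      ultimately have "Sup S + h \<in> S" unfolding S_def by blast
      then show False using cSup_upper[OF _ bdd] h(3) by force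
    qed
    then show ?thesis using c by (auto simp: S_def)
  qed
  have "g b \<le> g a + e" if "e > 0" for e
  proof -
    have "e / (b - a + 1) * (b - a) \<le> e" using ab that by (simp add: field_simps)
    with \<open>\<And>\<eta>. \<eta> > 0 \<Longrightarrow> g b \<le> g a + \<eta> * (b - a)\<close>[of "e / (b - a + 1)"] that ab
    show ?thesis by simp
  qed
  then show ?thesis by (rule field_le_epsilon)
qed

section \<open>Strongly continuous semigroups\<close>

text \<open>Sokal's gliding-hump proof of the uniform boundedness principle, for families that are
  linear only on a closed subspace.\<close>

lemma uniform_boundedness_on:
  fixes T :: "nat \<Rightarrow> 'a::banach \<Rightarrow> 'b::real_normed_vector"
  assumes X: "subspace X" "closed X"
    and add: "\<And>n x y. x \<in> X \<Longrightarrow> y \<in> X \<Longrightarrow> T n (x + y) = T n x + T n y"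
    and scale: "\<And>n c x. x \<in> X \<Longrightarrow> T n (c *\<^sub>R x) = c *\<^sub>R T n x"
    and bounded: "\<And>n. \<exists>K. \<forall>x\<in>X. norm (T n x) \<le> K * norm x"
    and pointwise: "\<And>x. x \<in> X \<Longrightarrow> \<exists>B. \<forall>n. norm (T n x) \<le> B"
  shows "\<exists>K. \<forall>n. \<forall>x\<in>X. norm (T n x) \<le> K * norm x"
proof (rule ccontr)
  assume neg: "\<not> ?thesis"
  have diff: "T n (x - y) = T n x - T n y" if "x \<in> X" "y \<in> X" for n x y
    using add[of x "(-1) *\<^sub>R y"] scale[of y n "-1"] that subspace_scale[OF X(1), of y "-1"] by simp
  have T0: "T n 0 = 0" for n using scale[OF subspace_0[OF X(1)], of n 0] by simp
  \<comment> \<open>The operator norm of \<open>T n\<close> on \<open>X\<close>. At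
    \<open>x = 0\<close> the quotient is \<open>0\<close> by convention, so the origin can stay in
    the range of the supremum.\<close>
  define N where "N n = (SUP x\<in>X. norm (T n x) / norm x)" for n
  have bdd: "bdd_above ((\<lambda>x. norm (T n x) / norm x) ` X)" for n
  proof -
    obtain K where K: "\<forall>x\<in>X. norm (T n x) \<le> K * norm x" using bounded by blast
    have "norm (T n x) / norm x \<le> \<bar>K\<bar>" if "x \<in> X" for x
    proof -
      have "norm (T n x) \<le> \<bar>K\<bar> * norm x"
        using K that by (meson abs_ge_self mult_right_mono norm_ge_zero order_trans)
      then show ?thesis by (cases "x = 0") (auto simp: field_simps)
    qed
    then show ?thesis by (auto intro!: bdd_aboveI[of _ "\<bar>K\<bar>"])
  qed
  have N_bound: "norm (T n x) \<le> N n * norm x" if "x \<in> X" for n x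
  proof (cases "x = 0")
    case False
    have "norm (T n x) / norm x \<le> N n" unfolding N_def using that bdd by (intro cSUP_upper)
    then show ?thesis using False by (simp add: field_simps)
  qed (simp add: T0)
  \<comment> \<open>Operator norms above \<open>4 ^ k\<close> against increments of length
    \<open>(1/3) ^ k\<close>: the former win although the latter are summable.\<close>
  have "\<exists>n. N n > 4 ^ k" for k :: nat
  proof (rule ccontr)
    assume "\<nexists>n. N n > 4 ^ k"
    then have "N n \<le> 4 ^ k" for n by (simp add: not_less)
    then have "norm (T n x) \<le> 4 ^ k * norm x" if "x \<in> X" for n x
      using N_bound[OF that, of n] mult_right_mono[of "N n" "4 ^ k" "norm x"] by (meson norm_ge_zero order_trans)
    with neg show False by blast
  qed
  then obtain n where n: "\<And>k. N (n k) > 4 ^ k" by metis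
  have "\<exists>y\<in>X. norm y = (1/3) ^ k \<and> norm (T (n k) y) \<ge> 2/3 * N (n k) * (1/3) ^ k" for k
  proof -
    have pos: "N (n k) > 0" using n[of k] by (meson less_trans zero_less_numeral zero_less_power)
    then have "2/3 * N (n k) < N (n k)" by simp
    then obtain x where x: "x \<in> X" "2/3 * N (n k) < norm (T (n k) x) / norm x"
      unfolding N_def using less_cSUP_iff[OF _ bdd[of "n k"]] subspace_0[OF X(1)] by blast
    have x0: "norm x > 0" using x(2) pos by (cases "x = 0") auto
    show ?thesis
    proof (intro bexI conjI)
      show "((1/3) ^ k / norm x) *\<^sub>R x \<in> X" using x X by (intro subspace_scale)
      show "norm (((1/3) ^ k / norm x) *\<^sub>R x) = (1/3) ^ k" using x0 by simp
      have "2/3 * N (n k) * (1/3) ^ k \<le> norm (T (n k) x) / norm x * (1/3) ^ k"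
        using x(2) by (intro mult_right_mono) auto
      then show "norm (T (n k) (((1/3) ^ k / norm x) *\<^sub>R x)) \<ge> 2/3 * N (n k) * (1/3) ^ k"
        using x x0 by (simp add: scale mult.commute)
    qed
  qed
  then obtain y where y: "\<And>k. y k \<in> X" "\<And>k. norm (y k) = (1/3) ^ k"
    "\<And>k. norm (T (n k) (y k)) \<ge> 2/3 * N (n k) * (1/3) ^ k" by metis
  \<comment> \<open>The sign of the increment is chosen so that the image under
    \<open>T (n k)\<close> is large. One of the two signs works, because twice the image of
    \<open>y k\<close> is the difference of the images of \<open>x + y k\<close> and
    \<open>x - y k\<close>.\<close>
  define step where "step k x = (if norm (T (n k) (x + y k)) \<ge> 2/3 * N (n k) * (1/3) ^ k
      then x + y k else x - y k)" for k x
  define x where "x = rec_nat 0 step"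
  have x_simps: "x 0 = 0" "x (Suc k) = step k (x k)" for k by (auto simp: x_def)
  have xX: "x k \<in> X" for k
    by (induction k) (auto simp: x_simps step_def subspace_0[OF X(1)] intro!: subspace_add subspace_diff X y)
  have x_step: "norm (x (Suc k) - x k) = (1/3) ^ k" for k
    by (auto simp: x_simps step_def y)
  have x_big: "norm (T (n k) (x (Suc k))) \<ge> 2/3 * N (n k) * (1/3) ^ k" for k
  proof (cases "norm (T (n k) (x k + y k)) \<ge> 2/3 * N (n k) * (1/3) ^ k")
    case False
    have "2 *\<^sub>R T (n k) (y k) = T (n k) (x k + y k) - T (n k) (x k - y k)"
      using xX y by (simp add: add diff scaleR_2)
    then have "2 * norm (T (n k) (y k)) = norm (T (n k) (x k + y k) - T (n k) (x k - y k))"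
      by (metis abs_numeral norm_scaleR)
    also have "\<dots> \<le> norm (T (n k) (x k + y k)) + norm (T (n k) (x k - y k))"
      by (rule norm_triangle_ineq4)
    finally show ?thesis using y(3)[of k] False by (simp add: x_simps step_def)
  qed (simp add: x_simps step_def)
  have dist_x: "norm (x (k + m) - x k) \<le> 3/2 * (1/3) ^ k - 3/2 * (1/3) ^ (k + m)" for k m
  proof (induction m)
    case (Suc m)
    have "norm (x (Suc (k + m)) - x k) \<le> norm (x (Suc (k + m)) - x (k + m)) + norm (x (k + m) - x k)"
      using norm_triangle_ineq[of "x (Suc (k + m)) - x (k + m)" "x (k + m) - x k"] by simp
    then show ?case using x_step[of "k + m"] Suc by simp
  qed simp
  have dist_x': "norm (x m - x k) \<le> 3/2 * (1/3) ^ k" if "k \<le> m" for k m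
    using dist_x[of k "m - k"] that order_trans[OF dist_x[of k "m - k"], of "3/2 * (1/3) ^ k"] by simp
  have "Cauchy x"
  proof (rule metric_CauchyI)
    fix e :: real assume "0 < e"
    have "(\<lambda>k. 3 * (1/3 :: real) ^ k) \<longlonglongrightarrow> 3 * 0" by (intro tendsto_intros LIMSEQ_realpow_zero) auto
    from order_tendstoD(2)[OF this, of e] \<open>0 < e\<close> obtain k where k: "3 * (1/3 :: real) ^ k < e"
      by (auto simp: eventually_sequentially)
    have "dist (x p) (x q) < e" if "p \<ge> k" "q \<ge> k" for p q
      using norm_triangle_ineq4[of "x p - x k" "x q - x k"] dist_x'[OF that(1)] dist_x'[OF that(2)] k
      by (simp add: dist_norm)
    then show "\<exists>M. \<forall>m\<ge>M. \<forall>n\<ge>M. dist (x m) (x n) < e" by blast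
  qed
  then obtain z where z: "x \<longlonglongrightarrow> z" by (auto simp: Cauchy_convergent_iff convergent_def)
  have zX: "z \<in> X" by (rule Lim_in_closed_set[OF X(2) _ _ z]) (auto simp: xX)
  have z_dist: "norm (z - x k) \<le> 3/2 * (1/3) ^ k" for k
  proof (rule LIMSEQ_le_const2)
    show "(\<lambda>m. norm (x m - x k)) \<longlonglongrightarrow> norm (z - x k)" by (intro tendsto_intros z)
  qed (use dist_x' in blast)
  obtain B where B: "\<And>n. norm (T n z) \<le> B" using pointwise[OF zX] by blast
  \<comment> \<open>All later increments together have length at most
    \<open>1/2 * (1/3) ^ k\<close>, which costs \<open>1/2\<close> of the \<open>2/3\<close> gained
    at stage \<open>k\<close>; \<open>1/6\<close> is left.\<close>
  have "1/6 * (4/3 :: real) ^ k \<le> B" for k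
  proof -
    have "norm (T (n k) (x (Suc k))) \<le> norm (T (n k) z) + norm (T (n k) (z - x (Suc k)))"
      using norm_triangle_ineq4[of "T (n k) z" "T (n k) (z - x (Suc k))"] zX xX by (simp add: diff)
    also have "norm (T (n k) (z - x (Suc k))) \<le> N (n k) * norm (z - x (Suc k))"
      by (intro N_bound subspace_diff X zX xX)
    also have "\<dots> \<le> N (n k) * (3/2 * (1/3) ^ Suc k)"
      using z_dist[of "Suc k"] less_trans[OF _ n[of k], of 0] by (intro mult_left_mono) auto
    finally have "2/3 * N (n k) * (1/3) ^ k \<le> B + N (n k) * (1/2 * (1/3) ^ k)"
      using x_big[of k] B[of "n k"] by simp
    then have "1/6 * N (n k) * (1/3) ^ k \<le> B" by simp
    moreover have "1/6 * (4/3 :: real) ^ k = 1/6 * 4 ^ k * (1/3) ^ k" by (simp add: power_divide)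
    moreover have "1/6 * 4 ^ k * (1/3) ^ k \<le> 1/6 * N (n k) * (1/3 :: real) ^ k"
      using n[of k] by (intro mult_right_mono mult_left_mono) auto
    ultimately show ?thesis by linarith
  qed
  note le = this
  obtain k where "(4/3 :: real) ^ k > 6 * B"
    using real_arch_pow[of "4/3" "6 * B"] by auto
  with le[of k] show False by simp
qed

lemma norm_divideR_le:
  fixes x :: "'a::real_normed_vector"
  assumes "norm x \<le> e * h" "0 < h" shows "norm (x /\<^sub>R h) \<le> e"
proof -
  have "norm (x /\<^sub>R h) = norm x / h" using assms(2) by (simp add: divide_inverse mult.commute)
  then show ?thesis using assms by (simp add: pos_divide_le_eq)
qed

locale c0_semigroup =
  fixes X :: "'a::banach set" and T :: "real \<Rightarrow> 'a \<Rightarrow> 'a"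
  assumes subspace_X: "subspace X" and closed_X: "closed X"
    and semigroup: "C0_semigroup_on X T"
begin

lemma mem: "t \<ge> 0 \<Longrightarrow> x \<in> X \<Longrightarrow> T t x \<in> X"
  and add: "t \<ge> 0 \<Longrightarrow> x \<in> X \<Longrightarrow> y \<in> X \<Longrightarrow> T t (x + y) = T t x + T t y"
  and scale: "t \<ge> 0 \<Longrightarrow> x \<in> X \<Longrightarrow> T t (c *\<^sub>R x) = c *\<^sub>R T t x"
  and bounded: "t \<ge> 0 \<Longrightarrow> \<exists>K. \<forall>x\<in>X. norm (T t x) \<le> K * norm x"
  and T_zero: "x \<in> X \<Longrightarrow> T 0 x = x"
  and T_add: "s \<ge> 0 \<Longrightarrow> t \<ge> 0 \<Longrightarrow> x \<in> X \<Longrightarrow> T (s + t) x = T s (T t x)"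
  and tendsto: "x \<in> X \<Longrightarrow> ((\<lambda>t. T t x) \<longlongrightarrow> x) (at_right 0)"
  using semigroup by (simp_all add: C0_semigroup_on_def)

lemma diff: "t \<ge> 0 \<Longrightarrow> x \<in> X \<Longrightarrow> y \<in> X \<Longrightarrow> T t (x - y) = T t x - T t y"
  using add[of t x "(-1) *\<^sub>R y"] scale[of t y "-1"] subspace_scale[OF subspace_X, of y "-1"] by simp

text \<open>Otherwise there are times tending to \<open>0\<close> whose operators are not uniformly
  bounded. Strong continuity bounds each orbit along these times, which contradicts the uniform
  boundedness principle.\<close>

lemma bounded_near_zero: "\<exists>\<delta>>0. \<exists>M\<ge>1. \<forall>t\<in>{0..\<delta>}. \<forall>x\<in>X. norm (T t x) \<le> M * norm x"
proof (rule ccontr)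
  assume neg: "\<not> ?thesis"
  have "\<exists>t\<in>{0..1 / Suc n}. \<exists>x\<in>X. norm (T t x) > real (Suc n) * norm x" for n :: nat
  proof (rule ccontr)
    assume "\<not> ?thesis"
    then have "\<forall>t\<in>{0..1 / Suc n}. \<forall>x\<in>X. norm (T t x) \<le> real (Suc n) * norm x" by (meson not_le)
    then have "\<exists>\<delta>>0. \<exists>M\<ge>1. \<forall>t\<in>{0..\<delta>}. \<forall>x\<in>X. norm (T t x) \<le> M * norm x"
      by (intro exI[of _ "1 / Suc n"] conjI exI[of _ "real (Suc n)"]) auto
    with neg show False by blast
  qed
  then obtain t where t: "\<And>n. t n \<in> {0..1 / Suc n}" "\<And>n. \<exists>x\<in>X. norm (T (t n) x) > Suc n * norm x"
    by metis
  have t_lim: "t \<longlonglongrightarrow> 0"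
  proof (rule tendsto_sandwich[of "\<lambda>_. 0" t sequentially "\<lambda>n. 1 / real (Suc n)"])
    show "(\<lambda>n. 1 / real (Suc n)) \<longlonglongrightarrow> 0" using LIMSEQ_inverse_real_of_nat by (simp add: inverse_eq_divide)
  qed (use t(1) in auto)
  have "\<exists>K. \<forall>n. \<forall>x\<in>X. norm (T (t n) x) \<le> K * norm x"
  proof (rule uniform_boundedness_on[OF subspace_X closed_X])
    fix x assume x: "x \<in> X"
    have "(\<lambda>n. T (t n) x) \<longlonglongrightarrow> x"
    proof (rule tendstoI)
      fix e :: real assume e: "0 < e"
      from tendstoD[OF tendsto[OF x] e] obtain d where d: "d > 0" "\<And>s. 0 < s \<Longrightarrow> s < d \<Longrightarrow> dist (T s x) x < e"
        by (auto simp: eventually_at_right_field)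
      have "dist (T s x) x < e" if "0 \<le> s" "s < d" for s
        using d(2)[of s] that e T_zero[OF x] by (cases "s = 0") auto
      moreover have "eventually (\<lambda>n. t n < d) sequentially" using order_tendstoD(2)[OF t_lim d(1)] .
      ultimately show "eventually (\<lambda>n. dist (T (t n) x) x < e) sequentially"
        using t(1) by (auto elim: eventually_mono)
    qed
    then have "Bseq (\<lambda>n. T (t n) x)" by (intro convergent_imp_Bseq) (auto simp: convergent_def)
    then show "\<exists>B. \<forall>n. norm (T (t n) x) \<le> B" by (auto simp: Bseq_def)
  qed (use t(1) in \<open>auto intro!: add scale bounded\<close>)
  then obtain K where K: "\<And>n x. x \<in> X \<Longrightarrow> norm (T (t n) x) \<le> K * norm x" by blast
  obtain n :: nat where n: "K \<le> n" using real_arch_simple by blast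
  from t(2)[of n] obtain x where x: "x \<in> X" "norm (T (t n) x) > Suc n * norm x" by blast
  have "K * norm x \<le> Suc n * norm x" using n by (intro mult_right_mono) auto
  then show False using K[OF x(1), of n] x(2) by simp
qed

lemma locally_bounded: "\<exists>M\<ge>1. \<forall>t\<in>{0..\<tau>}. \<forall>x\<in>X. norm (T t x) \<le> M * norm x"
proof -
  obtain \<delta> M where d: "\<delta> > 0" and M: "M \<ge> 1" "\<And>t x. t \<in> {0..\<delta>} \<Longrightarrow> x \<in> X \<Longrightarrow> norm (T t x) \<le> M * norm x"
    using bounded_near_zero by blast
  have *: "\<forall>t\<in>{0..real k * \<delta>}. \<forall>x\<in>X. norm (T t x) \<le> M ^ Suc k * norm x" for k
  proof (induction k)
    case 0 then show ?case using M d by auto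
  next
    case (Suc k)
    show ?case
    proof (intro ballI)
      fix t x assume t: "t \<in> {0..real (Suc k) * \<delta>}" and x: "x \<in> X"
      show "norm (T t x) \<le> M ^ Suc (Suc k) * norm x"
      proof (cases "t \<le> real k * \<delta>")
        case True
        then have "norm (T t x) \<le> M ^ Suc k * norm x" using Suc t x by auto
        also have "\<dots> \<le> M ^ Suc (Suc k) * norm x"
          by (intro mult_right_mono power_increasing) (use M in auto)
        finally show ?thesis .
      next
        case False
        define s where "s = real k * \<delta>"
        have s: "s \<ge> 0" "t - s \<in> {0..\<delta>}" using d False t by (auto simp: s_def algebra_simps)
        have "norm (T t x) = norm (T (t - s) (T s x))" using T_add[of "t - s" s x] s x by simp
        also have "\<dots> \<le> M * norm (T s x)" using s x by (intro M mem)
        also have "\<dots> \<le> M * (M ^ Suc k * norm x)" using Suc s x M by (intro mult_left_mono) (auto simp: s_def)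
        finally show ?thesis by (simp add: mult.assoc)
      qed
    qed
  qed
  obtain k :: nat where "\<tau> / \<delta> \<le> k" using real_arch_simple by blast
  then have "\<tau> \<le> k * \<delta>" using d by (simp add: field_simps)
  with *[of k] show ?thesis using M by (intro exI[of _ "M ^ Suc k"]) (auto simp del: power_Suc)
qed

lemma orbit_continuous:
  assumes "x \<in> X" shows "continuous_on {0..} (\<lambda>t. T t x)"
proof -
  have "continuous_on {0..\<tau>} (\<lambda>t. T t x)" for \<tau>
  proof -
    obtain M where M: "M \<ge> 1" "\<And>t x. t \<in> {0..\<tau>} \<Longrightarrow> x \<in> X \<Longrightarrow> norm (T t x) \<le> M * norm x"
      using locally_bounded[of \<tau>] by blast
    \<comment> \<open>Factoring out the operator of the smaller time reduces continuity from either
      side to continuity at zero, with the local bound \<open>M\<close>.\<close>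
    have le: "norm (T t x - T s x) \<le> M * norm (T (t - s) x - x)" if "0 \<le> s" "s \<le> t" "t \<le> \<tau>" for s t
    proof -
      have "T t x - T s x = T s (T (t - s) x - x)"
        using T_add[of s "t - s" x] that assms by (simp add: diff mem)
      then show ?thesis using that assms M(2)[of s "T (t - s) x - x"] by (simp add: subspace_diff[OF subspace_X] mem)
    qed
    show ?thesis
    proof (rule continuous_onI)
      fix t e :: real assume t: "t \<in> {0..\<tau>}" and e: "0 < e"
      then have "0 < e / (2 * M)" using M by simp
      from tendstoD[OF tendsto[OF assms] this] obtain d where
        d: "d > 0" "\<And>s. 0 < s \<Longrightarrow> s < d \<Longrightarrow> dist (T s x) x < e / (2 * M)"
        by (auto simp: eventually_at_right_field)
      have small: "M * norm (T s x - x) < e" if "0 \<le> s" "s < d" for s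
      proof (cases "s = 0")
        case False
        then have "M * norm (T s x - x) < M * (e / (2 * M))"
          using d(2)[of s] that M by (intro mult_strict_left_mono) (auto simp: dist_norm)
        then show ?thesis using M e by simp
      qed (use e T_zero[OF assms] in auto)
      show "\<exists>d>0. \<forall>t'\<in>{0..\<tau>}. dist t' t < d \<longrightarrow> dist (T t' x) (T t x) \<le> e"
      proof (intro exI[of _ d] conjI ballI impI d)
        fix t' assume t': "t' \<in> {0..\<tau>}" "dist t' t < d"
        show "dist (T t' x) (T t x) \<le> e"
        proof (cases "t' \<le> t")
          case True
          then show ?thesis using le[of t' t] small[of "t - t'"] t t' by (auto simp: dist_norm norm_minus_commute)
        next
          case False
          then show ?thesis using le[of t t'] small[of "t' - t"] t t' by (auto simp: dist_norm)
        qed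
      qed
    qed
  qed
  note * = this
  show ?thesis
  proof (subst continuous_on_eq_continuous_within, intro ballI)
    fix t :: real assume t: "t \<in> {0..}"
    have "continuous (at t within {0..t+1}) (\<lambda>t. T t x)"
      using *[of "t + 1"] t by (auto simp: continuous_on_eq_continuous_within)
    moreover have "at t within {0..t+1} = at t within {0..}"
      by (rule at_within_nhd[of _ "{..<t+1}"]) auto
    ultimately show "continuous (at t within {0..}) (\<lambda>t. T t x)" by simp
  qed
qed

text \<open>Around \<open>t\<close>, \<open>U\<close> is within \<open>O(\<delta>)\<close> of a
  genuine orbit that starts at \<open>t - \<delta>\<close>, and orbits are continuous. This serves
  mild solutions, and also limits of their difference quotients, for which the defect estimate is
  what is known.\<close>

lemma almost_orbit_continuous:
  assumes mem_U: "\<And>t. t \<ge> a \<Longrightarrow> U t \<in> X"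
    and close: "\<And>s t. a \<le> s \<Longrightarrow> s \<le> t \<Longrightarrow> t \<le> s + 1 \<Longrightarrow> norm (U t - T (t - s) (U s)) \<le> C * (t - s)"
    and t: "a < t"
  shows "isCont U t"
proof -
  define C' where "C' = \<bar>C\<bar> + 1"
  have C': "C' > 0" "norm (U t - T (t - s) (U s)) \<le> C' * (t - s)" if "a \<le> s" "s \<le> t" "t \<le> s + 1" for s t
    using close[OF that] mult_right_mono[of C C' "t - s"] that abs_ge_self[of C] unfolding C'_def by linarith+
  have C'0: "C' > 0" by (simp add: C'_def)
  show ?thesis
    unfolding continuous_at_eps_delta
  proof (intro allI impI)
    fix e :: real assume e: "0 < e"
    \<comment> \<open>The defect up to time \<open>t + \<delta>\<close> is at most
      \<open>C' * (2 * \<delta>) \<le> e / 4\<close>; the other two bounds keep the starting point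
      after \<open>a\<close> and the time span at most one.\<close>
    define \<delta> where "\<delta> = min (1/2) (min (t - a) (e / (8 * C')))"
    have d: "0 < \<delta>" "\<delta> \<le> 1/2" "\<delta> \<le> t - a" "\<delta> \<le> e / (8 * C')"
      using t e C'0 unfolding \<delta>_def by (simp, linarith, linarith, linarith)
    have Cd: "C' * \<delta> \<le> e / 8" using d(4) C'0 by (simp add: field_simps)
    define s0 where "s0 = t - \<delta>"
    have s0: "a \<le> s0" using d by (simp add: s0_def)
    define x where "x = U s0"
    have x: "x \<in> X" using mem_U s0 by (simp add: x_def)
    have "isCont (\<lambda>r. T (r - s0) x) t"
    proof -
      have "isCont (\<lambda>t. T t x) \<delta>"
        using orbit_continuous[OF x] d by (intro continuous_on_interior[of "{0..}"]) auto
      then show ?thesis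
        by (intro continuous_at_compose[of t "\<lambda>r. r - s0" "\<lambda>t. T t x", unfolded o_def]) (auto simp: s0_def)
    qed
    then obtain d' where d': "d' > 0" "\<And>r. dist r t < d' \<Longrightarrow> dist (T (r - s0) x) (T (t - s0) x) < e / 2"
      using e unfolding continuous_at_eps_delta by (metis half_gt_zero)
    have near: "norm (U r - T (r - s0) x) \<le> e / 4" if "dist r t < \<delta>" for r
    proof -
      have r: "s0 \<le> r" "r \<le> s0 + 1" "r - s0 \<le> 2 * \<delta>" using that d by (auto simp: s0_def dist_real_def)
      have "norm (U r - T (r - s0) x) \<le> C' * (r - s0)" using C'(2)[of s0 r] s0 r by (simp add: x_def)
      also have "\<dots> \<le> C' * (2 * \<delta>)" using r C'0 by (intro mult_left_mono) auto
      finally show ?thesis using Cd by simp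
    qed
    show "\<exists>d>0. \<forall>r. dist r t < d \<longrightarrow> dist (U r) (U t) < e"
    proof (intro exI[of _ "min \<delta> d'"] conjI allI impI)
      fix r assume r: "dist r t < min \<delta> d'"
      have "norm (U r - U t) \<le> norm (U r - T (r - s0) x) + norm (T (r - s0) x - T (t - s0) x) + norm (U t - T (t - s0) x)"
        using norm_triangle_ineq[of "U r - T (r - s0) x" "T (r - s0) x - U t"]
          norm_triangle_ineq[of "T (r - s0) x - T (t - s0) x" "T (t - s0) x - U t"]
        by (simp add: norm_minus_commute)
      also have "\<dots> < e" using near[of r] near[of t] d'(2)[of r] r d by (auto simp: dist_norm)
      finally show "dist (U r) (U t) < e" by (simp add: dist_norm)
    qed (use d d' in auto)
  qed
qed

lemma T_continuous: "t \<ge> 0 \<Longrightarrow> continuous_on X (T t)"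
proof -
  assume t: "t \<ge> 0"
  obtain K where K: "\<And>x. x \<in> X \<Longrightarrow> norm (T t x) \<le> K * norm x" using bounded[OF t] by blast
  show ?thesis
  proof (intro lipschitz_on_continuous_on lipschitz_onI)
    fix x y assume "x \<in> X" "y \<in> X"
    then have "dist (T t x) (T t y) \<le> K * dist x y"
      using K[of "x - y"] t by (simp add: dist_norm diff[symmetric] subspace_diff[OF subspace_X])
    also have "\<dots> \<le> \<bar>K\<bar> * dist x y" by (intro mult_right_mono) auto
    finally show "dist (T t x) (T t y) \<le> \<bar>K\<bar> * dist x y" .
  qed simp
qed

lemma T_jointly_continuous:
  assumes G: "continuous_on S G" "\<And>p. p \<in> S \<Longrightarrow> G p \<in> X"
  shows "continuous_on ({0..\<tau>} \<times> S) (\<lambda>x. T (fst x) (G (snd x)))"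
proof -
  obtain M where M: "M \<ge> 1" "\<And>t x. t \<in> {0..\<tau>} \<Longrightarrow> x \<in> X \<Longrightarrow> norm (T t x) \<le> M * norm x"
    using locally_bounded[of \<tau>] by blast
  show ?thesis
    unfolding continuous_on
  proof
    fix z0 assume z0: "z0 \<in> {0..\<tau>} \<times> S"
    let ?F = "at z0 within {0..\<tau>} \<times> S"
    let ?x = "G (snd z0)"
    have x: "?x \<in> X" using z0 G(2) by auto
    have lim1: "((\<lambda>z. G (snd z)) \<longlongrightarrow> ?x) ?F"
    proof -
      have "continuous_on ({0..\<tau>} \<times> S) (\<lambda>z. G (snd z))"
        by (rule continuous_on_compose2[OF G(1)]) (auto intro: continuous_intros)
      then show ?thesis using z0 unfolding continuous_on by blast
    qed
    have lim2: "((\<lambda>z. T (fst z) ?x) \<longlongrightarrow> T (fst z0) ?x) ?F"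
    proof -
      have "continuous_on ({0..\<tau>} \<times> S) (\<lambda>z. T (fst z) ?x)"
        by (rule continuous_on_compose2[OF orbit_continuous[OF x]]) (auto intro: continuous_intros)
      then show ?thesis using z0 unfolding continuous_on by blast
    qed
    have "((\<lambda>z. T (fst z) (G (snd z)) - T (fst z0) ?x) \<longlongrightarrow> 0) ?F"
    proof (rule Lim_null_comparison)
      show "\<forall>\<^sub>F z in ?F. norm (T (fst z) (G (snd z)) - T (fst z0) ?x)
          \<le> M * norm (G (snd z) - ?x) + norm (T (fst z) ?x - T (fst z0) ?x)"
        unfolding eventually_at_filter
      proof (intro always_eventually allI impI)
        fix z assume z: "z \<in> {0..\<tau>} \<times> S"
        have eq: "T (fst z) (G (snd z)) - T (fst z0) ?x = T (fst z) (G (snd z) - ?x) + (T (fst z) ?x - T (fst z0) ?x)"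
          using z x G(2) by (auto simp: diff)
        show "norm (T (fst z) (G (snd z)) - T (fst z0) ?x)
          \<le> M * norm (G (snd z) - ?x) + norm (T (fst z) ?x - T (fst z0) ?x)"
          unfolding eq
          by (rule norm_triangle_le, rule add_right_mono, rule M(2))
            (use z x G(2) subspace_diff[OF subspace_X, of "G (snd z)" ?x] in auto)
      qed
      have "((\<lambda>z. M * norm (G (snd z) - ?x) + norm (T (fst z) ?x - T (fst z0) ?x))
          \<longlongrightarrow> M * norm (?x - ?x) + norm (T (fst z0) ?x - T (fst z0) ?x)) ?F"
        by (intro tendsto_intros lim1 lim2)
      then show "((\<lambda>z. M * norm (G (snd z) - ?x) + norm (T (fst z) ?x - T (fst z0) ?x)) \<longlongrightarrow> 0) ?F"
        by simp
    qed
    then show "((\<lambda>z. T (fst z) (G (snd z))) \<longlongrightarrow> T (fst z0) ?x) ?F" by (rule LIM_zero_cancel)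
  qed
qed

text \<open>For \<open>q\<close> near \<open>r\<close> the integrand is close to \<open>G r\<close>,
  uniformly in \<open>r\<close>, since \<open>(p, q) \<mapsto> T p (G q)\<close> is uniformly
  continuous on a compact rectangle.\<close>

lemma duhamel_average:
  assumes G: "\<And>r. s \<le> r \<Longrightarrow> G r \<in> X" "continuous_on {s..} G" and e': "e' > 0"
  shows "\<exists>d>0. \<forall>h r. 0 < h \<longrightarrow> h < d \<longrightarrow> r \<in> {s..t} \<longrightarrow>
    norm (integral {r..r+h} (\<lambda>q. T (r + h - q) (G q)) - h *\<^sub>R G r) \<le> e' * h"
proof -
    let ?\<Psi> = "\<lambda>x. T (fst x) (G (snd x))"
    have \<Psi>_cont: "continuous_on ({0..1} \<times> {s..t+1}) ?\<Psi>"
      by (rule T_jointly_continuous) (use G in \<open>auto intro: continuous_on_subset[OF G(2)]\<close>)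
    then have "uniformly_continuous_on ({0..1} \<times> {s..t+1}) ?\<Psi>"
      by (intro compact_uniformly_continuous compact_Times) auto
    then obtain d where d: "d > 0" "\<And>x y. x \<in> {0..1} \<times> {s..t+1} \<Longrightarrow> y \<in> {0..1} \<times> {s..t+1} \<Longrightarrow>
        dist x y < d \<Longrightarrow> dist (?\<Psi> x) (?\<Psi> y) < e'"
      using e' unfolding uniformly_continuous_on_def by metis
    show ?thesis
    proof (intro exI[of _ "min 1 (d/2)"] conjI allI impI)
      fix h r :: real assume h: "0 < h" "h < min 1 (d/2)" and r: "r \<in> {s..t}"
      have cont: "continuous_on {r..r+h} (\<lambda>q. T (r + h - q) (G q))"
      proof -
        have "continuous_on {r..r+h} (\<lambda>q. (r + h - q, q))" by (intro continuous_intros)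
        moreover have "(\<lambda>q. (r + h - q, q)) ` {r..r+h} \<subseteq> {0..1} \<times> {s..t+1}" using r h by auto
        ultimately show ?thesis using continuous_on_compose2[OF \<Psi>_cont] by fastforce
      qed
        have "norm (integral {r..r+h} (\<lambda>q. T (r + h - q) (G q) - G r)) \<le> e' * (r + h - r)"
        proof (rule integral_bound)
          fix q assume q: "q \<in> {r..r+h}"
          have "dist (r + h - q, q) (0, r) \<le> dist (r + h - q) 0 + dist q r"
            using sqrt_sum_squares_le_sum_abs[of "r + h - q" "dist q r"] by (simp add: dist_Pair_Pair)
          also have "\<dots> < d" using q h by (auto simp: dist_real_def)
          finally have "dist (?\<Psi> (r + h - q, q)) (?\<Psi> (0, r)) < e'" using q h r by (intro d) auto
          then show "norm (T (r + h - q) (G q) - G r) \<le> e'" using r G(1) by (simp add: dist_norm T_zero)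
        qed (use h cont in \<open>auto intro!: continuous_intros\<close>)
        also have "integral {r..r+h} (\<lambda>q. T (r + h - q) (G q) - G r)
            = integral {r..r+h} (\<lambda>q. T (r + h - q) (G q)) - h *\<^sub>R G r"
          using h integrable_continuous_real[OF cont] by (subst integral_diff) auto
      finally show "norm (integral {r..r+h} (\<lambda>q. T (r + h - q) (G q)) - h *\<^sub>R G r) \<le> e' * h" by simp
    qed (use d in auto)
qed

text \<open>A mild solution need not be differentiable, but its time integral lies in the domain of
  the generator. This is the differential equation in integrated form, from which the weak form will
  be derived.\<close>

lemma mild_solution_generator:
  assumes st: "s \<le> t"
    and U: "\<And>r. s \<le> r \<Longrightarrow> U r \<in> X" "continuous_on {s..} U"
    and G: "\<And>r. s \<le> r \<Longrightarrow> G r \<in> X" "continuous_on {s..} G"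
    and mild: "\<And>p r. s \<le> p \<Longrightarrow> p \<le> r \<Longrightarrow> U r = T (r - p) (U p) + integral {p..r} (\<lambda>q. T (r - q) (G q))"
  shows "(integral {s..t} U, U t - U s - integral {s..t} G) \<in> generator X T"
proof -
  let ?I = "integral {s..t} U"
  have int_U: "U integrable_on {p..q}" if "s \<le> p" for p q
    by (rule integrable_continuous_real, rule continuous_on_subset[OF U(2)]) (use that in auto)
  have int_G: "G integrable_on {p..q}" if "s \<le> p" for p q
    by (rule integrable_continuous_real, rule continuous_on_subset[OF G(2)]) (use that in auto)
  have IX: "?I \<in> X"
    by (rule has_integral_mem_closed_subspace[OF subspace_X closed_X integrable_integral[OF int_U]])
      (use U in auto)
  have GX: "integral {s..t} G \<in> X"
    by (rule has_integral_mem_closed_subspace[OF subspace_X closed_X integrable_integral[OF int_G]])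
      (use G in auto)
  \<comment> \<open>The defect of \<open>U\<close> from an orbit over a time \<open>h\<close>. By
    \<open>mild\<close> it is the Duhamel integral over \<open>[r, r + h]\<close>, so
    \<open>\<rho> h r / h\<close> tends to \<open>G r\<close> uniformly in \<open>r\<close>.\<close>
  define \<rho> where "\<rho> h r = U (r + h) - T h (U r)" for h r
  have TU_cont: "continuous_on {s..t} (\<lambda>r. T h (U r))" if "h \<ge> 0" for h
    by (rule continuous_on_compose2[OF T_continuous[OF that]])
      (use U(1) in \<open>auto intro: continuous_on_subset[OF U(2)]\<close>)
  have Ushift_cont: "continuous_on {s..t} (\<lambda>r. U (r + h))" if "h \<ge> 0" for h
    by (rule continuous_on_compose2[OF U(2)]) (use that in \<open>auto intro!: continuous_intros\<close>)
  have \<rho>_int: "\<rho> h integrable_on {s..t}" if "h \<ge> 0" for h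
    unfolding \<rho>_def by (intro integrable_continuous_real continuous_on_diff TU_cont Ushift_cont that)
  have TI: "T h ?I = integral {s..t} (\<lambda>r. T h (U r))" if h: "h \<ge> 0" for h
  proof -
    obtain K where "\<And>x. x \<in> X \<Longrightarrow> norm (T h x) \<le> K * norm x" using bounded[OF h] by blast
    then have "((\<lambda>r. T h (U r)) has_integral T h ?I) {s..t}"
      using int_U[of s t] U h
      by (intro has_integral_linear_on[OF subspace_X closed_X integrable_integral]) (auto simp: add scale)
    then show ?thesis by (rule integral_unique[symmetric])
  qed
  \<comment> \<open>After the shift of variable the integrals over \<open>[s, t]\<close> cancel up
    to two end pieces, whose averages tend to \<open>U t\<close> and \<open>U s\<close>.\<close>
  have split: "T h ?I - ?I = integral {t..t+h} U - integral {s..s+h} U - integral {s..t} (\<rho> h)" if h: "h \<ge> 0" for h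
  proof -
    have "integral {s..t} (\<rho> h) = integral {s..t} (\<lambda>r. U (r + h)) - T h ?I"
      unfolding \<rho>_def TI[OF h]
      by (intro integral_diff integrable_continuous_real TU_cont Ushift_cont h)
    moreover have "integral {s..t} (\<lambda>r. U (r + h)) = integral {s+h..t+h} U"
      using integral_shift_Icc_real[of s t U h] by (simp add: o_def add.commute)
    moreover have "integral {s..s+h} U + integral {s+h..t+h} U = integral {s..t+h} U"
      using h st int_U by (intro Henstock_Kurzweil_Integration.integral_combine) auto
    then have "integral {s+h..t+h} U = integral {s..t+h} U - integral {s..s+h} U" by (metis add_diff_cancel_left')
    moreover have "integral {s..t} U + integral {t..t+h} U = integral {s..t+h} U"
      using h st int_U by (intro Henstock_Kurzweil_Integration.integral_combine) auto
    then have "integral {t..t+h} U = integral {s..t+h} U - integral {s..t} U" by (metis add_diff_cancel_left')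
    ultimately show ?thesis by simp
  qed
  have avg: "((\<lambda>h. integral {p..p+h} U /\<^sub>R h) \<longlongrightarrow> U p) (at_right 0)" if p: "s \<le> p" for p
  proof (rule tendstoI)
    fix e :: real assume e: "0 < e"
    have "(U \<longlongrightarrow> U p) (at p within {s..})" using U(2) p by (simp add: continuous_on)
    from tendstoD[OF this, of "e/2"] e obtain d where
      d: "d > 0" "\<And>r. s \<le> r \<Longrightarrow> r \<noteq> p \<Longrightarrow> dist r p < d \<Longrightarrow> dist (U r) (U p) < e/2"
      by (auto simp: eventually_at)
    have "dist (integral {p..p+h} U /\<^sub>R h) (U p) < e" if h: "0 < h" "h < d" for h
    proof -
      have "norm (integral {p..p+h} (\<lambda>r. U r - U p)) \<le> e/2 * (p + h - p)"
      proof (rule integral_bound)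
        show "continuous_on {p..p+h} (\<lambda>r. U r - U p)"
          by (intro continuous_intros continuous_on_subset[OF U(2)]) (use p in auto)
        show "norm (U r - U p) \<le> e/2" if "r \<in> {p..p+h}" for r
          using d(2)[of r] that h p e by (cases "r = p") (auto simp: dist_norm)
      qed (use h in auto)
      also have "integral {p..p+h} (\<lambda>r. U r - U p) = integral {p..p+h} U - h *\<^sub>R U p"
        using h p int_U by (subst integral_diff) auto
      finally have "norm ((integral {p..p+h} U - h *\<^sub>R U p) /\<^sub>R h) \<le> e/2"
        using h by (intro norm_divideR_le) auto
      also have "(integral {p..p+h} U - h *\<^sub>R U p) /\<^sub>R h = integral {p..p+h} U /\<^sub>R h - U p"
        using h by (simp add: scaleR_right_diff_distrib)
      finally show ?thesis using e by (simp add: dist_norm)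
    qed
    then show "\<forall>\<^sub>F h in at_right 0. dist (integral {p..p+h} U /\<^sub>R h) (U p) < e"
      using d by (auto simp: eventually_at_right_field)
  qed
  have \<rho>_lim: "((\<lambda>h. integral {s..t} (\<rho> h) /\<^sub>R h) \<longlongrightarrow> integral {s..t} G) (at_right 0)"
  proof (rule tendstoI)
    fix e :: real assume e: "0 < e"
    define e' where "e' = e / (t - s + 1)"
    have e': "e' > 0" "e' * (t - s) < e" using e st by (auto simp: e'_def field_simps)
    from duhamel_average[OF G e'(1)] obtain d where d: "d > 0"
      "\<And>h r. 0 < h \<Longrightarrow> h < d \<Longrightarrow> r \<in> {s..t} \<Longrightarrow>
        norm (integral {r..r+h} (\<lambda>q. T (r + h - q) (G q)) - h *\<^sub>R G r) \<le> e' * h"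
      by blast
    have "dist (integral {s..t} (\<rho> h) /\<^sub>R h) (integral {s..t} G) < e" if h: "0 < h" "h < d" for h
    proof -
      have \<rho>_near: "norm (\<rho> h r - h *\<^sub>R G r) \<le> e' * h" if r: "r \<in> {s..t}" for r
        using mild[of r "r + h"] d(2)[OF h r] r h by (simp add: \<rho>_def)
      have "norm (integral {s..t} (\<lambda>r. \<rho> h r - h *\<^sub>R G r)) \<le> (e' * h) * (t - s)"
      proof (rule integral_bound[OF st])
        show "continuous_on {s..t} (\<lambda>r. \<rho> h r - h *\<^sub>R G r)" unfolding \<rho>_def
          by (intro continuous_intros TU_cont Ushift_cont continuous_on_subset[OF G(2)]) (use h in auto)
      qed (rule \<rho>_near)
      also have "integral {s..t} (\<lambda>r. \<rho> h r - h *\<^sub>R G r) = integral {s..t} (\<rho> h) - h *\<^sub>R integral {s..t} G"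
        using h \<rho>_int int_G by (subst integral_diff) auto
      finally have "norm ((integral {s..t} (\<rho> h) - h *\<^sub>R integral {s..t} G) /\<^sub>R h) \<le> e' * (t - s)"
        using h by (intro norm_divideR_le) (auto simp: mult_ac)
      also have "(integral {s..t} (\<rho> h) - h *\<^sub>R integral {s..t} G) /\<^sub>R h
          = integral {s..t} (\<rho> h) /\<^sub>R h - integral {s..t} G"
        using h by (simp add: scaleR_right_diff_distrib)
      finally show ?thesis using e' by (simp add: dist_norm)
    qed
    then show "\<forall>\<^sub>F h in at_right 0. dist (integral {s..t} (\<rho> h) /\<^sub>R h) (integral {s..t} G) < e"
      using d by (auto simp: eventually_at_right_field )
  qed
  have "((\<lambda>h. (integral {t..t+h} U /\<^sub>R h - integral {s..s+h} U /\<^sub>R h) - integral {s..t} (\<rho> h) /\<^sub>R h)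
      \<longlongrightarrow> (U t - U s) - integral {s..t} G) (at_right 0)"
    using st by (intro tendsto_intros avg \<rho>_lim) auto
  then have "((\<lambda>h. (T h ?I - ?I) /\<^sub>R h) \<longlongrightarrow> U t - U s - integral {s..t} G) (at_right 0)"
  proof (rule Lim_transform_eventually)
    have "(integral {t..t+h} U /\<^sub>R h - integral {s..s+h} U /\<^sub>R h) - integral {s..t} (\<rho> h) /\<^sub>R h
        = (T h ?I - ?I) /\<^sub>R h" if "h > 0" for h
      unfolding split[OF less_imp_le[OF that]] by (simp add: scaleR_right_diff_distrib)
    then show "\<forall>\<^sub>F h in at_right 0. (integral {t..t+h} U /\<^sub>R h - integral {s..s+h} U /\<^sub>R h) - integral {s..t} (\<rho> h) /\<^sub>R h
        = (T h ?I - ?I) /\<^sub>R h"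
      by (auto simp: eventually_at_right_field intro!: exI[of _ 1])
  qed
  moreover have "U t - U s - integral {s..t} G \<in> X"
    using U(1)[of t] U(1)[of s] GX st by (intro subspace_diff subspace_X) auto
  ultimately show ?thesis using IX by (simp add: generator_def)
qed

text \<open>The averages of an orbit over \<open>[0, h]\<close> are in the domain, an orbit being a
  mild solution with source zero. The density of \<open>H^1_0\<close> in
  \<open>L^2(\<Omega>)\<close> will come from here.\<close>

lemma generator_domain_dense:
  assumes x: "x \<in> X" and e: "e > 0"
  shows "\<exists>y z. (y, z) \<in> generator X T \<and> dist y x < e"
proof -
  have cont: "continuous_on {0..} (\<lambda>t. T t x)" by (rule orbit_continuous[OF x])
  from tendstoD[OF tendsto[OF x], of "e/2"] e obtain d where
    d: "d > 0" "\<And>r. 0 < r \<Longrightarrow> r < d \<Longrightarrow> dist (T r x) x < e/2"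
    by (auto simp: eventually_at_right_field)
  define h where "h = d / 2"
  have h: "0 < h" "h < d" using d by (auto simp: h_def)
  have T_0: "T q 0 = 0" if "q \<ge> 0" for q
    using scale[OF that subspace_0[OF subspace_X], of 0] by simp
  have "(integral {0..h} (\<lambda>t. T t x), T h x - T 0 x - integral {0..h} (\<lambda>t. 0)) \<in> generator X T"
  proof (rule mild_solution_generator[OF _ _ cont])
    fix p r :: real assume pr: "0 \<le> p" "p \<le> r"
    have "integral {p..r} (\<lambda>q. T (r - q) 0) = integral {p..r} (\<lambda>q. 0)"
      by (rule integral_cong) (simp add: T_0)
    then show "T r x = T (r - p) (T p x) + integral {p..r} (\<lambda>q. T (r - q) 0)"
      using T_add[of "r - p" p x] pr x by simp
  qed (use h x in \<open>auto intro: mem subspace_0[OF subspace_X]\<close>)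
  then have gen: "((1/h) *\<^sub>R integral {0..h} (\<lambda>t. T t x), (1/h) *\<^sub>R (T h x - x)) \<in> generator X T"
  proof -
    assume "(integral {0..h} (\<lambda>t. T t x), T h x - T 0 x - integral {0..h} (\<lambda>t. 0)) \<in> generator X T"
    then have I: "integral {0..h} (\<lambda>t. T t x) \<in> X"
      and lim: "((\<lambda>k. (T k (integral {0..h} (\<lambda>t. T t x)) - integral {0..h} (\<lambda>t. T t x)) /\<^sub>R k) \<longlongrightarrow> T h x - x) (at_right 0)"
      by (auto simp: generator_def T_zero[OF x])
    have "((\<lambda>k. (1/h) *\<^sub>R ((T k (integral {0..h} (\<lambda>t. T t x)) - integral {0..h} (\<lambda>t. T t x)) /\<^sub>R k)) \<longlongrightarrow> (1/h) *\<^sub>R (T h x - x)) (at_right 0)"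
      by (intro tendsto_intros lim)
    then have "((\<lambda>k. (T k ((1/h) *\<^sub>R integral {0..h} (\<lambda>t. T t x)) - (1/h) *\<^sub>R integral {0..h} (\<lambda>t. T t x)) /\<^sub>R k) \<longlongrightarrow> (1/h) *\<^sub>R (T h x - x)) (at_right 0)"
      by (rule Lim_transform_eventually)
        (auto simp: eventually_at_right_field scale[OF _ I] scaleR_right_diff_distrib intro!: exI[of _ 1])
    then show ?thesis using I h x
      by (auto simp: generator_def intro!: subspace_scale[OF subspace_X] subspace_diff[OF subspace_X] mem)
  qed
  have "norm (integral {0..h} (\<lambda>t. T t x - x)) \<le> e/2 * (h - 0)"
  proof (rule integral_bound)
    show "continuous_on {0..h} (\<lambda>t. T t x - x)"
      by (intro continuous_intros continuous_on_subset[OF cont]) auto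
    show "norm (T t x - x) \<le> e/2" if "t \<in> {0..h}" for t
      using d(2)[of t] that h e T_zero[OF x] by (cases "t = 0") (auto simp: dist_norm)
  qed (use h in auto)
  also have "integral {0..h} (\<lambda>t. T t x - x) = integral {0..h} (\<lambda>t. T t x) - h *\<^sub>R x"
    using h by (subst integral_diff)
      (auto intro!: integrable_continuous_real continuous_on_subset[OF cont])
  finally have "norm ((integral {0..h} (\<lambda>t. T t x) - h *\<^sub>R x) /\<^sub>R h) \<le> e/2"
    using h by (intro norm_divideR_le) auto
  also have "(integral {0..h} (\<lambda>t. T t x) - h *\<^sub>R x) /\<^sub>R h = (1/h) *\<^sub>R integral {0..h} (\<lambda>t. T t x) - x"
    using h by (simp add: scaleR_right_diff_distrib inverse_eq_divide)
  finally have "dist ((1/h) *\<^sub>R integral {0..h} (\<lambda>t. T t x)) x < e"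
    using e by (simp add: dist_norm)
  with gen show ?thesis by blast
qed

end

section \<open>Weak solutions\<close>

lemma has_vector_derivative_quotient:
  fixes F :: "real \<Rightarrow> 'a::real_normed_vector"
  shows "(F has_vector_derivative D) (at t) \<longleftrightarrow> ((\<lambda>h. (F (t + h) - F t) /\<^sub>R h) \<longlongrightarrow> D) (at 0)"
proof -
  have "norm (F (t + h) - F t - h *\<^sub>R D) / norm h = norm ((F (t + h) - F t) /\<^sub>R h - D)" if "h \<noteq> 0" for h
  proof -
    have "(F (t + h) - F t) /\<^sub>R h - D = (F (t + h) - F t - h *\<^sub>R D) /\<^sub>R h"
      using that by (simp add: scaleR_right_diff_distrib)
    then show ?thesis by (simp add: divide_inverse mult.commute)
  qed
  then have "((\<lambda>h. norm (F (t + h) - F t - h *\<^sub>R D) / norm h) \<longlongrightarrow> 0) (at 0) \<longleftrightarrow>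
      ((\<lambda>h. norm ((F (t + h) - F t) /\<^sub>R h - D)) \<longlongrightarrow> 0) (at 0)"
    by (intro filterlim_cong refl) (auto simp: eventually_at intro!: exI[of _ 1])
  also have "\<dots> \<longleftrightarrow> ((\<lambda>h. (F (t + h) - F t) /\<^sub>R h) \<longlongrightarrow> D) (at 0)"
    by (simp add: tendsto_norm_zero_iff LIM_zero_iff)
  finally show ?thesis
    by (simp add: has_vector_derivative_def has_derivative_at bounded_linear_scaleR_left)
qed

lemma norm_diff_le_of_vector_derivative:
  fixes F :: "real \<Rightarrow> 'a::real_normed_vector"
  assumes "s \<le> t" and deriv: "\<And>r. r \<in> {s..t} \<Longrightarrow> (F has_vector_derivative F' r) (at r)"
    and bound: "\<And>r. r \<in> {s..t} \<Longrightarrow> norm (F' r) \<le> B"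
  shows "norm (F t - F s) \<le> B * (t - s)"
proof (cases "s = t")
  case False
  then have "s < t" using assms(1) by simp
  have "norm (F t - F s) \<le> B * t - B * s"
  proof (rule differentiable_bound_general[OF \<open>s < t\<close>, where f'=F'])
    show "continuous_on {s..t} F"
      by (rule continuous_at_imp_continuous_on) (use deriv has_vector_derivative_continuous in blast)
    show "((\<lambda>x. B * x) has_vector_derivative B) (at x)" for x
      by (auto intro!: derivative_eq_intros)
  qed (use deriv bound in \<open>auto intro!: continuous_intros\<close>)
  then show ?thesis by (simp add: right_diff_distrib)
qed simp

lemma continuous_on_UNIV_tendsto:
  "continuous_on UNIV F \<Longrightarrow> ((\<lambda>h. F (t + h)) \<longlongrightarrow> F t) (at (0::'b::real_normed_vector))"
  using LIM_offset_zero[of F "F t" t] by (simp add: continuous_on_def)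

lemma has_vector_derivative_shift:
  fixes F :: "real \<Rightarrow> 'a::real_normed_vector"
  assumes "(F has_vector_derivative F') (at (t + h))"
  shows "((\<lambda>t. F (t + h)) has_vector_derivative F') (at t)"
  using assms unfolding has_vector_derivative_quotient by (simp add: add_ac)

lemma integral_has_vector_derivative_at:
  fixes F :: "real \<Rightarrow> 'a::banach"
  assumes "continuous_on UNIV F" "s < t"
  shows "((\<lambda>r. integral {s..r} F) has_vector_derivative F t) (at t)"
proof -
  have "((\<lambda>r. integral {s..r} F) has_vector_derivative F t) (at t within {s..t+1})"
    by (rule integral_has_vector_derivative) (use assms in \<open>auto intro: continuous_on_subset\<close>)
  then show ?thesis using assms(2) by (simp add: at_within_Icc_at)
qed

text \<open>\<open>V\<close>, \<open>H\<close>, \<open>J\<close> and \<open>a\<close> model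
  \<open>H^1_0\<close>, \<open>L^2(\<Omega>)\<close>, the embedding and the form of the operator.
  Both spaces are closed subspaces of types because functions on \<open>\<Omega>\<close> are
  represented by their extensions by zero. \<open>c0\<close> and \<open>Ca\<close> express the
  equivalence of norms; the final bound is in terms of \<open>a\<close> and
  \<open>lam\<close>.\<close>

locale wave_form =
  fixes V :: "'v::{real_inner,banach} set" and H :: "'h::{real_inner,banach} set"
    and J :: "'v \<Rightarrow> 'h" and a :: "'v \<Rightarrow> 'v \<Rightarrow> real" and c0 Ca lam :: real
  assumes subspace_V: "subspace V" and closed_V: "closed V"
    and subspace_H: "subspace H" and closed_H: "closed H"
    and J: "bounded_linear J" and J_inj: "inj_on J V"
    and J_dense: "H \<subseteq> closure (J ` V)"
    and a_add: "\<And>u v w. u \<in> V \<Longrightarrow> v \<in> V \<Longrightarrow> w \<in> V \<Longrightarrow> a (u + v) w = a u w + a v w"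
    and a_scale: "\<And>c u w. u \<in> V \<Longrightarrow> w \<in> V \<Longrightarrow> a (c *\<^sub>R u) w = c * a u w"
    and a_sym: "\<And>u w. u \<in> V \<Longrightarrow> w \<in> V \<Longrightarrow> a u w = a w u"
    and c0: "c0 > 0" and coercive: "\<And>u. u \<in> V \<Longrightarrow> c0 * (norm u)\<^sup>2 \<le> a u u"
    and Ca: "Ca \<ge> 0" and a_upper: "\<And>u. u \<in> V \<Longrightarrow> a u u \<le> Ca * (norm u)\<^sup>2"
    and lam: "lam > 0" and a_lower: "\<And>u. u \<in> V \<Longrightarrow> lam * (norm (J u))\<^sup>2 \<le> a u u"
begin

lemmas V_add = subspace_add[OF subspace_V] and V_diff = subspace_diff[OF subspace_V]
  and V_scale = subspace_scale[OF subspace_V] and V_0 = subspace_0[OF subspace_V]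
lemmas V_intros = V_add V_diff V_scale V_0
lemmas H_add = subspace_add[OF subspace_H] and H_diff = subspace_diff[OF subspace_H]
  and H_scale = subspace_scale[OF subspace_H] and H_0 = subspace_0[OF subspace_H]
lemmas H_intros = H_add H_diff H_scale H_0

lemmas J_simps = linear_add[OF bounded_linear.linear[OF J]] linear_diff[OF bounded_linear.linear[OF J]]
  linear_scale[OF bounded_linear.linear[OF J]] linear_0[OF bounded_linear.linear[OF J]]

lemma a_diff: "u \<in> V \<Longrightarrow> v \<in> V \<Longrightarrow> w \<in> V \<Longrightarrow> a (u - v) w = a u w - a v w"
  using a_add[of u "(-1) *\<^sub>R v" w] a_scale[of v w "-1"] V_scale[of v "-1"] by simp

lemma a_add_right: "u \<in> V \<Longrightarrow> v \<in> V \<Longrightarrow> w \<in> V \<Longrightarrow> a w (u + v) = a w u + a w v"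
  and a_diff_right: "u \<in> V \<Longrightarrow> v \<in> V \<Longrightarrow> w \<in> V \<Longrightarrow> a w (u - v) = a w u - a w v"
  and a_scale_right: "u \<in> V \<Longrightarrow> w \<in> V \<Longrightarrow> a w (c *\<^sub>R u) = c * a w u"
  using a_add[of u v w] a_diff[of u v w] a_scale[of u w c] by (simp_all add: a_sym V_intros)

lemmas a_simps = a_add a_diff a_scale a_add_right a_diff_right a_scale_right

lemma a_scale_square: "u \<in> V \<Longrightarrow> a (c *\<^sub>R u) (c *\<^sub>R u) = c\<^sup>2 * a u u"
  by (simp add: a_scale a_scale_right V_scale power2_eq_square)

lemma a_nonneg: "u \<in> V \<Longrightarrow> 0 \<le> a u u"
  using coercive[of u] c0 by (smt (verit) mult_nonneg_nonneg zero_le_power2)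

lemma a_diff_square:
  "u \<in> V \<Longrightarrow> w \<in> V \<Longrightarrow> a (u - w) (u - w) = a u u - 2 * a u w + a w w"
  by (simp add: a_simps V_intros a_sym)

lemma a_Cauchy_Schwarz: assumes "u \<in> V" "w \<in> V" shows "(a u w)\<^sup>2 \<le> a u u * a w w"
proof (cases "a w w = 0")
  case True
  then have "norm w = 0" using coercive[OF assms(2)] c0 by (simp add: mult_le_0_iff)
  then have "a u w = 0" using a_scale_right[of w u 0] assms by simp
  then show ?thesis using a_nonneg assms by simp
next
  case False
  then have pos: "a w w > 0" using a_nonneg[OF assms(2)] by simp
  define c where "c = a u w / a w w"
  have "0 \<le> a (u - c *\<^sub>R w) (u - c *\<^sub>R w)" by (intro a_nonneg V_intros assms)
  also have "\<dots> = a u u - 2 * c * a u w + c * c * a w w"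
    using assms by (simp add: a_diff_square a_scale a_scale_right V_intros)
  also have "\<dots> = a u u - (a u w)\<^sup>2 / a w w" using pos by (simp add: c_def power2_eq_square field_simps)
  finally show ?thesis using pos by (simp add: field_simps)
qed

lemma a_bound: assumes "u \<in> V" "w \<in> V" shows "\<bar>a u w\<bar> \<le> Ca * (norm u * norm w)"
proof (rule power2_le_imp_le)
  have "(a u w)\<^sup>2 \<le> a u u * a w w" by (rule a_Cauchy_Schwarz[OF assms])
  also have "\<dots> \<le> (Ca * (norm u)\<^sup>2) * (Ca * (norm w)\<^sup>2)"
    by (intro mult_mono a_upper a_nonneg assms mult_nonneg_nonneg Ca) auto
  finally show "\<bar>a u w\<bar>\<^sup>2 \<le> (Ca * (norm u * norm w))\<^sup>2" by (simp add: power2_eq_square mult_ac)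
qed (use Ca in auto)

definition N where "N u = sqrt (a u u)"

lemma N_nonneg: "u \<in> V \<Longrightarrow> 0 \<le> N u" and N_sq: "u \<in> V \<Longrightarrow> (N u)\<^sup>2 = a u u"
  by (simp_all add: N_def a_nonneg)

lemma N_scale: "u \<in> V \<Longrightarrow> N (c *\<^sub>R u) = \<bar>c\<bar> * N u"
  by (simp add: N_def a_simps V_intros real_sqrt_mult mult.assoc[symmetric])

lemma N_le_norm: "u \<in> V \<Longrightarrow> N u \<le> sqrt Ca * norm u"
  unfolding N_def using real_sqrt_le_mono[OF a_upper[of u]] by (simp add: real_sqrt_mult)

lemma J_le_N: assumes "u \<in> V" shows "norm (J u) \<le> N u / sqrt lam"
proof -
  have "sqrt (lam * (norm (J u))\<^sup>2) \<le> N u" unfolding N_def by (intro real_sqrt_le_mono a_lower assms)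
  then show ?thesis using lam by (simp add: real_sqrt_mult field_simps)
qed

lemma a_tendsto:
  assumes f: "(f \<longlongrightarrow> x) F" "\<And>n. f n \<in> V" "x \<in> V" and g: "(g \<longlongrightarrow> y) F" "\<And>n. g n \<in> V" "y \<in> V"
  shows "((\<lambda>n. a (f n) (g n)) \<longlongrightarrow> a x y) F"
proof (rule LIM_zero_cancel, rule Lim_null_comparison)
  have "a (f n) (g n) - a x y = a (f n - x) (g n) + a x (g n - y)" for n
    using assms by (simp add: a_simps V_intros)
  then show "\<forall>\<^sub>F n in F. norm (a (f n) (g n) - a x y)
      \<le> Ca * (norm (f n - x) * norm (g n)) + Ca * (norm x * norm (g n - y))"
    using assms a_bound[of "f _ - x" "g _"] a_bound[of x "g _ - y"]
    by (intro always_eventually allI) (auto simp: V_intros intro!: order_trans[OF abs_triangle_ineq] add_mono)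
  have "((\<lambda>n. Ca * (norm (f n - x) * norm (g n)) + Ca * (norm x * norm (g n - y))) \<longlongrightarrow>
      Ca * (norm (x - x) * norm y) + Ca * (norm x * norm (y - y))) F"
    by (intro tendsto_intros f g)
  then show "((\<lambda>n. Ca * (norm (f n - x) * norm (g n)) + Ca * (norm x * norm (g n - y))) \<longlongrightarrow> 0) F"
    by simp
qed

lemma a_has_derivative:
  assumes f: "(f has_vector_derivative f') (at t)" "\<And>r. f r \<in> V" "f' \<in> V"
    and g: "(g has_vector_derivative g') (at t)" "\<And>r. g r \<in> V" "g' \<in> V"
  shows "((\<lambda>r. a (f r) (g r)) has_real_derivative a f' (g t) + a (f t) g') (at t)"
  unfolding has_real_derivative_iff_has_vector_derivative has_vector_derivative_quotient
proof -
  have "((\<lambda>h. a ((f (t + h) - f t) /\<^sub>R h) (g (t + h)) + a (f t) ((g (t + h) - g t) /\<^sub>R h)) \<longlongrightarrow>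
      a f' (g t) + a (f t) g') (at 0)"
    using f g by (intro tendsto_add a_tendsto tendsto_const)
      (auto simp: has_vector_derivative_quotient[symmetric] V_intros
        intro!: isContD has_vector_derivative_continuous LIM_offset_zero)
  then show "((\<lambda>h. (a (f (t + h)) (g (t + h)) - a (f t) (g t)) /\<^sub>R h) \<longlongrightarrow> a f' (g t) + a (f t) g') (at 0)"
    by (rule Lim_transform_eventually)
      (use f g in \<open>auto simp: a_simps V_intros algebra_simps intro!: always_eventually\<close>)
qed

lemma H_eq_0: assumes "w \<in> H" "\<And>\<phi>. \<phi> \<in> V \<Longrightarrow> w \<bullet> J \<phi> = 0" shows "w = 0"
proof -
  have "closed {x. w \<bullet> x = 0}" by (intro closed_Collect_eq continuous_intros)
  then have "closure (J ` V) \<subseteq> {x. w \<bullet> x = 0}" using assms(2) by (intro closure_minimal) auto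
  then have "w \<bullet> w = 0" using J_dense assms(1) by blast
  then show ?thesis by simp
qed

text \<open>The equation \<open>\<epsilon> v' + v + A u = g\<close> as an identity of functionals on
  \<open>V\<close>: \<open>A u\<close> need not be an element of \<open>H\<close>, hence neither
  need \<open>v'\<close>. Accordingly \<open>u\<close> is differentiable only after
  \<open>J\<close>, and \<open>v\<close> only when tested.\<close>

definition weak_sol where
  "weak_sol \<epsilon> u v g \<longleftrightarrow> (\<forall>t. u t \<in> V \<and> v t \<in> H) \<and>
     continuous_on UNIV u \<and> continuous_on UNIV v \<and> continuous_on UNIV g \<and>
     (\<forall>t. ((\<lambda>t. J (u t)) has_vector_derivative v t) (at t)) \<and>
     (\<forall>\<phi>\<in>V. \<forall>t. ((\<lambda>t. v t \<bullet> J \<phi>) has_real_derivative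
        (- (v t \<bullet> J \<phi>) - a (u t) \<phi> + g t \<bullet> J \<phi>) / \<epsilon>) (at t))"

lemma weak_solD:
  assumes "weak_sol \<epsilon> u v g"
  shows "u t \<in> V" "v t \<in> H" "continuous_on UNIV u" "continuous_on UNIV v" "continuous_on UNIV g"
    "((\<lambda>t. J (u t)) has_vector_derivative v t) (at t)"
    "\<phi> \<in> V \<Longrightarrow> ((\<lambda>t. v t \<bullet> J \<phi>) has_real_derivative
        (- (v t \<bullet> J \<phi>) - a (u t) \<phi> + g t \<bullet> J \<phi>) / \<epsilon>) (at t)"
  using assms unfolding weak_sol_def by blast+

lemma weak_sol_difference_quotient:
  assumes "weak_sol \<epsilon> u v g"
  shows "weak_sol \<epsilon> (\<lambda>t. c *\<^sub>R (u (t + h) - u t)) (\<lambda>t. c *\<^sub>R (v (t + h) - v t)) (\<lambda>t. c *\<^sub>R (g (t + h) - g t))"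
proof -
  note D = weak_solD[OF assms]
  have shift: "continuous_on UNIV (\<lambda>t. F (t + h))" if "continuous_on UNIV F" for F :: "real \<Rightarrow> 'b::topological_space"
    by (rule continuous_on_compose2[OF that]) (auto intro: continuous_intros)
  show ?thesis
    unfolding weak_sol_def
  proof (intro conjI allI ballI)
    fix t
    show "((\<lambda>t. J (c *\<^sub>R (u (t + h) - u t))) has_vector_derivative c *\<^sub>R (v (t + h) - v t)) (at t)"
      unfolding J_simps using D(6)
      by (intro derivative_eq_intros has_vector_derivative_shift) (auto intro: D(6))
    fix \<phi> assume \<phi>: "\<phi> \<in> V"
    have 1: "((\<lambda>t. c * (v (t + h) \<bullet> J \<phi> - v t \<bullet> J \<phi>)) has_vector_derivative
      c * ((- (v (t + h) \<bullet> J \<phi>) - a (u (t + h)) \<phi> + g (t + h) \<bullet> J \<phi>) / \<epsilon> -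
        (- (v t \<bullet> J \<phi>) - a (u t) \<phi> + g t \<bullet> J \<phi>) / \<epsilon>)) (at t)"
      using D(7)[OF \<phi>] unfolding has_real_derivative_iff_has_vector_derivative
      by (intro has_vector_derivative_mult_right has_vector_derivative_diff has_vector_derivative_shift) auto
    show "((\<lambda>t. c *\<^sub>R (v (t + h) - v t) \<bullet> J \<phi>) has_real_derivative
        (- (c *\<^sub>R (v (t + h) - v t) \<bullet> J \<phi>) - a (c *\<^sub>R (u (t + h) - u t)) \<phi> +
          c *\<^sub>R (g (t + h) - g t) \<bullet> J \<phi>) / \<epsilon>) (at t)"
      unfolding has_real_derivative_iff_has_vector_derivative
      by (rule has_vector_derivative_eq_rhs[OF has_vector_derivative_transform[OF _ _ 1]])
       (use D(1) \<phi> in \<open>auto simp: inner_diff_left a_simps V_intros diff_divide_distrib add_divide_distrib algebra_simps\<close>)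
  qed (use D in \<open>auto intro!: V_intros H_intros continuous_intros shift\<close>)
qed

lemma energy_cross:
  assumes "weak_sol \<epsilon> u v g"
  shows "((\<lambda>t. J (u t) \<bullet> v t) has_real_derivative
    (norm (v t))\<^sup>2 + (- (v t \<bullet> J (u t)) - a (u t) (u t) + g t \<bullet> J (u t)) / \<epsilon>) (at t)"
  unfolding has_real_derivative_iff_has_vector_derivative has_vector_derivative_quotient
proof -
  note D = weak_solD[OF assms]
  let ?D = "(- (v t \<bullet> J (u t)) - a (u t) (u t) + g t \<bullet> J (u t)) / \<epsilon>"
  \<comment> \<open>The increment of the product is split so that the quotient of \<open>v\<close>
    meets the fixed element \<open>J (u t)\<close>; only in such pairings is \<open>v\<close> known
    to be differentiable.\<close>
  have "((\<lambda>h. ((J (u (t + h)) - J (u t)) /\<^sub>R h) \<bullet> v (t + h) + (v (t + h) \<bullet> J (u t) - v t \<bullet> J (u t)) /\<^sub>R h)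
     \<longlongrightarrow> v t \<bullet> v t + ?D) (at 0)"
    using D(6)[of t] D(7)[of "u t" t] D(1)[of t]
    unfolding has_real_derivative_iff_has_vector_derivative has_vector_derivative_quotient
    by (intro tendsto_intros continuous_on_UNIV_tendsto D) auto
  then show "((\<lambda>h. (J (u (t + h)) \<bullet> v (t + h) - J (u t) \<bullet> v t) /\<^sub>R h) \<longlongrightarrow> (norm (v t))\<^sup>2 + ?D) (at 0)"
    unfolding power2_norm_eq_inner
    by (rule Lim_transform_eventually)
      (auto simp: inner_diff_left inner_diff_right inner_commute algebra_simps intro!: always_eventually)
qed

text \<open>A weak solution is too rough to be tested with its own time derivative; its averages over
  \<open>[t, t + \<eta>]\<close> are not.\<close>

lemma energy_identity:
  assumes sol: "weak_sol \<epsilon> u v g" and eps: "\<epsilon> > 0"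
  shows "((\<lambda>t. \<epsilon> * (norm (v t))\<^sup>2 + a (u t) (u t)) has_real_derivative 2 * ((g t - v t) \<bullet> v t)) (at t)"
proof -
  note D = weak_solD[OF sol]
  define A B where "A = t - 1" and "B = t + 1"
  define P where "P r = integral {A..r} u" for r
  define \<Gamma> where "\<Gamma> r = integral {A..r} g" for r
  have PV: "P r \<in> V" for r
  proof -
    have "u integrable_on {A..r}"
      by (rule integrable_continuous_real, rule continuous_on_subset[OF D(3)]) simp
    from has_integral_mem_closed_subspace[OF subspace_V closed_V integrable_integral[OF this]]
    show ?thesis unfolding P_def using D(1) by blast
  qed
  have P': "(P has_vector_derivative u r) (at r)" if "A < r" for r
    unfolding P_def[abs_def] by (rule integral_has_vector_derivative_at[OF D(3) that])
  have \<Gamma>': "(\<Gamma> has_vector_derivative g r) (at r)" if "A < r" for r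
    unfolding \<Gamma>_def[abs_def] by (rule integral_has_vector_derivative_at[OF D(5) that])
  \<comment> \<open>\<open>J (w \<eta> r)\<close>, \<open>x \<eta> r\<close> and
    \<open>\<gamma> \<eta> r\<close> are the averages of \<open>v\<close>, \<open>u\<close> and
    \<open>g\<close> over \<open>[r, r + \<eta>]\<close>. The point is that \<open>w \<eta>\<close>
    is the derivative of \<open>x \<eta>\<close> and lies in \<open>V\<close>, so it may serve as a
    test element.\<close>
  define w where "w \<eta> r = (1/\<eta>) *\<^sub>R (u (r + \<eta>) - u r)" for \<eta> r
  define \<zeta> where "\<zeta> \<eta> r = (1/\<eta>) *\<^sub>R (v (r + \<eta>) - v r)" for \<eta> r
  define x where "x \<eta> r = (1/\<eta>) *\<^sub>R (P (r + \<eta>) - P r)" for \<eta> r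
  define \<gamma> where "\<gamma> \<eta> r = (1/\<eta>) *\<^sub>R (\<Gamma> (r + \<eta>) - \<Gamma> r)" for \<eta> r
  have mem: "w \<eta> r \<in> V" "x \<eta> r \<in> V" for \<eta> r
    by (auto simp: w_def x_def intro!: V_intros PV D(1))
  have tested: "\<epsilon> * (\<zeta> \<eta> r \<bullet> J \<phi>) = - (J (w \<eta> r) \<bullet> J \<phi>) - a (x \<eta> r) \<phi> + \<gamma> \<eta> r \<bullet> J \<phi>"
    if r: "A < r" "0 < \<eta>" and \<phi>: "\<phi> \<in> V" for \<eta> r \<phi>
  proof -
    \<comment> \<open>The tested equation integrated in time: \<open>q\<close> is constant, and its
      vanishing increment over \<open>[r, r + \<eta>]\<close> is the equation for the
      averages.\<close>
    define q where "q r = \<epsilon> * (v r \<bullet> J \<phi>) + J (u r) \<bullet> J \<phi> + a (P r) \<phi> - \<Gamma> r \<bullet> J \<phi>" for r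
    have "(q has_real_derivative 0) (at s)" if s: "A < s" for s
    proof -
      have 1: "((\<lambda>r. a (P r) \<phi>) has_real_derivative a (u s) \<phi>) (at s)"
        using a_has_derivative[OF P'[OF s] PV D(1) has_vector_derivative_const, of \<phi>] \<phi>
          a_scale_right[of 0 "P s" 0] PV V_0 by simp
      have 2: "((\<lambda>r. J (u r) \<bullet> J \<phi>) has_real_derivative v s \<bullet> J \<phi>) (at s)"
        "((\<lambda>r. \<Gamma> r \<bullet> J \<phi>) has_real_derivative g s \<bullet> J \<phi>) (at s)"
        using bounded_linear.has_vector_derivative[OF bounded_linear_inner_left D(6)]
          bounded_linear.has_vector_derivative[OF bounded_linear_inner_left \<Gamma>'[OF s]]
        by (simp_all add: has_real_derivative_iff_has_vector_derivative)
      show ?thesis unfolding q_def[abs_def]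
        by (rule derivative_eq_intros 1 2 D(7)[OF \<phi>] refl)+ (use eps in simp)
    qed
    then have "q (r + \<eta>) = q r"
      using r by (intro DERIV_isconst_end[of r "r + \<eta>" q] continuous_at_imp_continuous_on ballI)
        (auto intro!: DERIV_isCont[where D=0])
    then have "\<epsilon> * ((v (r + \<eta>) - v r) \<bullet> J \<phi>) = - ((J (u (r + \<eta>)) - J (u r)) \<bullet> J \<phi>) - a (P (r + \<eta>) - P r) \<phi>
        + (\<Gamma> (r + \<eta>) - \<Gamma> r) \<bullet> J \<phi>"
      using PV \<phi> by (simp add: q_def inner_diff_left a_diff algebra_simps)
    then have "(1/\<eta>) * (\<epsilon> * ((v (r + \<eta>) - v r) \<bullet> J \<phi>)) = (1/\<eta>) * (- ((J (u (r + \<eta>)) - J (u r)) \<bullet> J \<phi>)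
        - a (P (r + \<eta>) - P r) \<phi> + (\<Gamma> (r + \<eta>) - \<Gamma> r) \<bullet> J \<phi>)" by simp
    then show ?thesis
      using PV \<phi> unfolding w_def \<zeta>_def x_def \<gamma>_def
      by (simp add: J_simps a_scale V_intros inner_scaleR_left algebra_simps del: scaleR_right_diff_distrib
          flip: times_divide_eq_left)
  qed
  have smooth: "((\<lambda>r. \<epsilon> * (norm (J (w \<eta> r)))\<^sup>2 + a (x \<eta> r) (x \<eta> r)) has_real_derivative
      2 * ((\<gamma> \<eta> r - J (w \<eta> r)) \<bullet> J (w \<eta> r))) (at r)" if r: "A < r" "0 < \<eta>" for \<eta> r
  proof -
    have Jw': "((\<lambda>r. J (w \<eta> r)) has_vector_derivative \<zeta> \<eta> r) (at r)"
      unfolding w_def \<zeta>_def J_simps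
      by (rule derivative_eq_intros has_vector_derivative_shift D(6) refl)+ simp
    have x': "(x \<eta> has_vector_derivative w \<eta> r) (at r)"
      unfolding x_def[abs_def] w_def
      by (rule derivative_eq_intros has_vector_derivative_shift P' refl)+ (use r in \<open>auto intro: P'\<close>)
    have 1: "((\<lambda>r. J (w \<eta> r) \<bullet> J (w \<eta> r)) has_vector_derivative J (w \<eta> r) \<bullet> \<zeta> \<eta> r + \<zeta> \<eta> r \<bullet> J (w \<eta> r)) (at r)"
      by (rule bounded_bilinear.has_vector_derivative[OF bounded_bilinear_inner Jw' Jw'])
    have 2: "((\<lambda>r. a (x \<eta> r) (x \<eta> r)) has_real_derivative a (w \<eta> r) (x \<eta> r) + a (x \<eta> r) (w \<eta> r)) (at r)"
      by (rule a_has_derivative[OF x' mem(2) mem(1) x' mem(2) mem(1)])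
    have "((\<lambda>r. \<epsilon> * (norm (J (w \<eta> r)))\<^sup>2 + a (x \<eta> r) (x \<eta> r)) has_real_derivative
        \<epsilon> * (J (w \<eta> r) \<bullet> \<zeta> \<eta> r + \<zeta> \<eta> r \<bullet> J (w \<eta> r)) + (a (w \<eta> r) (x \<eta> r) + a (x \<eta> r) (w \<eta> r))) (at r)"
      unfolding power2_norm_eq_inner
      using DERIV_add[OF DERIV_cmult[OF 1[folded has_real_derivative_iff_has_vector_derivative], of \<epsilon>] 2] by simp
    moreover have "\<epsilon> * (J (w \<eta> r) \<bullet> \<zeta> \<eta> r + \<zeta> \<eta> r \<bullet> J (w \<eta> r)) + (a (w \<eta> r) (x \<eta> r) + a (x \<eta> r) (w \<eta> r))
        = 2 * (\<epsilon> * (\<zeta> \<eta> r \<bullet> J (w \<eta> r)) + a (x \<eta> r) (w \<eta> r))"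
      using a_sym[OF mem] by (simp add: inner_commute algebra_simps)
    moreover have "\<dots> = 2 * ((\<gamma> \<eta> r - J (w \<eta> r)) \<bullet> J (w \<eta> r))"
      unfolding tested[OF r mem(1)] by (simp add: inner_diff_left)
    ultimately show ?thesis by simp
  qed
  \<comment> \<open>Steps of at most \<open>1/2\<close>, so that \<open>[s, s + k n]\<close> with
    \<open>s \<le> t + 1/2\<close> stays within \<open>{A..B}\<close>.\<close>
  define k :: "nat \<Rightarrow> real" where "k n = inverse (real (Suc (Suc n)))" for n
  have k: "0 < k n" "k n \<le> 1/2" for n by (auto simp: k_def field_simps)
  have k_lim: "filterlim k (at 0) sequentially"
  proof -
    have "k \<longlonglongrightarrow> 0" unfolding k_def[abs_def] by (rule LIMSEQ_Suc[OF LIMSEQ_inverse_real_of_nat])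
    then show ?thesis using k(1) by (simp add: filterlim_at less_imp_neq[symmetric])
  qed
  have lims: "(\<lambda>n. J (w (k n) r)) \<longlonglongrightarrow> v r" "(\<lambda>n. x (k n) r) \<longlonglongrightarrow> u r" "(\<lambda>n. \<gamma> (k n) r) \<longlonglongrightarrow> g r"
    if r: "A < r" for r
    using D(6)[of r] P'[OF r] \<Gamma>'[OF r] k_lim unfolding has_vector_derivative_quotient
    by (auto simp: w_def x_def \<gamma>_def J_simps divide_inverse dest: filterlim_compose)
  let ?e = "\<lambda>r. \<epsilon> * (norm (v r))\<^sup>2 + a (u r) (u r)" and ?e' = "\<lambda>r. 2 * ((g r - v r) \<bullet> v r)"
  \<comment> \<open>The identity for the averages is integrated and passes to the limit by dominated
    convergence; the averages are bounded by the bounds of \<open>v\<close> and \<open>g\<close> on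
    \<open>{A..B}\<close>.\<close>
  have e_diff: "(?e' has_integral ?e r - ?e (t - 1/2)) {t - 1/2..r}" if r: "r \<in> {t - 1/2..t + 1/2}" for r
  proof -
    let ?S = "{t - 1/2..r}"
    define f where "f n s = 2 * ((\<gamma> (k n) s - J (w (k n) s)) \<bullet> J (w (k n) s))" for n s
    have f_int: "(f n has_integral
        (\<epsilon> * (norm (J (w (k n) r)))\<^sup>2 + a (x (k n) r) (x (k n) r)) -
        (\<epsilon> * (norm (J (w (k n) (t - 1/2))))\<^sup>2 + a (x (k n) (t - 1/2)) (x (k n) (t - 1/2)))) ?S" for n
      unfolding f_def[abs_def]
    proof (rule fundamental_theorem_of_calculus)
      fix s assume "s \<in> ?S"
      then have "A < s" by (simp add: A_def)
      from smooth[OF this k(1)[of n]]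
      show "((\<lambda>r. \<epsilon> * (norm (J (w (k n) r)))\<^sup>2 + a (x (k n) r) (x (k n) r)) has_vector_derivative
          2 * ((\<gamma> (k n) s - J (w (k n) s)) \<bullet> J (w (k n) s))) (at s within ?S)"
        unfolding has_real_derivative_iff_has_vector_derivative by (rule has_vector_derivative_at_within)
    qed (use r in auto)
    have bnd: "\<exists>K. \<forall>s\<in>{A..B}. norm (F s) \<le> K" if "continuous_on UNIV F" for F :: "real \<Rightarrow> 'h"
      using compact_continuous_image[OF continuous_on_subset[OF that subset_UNIV], of "{A..B}"]
      by (auto dest!: compact_imp_bounded simp: bounded_iff)
    obtain Kv Kg where K: "\<And>s. s \<in> {A..B} \<Longrightarrow> norm (v s) \<le> Kv" "\<And>s. s \<in> {A..B} \<Longrightarrow> norm (g s) \<le> Kg"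
      using bnd[OF D(4)] bnd[OF D(5)] by metis
    have bounds: "norm (J (w (k n) s)) \<le> Kv" "norm (\<gamma> (k n) s) \<le> Kg" if s: "s \<in> ?S" for n s
    proof -
      have s': "A < s" "s + k n \<le> B" using s r k[of n] by (auto simp: A_def B_def)
      have "norm (J (u (s + k n)) - J (u s)) \<le> Kv * (s + k n - s)"
        by (rule norm_diff_le_of_vector_derivative[OF _ D(6) K(1)]) (use k[of n] s' in auto)
      then show "norm (J (w (k n) s)) \<le> Kv"
        using norm_divideR_le[of _ Kv "k n"] k[of n] by (simp add: w_def J_simps inverse_eq_divide)
      have "norm (\<Gamma> (s + k n) - \<Gamma> s) \<le> Kg * (s + k n - s)"
        by (rule norm_diff_le_of_vector_derivative[OF _ \<Gamma>' K(2)]) (use k[of n] s' in auto)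
      then show "norm (\<gamma> (k n) s) \<le> Kg"
        using norm_divideR_le[of _ Kg "k n"] k[of n] by (simp add: \<gamma>_def inverse_eq_divide)
    qed
    have f_bound: "norm (f n s) \<le> 2 * ((Kg + Kv) * Kv)" if "s \<in> ?S" for n s
    proof -
      have "\<bar>(\<gamma> (k n) s - J (w (k n) s)) \<bullet> J (w (k n) s)\<bar> \<le> norm (\<gamma> (k n) s - J (w (k n) s)) * norm (J (w (k n) s))"
        by (rule Cauchy_Schwarz_ineq2)
      also have "\<dots> \<le> (Kg + Kv) * Kv"
        using bounds[OF that, of n] norm_triangle_ineq4[of "\<gamma> (k n) s" "J (w (k n) s)"]
          norm_ge_zero[of "\<gamma> (k n) s"] norm_ge_zero[of "J (w (k n) s)"]
        by (intro mult_mono; linarith)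
      finally show ?thesis by (simp add: f_def abs_mult)
    qed
    have f_lim: "(\<lambda>n. f n s) \<longlonglongrightarrow> ?e' s" if "s \<in> ?S" for s
      unfolding f_def using that by (intro tendsto_intros lims) (auto simp: A_def)
    have "?e' integrable_on ?S" "(\<lambda>n. integral ?S (f n)) \<longlonglongrightarrow> integral ?S ?e'"
      using dominated_convergence[of f ?S "\<lambda>_. 2 * ((Kg + Kv) * Kv)" ?e'] f_int f_bound f_lim
      by (auto simp: has_integral_iff)
    moreover have "(\<lambda>n. integral ?S (f n)) \<longlonglongrightarrow> ?e r - ?e (t - 1/2)"
      unfolding integral_unique[OF f_int]
      using r by (intro tendsto_intros a_tendsto lims mem D(1)) (auto simp: A_def)
    ultimately show ?thesis using LIMSEQ_unique by (auto simp: has_integral_iff)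
  qed
  have "((\<lambda>r. integral {t - 1/2..r} ?e') has_real_derivative ?e' t) (at t within {t - 1/2..t + 1/2})"
    by (rule integral_has_real_derivative) (auto intro!: continuous_intros continuous_on_subset[OF D(4)] continuous_on_subset[OF D(5)])
  from DERIV_add[OF this DERIV_const[of "?e (t - 1/2)"]]
  have "((\<lambda>r. integral {t - 1/2..r} ?e' + ?e (t - 1/2)) has_real_derivative ?e' t) (at t within {t - 1/2..t + 1/2})"
    by (simp only: add_0_right)
  then have "(?e has_real_derivative ?e' t) (at t within {t - 1/2..t + 1/2})"
  proof (rule has_field_derivative_transform_within[of _ _ _ _ 1])
    show "integral {t - 1/2..r} ?e' + ?e (t - 1/2) = ?e r" if "r \<in> {t - 1/2..t + 1/2}" for r
      unfolding integral_unique[OF e_diff[OF that]] by simp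
  qed simp_all
  then show ?thesis by (simp add: at_within_Icc_at)
qed

end

section \<open>Difference quotients\<close>

text \<open>\<open>P x w\<close> models the derivative of the nonlinearity at \<open>x\<close>,
  multiplied by \<open>w\<close>. \<open>f_taylor\<close> admits a base point \<open>c\<close> other
  than \<open>x\<close> and \<open>y\<close>, so that \<open>P\<close> can be frozen. In
  \<open>P_lipschitz_weak\<close> the base point varies in the norm of \<open>H\<close> only, at the
  price of testing with \<open>J w\<close>; this is the norm in which \<open>u'\<close> is
  controlled uniformly in \<open>\<epsilon>\<close>.\<close>

locale wave_nonlinearity = wave_form V H J a c0 Ca lam
  for V :: "'v::{real_inner,banach} set" and H :: "'h::{real_inner,banach} set"
    and J :: "'v \<Rightarrow> 'h" and a :: "'v \<Rightarrow> 'v \<Rightarrow> real" and c0 Ca lam :: real +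
  fixes f :: "'v \<Rightarrow> 'h" and P :: "'v \<Rightarrow> 'v \<Rightarrow> 'h" and R L :: real
  assumes L: "L \<ge> 0"
    and f_mem: "\<And>x. x \<in> V \<Longrightarrow> f x \<in> H"
    and f_bound: "\<And>x. x \<in> V \<Longrightarrow> a x x \<le> R \<Longrightarrow> norm (f x) \<le> L"
    and f_lipschitz: "\<And>x y. x \<in> V \<Longrightarrow> a x x \<le> R \<Longrightarrow> y \<in> V \<Longrightarrow> a y y \<le> R \<Longrightarrow>
      norm (f x - f y) \<le> L * sqrt (a (x - y) (x - y))"
    and P_add: "\<And>x w w'. x \<in> V \<Longrightarrow> a x x \<le> R \<Longrightarrow> w \<in> V \<Longrightarrow> w' \<in> V \<Longrightarrow> P x (w + w') = P x w + P x w'"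
    and P_scale: "\<And>x w c. x \<in> V \<Longrightarrow> a x x \<le> R \<Longrightarrow> w \<in> V \<Longrightarrow> P x (c *\<^sub>R w) = c *\<^sub>R P x w"
    and P_bound: "\<And>x w. x \<in> V \<Longrightarrow> a x x \<le> R \<Longrightarrow> w \<in> V \<Longrightarrow> norm (P x w) \<le> L * sqrt (a w w)"
    and P_sym: "\<And>x w w'. x \<in> V \<Longrightarrow> a x x \<le> R \<Longrightarrow> w \<in> V \<Longrightarrow> w' \<in> V \<Longrightarrow> P x w \<bullet> J w' = P x w' \<bullet> J w"
    and P_lipschitz: "\<And>x y w. x \<in> V \<Longrightarrow> a x x \<le> R \<Longrightarrow> y \<in> V \<Longrightarrow> a y y \<le> R \<Longrightarrow> w \<in> V \<Longrightarrow>
      norm (P x w - P y w) \<le> L * sqrt (a (x - y) (x - y)) * sqrt (a w w)"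
    and P_lipschitz_weak: "\<And>x y w. x \<in> V \<Longrightarrow> a x x \<le> R \<Longrightarrow> y \<in> V \<Longrightarrow> a y y \<le> R \<Longrightarrow> w \<in> V \<Longrightarrow>
      \<bar>(P x w - P y w) \<bullet> J w\<bar> \<le> L * norm (J (x - y)) * a w w"
    and f_taylor: "\<And>x y c. x \<in> V \<Longrightarrow> a x x \<le> R \<Longrightarrow> y \<in> V \<Longrightarrow> a y y \<le> R \<Longrightarrow> c \<in> V \<Longrightarrow> a c c \<le> R \<Longrightarrow>
      norm (f x - f y - P c (x - y)) \<le>
        L * (sqrt (a (x - c) (x - c)) + sqrt (a (y - c) (y - c))) * sqrt (a (x - y) (x - y))"
begin

lemma P_diff:
  "x \<in> V \<Longrightarrow> a x x \<le> R \<Longrightarrow> w \<in> V \<Longrightarrow> w' \<in> V \<Longrightarrow> P x (w - w') = P x w - P x w'"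
  using P_add[of x w "(-1) *\<^sub>R w'"] P_scale[of x w' "-1"] V_scale[of w' "-1"] by simp

text \<open>By symmetry the increment of the quadratic form from \<open>y\<close> to
  \<open>x\<close> is \<open>(P c x + P c y) \<bullet> J (x - y)\<close>, so \<open>u\<close> has to
  be differentiable only after \<open>J\<close>.\<close>

lemma P_form_has_derivative:
  assumes c: "c \<in> V" "a c c \<le> R" and u: "continuous_on UNIV u" "\<And>t. u t \<in> V"
    and deriv: "((\<lambda>t. J (u t)) has_vector_derivative y) (at t)"
  shows "((\<lambda>t. P c (u t) \<bullet> J (u t)) has_real_derivative 2 * (P c (u t) \<bullet> y)) (at t)"
  unfolding has_real_derivative_iff_has_vector_derivative has_vector_derivative_quotient
proof -
  have "((\<lambda>h. P c (u (t + h)) - P c (u t)) \<longlongrightarrow> 0) (at 0)"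
  proof (rule Lim_null_comparison)
    have "norm (P c (u (t + h)) - P c (u t)) \<le> L * sqrt (a (u (t + h) - u t) (u (t + h) - u t))" for h
      using P_bound[OF c, of "u (t + h) - u t"] u(2) by (simp add: P_diff[OF c] V_intros)
    then show "\<forall>\<^sub>F h in at 0. norm (P c (u (t + h)) - P c (u t)) \<le> L * sqrt (a (u (t + h) - u t) (u (t + h) - u t))"
      by simp
    have "((\<lambda>h. L * sqrt (a (u (t + h) - u t) (u (t + h) - u t))) \<longlongrightarrow> L * sqrt (a (u t - u t) (u t - u t))) (at 0)"
      by (intro tendsto_intros a_tendsto continuous_on_UNIV_tendsto u V_intros)
    then show "((\<lambda>h. L * sqrt (a (u (t + h) - u t) (u (t + h) - u t))) \<longlongrightarrow> 0) (at 0)"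
      using a_scale[of 0 0 0] V_0 by simp
  qed
  then have "((\<lambda>h. P c (u (t + h))) \<longlongrightarrow> P c (u t)) (at 0)" by (rule LIM_zero_cancel)
  moreover have "((\<lambda>h. (J (u (t + h)) - J (u t)) /\<^sub>R h) \<longlongrightarrow> y) (at 0)"
    using deriv by (simp add: has_vector_derivative_quotient)
  ultimately have "((\<lambda>h. (P c (u (t + h)) + P c (u t)) \<bullet> ((J (u (t + h)) - J (u t)) /\<^sub>R h)) \<longlongrightarrow>
      (P c (u t) + P c (u t)) \<bullet> y) (at 0)"
    by (intro tendsto_intros)
  then show "((\<lambda>h. (P c (u (t + h)) \<bullet> J (u (t + h)) - P c (u t) \<bullet> J (u t)) /\<^sub>R h) \<longlongrightarrow> 2 * (P c (u t) \<bullet> y)) (at 0)"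
    unfolding inner_add_left[of "P c (u t)" "P c (u t)" y] mult_2
    by (rule Lim_transform_eventually)
      (use P_sym[OF c u(2) u(2)] in \<open>auto simp: inner_diff_right inner_add_left algebra_simps intro!: always_eventually\<close>)
qed

end

lemma exp_decay_of_derivative_le:
  fixes E :: "real \<Rightarrow> real"
  assumes "s \<le> t" and deriv: "\<And>r. r \<in> {s..t} \<Longrightarrow> (E has_real_derivative E' r) (at r)"
    and le: "\<And>r. r \<in> {s..t} \<Longrightarrow> E' r \<le> - k * E r + k * M" and k: "k > 0"
  shows "E t - M \<le> exp (- k * (t - s)) * (E s - M)"
proof -
  have "(E t - M) * exp (k * t) \<le> (E s - M) * exp (k * s)"
  proof (rule DERIV_nonpos_imp_nonincreasing[OF \<open>s \<le> t\<close>])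
    fix r assume r: "s \<le> r" "r \<le> t"
    have "((\<lambda>r. (E r - M) * exp (k * r)) has_real_derivative (E' r + k * E r - k * M) * exp (k * r)) (at r)"
      using r by (auto intro!: derivative_eq_intros deriv simp: algebra_simps)
    moreover have "(E' r + k * E r - k * M) * exp (k * r) \<le> 0"
      using le[of r] r by (intro mult_nonpos_nonneg) auto
    ultimately show "\<exists>y. ((\<lambda>r. (E r - M) * exp (k * r)) has_real_derivative y) (at r) \<and> y \<le> 0" by blast
  qed
  then have "(E t - M) * exp (k * t) * exp (- k * t) \<le> (E s - M) * exp (k * s) * exp (- k * t)"
    by (intro mult_right_mono) auto
  then show ?thesis by (simp add: mult.assoc exp_add[symmetric] algebra_simps)
qed

lemma young: fixes x y :: real assumes "\<eta> > 0" shows "x * y \<le> \<eta> * x\<^sup>2 + y\<^sup>2 / (4 * \<eta>)"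
proof -
  have "0 \<le> (2 * \<eta> * x - y)\<^sup>2 / (4 * \<eta>)" using assms by simp
  also have "\<dots> = \<eta> * x\<^sup>2 + y\<^sup>2 / (4 * \<eta>) - x * y"
    using assms by (simp add: power2_eq_square field_simps)
  finally show ?thesis by simp
qed

locale wave_trajectory = wave_nonlinearity V H J a c0 Ca lam f P R L
  for V :: "'v::{real_inner,banach} set" and H :: "'h::{real_inner,banach} set"
    and J a c0 Ca lam f P R L +
  fixes \<epsilon> :: real and u :: "real \<Rightarrow> 'v" and v :: "real \<Rightarrow> 'h"
  assumes eps: "0 < \<epsilon>" "\<epsilon> \<le> 1"
    and sol: "weak_sol \<epsilon> u v (\<lambda>t. f (u t))"
    and energy_le: "\<And>t. a (u t) (u t) + \<epsilon> * (norm (v t))\<^sup>2 \<le> R"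
    and unif: "uniformly_continuous_on UNIV u"
begin

lemmas solD = weak_solD[OF sol]

lemma u_mem: "u t \<in> V" and v_mem: "v t \<in> H" using solD by blast+

lemma u_ball: "a (u t) (u t) \<le> R"
  using energy_le[of t] eps by (smt (verit) mult_nonneg_nonneg zero_le_power2)

lemma R_nonneg: "0 \<le> R" using u_ball[of 0] a_nonneg[OF u_mem] by (rule order_trans[rotated])

lemma v_bound: "norm (v t) \<le> sqrt (R / \<epsilon>)"
proof (rule real_le_rsqrt)
  have "\<epsilon> * (norm (v t))\<^sup>2 \<le> R" using energy_le[of t] a_nonneg[OF u_mem[of t]] by simp
  then show "(norm (v t))\<^sup>2 \<le> R / \<epsilon>" using eps by (simp add: field_simps)
qed

text \<open>The bound \<open>M\<close> comes from \<open>e(t + \<tau>) \<le> q (1 + \<eta>) / (1 - \<eta>) e(t) + M'\<close> with a factor smaller than one: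
  on \<open>\<real>\<close> the supremum of \<open>e\<close> can be absorbed.\<close>

lemma difference_quotient_bound:
  shows "\<exists>\<tau>>0. \<exists>M. \<forall>h t. 0 < h \<longrightarrow> h \<le> \<tau> \<longrightarrow>
    \<epsilon> * (norm ((1/h) *\<^sub>R (v (t + h) - v t)))\<^sup>2 +
      a ((1/h) *\<^sub>R (u (t + h) - u t)) ((1/h) *\<^sub>R (u (t + h) - u t)) \<le> M"
proof -
  \<comment> \<open>Bounds \<open>v\<close>, and therefore the difference quotients of
    \<open>J u\<close>, on which the lower-order terms below depend. It is not uniform in
    \<open>\<epsilon>\<close>.\<close>
  define m where "m = sqrt (R / \<epsilon>)"
  have m: "m \<ge> 0" "\<And>t. norm (v t) \<le> m" using R_nonneg eps v_bound by (auto simp: m_def)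
  obtain d where d: "d > 0" "\<And>s t. dist s t < d \<Longrightarrow> N (u s - u t) * (16 * (L + 1)) \<le> 1"
  proof -
    \<comment> \<open>Two increments of energy norm at most \<open>1 / (16 * (L + 1))\<close> make
      \<open>L\<close> times their sum at most \<open>1/8\<close>, the admissible size of the
      linearisation error.\<close>
    define e where "e = 1 / (16 * (L + 1) * (sqrt Ca + 1))"
    have e: "e > 0" using L Ca by (auto simp: e_def intro!: divide_pos_pos mult_pos_pos add_nonneg_pos)
    then obtain d where d: "d > 0" "\<And>s t. dist s t < d \<Longrightarrow> dist (u s) (u t) < e"
      using unif unfolding uniformly_continuous_on_def by (metis UNIV_I)
    have "N (u s - u t) * (16 * (L + 1)) \<le> 1" if "dist s t < d" for s t
    proof -
      have "N (u s - u t) \<le> sqrt Ca * norm (u s - u t)" by (intro N_le_norm V_intros u_mem)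
      also have "\<dots> \<le> (sqrt Ca + 1) * e"
        using d(2)[OF that] Ca by (intro mult_mono) (auto simp: dist_norm)
      also have "\<dots> = 1 / (16 * (L + 1))" using Ca by (simp add: e_def add_nonneg_eq_0_iff)
      finally show ?thesis using L by (simp add: field_simps)
    qed
    with d(1) show ?thesis using that by blast
  qed
  \<comment> \<open>For \<open>t\<close> in \<open>[t0, t0 + \<tau>]\<close> and
    \<open>h \<le> \<tau>\<close> both \<open>t\<close> and \<open>t + h\<close> are closer than
    \<open>d\<close> to \<open>t0\<close>.\<close>
  define \<tau> where "\<tau> = d / 4"
  have \<tau>: "\<tau> > 0" using d by (simp add: \<tau>_def)
  define q where "q = exp (- (1/8) * \<tau>)"
  have q: "0 < q" "q < 1" using \<tau> by (auto simp: q_def)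
  \<comment> \<open>Chosen for \<open>(1 - \<eta>) - q * (1 + \<eta>) \<ge> (1 - q) / 2\<close>, the
    coefficient of the supremum that survives the absorption.\<close>
  define \<eta> where "\<eta> = (1 - q) / 4"
  have \<eta>: "\<eta> > 0" "\<eta> \<le> 1/4" using q by (auto simp: \<eta>_def)
  \<comment> \<open>\<open>M1 \<eta>\<close> is the additive error when the modified energy is
    compared with \<open>e\<close> up to a factor \<open>1 \<plusminus> \<eta>\<close>;
    \<open>M2\<close> also absorbs the constant \<open>(1/2) * (L\<^sup>2 * m\<^sup>2)\<close> of
    the differential inequality, multiplied by eight.\<close>
  define M1 where "M1 \<eta> = (L\<^sup>2 * m\<^sup>2 + m\<^sup>2) / (4 * \<eta>) + m\<^sup>2 / 4" for \<eta> :: real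
  define M2 where "M2 = M1 1 + 4 * L\<^sup>2 * m\<^sup>2"
  have M2: "M2 \<ge> 0" by (simp add: M2_def M1_def)
  define M where "M = (2 * M1 \<eta> + M2) / ((1 - q) / 2)"
  show ?thesis
  proof (rule exI[of _ \<tau>], rule conjI[OF \<tau>], rule exI[of _ M], intro allI impI)
    fix h t0 :: real assume h: "0 < h" "h \<le> \<tau>"
    define w where "w t = (1/h) *\<^sub>R (u (t + h) - u t)" for t
    define y where "y t = (1/h) *\<^sub>R (v (t + h) - v t)" for t
    define S where "S t = (1/h) *\<^sub>R (f (u (t + h)) - f (u t))" for t
    have sol_h: "weak_sol \<epsilon> w y S"
      using weak_sol_difference_quotient[OF sol, of "1/h" h] by (simp add: w_def[abs_def] y_def[abs_def] S_def[abs_def])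
    note Dh = weak_solD[OF sol_h]
    have w_mem: "w t \<in> V" for t using Dh(1) .
    define e where "e t = \<epsilon> * (norm (y t))\<^sup>2 + a (w t) (w t)" for t
    have e_nonneg: "e t \<ge> 0" for t unfolding e_def using eps a_nonneg[OF w_mem] by simp
    have aw: "0 \<le> a (w t) (w t)" for t by (rule a_nonneg[OF w_mem])
    have Jw: "norm (J (w t)) \<le> m" for t
    proof -
      have "norm (J (u (t + h)) - J (u t)) \<le> m * (t + h - t)"
        by (rule norm_diff_le_of_vector_derivative[OF _ solD(6) m(2)]) (use h in auto)
      then show ?thesis using norm_divideR_le[of _ m h] h by (simp add: w_def J_simps inverse_eq_divide)
    qed
    have S_le: "norm (S t) \<le> L * N (w t)" for t
    proof -
      have "norm (S t) = (1/h) * norm (f (u (t + h)) - f (u t))" using h by (simp add: S_def)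
      also have "\<dots> \<le> (1/h) * (L * N (u (t + h) - u t))"
        using f_lipschitz[OF u_mem u_ball u_mem u_ball] h by (intro mult_left_mono) (auto simp: N_def)
      also have "\<dots> = L * N (w t)" using h u_mem by (simp add: w_def N_scale V_intros)
      finally show ?thesis .
    qed
    have step: "(1 - \<eta>) * e (t0 + \<tau>) \<le> q * ((1 + \<eta>) * e t0) + (2 * M1 \<eta> + M2)" for t0
    proof -
      define c where "c = u t0"
      have c: "c \<in> V" "a c c \<le> R" using u_mem u_ball by (auto simp: c_def)
      \<comment> \<open>Freezing \<open>P\<close> at \<open>c\<close> replaces \<open>S t\<close> by
        \<open>S t - P c (w t)\<close> in the derivative of \<open>e\<close>, which is small near
        \<open>t0\<close>. The cross term supplies the missing dissipation of
        \<open>a (w t) (w t)\<close>; its by-product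
        \<open>- (1/2) * (y t \<bullet> J (w t))\<close> is cancelled by the last term.\<close>
      define Ec where "Ec t = e t - P c (w t) \<bullet> J (w t) + (\<epsilon> / 2) * (J (w t) \<bullet> y t) + (1/4) * (norm (J (w t)))\<^sup>2" for t
      define Ec' where "Ec' t = 2 * ((S t - y t) \<bullet> y t) - 2 * (P c (w t) \<bullet> y t)
        + (\<epsilon> / 2) * ((norm (y t))\<^sup>2 + (- (y t \<bullet> J (w t)) - a (w t) (w t) + S t \<bullet> J (w t)) / \<epsilon>)
        + (1/4) * (2 * (J (w t) \<bullet> y t))" for t
      have deriv: "(Ec has_real_derivative Ec' t) (at t)" for t
      proof -
        have 1: "((\<lambda>t. (norm (J (w t)))\<^sup>2) has_real_derivative 2 * (J (w t) \<bullet> y t)) (at t)"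
          using bounded_bilinear.has_vector_derivative[OF bounded_bilinear_inner Dh(6) Dh(6), of t]
          unfolding power2_norm_eq_inner has_real_derivative_iff_has_vector_derivative by (simp add: inner_commute)
        show ?thesis unfolding Ec_def[abs_def] Ec'_def e_def
          by (intro DERIV_add DERIV_diff DERIV_cmult 1 energy_identity[OF sol_h eps(1)] energy_cross[OF sol_h]
            P_form_has_derivative c Dh w_mem)
      qed
      \<comment> \<open>Each of the three corrections contains \<open>J (w t)\<close>, which is
        bounded by \<open>m\<close>.\<close>
      have close: "\<bar>Ec t - e t\<bar> \<le> \<kappa> * e t + M1 \<kappa>" if \<kappa>: "\<kappa> > 0" for t \<kappa>
      proof -
        have "\<bar>P c (w t) \<bullet> J (w t)\<bar> \<le> norm (P c (w t)) * norm (J (w t))" by (rule Cauchy_Schwarz_ineq2)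
        also have "\<dots> \<le> (L * N (w t)) * m"
          using P_bound[OF c w_mem[of t]] Jw[of t] L N_nonneg[OF w_mem] by (intro mult_mono) (auto simp: N_def)
        also have "\<dots> \<le> \<kappa> * (N (w t))\<^sup>2 + (L * m)\<^sup>2 / (4 * \<kappa>)" using young[OF \<kappa>, of "N (w t)" "L * m"] by (simp add: mult_ac)
        finally have 1: "\<bar>P c (w t) \<bullet> J (w t)\<bar> \<le> \<kappa> * a (w t) (w t) + (L\<^sup>2 * m\<^sup>2) / (4 * \<kappa>)"
          by (simp add: N_sq[OF w_mem] power_mult_distrib)
        have "\<bar>J (w t) \<bullet> y t\<bar> \<le> norm (J (w t)) * norm (y t)" by (rule Cauchy_Schwarz_ineq2)
        also have "\<dots> \<le> m * norm (y t)" using Jw by (intro mult_right_mono) auto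
        also have "\<dots> \<le> \<kappa> * (norm (y t))\<^sup>2 + m\<^sup>2 / (4 * \<kappa>)" using young[OF \<kappa>, of "norm (y t)" m] by (simp add: mult_ac)
        finally have "(\<epsilon> / 2) * \<bar>J (w t) \<bullet> y t\<bar> \<le> (\<epsilon> / 2) * (\<kappa> * (norm (y t))\<^sup>2 + m\<^sup>2 / (4 * \<kappa>))"
          using eps by (intro mult_left_mono) auto
        also have "\<dots> \<le> \<epsilon> * (\<kappa> * (norm (y t))\<^sup>2) + 1 * (m\<^sup>2 / (4 * \<kappa>))"
          unfolding distrib_left using eps \<kappa> by (intro add_mono mult_right_mono) auto
        finally have 2: "\<bar>(\<epsilon> / 2) * (J (w t) \<bullet> y t)\<bar> \<le> \<epsilon> * (\<kappa> * (norm (y t))\<^sup>2) + m\<^sup>2 / (4 * \<kappa>)"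
          using eps by (simp add: abs_mult)
        have 3: "(norm (J (w t)))\<^sup>2 \<le> m\<^sup>2" using Jw by (intro power_mono) auto
        have "\<kappa> * e t + M1 \<kappa> = (\<kappa> * a (w t) (w t) + (L\<^sup>2 * m\<^sup>2) / (4 * \<kappa>)) + (\<epsilon> * (\<kappa> * (norm (y t))\<^sup>2) + m\<^sup>2 / (4 * \<kappa>)) + m\<^sup>2 / 4"
          by (simp add: e_def M1_def algebra_simps add_divide_distrib)
        moreover have "Ec t - e t = (\<epsilon> / 2) * (J (w t) \<bullet> y t) - P c (w t) \<bullet> J (w t) + (1/4) * (norm (J (w t)))\<^sup>2"
          by (simp add: Ec_def)
        ultimately show ?thesis using 1 2 3 zero_le_power2[of "norm (J (w t))"] by linarith
      qed
      have Ec'_le: "Ec' t \<le> - (1/8) * Ec t + (1/8) * M2" if t: "t \<in> {t0..t0 + \<tau>}" for t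
      proof -
        have "norm (S t - P c (w t)) \<le> (1/8) * N (w t)"
        proof -
          have "norm (S t - P c (w t)) = (1/h) * norm (f (u (t + h)) - f (u t) - P c (u (t + h) - u t))"
          proof -
            have "S t - P c (w t) = (1/h) *\<^sub>R (f (u (t + h)) - f (u t) - P c (u (t + h) - u t))"
              unfolding S_def w_def P_scale[OF c V_diff[OF u_mem u_mem]] by (simp only: scaleR_right_diff_distrib)
            then show ?thesis using h by simp
          qed
          also have "\<dots> \<le> (1/h) * (L * (N (u (t + h) - c) + N (u t - c)) * N (u (t + h) - u t))"
            using f_taylor[OF u_mem u_ball u_mem u_ball c] h by (intro mult_left_mono) (auto simp: N_def)
          also have "\<dots> = (L * (N (u (t + h) - c) + N (u t - c))) * N (w t)"
            using h u_mem by (simp add: w_def N_scale V_intros)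
          also have "\<dots> \<le> (1/8) * N (w t)"
          proof (intro mult_right_mono N_nonneg w_mem)
            have "N (u (t + h) - c) * (16 * (L + 1)) \<le> 1"
              unfolding c_def using t h \<tau> by (intro d(2)) (auto simp: dist_real_def \<tau>_def)
            moreover have "N (u t - c) * (16 * (L + 1)) \<le> 1"
              unfolding c_def using t h \<tau> by (intro d(2)) (auto simp: dist_real_def \<tau>_def)
            ultimately have "(N (u (t + h) - c) + N (u t - c)) * (16 * (L + 1)) \<le> 2" by (simp add: distrib_right)
            moreover define k where "k = N (u (t + h) - c) + N (u t - c)"
            ultimately have "16 * (L * k) + 16 * k \<le> 2" by (simp add: algebra_simps)
            moreover have "0 \<le> k"
              unfolding k_def using u_mem c by (intro add_nonneg_nonneg N_nonneg V_intros) auto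
            ultimately have "L * k \<le> 1/8" by linarith
            then show "L * (N (u (t + h) - c) + N (u t - c)) \<le> 1/8" by (simp add: k_def)
          qed
          finally show ?thesis .
        qed
        then have "\<bar>(S t - P c (w t)) \<bullet> y t\<bar> \<le> (1/8) * N (w t) * norm (y t)"
          using Cauchy_Schwarz_ineq2[of "S t - P c (w t)" "y t"] by (meson mult_right_mono norm_ge_zero order_trans)
        also have "\<dots> \<le> (1/8) * ((1/4) * a (w t) (w t) + (norm (y t))\<^sup>2)"
          using young[of "1/4" "N (w t)" "norm (y t)"] by (simp add: N_sq[OF w_mem])
        finally have "(S t - P c (w t)) \<bullet> y t \<le> (1/8) * ((1/4) * a (w t) (w t) + (norm (y t))\<^sup>2)"
          by (rule abs_le_D1)
        then have 1: "2 * ((S t - P c (w t)) \<bullet> y t) \<le> (1/16) * a (w t) (w t) + (1/4) * (norm (y t))\<^sup>2"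
          by (simp add: algebra_simps)
        have "\<bar>S t \<bullet> J (w t)\<bar> \<le> (L * N (w t)) * m"
          using Cauchy_Schwarz_ineq2[of "S t" "J (w t)"] S_le[of t] Jw[of t] L N_nonneg[OF w_mem[of t]]
          by (meson mult_mono norm_ge_zero order_trans mult_nonneg_nonneg)
        also have "\<dots> \<le> (1/4) * a (w t) (w t) + L\<^sup>2 * m\<^sup>2"
          using young[of "1/4" "N (w t)" "L * m"] by (simp add: N_sq[OF w_mem] power_mult_distrib mult_ac)
        finally have 2: "(1/2) * (S t \<bullet> J (w t)) \<le> (1/8) * a (w t) (w t) + (1/2) * (L\<^sup>2 * m\<^sup>2)" by linarith
        have "Ec' t = 2 * ((S t - P c (w t)) \<bullet> y t) - 2 * (norm (y t))\<^sup>2 + (\<epsilon> / 2) * (norm (y t))\<^sup>2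
            - (1/2) * a (w t) (w t) + (1/2) * (S t \<bullet> J (w t))"
        proof -
          have expand: "(\<epsilon> / 2) * (x + X / \<epsilon>) = (\<epsilon> / 2) * x + X / 2" for x X using eps by (simp add: field_simps)
          show ?thesis unfolding Ec'_def expand
            by (simp add: inner_diff_left inner_diff_right power2_norm_eq_inner inner_commute add_divide_distrib diff_divide_distrib)
        qed
        also have "\<dots> \<le> - (1/4) * a (w t) (w t) - (1/4) * (norm (y t))\<^sup>2 + (1/2) * (L\<^sup>2 * m\<^sup>2)"
        proof -
          have "(\<epsilon> / 2) * (norm (y t))\<^sup>2 \<le> (1/2) * (norm (y t))\<^sup>2" using eps by (intro mult_right_mono) auto
          then show ?thesis using 1 2 aw[of t] zero_le_power2[of "norm (y t)"] by linarith
        qed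
        also have "\<dots> \<le> - (1/4) * e t + (1/2) * (L\<^sup>2 * m\<^sup>2)"
        proof -
          have "\<epsilon> * (norm (y t))\<^sup>2 \<le> 1 * (norm (y t))\<^sup>2" using eps by (intro mult_right_mono) auto
          then show ?thesis unfolding e_def distrib_left by linarith
        qed
        also have "\<dots> \<le> - (1/8) * Ec t + (1/8) * M2"
        proof -
          have "Ec t \<le> 2 * e t + M1 1" using abs_le_D1[OF close[of 1 t]] by simp
          then show ?thesis by (simp add: M2_def add_divide_distrib)
        qed
        finally show ?thesis .
      qed
      have "Ec (t0 + \<tau>) - M2 \<le> exp (- (1/8) * (t0 + \<tau> - t0)) * (Ec t0 - M2)"
        by (rule exp_decay_of_derivative_le[OF _ deriv Ec'_le]) (use \<tau> in auto)
      then have "Ec (t0 + \<tau>) \<le> q * Ec t0 + (1 - q) * M2" by (simp add: q_def algebra_simps)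
      moreover have "(1 - q) * M2 \<le> 1 * M2" using q M2 by (intro mult_right_mono) auto
      moreover have "Ec t0 \<le> (1 + \<eta>) * e t0 + M1 \<eta>"
        using abs_le_D1[OF close[OF \<eta>(1), of t0]] by (simp add: algebra_simps)
      then have "q * Ec t0 \<le> q * ((1 + \<eta>) * e t0 + M1 \<eta>)" using q by (intro mult_left_mono) auto
      then have "q * Ec t0 \<le> q * ((1 + \<eta>) * e t0) + q * M1 \<eta>" by (simp only: distrib_left)
      moreover have "q * M1 \<eta> \<le> 1 * M1 \<eta>" using q \<eta> by (intro mult_right_mono) (auto simp: M1_def)
      moreover have "(1 - \<eta>) * e (t0 + \<tau>) \<le> Ec (t0 + \<tau>) + M1 \<eta>"
        using abs_le_D2[OF close[OF \<eta>(1), of "t0 + \<tau>"]] by (simp add: algebra_simps)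
      ultimately show ?thesis by linarith
    qed
    \<comment> \<open>This bound degenerates as \<open>h\<close> tends to zero. It only ensures that
      the supremum is finite, without which it could not be absorbed.\<close>
    have bdd: "bdd_above (range e)"
    proof -
      have "e t \<le> 4 * R / h\<^sup>2 + 4 * R / h\<^sup>2" for t
      proof -
        have "\<epsilon> * (norm (v (t + h) - v t))\<^sup>2 \<le> \<epsilon> * (2 * (norm (v (t + h)))\<^sup>2 + 2 * (norm (v t))\<^sup>2)"
        proof (rule mult_left_mono)
          have "0 \<le> (norm (v (t + h) + v t))\<^sup>2" by simp
          then show "(norm (v (t + h) - v t))\<^sup>2 \<le> 2 * (norm (v (t + h)))\<^sup>2 + 2 * (norm (v t))\<^sup>2"
            by (simp add: power2_norm_eq_inner inner_simps inner_commute)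
        qed (use eps in auto)
        also have "\<dots> \<le> 4 * R"
          using energy_le[of t] energy_le[of "t + h"] a_nonneg[OF u_mem[of t]] a_nonneg[OF u_mem[of "t + h"]]
          by (simp add: distrib_left)
        finally have 1: "\<epsilon> * (norm (v (t + h) - v t))\<^sup>2 \<le> 4 * R" .
        have "0 \<le> a (u (t + h) + u t) (u (t + h) + u t)" by (intro a_nonneg V_intros u_mem)
        then have "a (u (t + h) - u t) (u (t + h) - u t) \<le> 2 * a (u (t + h)) (u (t + h)) + 2 * a (u t) (u t)"
          using u_mem by (simp add: a_simps V_intros a_sym[of "u (t + h)" "u t"])
        also have "\<dots> \<le> 4 * R" using u_ball[of t] u_ball[of "t + h"] by simp
        finally have 2: "a (u (t + h) - u t) (u (t + h) - u t) \<le> 4 * R" .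
        have "e t = (\<epsilon> * (norm (v (t + h) - v t))\<^sup>2) / h\<^sup>2 + a (u (t + h) - u t) (u (t + h) - u t) / h\<^sup>2"
          unfolding e_def y_def w_def a_scale_square[OF V_diff[OF u_mem u_mem]]
          by (simp add: power_divide)
        then show ?thesis
          using add_mono[OF divide_right_mono[OF 1, of "h\<^sup>2"] divide_right_mono[OF 2, of "h\<^sup>2"]] by simp
      qed
      then show ?thesis by (auto intro!: bdd_aboveI)
    qed
    define s where "s = (SUP t. e t)"
    have e_le: "e t \<le> s" for t unfolding s_def by (intro cSUP_upper bdd) auto
    have "s \<le> (q * ((1 + \<eta>) * s) + (2 * M1 \<eta> + M2)) / (1 - \<eta>)"
      unfolding s_def
    proof (rule cSUP_least)
      fix t
      have "(1 - \<eta>) * e (t - \<tau> + \<tau>) \<le> q * ((1 + \<eta>) * e (t - \<tau>)) + (2 * M1 \<eta> + M2)" by (rule step)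
      also have "\<dots> \<le> q * ((1 + \<eta>) * s) + (2 * M1 \<eta> + M2)"
        using q \<eta> e_le by (intro add_right_mono mult_left_mono) auto
      finally show "e t \<le> (q * ((1 + \<eta>) * (SUP t. e t)) + (2 * M1 \<eta> + M2)) / (1 - \<eta>)"
        using \<eta> by (simp add: s_def field_simps)
    qed simp
    then have "(1 - \<eta>) * s \<le> q * ((1 + \<eta>) * s) + (2 * M1 \<eta> + M2)" using \<eta> by (simp add: field_simps)
    moreover have "((1 - q) / 2) * s \<le> (1 - \<eta>) * s - q * ((1 + \<eta>) * s)"
    proof -
      have "s \<ge> 0" using e_le[of 0] e_nonneg[of 0] by simp
      moreover have "(1 - q) / 2 \<le> (1 - \<eta>) - q * (1 + \<eta>)"
      proof -
        have "\<eta> * (1 + q) \<le> \<eta> * 2" using q \<eta> by (intro mult_left_mono) auto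
        then show ?thesis by (simp add: \<eta>_def field_simps)
      qed
      ultimately show ?thesis using mult_right_mono[of "(1 - q) / 2" "(1 - \<eta>) - q * (1 + \<eta>)" s] by (simp add: algebra_simps)
    qed
    ultimately have "((1 - q) / 2) * s \<le> 2 * M1 \<eta> + M2" by linarith
    then have "s \<le> M" using q by (simp add: M_def field_simps)
    then show "\<epsilon> * (norm ((1/h) *\<^sub>R (v (t0 + h) - v t0)))\<^sup>2 +
      a ((1/h) *\<^sub>R (u (t0 + h) - u t0)) ((1/h) *\<^sub>R (u (t0 + h) - u t0)) \<le> M"
      using e_le[of t0] by (simp add: e_def w_def y_def)
  qed
qed

end

context wave_nonlinearity begin

lemma f_continuous:
  assumes u: "continuous_on UNIV u" "\<And>t. u t \<in> V" "\<And>t. a (u t) (u t) \<le> R"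
  shows "continuous_on UNIV (\<lambda>t. f (u t))"
  unfolding continuous_on_def
proof
  fix t
  have ut: "(u \<longlongrightarrow> u t) (at t)" using u(1) by (simp add: continuous_on_def)
  have "((\<lambda>s. f (u s) - f (u t)) \<longlongrightarrow> 0) (at t)"
  proof (rule Lim_null_comparison)
    show "\<forall>\<^sub>F s in at t. norm (f (u s) - f (u t)) \<le> L * sqrt (a (u s - u t) (u s - u t))"
      using f_lipschitz u by simp
    have "((\<lambda>s. L * sqrt (a (u s - u t) (u s - u t))) \<longlongrightarrow> L * sqrt (a (u t - u t) (u t - u t))) (at t)"
      by (intro tendsto_intros a_tendsto V_intros u(2) ut)
    then show "((\<lambda>s. L * sqrt (a (u s - u t) (u s - u t))) \<longlongrightarrow> 0) (at t)"
      using a_scale[of 0 0 0] V_0 by simp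
  qed
  then show "((\<lambda>s. f (u s)) \<longlongrightarrow> f (u t)) (at t)" by (rule LIM_zero_cancel)
qed

end

context wave_trajectory begin

text \<open>Bounded difference quotients have weak cluster points. Those of \<open>u\<close>
  converge strongly after \<open>J\<close> and those of \<open>v\<close> when tested, which
  identifies \<open>J w\<close> and \<open>z\<close>. The second claim makes \<open>a (u t)\<close>
  a continuous functional for the norm of \<open>H\<close>, so \<open>u t\<close> will lie in the
  domain of the operator.\<close>

lemma weak_regularity:
  shows "\<exists>w\<in>V. J w = v t"
    and "\<exists>z\<in>H. \<forall>\<phi>\<in>V. z \<bullet> J \<phi> = (- (v t \<bullet> J \<phi>) - a (u t) \<phi> + f (u t) \<bullet> J \<phi>) / \<epsilon>"
proof -
  obtain \<tau> M where \<tau>: "\<tau> > 0" and M: "\<And>h t. 0 < h \<Longrightarrow> h \<le> \<tau> \<Longrightarrow>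
    \<epsilon> * (norm ((1/h) *\<^sub>R (v (t + h) - v t)))\<^sup>2 +
      a ((1/h) *\<^sub>R (u (t + h) - u t)) ((1/h) *\<^sub>R (u (t + h) - u t)) \<le> M"
    using difference_quotient_bound by metis
  define h where "h n = \<tau> * inverse (real (Suc n))" for n
  have h: "0 < h n" "h n \<le> \<tau>" for n using \<tau> by (auto simp: h_def field_simps)
  have h_lim: "filterlim h (at 0) sequentially"
  proof -
    have "h \<longlonglongrightarrow> \<tau> * 0" unfolding h_def[abs_def] by (intro tendsto_intros LIMSEQ_inverse_real_of_nat)
    then show ?thesis using h(1) by (simp add: filterlim_at less_imp_neq[symmetric])
  qed
  define x where "x n = (1/h n) *\<^sub>R (u (t + h n) - u t)" for n
  define y where "y n = (1/h n) *\<^sub>R (v (t + h n) - v t)" for n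
  have x_mem: "x n \<in> V" for n by (auto simp: x_def intro!: V_intros u_mem)
  have y_mem: "y n \<in> H" for n by (auto simp: y_def intro!: H_intros v_mem)
  have bound: "\<epsilon> * (norm (y n))\<^sup>2 + a (x n) (x n) \<le> M" for n
    unfolding x_def y_def by (rule M[OF h])
  have ax: "a (x n) (x n) \<le> M" for n
    using bound[of n] eps by (smt (verit) mult_nonneg_nonneg zero_le_power2)
  have "norm (x n) \<le> sqrt (M / c0)" for n
    using coercive[OF x_mem[of n]] ax[of n] c0 by (intro real_le_rsqrt) (simp add: field_simps)
  then obtain w where w: "\<And>S. closed S \<Longrightarrow> convex S \<Longrightarrow> eventually (\<lambda>n. x n \<in> S) sequentially \<Longrightarrow> w \<in> S"
    by (rule hilbert_weak_cluster_point[of x]) blast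
  have "w \<in> V" using subspace_imp_convex[OF subspace_V] closed_V x_mem by (intro w) auto
  moreover have "J w = v t"
  proof (rule bounded_linear_weak_cluster[OF w J])
    show "(\<lambda>n. J (x n)) \<longlonglongrightarrow> v t"
      using solD(6)[of t] h_lim unfolding has_vector_derivative_quotient
      by (auto simp: x_def J_simps inverse_eq_divide dest: filterlim_compose)
  qed
  ultimately show "\<exists>w\<in>V. J w = v t" by blast
  have "norm (y n) \<le> sqrt (M / \<epsilon>)" for n
    using bound[of n] a_nonneg[OF x_mem[of n]] eps by (intro real_le_rsqrt) (simp add: field_simps)
  then obtain z where z: "\<And>S. closed S \<Longrightarrow> convex S \<Longrightarrow> eventually (\<lambda>n. y n \<in> S) sequentially \<Longrightarrow> z \<in> S"
    by (rule hilbert_weak_cluster_point[of y]) blast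
  have "z \<in> H" using subspace_imp_convex[OF subspace_H] closed_H y_mem by (intro z) auto
  moreover have "z \<bullet> J \<phi> = (- (v t \<bullet> J \<phi>) - a (u t) \<phi> + f (u t) \<bullet> J \<phi>) / \<epsilon>" if \<phi>: "\<phi> \<in> V" for \<phi>
  proof (rule bounded_linear_weak_cluster[OF z bounded_linear_inner_left])
    show "(\<lambda>n. y n \<bullet> J \<phi>) \<longlonglongrightarrow> (- (v t \<bullet> J \<phi>) - a (u t) \<phi> + f (u t) \<bullet> J \<phi>) / \<epsilon>"
      using solD(7)[OF \<phi>, of t] h_lim unfolding has_real_derivative_iff_has_vector_derivative has_vector_derivative_quotient
      by (auto simp: y_def inner_diff_left divide_inverse mult.commute dest: filterlim_compose)
  qed
  ultimately show "\<exists>z\<in>H. \<forall>\<phi>\<in>V. z \<bullet> J \<phi> = (- (v t \<bullet> J \<phi>) - a (u t) \<phi> + f (u t) \<bullet> J \<phi>) / \<epsilon>" by blast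
qed

end

section \<open>The operator of the form, and mild solutions\<close>

context wave_form begin

definition dom where "dom = {x \<in> V. \<exists>w\<in>H. \<forall>\<phi>\<in>V. a x \<phi> = w \<bullet> J \<phi>}"
definition op where "op x = (THE w. w \<in> H \<and> (\<forall>\<phi>\<in>V. a x \<phi> = w \<bullet> J \<phi>))"

lemma op_eq: assumes "w \<in> H" "\<And>\<phi>. \<phi> \<in> V \<Longrightarrow> a x \<phi> = w \<bullet> J \<phi>" shows "op x = w"
  unfolding op_def
proof (rule the_equality)
  fix w' assume w': "w' \<in> H \<and> (\<forall>\<phi>\<in>V. a x \<phi> = w' \<bullet> J \<phi>)"
  have "w' - w = 0" using w' assms by (intro H_eq_0 H_diff) (simp_all add: inner_diff_left)
  then show "w' = w" by simp
qed (use assms in auto)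

lemma dom_op: assumes "x \<in> dom" shows "x \<in> V" "op x \<in> H" "\<And>\<phi>. \<phi> \<in> V \<Longrightarrow> a x \<phi> = op x \<bullet> J \<phi>"
proof -
  obtain w where w: "x \<in> V" "w \<in> H" "\<And>\<phi>. \<phi> \<in> V \<Longrightarrow> a x \<phi> = w \<bullet> J \<phi>"
    using assms unfolding dom_def by blast
  have "op x = w" by (rule op_eq[OF w(2,3)])
  with w show "x \<in> V" "op x \<in> H" "\<And>\<phi>. \<phi> \<in> V \<Longrightarrow> a x \<phi> = op x \<bullet> J \<phi>" by simp_all
qed

end

locale wave_mild = wave_nonlinearity V H J a c0 Ca lam f P R L
  for V :: "'v::{real_inner,banach} set" and H :: "'h::{real_inner,banach} set"
    and J a c0 Ca lam f P R L +
  fixes \<epsilon> :: real and T :: "real \<Rightarrow> 'v \<times> 'h \<Rightarrow> 'v \<times> 'h" and u :: "real \<Rightarrow> 'v" and v :: "real \<Rightarrow> 'h"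
  assumes eps: "0 < \<epsilon>" "\<epsilon> \<le> 1"
    and semigroup: "C0_semigroup_on (V \<times> H) T"
    and generator: "generator (V \<times> H) T =
      {((x, J y), (y, - (1 / \<epsilon>) *\<^sub>R (J y + op x))) | x y. x \<in> dom \<and> y \<in> V}"
    and u_mem: "\<And>t. u t \<in> V" and v_mem: "\<And>t. v t \<in> H"
    and mild: "\<And>s t. s \<le> t \<Longrightarrow>
      ((\<lambda>p. T (t - p) (0, (1 / \<epsilon>) *\<^sub>R f (u p))) has_integral (u t, v t) - T (t - s) (u s, v s)) {s..t}"
    and energy_le: "\<And>t. a (u t) (u t) + \<epsilon> * (norm (v t))\<^sup>2 \<le> R"
    and unif: "uniformly_continuous_on UNIV u"
begin

sublocale T: c0_semigroup "V \<times> H" T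
  by unfold_locales (auto intro: subspace_Times subspace_V subspace_H closed_Times closed_V closed_H semigroup)

lemma u_ball: "a (u t) (u t) \<le> R"
  using energy_le[of t] eps by (smt (verit) mult_nonneg_nonneg zero_le_power2)

lemma u_cont: "continuous_on UNIV u" by (rule uniformly_continuous_imp_continuous[OF unif])

definition U where "U t = (u t, v t)"
definition G where "G t = (0 :: 'v, (1 / \<epsilon>) *\<^sub>R f (u t))"

lemma U_mem: "U t \<in> V \<times> H" and G_mem: "G t \<in> V \<times> H"
  by (auto simp: U_def G_def u_mem v_mem intro!: V_0 H_scale f_mem)

lemma fu_cont: "continuous_on UNIV (\<lambda>t. f (u t))" by (rule f_continuous[OF u_cont u_mem u_ball])

lemma G_cont: "continuous_on UNIV G"
  unfolding G_def[abs_def] by (intro continuous_intros fu_cont)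

lemma mild': "s \<le> t \<Longrightarrow> ((\<lambda>p. T (t - p) (G p)) has_integral U t - T (t - s) (U s)) {s..t}"
  unfolding U_def G_def by (rule mild)

lemma G_norm: "norm (G t) \<le> L / \<epsilon>"
  using f_bound[OF u_mem u_ball, of t] eps by (simp add: G_def norm_Pair divide_right_mono)

text \<open>By hypothesis only \<open>u\<close> is continuous. The Duhamel integral over
  \<open>[s, t]\<close> is at most a multiple of \<open>t - s\<close>, so \<open>U\<close> is an
  almost orbit and \<open>v\<close> is continuous as well.\<close>

lemma U_isCont: "isCont U t"
proof -
  obtain M where M: "M \<ge> 1" "\<And>t x. t \<in> {0..1} \<Longrightarrow> x \<in> V \<times> H \<Longrightarrow> norm (T t x) \<le> M * norm x"
    using T.locally_bounded[of 1] by blast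
  show ?thesis
  proof (rule T.almost_orbit_continuous[of "t - 1" U "M * (L / \<epsilon>)"])
    fix s t :: real assume st: "s \<le> t" "t \<le> s + 1"
    show "norm (U t - T (t - s) (U s)) \<le> M * (L / \<epsilon>) * (t - s)"
    proof (rule has_integral_bound_real[OF _ finite.emptyI mild'[OF st(1)], simplified content_real[OF st(1)]])
      show "0 \<le> M * (L / \<epsilon>)" using M L eps by auto
      fix p assume p: "p \<in> {s..t} - {}"
      have "norm (T (t - p) (G p)) \<le> M * norm (G p)" using p st G_mem by (intro M) auto
      also have "\<dots> \<le> M * (L / \<epsilon>)" using G_norm M by (intro mult_left_mono) auto
      finally show "norm (T (t - p) (G p)) \<le> M * (L / \<epsilon>)" .
    qed
  qed (auto simp: U_mem)
qed

lemma U_cont: "continuous_on UNIV U" by (intro continuous_at_imp_continuous_on ballI U_isCont)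

lemma v_cont: "continuous_on UNIV v"
  using continuous_on_snd[OF U_cont] by (simp add: U_def)

text \<open>The generator relation for the integral of \<open>U\<close>, read in components; the
  first component of its value is \<open>u t - u s\<close>.\<close>

lemma integrated:
  assumes st: "s \<le> t"
  shows "J (u t) - J (u s) = integral {s..t} v"
    and "integral {s..t} u \<in> dom"
    and "\<epsilon> *\<^sub>R (v t - v s) = integral {s..t} (\<lambda>p. f (u p)) - (J (u t) - J (u s)) - op (integral {s..t} u)"
proof -
  have "(integral {s..t} U, U t - U s - integral {s..t} G) \<in> generator (V \<times> H) T"
  proof (rule T.mild_solution_generator[OF st])
    show "U r = T (r - p) (U p) + integral {p..r} (\<lambda>q. T (r - q) (G q))" if "p \<le> r" for p r
      using integral_unique[OF mild'[OF that]] by simp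
  qed (auto simp: U_mem G_mem intro: continuous_on_subset[OF U_cont] continuous_on_subset[OF G_cont])
  then obtain x y where xy: "x \<in> dom" "y \<in> V" "integral {s..t} U = (x, J y)"
    "U t - U s - integral {s..t} G = (y, - (1 / \<epsilon>) *\<^sub>R (J y + op x))"
    unfolding generator by auto
  have int: "F integrable_on {s..t}" if "continuous_on UNIV F" for F :: "real \<Rightarrow> 'b::banach"
    by (rule integrable_continuous_real[OF continuous_on_subset[OF that]]) simp
  have x: "x = integral {s..t} u"
    using integral_linear[OF int[OF U_cont] bounded_linear_fst] xy(3) by (simp add: o_def U_def)
  have y: "J y = integral {s..t} v"
    using integral_linear[OF int[OF U_cont] bounded_linear_snd] xy(3) by (simp add: o_def U_def)
  have G1: "fst (integral {s..t} G) = 0"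
    using integral_linear[OF int[OF G_cont] bounded_linear_fst] by (simp add: o_def G_def)
  have G2: "snd (integral {s..t} G) = (1 / \<epsilon>) *\<^sub>R integral {s..t} (\<lambda>p. f (u p))"
    using integral_linear[OF int[OF G_cont] bounded_linear_snd] by (simp add: o_def G_def)
  have yu: "y = u t - u s" using arg_cong[OF xy(4), of fst] by (simp add: U_def G1)
  have v: "v t - v s - (1 / \<epsilon>) *\<^sub>R integral {s..t} (\<lambda>p. f (u p)) = - (1 / \<epsilon>) *\<^sub>R (J y + op x)"
    using arg_cong[OF xy(4), of snd] by (simp add: U_def G2)
  show "J (u t) - J (u s) = integral {s..t} v" using y yu by (simp add: J_simps)
  show "integral {s..t} u \<in> dom" using xy(1) x by simp
  have "\<epsilon> *\<^sub>R (v t - v s - (1 / \<epsilon>) *\<^sub>R integral {s..t} (\<lambda>p. f (u p))) = \<epsilon> *\<^sub>R (- (1 / \<epsilon>) *\<^sub>R (J y + op x))"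
    using v by simp
  then show "\<epsilon> *\<^sub>R (v t - v s) = integral {s..t} (\<lambda>p. f (u p)) - (J (u t) - J (u s)) - op (integral {s..t} u)"
    using eps by (simp add: scaleR_right_diff_distrib scaleR_right_distrib yu x J_simps algebra_simps)
qed

text \<open>After testing, \<open>op\<close> of the integral of \<open>u\<close> becomes
  \<open>a\<close> of that integral, which can be differentiated in time although \<open>u t\<close>
  is not yet known to lie in \<open>dom\<close>.\<close>

lemma weak: "weak_sol \<epsilon> u v (\<lambda>t. f (u t))"
  unfolding weak_sol_def
proof (intro conjI allI ballI u_mem v_mem u_cont v_cont fu_cont)
  fix t :: real
  define s where "s = t - 1"
  have s: "s < t" by (simp add: s_def)
  have "((\<lambda>r. J (u s) + integral {s..r} v) has_vector_derivative v t) (at t)"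
    using has_vector_derivative_add[OF has_vector_derivative_const[of "J (u s)"] integral_has_vector_derivative_at[OF v_cont s]]
    by (simp only: add_0_left)
  then show Ju': "((\<lambda>t. J (u t)) has_vector_derivative v t) (at t)"
  proof (rule has_vector_derivative_transform_within_open[of _ _ _ "{s<..}"])
    show "J (u s) + integral {s..r} v = J (u r)" if "r \<in> {s<..}" for r
      using integrated(1)[of s r, symmetric] that by simp
  qed (use s in simp_all)
  fix \<phi> assume \<phi>: "\<phi> \<in> V"
  define I where "I r = integral {s..r} u" for r
  have I_mem: "I r \<in> V" for r
  proof -
    have "u integrable_on {s..r}"
      by (rule integrable_continuous_real[OF continuous_on_subset[OF u_cont]]) simp
    from has_integral_mem_closed_subspace[OF subspace_V closed_V integrable_integral[OF this]]
    show ?thesis unfolding I_def using u_mem by blast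
  qed
  have eq: "v r \<bullet> J \<phi> = v s \<bullet> J \<phi> + (integral {s..r} (\<lambda>p. f (u p)) \<bullet> J \<phi> - (J (u r) - J (u s)) \<bullet> J \<phi> - a (I r) \<phi>) / \<epsilon>"
    if "s \<le> r" for r
  proof -
    have "\<epsilon> * ((v r - v s) \<bullet> J \<phi>) = (integral {s..r} (\<lambda>p. f (u p)) - (J (u r) - J (u s)) - op (I r)) \<bullet> J \<phi>"
      using integrated(3)[OF that] unfolding I_def by (metis inner_scaleR_left)
    also have "\<dots> = integral {s..r} (\<lambda>p. f (u p)) \<bullet> J \<phi> - (J (u r) - J (u s)) \<bullet> J \<phi> - a (I r) \<phi>"
      using dom_op(3)[OF integrated(2)[OF that] \<phi>] by (simp add: inner_diff_left I_def)
    finally show ?thesis using eps by (simp add: inner_diff_left field_simps)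
  qed
  have I': "(I has_vector_derivative u t) (at t)" unfolding I_def[abs_def]
    by (rule integral_has_vector_derivative_at[OF u_cont s])
  have 1: "((\<lambda>r. a (I r) \<phi>) has_real_derivative a (u t) \<phi>) (at t)"
    using a_has_derivative[OF I' I_mem u_mem has_vector_derivative_const, of \<phi>] \<phi>
      a_scale_right[of 0 "I t" 0] I_mem V_0 by simp
  have 2: "((\<lambda>r. integral {s..r} (\<lambda>p. f (u p)) \<bullet> J \<phi>) has_real_derivative f (u t) \<bullet> J \<phi>) (at t)"
    "((\<lambda>r. (J (u r) - J (u s)) \<bullet> J \<phi>) has_real_derivative v t \<bullet> J \<phi>) (at t)"
    using bounded_linear.has_vector_derivative[OF bounded_linear_inner_left integral_has_vector_derivative_at[OF fu_cont s]]
      bounded_linear.has_vector_derivative[OF bounded_linear_inner_left has_vector_derivative_diff[OF Ju' has_vector_derivative_const]]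
    by (simp_all add: has_real_derivative_iff_has_vector_derivative)
  have "((\<lambda>r. v s \<bullet> J \<phi> + (integral {s..r} (\<lambda>p. f (u p)) \<bullet> J \<phi> - (J (u r) - J (u s)) \<bullet> J \<phi> - a (I r) \<phi>) / \<epsilon>)
      has_real_derivative (- (v t \<bullet> J \<phi>) - a (u t) \<phi> + f (u t) \<bullet> J \<phi>) / \<epsilon>) (at t)"
    by (rule derivative_eq_intros 1 2 refl)+ (use eps in simp_all)
  then show "((\<lambda>t. v t \<bullet> J \<phi>) has_real_derivative (- (v t \<bullet> J \<phi>) - a (u t) \<phi> + f (u t) \<bullet> J \<phi>) / \<epsilon>) (at t)"
    unfolding has_real_derivative_iff_has_vector_derivative
  proof (rule has_vector_derivative_transform_within_open[of _ _ _ "{s<..}"])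
    show "v s \<bullet> J \<phi> + (integral {s..r} (\<lambda>p. f (u p)) \<bullet> J \<phi> - (J (u r) - J (u s)) \<bullet> J \<phi> - a (I r) \<phi>) / \<epsilon> = v r \<bullet> J \<phi>"
      if "r \<in> {s<..}" for r
      using eq[of r] that by simp
  qed (use s in simp_all)
qed

sublocale wave_trajectory V H J a c0 Ca lam f P R L \<epsilon> u v
  by unfold_locales (use eps weak energy_le unif in auto)

end

section \<open>Regularity\<close>

lemma has_vector_derivative_within_quotient:
  fixes F :: "real \<Rightarrow> 'a::real_normed_vector"
  shows "(F has_vector_derivative D) (at t within S) \<longleftrightarrow> ((\<lambda>s. (F s - F t) /\<^sub>R (s - t)) \<longlongrightarrow> D) (at t within S)"
proof -
  have "norm (F s - F t - (s - t) *\<^sub>R D) / norm (s - t) = norm ((F s - F t) /\<^sub>R (s - t) - D)" if "s \<noteq> t" for s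
  proof -
    have "(F s - F t) /\<^sub>R (s - t) - D = (F s - F t - (s - t) *\<^sub>R D) /\<^sub>R (s - t)"
      using that by (simp add: scaleR_right_diff_distrib)
    then show ?thesis by (simp add: divide_inverse mult.commute)
  qed
  then have "((\<lambda>s. norm (F s - F t - (s - t) *\<^sub>R D) / norm (s - t)) \<longlongrightarrow> 0) (at t within S) \<longleftrightarrow>
      ((\<lambda>s. norm ((F s - F t) /\<^sub>R (s - t) - D)) \<longlongrightarrow> 0) (at t within S)"
    by (intro filterlim_cong refl) (auto simp: eventually_at intro!: exI[of _ 1])
  also have "\<dots> \<longleftrightarrow> ((\<lambda>s. (F s - F t) /\<^sub>R (s - t)) \<longlongrightarrow> D) (at t within S)"
    by (simp add: tendsto_norm_zero_iff LIM_zero_iff)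
  finally show ?thesis
    by (simp add: has_vector_derivative_def has_derivative_iff_norm bounded_linear_scaleR_left)
qed

context wave_mild begin

text \<open>Pointwise, \<open>(u t, v t)\<close> is now in the domain of the generator, so the mild
  formula has a right derivative \<open>W t\<close>. Its continuity is the issue: the quotients
  \<open>Q h\<close> are almost orbits with a defect independent of \<open>h\<close>, a property
  that survives the limit. With \<open>w\<close> and \<open>z\<close> continuous, integrated
  identities yield two-sided derivatives.\<close>

lemma regularity:
  obtains w z where "\<And>t. w t \<in> V" "\<And>t. J (w t) = v t" "\<And>t. z t \<in> H"
    "continuous_on UNIV w" "continuous_on UNIV z"
    "\<And>t. (u has_vector_derivative w t) (at t)" "\<And>t. (v has_vector_derivative z t) (at t)"
    "\<And>t \<phi>. \<phi> \<in> V \<Longrightarrow> z t \<bullet> J \<phi> = (- (v t \<bullet> J \<phi>) - a (u t) \<phi> + f (u t) \<bullet> J \<phi>) / \<epsilon>"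
proof -
  obtain w where w: "\<And>t. w t \<in> V" "\<And>t. J (w t) = v t" using weak_regularity(1) by metis
  obtain z where z: "\<And>t. z t \<in> H"
    "\<And>t \<phi>. \<phi> \<in> V \<Longrightarrow> z t \<bullet> J \<phi> = (- (v t \<bullet> J \<phi>) - a (u t) \<phi> + f (u t) \<bullet> J \<phi>) / \<epsilon>"
    using weak_regularity(2) by metis
  define W where "W t = (w t, z t)" for t
  have W_mem: "W t \<in> V \<times> H" for t by (simp add: W_def w z)
  define Q where "Q h t = (U (t + h) - U t) /\<^sub>R h" for h t
  have Q_mem: "Q h t \<in> V \<times> H" for h t
    unfolding Q_def using U_mem T.subspace_X by (intro subspace_scale subspace_diff)
  have Q_lim: "((\<lambda>h. Q h t) \<longlongrightarrow> W t) (at_right 0)" for t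
  proof -
    have a_z: "a (u t) \<phi> = (f (u t) - v t - \<epsilon> *\<^sub>R z t) \<bullet> J \<phi>" if "\<phi> \<in> V" for \<phi>
      using z(2)[OF that, of t] eps by (simp add: inner_diff_left inner_add_left field_simps)
    have mem: "f (u t) - v t - \<epsilon> *\<^sub>R z t \<in> H"
      by (intro H_intros f_mem u_mem v_mem z)
    have op: "op (u t) = f (u t) - v t - \<epsilon> *\<^sub>R z t"
      by (rule op_eq[OF mem a_z])
    have "u t \<in> dom" unfolding dom_def using u_mem mem a_z by blast
    then have "((u t, J (w t)), (w t, - (1 / \<epsilon>) *\<^sub>R (J (w t) + op (u t)))) \<in> generator (V \<times> H) T"
      unfolding generator using w(1) by blast
    moreover have "- (1 / \<epsilon>) *\<^sub>R (J (w t) + op (u t)) = z t - (1 / \<epsilon>) *\<^sub>R f (u t)"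
      unfolding op w(2) using eps by (simp add: scaleR_right_diff_distrib scaleR_right_distrib)
    ultimately have gen: "((\<lambda>h. (T h (U t) - U t) /\<^sub>R h) \<longlongrightarrow> (w t, z t - (1 / \<epsilon>) *\<^sub>R f (u t))) (at_right 0)"
      by (simp add: generator_def U_def w(2))
    have avg: "((\<lambda>h. integral {t..t+h} (\<lambda>q. T (t + h - q) (G q)) /\<^sub>R h) \<longlongrightarrow> G t) (at_right 0)"
    proof (rule tendstoI)
      fix e :: real assume e: "0 < e"
      have "\<exists>d>0. \<forall>h r. 0 < h \<longrightarrow> h < d \<longrightarrow> r \<in> {t..t} \<longrightarrow>
          norm (integral {r..r+h} (\<lambda>q. T (r + h - q) (G q)) - h *\<^sub>R G r) \<le> e/2 * h"
        by (rule T.duhamel_average[OF G_mem continuous_on_subset[OF G_cont subset_UNIV]]) (use e in simp)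
      then obtain d where d: "d > 0" "\<And>h. 0 < h \<Longrightarrow> h < d \<Longrightarrow>
          norm (integral {t..t+h} (\<lambda>q. T (t + h - q) (G q)) - h *\<^sub>R G t) \<le> e/2 * h"
        by auto
      have "dist (integral {t..t+h} (\<lambda>q. T (t + h - q) (G q)) /\<^sub>R h) (G t) < e" if h: "0 < h" "h < d" for h
      proof -
        have "integral {t..t+h} (\<lambda>q. T (t + h - q) (G q)) /\<^sub>R h - G t
            = (integral {t..t+h} (\<lambda>q. T (t + h - q) (G q)) - h *\<^sub>R G t) /\<^sub>R h"
          using h by (simp add: scaleR_right_diff_distrib)
        then show ?thesis using norm_divideR_le[OF d(2)[OF h] h(1)] e by (simp add: dist_norm)
      qed
      then show "\<forall>\<^sub>F h in at_right 0. dist (integral {t..t+h} (\<lambda>q. T (t + h - q) (G q)) /\<^sub>R h) (G t) < e"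
        using d(1) by (auto simp: eventually_at_right_field)
    qed
    have "((\<lambda>h. (T h (U t) - U t) /\<^sub>R h + integral {t..t+h} (\<lambda>q. T (t + h - q) (G q)) /\<^sub>R h)
        \<longlongrightarrow> (w t, z t - (1 / \<epsilon>) *\<^sub>R f (u t)) + G t) (at_right 0)"
      by (intro tendsto_add gen avg)
    moreover have "(w t, z t - (1 / \<epsilon>) *\<^sub>R f (u t)) + G t = W t" by (simp add: W_def G_def)
    ultimately have lim: "((\<lambda>h. (T h (U t) - U t) /\<^sub>R h + integral {t..t+h} (\<lambda>q. T (t + h - q) (G q)) /\<^sub>R h)
        \<longlongrightarrow> W t) (at_right 0)" by simp
    show ?thesis
    proof (rule Lim_transform_eventually[OF lim])
      have "(T h (U t) - U t) /\<^sub>R h + integral {t..t+h} (\<lambda>q. T (t + h - q) (G q)) /\<^sub>R h = Q h t"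
        if "h > 0" for h
        using integral_unique[OF mild'[of t "t + h"]] that
        by (simp add: Q_def scaleR_right_diff_distrib)
      then show "\<forall>\<^sub>F h in at_right 0. (T h (U t) - U t) /\<^sub>R h +
          integral {t..t+h} (\<lambda>q. T (t + h - q) (G q)) /\<^sub>R h = Q h t"
        by (auto simp: eventually_at_right_field intro!: exI[of _ 1])
    qed
  qed
  obtain \<tau> M where \<tau>: "\<tau> > 0" and M: "\<And>h t. 0 < h \<Longrightarrow> h \<le> \<tau> \<Longrightarrow>
    \<epsilon> * (norm ((1/h) *\<^sub>R (v (t + h) - v t)))\<^sup>2 +
      a ((1/h) *\<^sub>R (u (t + h) - u t)) ((1/h) *\<^sub>R (u (t + h) - u t)) \<le> M"
    using difference_quotient_bound by metis
  \<comment> \<open>The bound for the difference quotients and the Lipschitz estimate for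
    \<open>f\<close> make the source Lipschitz in time.\<close>
  have G_quot: "norm (G (q + h) - G q) \<le> h * (L * sqrt M / \<epsilon>)" if h: "0 < h" "h \<le> \<tau>" for h q
  proof -
    have mem: "(1/h) *\<^sub>R (u (q + h) - u q) \<in> V" by (intro V_intros u_mem)
    have "0 \<le> \<epsilon> * (norm ((1/h) *\<^sub>R (v (q + h) - v q)))\<^sup>2" using eps by simp
    then have "a ((1/h) *\<^sub>R (u (q + h) - u q)) ((1/h) *\<^sub>R (u (q + h) - u q)) \<le> M"
      using M[OF h, of q] by linarith
    then have "N ((1/h) *\<^sub>R (u (q + h) - u q)) \<le> sqrt M" unfolding N_def by (rule real_sqrt_le_mono)
    then have "N (u (q + h) - u q) \<le> h * sqrt M"
      unfolding N_scale[OF V_diff[OF u_mem u_mem]] using h by (simp add: field_simps)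
    then have "L * N (u (q + h) - u q) \<le> L * (h * sqrt M)" using L by (intro mult_left_mono) auto
    then have "norm (f (u (q + h)) - f (u q)) \<le> L * (h * sqrt M)"
      using f_lipschitz[OF u_mem u_ball u_mem u_ball, of "q + h" q] unfolding N_def by linarith
    moreover have "norm (G (q + h) - G q) = norm (f (u (q + h)) - f (u q)) / \<epsilon>"
      using eps by (simp add: G_def norm_Pair scaleR_right_diff_distrib[symmetric])
    ultimately show ?thesis using eps by (simp add: divide_right_mono mult_ac)
  qed
  obtain K where K: "K \<ge> 1" "\<And>t x. t \<in> {0..1} \<Longrightarrow> x \<in> V \<times> H \<Longrightarrow> norm (T t x) \<le> K * norm x"
    using T.locally_bounded[of 1] by blast
  define B where "B = K * (L * sqrt M / \<epsilon>)"
  \<comment> \<open>The mild formula on \<open>[s, t]\<close> is subtracted from the one shifted by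
    \<open>h\<close>; the sources differ by a term of order \<open>h\<close>, which the quotient
    compensates.\<close>
  have Q_close: "norm (Q h t - T (t - s) (Q h s)) \<le> B * (t - s)"
    if st: "s \<le> t" "t \<le> s + 1" and h: "0 < h" "h \<le> \<tau>" for s t h
  proof -
    have 1: "((\<lambda>p. T (t - p) (G p)) has_integral U t - T (t - s) (U s)) {s..t}" by (rule mild'[OF st(1)])
    have "((\<lambda>p. T (t + h - p) (G p)) has_integral U (t + h) - T (t + h - (s + h)) (U (s + h))) {s + h..t + h}"
      using st by (intro mild') simp
    from has_integral_shift_real_ivl[OF this, of h]
    have 2: "((\<lambda>p. T (t - p) (G (p + h))) has_integral U (t + h) - T (t - s) (U (s + h))) {s..t}" by simp
    have "norm ((U (t + h) - T (t - s) (U (s + h))) - (U t - T (t - s) (U s))) \<le> h * B * measure lborel {s..t}"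
    proof (rule has_integral_bound_real[OF _ finite.emptyI has_integral_diff[OF 2 1]])
      have "0 \<le> h * (L * sqrt M / \<epsilon>)" using order_trans[OF norm_ge_zero G_quot[OF h]] .
      then have "0 \<le> K * (h * (L * sqrt M / \<epsilon>))"
        using mult_nonneg_nonneg[of K "h * (L * sqrt M / \<epsilon>)"] K(1) by linarith
      then show "0 \<le> h * B" by (simp add: B_def mult_ac)
      fix p assume p: "p \<in> {s..t} - {}"
      have "norm (T (t - p) (G (p + h)) - T (t - p) (G p)) = norm (T (t - p) (G (p + h) - G p))"
        using p G_mem by (simp add: T.diff)
      also have "\<dots> \<le> K * norm (G (p + h) - G p)"
        using p st by (intro K(2) subspace_diff[OF T.subspace_X] G_mem) auto
      also have "\<dots> \<le> K * (h * (L * sqrt M / \<epsilon>))" using G_quot[OF h, of p] K by (intro mult_left_mono) auto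
      finally show "norm (T (t - p) (G (p + h)) - T (t - p) (G p)) \<le> h * B" by (simp add: B_def mult_ac)
    qed
    then have "norm (((U (t + h) - T (t - s) (U (s + h))) - (U t - T (t - s) (U s))) /\<^sub>R h) \<le> B * (t - s)"
      using h st by (intro norm_divideR_le) (auto simp: mult_ac)
    also have "((U (t + h) - T (t - s) (U (s + h))) - (U t - T (t - s) (U s))) /\<^sub>R h = Q h t - T (t - s) (Q h s)"
    proof -
      have "T (t - s) (Q h s) = (T (t - s) (U (s + h)) - T (t - s) (U s)) /\<^sub>R h"
        unfolding Q_def using st U_mem T.subspace_X by (simp add: T.scale T.diff subspace_diff)
      then show ?thesis by (simp add: Q_def scaleR_right_diff_distrib)
    qed
    finally show ?thesis .
  qed
  have W_close: "norm (W t - T (t - s) (W s)) \<le> B * (t - s)" if st: "s \<le> t" "t \<le> s + 1" for s t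
  proof (rule tendsto_upperbound)
    have "((\<lambda>h. T (t - s) (Q h s)) \<longlongrightarrow> T (t - s) (W s)) (at_right 0)"
      by (rule continuous_on_tendsto_compose[OF T.T_continuous Q_lim]) (use st W_mem Q_mem in auto)
    then show "((\<lambda>h. norm (Q h t - T (t - s) (Q h s))) \<longlongrightarrow> norm (W t - T (t - s) (W s))) (at_right 0)"
      by (intro tendsto_intros Q_lim)
    show "\<forall>\<^sub>F h in at_right 0. norm (Q h t - T (t - s) (Q h s)) \<le> B * (t - s)"
      using Q_close[OF st] \<tau> by (auto simp: eventually_at_right_field intro!: exI[of _ \<tau>])
  qed simp
  have W_cont: "continuous_on UNIV W"
  proof (intro continuous_at_imp_continuous_on ballI)
    fix t show "isCont W t"
      by (rule T.almost_orbit_continuous[of "t - 1" W B]) (use W_mem W_close in auto)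
  qed
  have w_cont: "continuous_on UNIV w" and z_cont: "continuous_on UNIV z"
    using continuous_on_fst[OF W_cont] continuous_on_snd[OF W_cont] by (simp_all add: W_def)
  have int_on: "F integrable_on {s..t}" if "continuous_on UNIV F" for F :: "real \<Rightarrow> 'b::banach" and s t
    by (rule integrable_continuous_real[OF continuous_on_subset[OF that]]) simp
  \<comment> \<open>Under \<open>J\<close> the identity is contained in the integrated equation, and
    \<open>J\<close> is injective on \<open>V\<close>.\<close>
  have u_eq: "u t = u s + integral {s..t} w" if "s \<le> t" for s t
  proof -
    have mem: "integral {s..t} w \<in> V"
      by (rule has_integral_mem_closed_subspace[OF subspace_V closed_V integrable_integral[OF int_on[OF w_cont]]])
        (rule w)
    have "J (u t - u s) = J (integral {s..t} w)"
      using integrated(1)[OF that] integral_linear[OF int_on[OF w_cont, of s t] J] w(2) by (simp add: o_def J_simps)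
    then have "u t - u s = integral {s..t} w" by (rule inj_onD[OF J_inj]) (intro V_intros u_mem mem)+
    then show ?thesis by (simp add: algebra_simps)
  qed
  \<comment> \<open>The weak equation gives the identity tested with all of \<open>V\<close>, whose
    image is dense in \<open>H\<close>.\<close>
  have v_eq: "v t = v s + integral {s..t} z" if st: "s \<le> t" for s t
  proof -
    have mem: "integral {s..t} z \<in> H"
      by (rule has_integral_mem_closed_subspace[OF subspace_H closed_H integrable_integral[OF int_on[OF z_cont]]])
        (rule z)
    have "v t - v s - integral {s..t} z = 0"
    proof (rule H_eq_0)
      fix \<phi> assume \<phi>: "\<phi> \<in> V"
      have "((\<lambda>r. z r \<bullet> J \<phi>) has_integral v t \<bullet> J \<phi> - v s \<bullet> J \<phi>) {s..t}"
        by (rule fundamental_theorem_of_calculus[OF st])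
          (use solD(7)[OF \<phi>] z(2)[OF \<phi>] in \<open>auto simp: has_real_derivative_iff_has_vector_derivative intro: has_vector_derivative_at_within\<close>)
      moreover have "((\<lambda>r. z r \<bullet> J \<phi>) has_integral integral {s..t} z \<bullet> J \<phi>) {s..t}"
        using has_integral_linear[OF integrable_integral[OF int_on[OF z_cont, of s t]] bounded_linear_inner_left]
        by (simp add: o_def)
      ultimately show "(v t - v s - integral {s..t} z) \<bullet> J \<phi> = 0"
        by (simp add: inner_diff_left has_integral_unique)
    qed (intro H_intros v_mem mem)
    then show ?thesis by (simp add: algebra_simps)
  qed
  have u': "(u has_vector_derivative w t) (at t)" for t
  proof -
    have "((\<lambda>r. u (t - 1) + integral {t - 1..r} w) has_vector_derivative w t) (at t)"
      using has_vector_derivative_add[OF has_vector_derivative_const[of "u (t - 1)"] integral_has_vector_derivative_at[OF w_cont, of "t - 1" t]]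
      by simp
    then show ?thesis
    proof (rule has_vector_derivative_transform_within_open[of _ _ _ "{t - 1<..}"])
      show "u (t - 1) + integral {t - 1..r} w = u r" if "r \<in> {t - 1<..}" for r
        by (rule u_eq[symmetric]) (use that in simp)
    qed simp_all
  qed
  have v': "(v has_vector_derivative z t) (at t)" for t
  proof -
    have "((\<lambda>r. v (t - 1) + integral {t - 1..r} z) has_vector_derivative z t) (at t)"
      using has_vector_derivative_add[OF has_vector_derivative_const[of "v (t - 1)"] integral_has_vector_derivative_at[OF z_cont, of "t - 1" t]]
      by simp
    then show ?thesis
    proof (rule has_vector_derivative_transform_within_open[of _ _ _ "{t - 1<..}"])
      show "v (t - 1) + integral {t - 1..r} z = v r" if "r \<in> {t - 1<..}" for r
        by (rule v_eq[symmetric]) (use that in simp)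
    qed simp_all
  qed
  show ?thesis by (rule that[OF w(1,2) z(1) w_cont z_cont u' v' z(2)])
qed

end

section \<open>Differentiability and potential of the nonlinearity\<close>

context wave_nonlinearity begin

lemma N_tendsto:
  "(g \<longlongrightarrow> x) F \<Longrightarrow> (\<And>n. g n \<in> V) \<Longrightarrow> x \<in> V \<Longrightarrow> ((\<lambda>n. N (g n)) \<longlongrightarrow> N x) F"
  unfolding N_def by (intro tendsto_intros a_tendsto)

lemma N_0 [simp]: "N 0 = 0" using N_scale[of 0 0] V_0 by simp

text \<open>\<open>f_taylor\<close> at the base point \<open>u t\<close> leaves an error that is the
  product of a null factor and a convergent quotient. Derivatives are taken within \<open>S\<close>
  for the sake of rays \<open>\<theta> *\<^sub>R x\<close>, which are known to stay in the ball for
  \<open>\<theta>\<close> in \<open>[0, 1]\<close>.\<close>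

lemma f_has_vector_derivative:
  assumes u: "(u has_vector_derivative w) (at t within S)" and mem: "\<And>s. u s \<in> V" "w \<in> V"
    and ball: "\<And>s. s \<in> S \<Longrightarrow> a (u s) (u s) \<le> R" and t: "t \<in> S"
  shows "((\<lambda>s. f (u s)) has_vector_derivative P (u t) w) (at t within S)"
  unfolding has_vector_derivative_within_quotient
proof (rule LIM_zero_cancel, rule Lim_null_comparison)
  define q where "q s = (u s - u t) /\<^sub>R (s - t)" for s
  have q_mem: "q s \<in> V" for s unfolding q_def by (intro V_intros mem)
  have q: "(q \<longlongrightarrow> w) (at t within S)"
    using u by (simp add: has_vector_derivative_within_quotient q_def[abs_def])
  have uc: "(u \<longlongrightarrow> u t) (at t within S)"
    using has_vector_derivative_continuous[OF u] by (simp add: continuous_within)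
  have c: "u t \<in> V" "a (u t) (u t) \<le> R" using mem ball t by auto
  have "norm ((f (u s) - f (u t)) /\<^sub>R (s - t) - P (u t) w) \<le> L * N (u s - u t) * N (q s) + L * N (q s - w)"
    if s: "s \<in> S" "s \<noteq> t" for s
  proof -
    have "norm ((f (u s) - f (u t) - P (u t) (u s - u t)) /\<^sub>R (s - t))
        = norm (f (u s) - f (u t) - P (u t) (u s - u t)) / \<bar>s - t\<bar>"
      by (simp add: divide_inverse mult.commute)
    also have "\<dots> \<le> L * (N (u s - u t) + N (u t - u t)) * N (u s - u t) / \<bar>s - t\<bar>"
      using f_taylor[OF mem(1) ball[OF s(1)] c c] unfolding N_def by (intro divide_right_mono) auto
    also have "\<dots> = L * N (u s - u t) * N (q s)"
      unfolding q_def using mem by (simp add: N_scale V_intros divide_inverse)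
    finally have 1: "norm ((f (u s) - f (u t) - P (u t) (u s - u t)) /\<^sub>R (s - t)) \<le> L * N (u s - u t) * N (q s)" .
    have 2: "norm (P (u t) (q s - w)) \<le> L * N (q s - w)"
      unfolding N_def by (intro P_bound c V_intros q_mem mem)
    have "(f (u s) - f (u t)) /\<^sub>R (s - t) - P (u t) w
        = (f (u s) - f (u t) - P (u t) (u s - u t)) /\<^sub>R (s - t) + P (u t) (q s - w)"
    proof -
      have "P (u t) (q s) = P (u t) (u s - u t) /\<^sub>R (s - t)"
        unfolding q_def by (rule P_scale[OF c]) (intro V_intros mem)
      then show ?thesis by (simp add: P_diff[OF c q_mem mem(2)] scaleR_right_diff_distrib)
    qed
    then show ?thesis using norm_triangle_mono[OF 1 2] by simp
  qed
  then show "\<forall>\<^sub>F s in at t within S. norm ((f (u s) - f (u t)) /\<^sub>R (s - t) - P (u t) w)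
      \<le> L * N (u s - u t) * N (q s) + L * N (q s - w)"
    by (auto simp: eventually_at_filter)
  have "((\<lambda>s. L * N (u s - u t) * N (q s) + L * N (q s - w)) \<longlongrightarrow> L * N (u t - u t) * N w + L * N (w - w)) (at t within S)"
    by (intro tendsto_intros N_tendsto uc q V_intros mem q_mem)
  then show "((\<lambda>s. L * N (u s - u t) * N (q s) + L * N (q s - w)) \<longlongrightarrow> 0) (at t within S)" by simp
qed

definition \<Phi> where "\<Phi> x = integral {0..1} (\<lambda>\<theta>. f (\<theta> *\<^sub>R x) \<bullet> J x)"

lemma ball_scale: assumes "x \<in> V" "a x x \<le> R" "\<theta> \<in> {0..1}" shows "a (\<theta> *\<^sub>R x) (\<theta> *\<^sub>R x) \<le> R"
proof -
  have "\<theta> * \<theta> * a x x \<le> 1 * a x x"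
    using assms a_nonneg by (intro mult_right_mono) (auto simp: mult_le_one)
  then show ?thesis using assms by (simp add: a_simps V_intros)
qed

lemma f_ray_has_derivative:
  assumes "x \<in> V" "a x x \<le> R" "\<theta> \<in> {0..1}"
  shows "((\<lambda>\<theta>. f (\<theta> *\<^sub>R x)) has_vector_derivative P (\<theta> *\<^sub>R x) x) (at \<theta> within {0..1})"
proof (rule f_has_vector_derivative[where u="\<lambda>\<theta>. \<theta> *\<^sub>R x"])
  show "((\<lambda>\<theta>. \<theta> *\<^sub>R x) has_vector_derivative x) (at \<theta> within {0..1})"
    using has_vector_derivative_scaleR[OF DERIV_ident has_vector_derivative_const[of x]] by simp
qed (use assms in \<open>auto intro: ball_scale V_scale\<close>)

lemma \<Phi>_integrable:
  assumes "x \<in> V" "a x x \<le> R" shows "(\<lambda>\<theta>. f (\<theta> *\<^sub>R x) \<bullet> y) integrable_on {0..1}"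
proof (intro integrable_continuous_real continuous_on_inner continuous_on_const)
  show "continuous_on {0..1} (\<lambda>\<theta>. f (\<theta> *\<^sub>R x))"
    using has_vector_derivative_continuous[OF f_ray_has_derivative[OF assms]]
    by (simp add: continuous_on_eq_continuous_within)
qed

lemma \<Phi>_bound: assumes "x \<in> V" "a x x \<le> R" shows "\<bar>\<Phi> x\<bar> \<le> L * sqrt (R / lam)"
proof -
  have J: "norm (J x) \<le> sqrt (R / lam)"
    using a_lower[OF assms(1)] assms(2) lam by (intro real_le_rsqrt) (simp add: field_simps)
  have "norm (\<Phi> x) \<le> (L * sqrt (R / lam)) * measure lborel {0..1::real}"
    unfolding \<Phi>_def
  proof (rule has_integral_bound_real[OF _ finite.emptyI integrable_integral[OF \<Phi>_integrable[OF assms]]])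
    fix \<theta> :: real assume "\<theta> \<in> {0..1} - {}"
    then have "norm (f (\<theta> *\<^sub>R x)) \<le> L" using assms by (intro f_bound V_intros ball_scale) auto
    then have "norm (f (\<theta> *\<^sub>R x)) * norm (J x) \<le> L * sqrt (R / lam)"
      using J L by (intro mult_mono) auto
    then show "norm (f (\<theta> *\<^sub>R x) \<bullet> J x) \<le> L * sqrt (R / lam)"
      using Cauchy_Schwarz_ineq2[of "f (\<theta> *\<^sub>R x)" "J x"] by simp
  qed (use L order_trans[OF norm_ge_zero J] in \<open>auto intro!: mult_nonneg_nonneg\<close>)
  then show ?thesis by simp
qed

text \<open>\<^term>\<open>\<Phi>\<close> is a potential of \<^term>\<open>f\<close> because the derivative \<^term>\<open>P\<close> of \<^term>\<open>f\<close> is symmetric.\<close>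

lemma \<Phi>_taylor:
  assumes x: "x \<in> V" "a x x \<le> R" and y: "y \<in> V" "a y y \<le> R"
  shows "\<bar>\<Phi> x - \<Phi> y - f y \<bullet> J (x - y)\<bar> \<le> ((L * sqrt R + L) / sqrt lam) * a (x - y) (x - y)"
proof -
  define d where "d = x - y"
  have d: "d \<in> V" "x = y + d" using x y by (auto simp: d_def V_intros)
  \<comment> \<open>The derivative of
    \<open>\<theta> * (f (\<theta> *\<^sub>R y) \<bullet> J d)\<close>. It turns
    \<open>f y \<bullet> J d\<close> into an integral that can be compared with
    \<open>\<Phi> x - \<Phi> y\<close> under the integral sign.\<close>
  define D where "D \<theta> = f (\<theta> *\<^sub>R y) \<bullet> J d + \<theta> * (P (\<theta> *\<^sub>R y) y \<bullet> J d)" for \<theta>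
  have D_int: "(D has_integral f y \<bullet> J d) {0..1}"
  proof -
    have "(D has_integral (1 *\<^sub>R (f (1 *\<^sub>R y) \<bullet> J d) - 0 *\<^sub>R (f (0 *\<^sub>R y) \<bullet> J d))) {0..1}"
    proof (rule fundamental_theorem_of_calculus)
      fix \<theta> :: real assume \<theta>: "\<theta> \<in> {0..1}"
      have "((\<lambda>\<theta>. f (\<theta> *\<^sub>R y) \<bullet> J d) has_vector_derivative P (\<theta> *\<^sub>R y) y \<bullet> J d) (at \<theta> within {0..1})"
        by (rule bounded_linear.has_vector_derivative[OF bounded_linear_inner_left f_ray_has_derivative[OF y \<theta>]])
      from has_vector_derivative_scaleR[OF DERIV_ident this]
      show "((\<lambda>\<theta>. \<theta> *\<^sub>R (f (\<theta> *\<^sub>R y) \<bullet> J d)) has_vector_derivative D \<theta>) (at \<theta> within {0..1})"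
        by (simp add: D_def add.commute)
    qed simp
    then show ?thesis by simp
  qed
  define rem where "rem \<theta> = (f (\<theta> *\<^sub>R x) \<bullet> J x - f (\<theta> *\<^sub>R y) \<bullet> J y) - D \<theta>" for \<theta>
  have rem_int: "(rem has_integral (\<Phi> x - \<Phi> y) - f y \<bullet> J d) {0..1}"
    unfolding rem_def[abs_def] \<Phi>_def
    by (intro has_integral_diff D_int integrable_integral \<Phi>_integrable x y)
  have "norm ((\<Phi> x - \<Phi> y) - f y \<bullet> J d) \<le> (((L * sqrt R + L) / sqrt lam) * a d d) * measure lborel {0..1::real}"
  proof (rule has_integral_bound_real[OF _ finite.emptyI rem_int])
    have R: "0 \<le> R" using x a_nonneg[of x] by simp
    show "0 \<le> ((L * sqrt R + L) / sqrt lam) * a d d"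
      using L lam R a_nonneg[OF d(1)] by (intro mult_nonneg_nonneg divide_nonneg_nonneg) auto
    fix \<theta> :: real assume "\<theta> \<in> {0..1} - {}"
    then have \<theta>: "\<theta> \<in> {0..1}" "\<theta> \<ge> 0" "\<theta> \<le> 1" by auto
    have \<theta>y: "\<theta> *\<^sub>R y \<in> V" "a (\<theta> *\<^sub>R y) (\<theta> *\<^sub>R y) \<le> R"
      and \<theta>x: "\<theta> *\<^sub>R x \<in> V" "a (\<theta> *\<^sub>R x) (\<theta> *\<^sub>R x) \<le> R"
      using x y \<theta> by (auto intro!: V_intros ball_scale)
    define r where "r = f (\<theta> *\<^sub>R x) - f (\<theta> *\<^sub>R y) - P (\<theta> *\<^sub>R y) (\<theta> *\<^sub>R d)"
    \<comment> \<open>Symmetry exchanges \<open>y\<close> and \<open>d\<close> in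
      \<open>P (\<theta> *\<^sub>R y) y \<bullet> J d\<close>; the terms of first order in
      \<open>d\<close> then cancel, and the two that remain are quadratic.\<close>
    have eq: "rem \<theta> = r \<bullet> J x + \<theta> * (P (\<theta> *\<^sub>R y) d \<bullet> J d)"
      using P_sym[OF \<theta>y y(1) d(1)] d
      by (simp add: rem_def D_def r_def P_scale[OF \<theta>y] J_simps inner_diff_left inner_add_right inner_add_left algebra_simps)
    have "norm r \<le> L * (N (\<theta> *\<^sub>R x - \<theta> *\<^sub>R y) + N (\<theta> *\<^sub>R y - \<theta> *\<^sub>R y)) * N (\<theta> *\<^sub>R x - \<theta> *\<^sub>R y)"
      using f_taylor[OF \<theta>x \<theta>y \<theta>y] unfolding r_def N_def d_def by (simp add: scaleR_right_diff_distrib)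
    also have "\<dots> = L * (\<theta> * N d) * (\<theta> * N d)"
    proof -
      have "\<theta> *\<^sub>R x - \<theta> *\<^sub>R y = \<theta> *\<^sub>R d" by (simp add: d_def scaleR_right_diff_distrib)
      then show ?thesis using \<theta> d by (simp add: N_scale)
    qed
    also have "\<dots> = (\<theta> * \<theta>) * (L * a d d)" using N_sq[OF d(1)] by (simp add: power2_eq_square)
    also have "\<dots> \<le> 1 * (L * a d d)"
      using \<theta> L a_nonneg[OF d(1)] by (intro mult_right_mono) (auto simp: mult_le_one)
    finally have r: "norm r \<le> L * a d d" by simp
    have Jx: "norm (J x) \<le> sqrt R / sqrt lam"
      using J_le_N[OF x(1)] real_sqrt_le_mono[OF x(2)] lam unfolding N_def
      by (meson divide_right_mono order_trans real_sqrt_ge_zero less_imp_le)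
    have "\<bar>r \<bullet> J x\<bar> \<le> norm r * norm (J x)" by (rule Cauchy_Schwarz_ineq2)
    also have "\<dots> \<le> (L * a d d) * (sqrt R / sqrt lam)" using r Jx L a_nonneg[OF d(1)] by (intro mult_mono) auto
    finally have 1: "\<bar>r \<bullet> J x\<bar> \<le> (L * a d d) * (sqrt R / sqrt lam)" .
    have "\<bar>P (\<theta> *\<^sub>R y) d \<bullet> J d\<bar> \<le> norm (P (\<theta> *\<^sub>R y) d) * norm (J d)" by (rule Cauchy_Schwarz_ineq2)
    also have "\<dots> \<le> (L * N d) * (N d / sqrt lam)"
      using P_bound[OF \<theta>y d(1)] J_le_N[OF d(1)] L N_nonneg[OF d(1)] unfolding N_def by (intro mult_mono) auto
    also have "\<dots> = L * a d d / sqrt lam" using N_sq[OF d(1)] by (simp add: power2_eq_square)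
    finally have "\<theta> * \<bar>P (\<theta> *\<^sub>R y) d \<bullet> J d\<bar> \<le> 1 * (L * a d d / sqrt lam)"
      using \<theta> by (intro mult_mono) auto
    then have 2: "\<bar>\<theta> * (P (\<theta> *\<^sub>R y) d \<bullet> J d)\<bar> \<le> L * a d d / sqrt lam" using \<theta> by (simp add: abs_mult)
    show "norm (rem \<theta>) \<le> ((L * sqrt R + L) / sqrt lam) * a d d"
      unfolding eq real_norm_def using 1 2 abs_triangle_ineq[of "r \<bullet> J x" "\<theta> * (P (\<theta> *\<^sub>R y) d \<bullet> J d)"]
      by (simp add: algebra_simps add_divide_distrib)
  qed
  then show ?thesis by (simp add: d_def)
qed

lemma \<Phi>_has_derivative:
  assumes u: "(u has_vector_derivative w) (at t)" "\<And>s. u s \<in> V" "w \<in> V" "\<And>s. a (u s) (u s) \<le> R"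
  shows "((\<lambda>s. \<Phi> (u s)) has_real_derivative f (u t) \<bullet> J w) (at t)"
  unfolding has_real_derivative_iff_has_vector_derivative has_vector_derivative_within_quotient
proof -
  define q where "q s = (u s - u t) /\<^sub>R (s - t)" for s
  have q_mem: "q s \<in> V" for s unfolding q_def by (intro V_intros u)
  have q: "(q \<longlongrightarrow> w) (at t)"
    using u(1) by (simp add: has_vector_derivative_within_quotient q_def[abs_def])
  define C where "C = (L * sqrt R + L) / sqrt lam"
  have "((\<lambda>s. (\<Phi> (u s) - \<Phi> (u t)) /\<^sub>R (s - t) - f (u t) \<bullet> J (q s)) \<longlongrightarrow> 0) (at t)"
  proof (rule Lim_null_comparison)
    have "norm ((\<Phi> (u s) - \<Phi> (u t)) /\<^sub>R (s - t) - f (u t) \<bullet> J (q s)) \<le> C * (\<bar>s - t\<bar> * a (q s) (q s))"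
      if "s \<noteq> t" for s
    proof -
      have "(\<Phi> (u s) - \<Phi> (u t)) /\<^sub>R (s - t) - f (u t) \<bullet> J (q s)
          = (\<Phi> (u s) - \<Phi> (u t) - f (u t) \<bullet> J (u s - u t)) / (s - t)"
        by (simp add: q_def J_simps divide_inverse inner_diff_right algebra_simps)
      then have "norm ((\<Phi> (u s) - \<Phi> (u t)) /\<^sub>R (s - t) - f (u t) \<bullet> J (q s))
          = \<bar>\<Phi> (u s) - \<Phi> (u t) - f (u t) \<bullet> J (u s - u t)\<bar> / \<bar>s - t\<bar>" by simp
      also have "\<dots> \<le> C * a (u s - u t) (u s - u t) / \<bar>s - t\<bar>"
        unfolding C_def by (intro divide_right_mono \<Phi>_taylor u) simp
      also have "\<dots> = C * (\<bar>s - t\<bar> * a (q s) (q s))"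
      proof -
        have "\<bar>x\<bar> * ((inverse x)\<^sup>2 * y) = y / \<bar>x\<bar>" if "x \<noteq> 0" for x y :: real
          using that by (simp add: power2_eq_square field_simps abs_if)
        from this[of "s - t"] that show ?thesis
          unfolding q_def a_scale_square[OF V_diff[OF u(2) u(2)]] by simp
      qed
      finally show ?thesis .
    qed
    then show "\<forall>\<^sub>F s in at t. norm ((\<Phi> (u s) - \<Phi> (u t)) /\<^sub>R (s - t) - f (u t) \<bullet> J (q s)) \<le> C * (\<bar>s - t\<bar> * a (q s) (q s))"
      by (simp add: eventually_at_filter)
    have "((\<lambda>s. C * (\<bar>s - t\<bar> * a (q s) (q s))) \<longlongrightarrow> C * (\<bar>t - t\<bar> * a w w)) (at t)"
      by (intro tendsto_intros a_tendsto q q_mem u)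
    then show "((\<lambda>s. C * (\<bar>s - t\<bar> * a (q s) (q s))) \<longlongrightarrow> 0) (at t)" by simp
  qed
  moreover have "((\<lambda>s. f (u t) \<bullet> J (q s)) \<longlongrightarrow> f (u t) \<bullet> J w) (at t)"
    by (intro tendsto_intros bounded_linear.tendsto[OF J q])
  ultimately have "((\<lambda>s. ((\<Phi> (u s) - \<Phi> (u t)) /\<^sub>R (s - t) - f (u t) \<bullet> J (q s)) + f (u t) \<bullet> J (q s)) \<longlongrightarrow> 0 + f (u t) \<bullet> J w) (at t)"
    by (rule tendsto_add)
  then show "((\<lambda>s. (\<Phi> (u s) - \<Phi> (u t)) /\<^sub>R (s - t)) \<longlongrightarrow> f (u t) \<bullet> J w) (at t)" by simp
qed

end

section \<open>The uniform estimate\<close>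

locale wave_regular = wave_trajectory V H J a c0 Ca lam f P R L \<epsilon> u v
  for V :: "'v::{real_inner,banach} set" and H :: "'h::{real_inner,banach} set"
    and J a c0 Ca lam f P R L \<epsilon> u v +
  fixes w :: "real \<Rightarrow> 'v" and z :: "real \<Rightarrow> 'h"
  assumes w_mem: "\<And>t. w t \<in> V" and J_w: "\<And>t. J (w t) = v t" and z_mem: "\<And>t. z t \<in> H"
    and w_cont: "continuous_on UNIV w" and z_cont: "continuous_on UNIV z"
    and u_deriv: "\<And>t. (u has_vector_derivative w t) (at t)"
    and v_deriv: "\<And>t. (v has_vector_derivative z t) (at t)"
    and z_eq: "\<And>t \<phi>. \<phi> \<in> V \<Longrightarrow> z t \<bullet> J \<phi> = (- (v t \<bullet> J \<phi>) - a (u t) \<phi> + f (u t) \<bullet> J \<phi>) / \<epsilon>"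
begin

lemma Pw_cont: "continuous_on UNIV (\<lambda>t. P (u t) (w t))"
  unfolding continuous_on_def
proof
  fix t
  have ut: "(u \<longlongrightarrow> u t) (at t)" and wt: "(w \<longlongrightarrow> w t) (at t)"
    using solD(3) w_cont by (simp_all add: continuous_on_def)
  have "((\<lambda>s. P (u s) (w s) - P (u t) (w t)) \<longlongrightarrow> 0) (at t)"
  proof (rule Lim_null_comparison)
    have "norm (P (u s) (w s) - P (u t) (w t)) \<le> L * N (u s - u t) * N (w s) + L * N (w s - w t)" for s
    proof -
      have 1: "norm (P (u s) (w s) - P (u t) (w s)) \<le> L * N (u s - u t) * N (w s)"
        unfolding N_def by (intro P_lipschitz u_mem u_ball w_mem)
      have 2: "norm (P (u t) (w s - w t)) \<le> L * N (w s - w t)"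
        unfolding N_def by (intro P_bound u_mem u_ball w_mem V_intros)
      have eq: "P (u s) (w s) - P (u t) (w t) = (P (u s) (w s) - P (u t) (w s)) + P (u t) (w s - w t)"
        by (simp add: P_diff[OF u_mem u_ball w_mem w_mem])
      show ?thesis unfolding eq by (rule norm_triangle_mono[OF 1 2])
    qed
    then show "\<forall>\<^sub>F s in at t. norm (P (u s) (w s) - P (u t) (w t)) \<le> L * N (u s - u t) * N (w s) + L * N (w s - w t)"
      by simp
    have "((\<lambda>s. L * N (u s - u t) * N (w s) + L * N (w s - w t)) \<longlongrightarrow> L * N (u t - u t) * N (w t) + L * N (w t - w t)) (at t)"
      by (intro tendsto_intros N_tendsto ut wt V_intros u_mem w_mem)
    then show "((\<lambda>s. L * N (u s - u t) * N (w s) + L * N (w s - w t)) \<longlongrightarrow> 0) (at t)" by simp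
  qed
  then show "((\<lambda>s. P (u s) (w s)) \<longlongrightarrow> P (u t) (w t)) (at t)" by (rule LIM_zero_cancel)
qed

text \<open>The right-hand side of \<open>z_eq\<close> has become differentiable, as
  \<open>u\<close> and \<open>v\<close> now have derivatives in \<open>V\<close> and
  \<open>H\<close>. So \<open>(w, z)\<close> solves the linearised equation exactly, without
  difference quotients.\<close>

lemma weak_w: "weak_sol \<epsilon> w z (\<lambda>t. P (u t) (w t))"
  unfolding weak_sol_def
proof (intro conjI allI ballI w_mem z_mem w_cont z_cont Pw_cont)
  fix t
  show "((\<lambda>t. J (w t)) has_vector_derivative z t) (at t)" using v_deriv by (simp add: J_w)
  fix \<phi> assume \<phi>: "\<phi> \<in> V"
  have 1: "((\<lambda>t. a (u t) \<phi>) has_real_derivative a (w t) \<phi>) (at t)"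
    using a_has_derivative[OF u_deriv[of t] u_mem w_mem has_vector_derivative_const, of \<phi>] \<phi>
      a_scale_right[of 0 "u t" 0] u_mem V_0 by simp
  have f': "((\<lambda>t. f (u t)) has_vector_derivative P (u t) (w t)) (at t)"
    by (rule f_has_vector_derivative[OF u_deriv u_mem w_mem u_ball]) simp
  have 2: "((\<lambda>t. f (u t) \<bullet> J \<phi>) has_real_derivative P (u t) (w t) \<bullet> J \<phi>) (at t)"
    "((\<lambda>t. v t \<bullet> J \<phi>) has_real_derivative z t \<bullet> J \<phi>) (at t)"
    using bounded_linear.has_vector_derivative[OF bounded_linear_inner_left f']
      bounded_linear.has_vector_derivative[OF bounded_linear_inner_left v_deriv]
    by (simp_all add: has_real_derivative_iff_has_vector_derivative)
  have "((\<lambda>t. (- (v t \<bullet> J \<phi>) - a (u t) \<phi> + f (u t) \<bullet> J \<phi>) / \<epsilon>) has_real_derivative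
      (- (z t \<bullet> J \<phi>) - a (w t) \<phi> + P (u t) (w t) \<bullet> J \<phi>) / \<epsilon>) (at t)"
    by (intro DERIV_cdivide DERIV_add DERIV_diff DERIV_minus 1 2)
  then show "((\<lambda>t. z t \<bullet> J \<phi>) has_real_derivative
      (- (z t \<bullet> J \<phi>) - a (w t) \<phi> + P (u t) (w t) \<bullet> J \<phi>) / \<epsilon>) (at t)"
    by (simp only: z_eq[OF \<phi>])
qed

text \<open>The negative of the natural energy of the equation. It serves as a primitive of
  \<open>|v|^2\<close>: time integrals of \<open>|v|^2\<close> appear as increments of
  \<open>\<mu>\<close>.\<close>

definition \<mu> where "\<mu> t = \<Phi> (u t) - (1/2) * (\<epsilon> * (norm (v t))\<^sup>2 + a (u t) (u t))"

lemma \<mu>_deriv: "(\<mu> has_real_derivative (norm (v t))\<^sup>2) (at t)"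
proof -
  have "(\<mu> has_real_derivative f (u t) \<bullet> J (w t) - (1/2) * (2 * ((f (u t) - v t) \<bullet> v t))) (at t)"
    unfolding \<mu>_def[abs_def]
    by (intro DERIV_diff DERIV_cmult energy_identity[OF sol eps(1)] \<Phi>_has_derivative u_deriv u_mem w_mem u_ball)
  moreover have "f (u t) \<bullet> J (w t) - (1/2) * (2 * ((f (u t) - v t) \<bullet> v t)) = (norm (v t))\<^sup>2"
    by (simp add: J_w inner_diff_left power2_norm_eq_inner diff_divide_distrib)
  ultimately show ?thesis by simp
qed

text \<open>The quadratic part of the energy lies between \<open>0\<close> and \<open>R\<close> and
  \<open>\<Phi>\<close> is bounded on the ball, so the total dissipation has a bound free of
  \<open>\<epsilon>\<close>.\<close>

lemma \<mu>_variation: "\<mu> t - \<mu> s \<le> R / 2 + 2 * (L * sqrt (R / lam))"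
proof -
  have "0 \<le> \<epsilon> * (norm (v r))\<^sup>2 + a (u r) (u r)" for r
    using eps a_nonneg[OF u_mem[of r]] by simp
  from this[of t] energy_le[of s] abs_le_D1[OF \<Phi>_bound[OF u_mem u_ball, of t]] abs_le_D2[OF \<Phi>_bound[OF u_mem u_ball, of s]]
  show ?thesis unfolding \<mu>_def by argo
qed

text \<open>Compared with the energy for difference quotients, \<open>P\<close> is evaluated at \<open>u(t)\<close>, which costs
  \<open>L \<bar>v\<bar> \<langle>A w, w\<rangle>\<close> in the derivative, and \<open>L\<^sup>2 \<bar>v\<bar>\<^sup>2\<close> keeps \<open>E\<close> positive.\<close>

definition E where "E t = (\<epsilon> * (norm (z t))\<^sup>2 + a (w t) (w t)) - P (u t) (w t) \<bullet> v t
  + L\<^sup>2 * (norm (v t))\<^sup>2 + (1/2) * (\<epsilon> * (v t \<bullet> z t)) + (1/4) * (norm (v t))\<^sup>2"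

lemma Pwv_le:
  assumes "\<eta> > 0"
  shows "\<bar>P (u t) (w t) \<bullet> v t\<bar> \<le> \<eta> * a (w t) (w t) + L\<^sup>2 * (norm (v t))\<^sup>2 / (4 * \<eta>)"
proof -
  have "\<bar>P (u t) (w t) \<bullet> v t\<bar> \<le> norm (P (u t) (w t)) * norm (v t)" by (rule Cauchy_Schwarz_ineq2)
  also have "\<dots> \<le> (L * N (w t)) * norm (v t)"
    using P_bound[OF u_mem u_ball w_mem, of t t] unfolding N_def by (intro mult_right_mono) auto
  also have "\<dots> \<le> \<eta> * (N (w t))\<^sup>2 + (L * norm (v t))\<^sup>2 / (4 * \<eta>)"
    using young[OF assms, of "N (w t)" "L * norm (v t)"] by (simp add: mult_ac)
  finally show ?thesis by (simp add: N_sq[OF w_mem] power_mult_distrib)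
qed

lemma vz_le: "\<bar>v t \<bullet> z t\<bar> \<le> (1/2) * (norm (z t))\<^sup>2 + (1/2) * (norm (v t))\<^sup>2"
proof -
  have "\<bar>v t \<bullet> z t\<bar> \<le> norm (z t) * norm (v t)" using Cauchy_Schwarz_ineq2[of "v t" "z t"] by (simp add: mult.commute)
  also have "\<dots> \<le> (1/2) * (norm (z t))\<^sup>2 + (1/2) * (norm (v t))\<^sup>2"
    using young[of "1/2" "norm (z t)" "norm (v t)"] by simp
  finally show ?thesis .
qed

lemma eps_mult_le: "x \<ge> 0 \<Longrightarrow> \<epsilon> * x \<le> x"
  using mult_right_mono[of \<epsilon> 1 x] eps by simp

lemma eps_vz_le: "\<epsilon> * \<bar>v t \<bullet> z t\<bar> \<le> (1/2) * (\<epsilon> * (norm (z t))\<^sup>2) + (1/2) * (norm (v t))\<^sup>2"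
proof -
  have "\<epsilon> * \<bar>v t \<bullet> z t\<bar> \<le> \<epsilon> * ((1/2) * (norm (z t))\<^sup>2 + (1/2) * (norm (v t))\<^sup>2)"
    using vz_le eps by (intro mult_left_mono) auto
  also have "\<dots> = (1/2) * (\<epsilon> * (norm (z t))\<^sup>2) + (1/2) * (\<epsilon> * (norm (v t))\<^sup>2)" by (simp add: distrib_left)
  also have "\<dots> \<le> (1/2) * (\<epsilon> * (norm (z t))\<^sup>2) + (1/2) * (norm (v t))\<^sup>2"
    using eps_mult_le[of "(norm (v t))\<^sup>2"] by simp
  finally show ?thesis .
qed

text \<open>The two positive multiples of \<open>|v|^2\<close> in \<open>E\<close> are matched to
  the negative terms: \<open>L\<^sup>2\<close> compensates that of \<open>P\<close>, split with
  weight \<open>1/4\<close>, and \<open>1/4\<close> that of the cross term.\<close>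

lemma E_lower: "\<epsilon> * (norm (z t))\<^sup>2 + a (w t) (w t) \<le> 2 * E t"
proof -
  have "P (u t) (w t) \<bullet> v t \<le> (1/4) * a (w t) (w t) + L\<^sup>2 * (norm (v t))\<^sup>2"
    using abs_le_D1[OF Pwv_le[of "1/4" t]] by simp
  moreover have "- (\<epsilon> * (v t \<bullet> z t)) \<le> \<epsilon> * \<bar>v t \<bullet> z t\<bar>"
    using mult_left_mono[of "- (v t \<bullet> z t)" "\<bar>v t \<bullet> z t\<bar>" \<epsilon>] eps by simp
  moreover have "0 \<le> \<epsilon> * (norm (z t))\<^sup>2" using eps by simp
  ultimately show ?thesis using eps_vz_le[of t] a_nonneg[OF w_mem, of t] unfolding E_def by argo
qed

lemma E_upper:
  "E t \<le> (5/4) * (\<epsilon> * (norm (z t))\<^sup>2 + a (w t) (w t)) + (2 * L\<^sup>2 + 1/2) * (norm (v t))\<^sup>2"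
proof -
  have "- (P (u t) (w t) \<bullet> v t) \<le> (1/4) * a (w t) (w t) + L\<^sup>2 * (norm (v t))\<^sup>2"
    using abs_le_D2[OF Pwv_le[of "1/4" t]] by simp
  moreover have "\<epsilon> * (v t \<bullet> z t) \<le> \<epsilon> * \<bar>v t \<bullet> z t\<bar>"
    using mult_left_mono[of "v t \<bullet> z t" "\<bar>v t \<bullet> z t\<bar>" \<epsilon>] eps by simp
  moreover have "0 \<le> \<epsilon> * (norm (z t))\<^sup>2" using eps by simp
  ultimately show ?thesis using eps_vz_le[of t] a_nonneg[OF w_mem, of t] unfolding E_def by argo
qed

text \<open>The derivative at \<open>t\<close> of the energy \<open>E\<close> with the base point of
  \<open>P\<close> frozen at \<open>u t\<close>, in the shape in which the differentiation rules
  deliver it.\<close>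

definition F' where "F' t = 2 * ((P (u t) (w t) - z t) \<bullet> z t) - 2 * (P (u t) (w t) \<bullet> z t)
  + L\<^sup>2 * (2 * (v t \<bullet> z t))
  + (1/2) * (\<epsilon> * ((norm (z t))\<^sup>2 + (- (z t \<bullet> v t) - a (w t) (w t) + P (u t) (w t) \<bullet> v t) / \<epsilon>))
  + (1/4) * (2 * (v t \<bullet> z t))"

text \<open>The coefficients of \<open>|v|^2\<close> that arise from
  \<open>L\<^sup>2 * (2 * (v t \<bullet> z t))\<close>, from
  \<open>P (u t) (w t) \<bullet> v t\<close>, and from a fifth of \<open>E_upper\<close>.\<close>

definition c1 where "c1 = 2 * L ^ 4 + L\<^sup>2 / 2 + (2 * L\<^sup>2 + 1/2) / 5"

lemma c1_nonneg: "c1 \<ge> 0" by (simp add: c1_def)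

text \<open>The factor \<open>L * norm (v t)\<close> has no bound uniform in
  \<open>\<epsilon>\<close>. Young's inequality splits it into \<open>1/8\<close>, absorbed by the
  dissipation, and a multiple of \<open>|v|^2\<close>, which is integrable in time. A quarter of the
  energy remains, and \<open>E_upper\<close> turns it into a fifth of \<open>E\<close>.\<close>

lemma E_dissipation:
  "F' t + L * norm (v t) * a (w t) (w t) \<le> - (1/5) * E t + c1 * (norm (v t))\<^sup>2 + 4 * L\<^sup>2 * (norm (v t))\<^sup>2 * E t"
proof -
  have expand: "\<epsilon> * (x + X / \<epsilon>) = \<epsilon> * x + X" for x X using eps by (simp add: field_simps)
  have F'_eq: "F' t = - 2 * (norm (z t))\<^sup>2 + (1/2) * (\<epsilon> * (norm (z t))\<^sup>2) + 2 * L\<^sup>2 * (v t \<bullet> z t)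
      - (1/2) * a (w t) (w t) + (1/2) * (P (u t) (w t) \<bullet> v t)"
    unfolding F'_def expand by (simp add: inner_diff_left inner_diff_right power2_norm_eq_inner inner_commute algebra_simps)
  have 1: "2 * L\<^sup>2 * (v t \<bullet> z t) \<le> (1/2) * (norm (z t))\<^sup>2 + 2 * L ^ 4 * (norm (v t))\<^sup>2"
  proof -
    have "v t \<bullet> z t \<le> norm (z t) * norm (v t)" using norm_cauchy_schwarz[of "v t" "z t"] by (simp add: mult.commute)
    then have "2 * L\<^sup>2 * (v t \<bullet> z t) \<le> 2 * L\<^sup>2 * (norm (z t) * norm (v t))" by (intro mult_left_mono) auto
    also have "\<dots> = norm (z t) * (2 * L\<^sup>2 * norm (v t))" by simp
    also have "\<dots> \<le> (1/2) * (norm (z t))\<^sup>2 + (2 * L\<^sup>2 * norm (v t))\<^sup>2 / (4 * (1/2))" by (rule young) simp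
    also have "(2 * L\<^sup>2 * norm (v t))\<^sup>2 / (4 * (1/2)) = 2 * L ^ 4 * (norm (v t))\<^sup>2"
      by (simp add: power_mult_distrib flip: power_mult)
    finally show ?thesis .
  qed
  have 2: "(1/2) * (P (u t) (w t) \<bullet> v t) \<le> (1/8) * a (w t) (w t) + (L\<^sup>2 / 2) * (norm (v t))\<^sup>2"
    using abs_le_D1[OF Pwv_le[of "1/4" t]] by simp
  have 3: "L * norm (v t) * a (w t) (w t) \<le> (1/8) * a (w t) (w t) + 2 * (L\<^sup>2 * (norm (v t))\<^sup>2 * a (w t) (w t))"
  proof -
    have "1 * (L * norm (v t)) \<le> (1/8) * 1\<^sup>2 + (L * norm (v t))\<^sup>2 / (4 * (1/8))" by (rule young) simp
    then have "L * norm (v t) \<le> 1/8 + 2 * (L\<^sup>2 * (norm (v t))\<^sup>2)" by (simp add: power_mult_distrib)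
    then have "L * norm (v t) * a (w t) (w t) \<le> (1/8 + 2 * (L\<^sup>2 * (norm (v t))\<^sup>2)) * a (w t) (w t)"
      by (intro mult_right_mono a_nonneg w_mem)
    then show ?thesis by (simp add: algebra_simps)
  qed
  have 4: "L\<^sup>2 * (norm (v t))\<^sup>2 * a (w t) (w t) \<le> L\<^sup>2 * (norm (v t))\<^sup>2 * (2 * E t)"
  proof (intro mult_left_mono)
    show "a (w t) (w t) \<le> 2 * E t" using E_lower[of t] eps
      by (smt (verit) mult_nonneg_nonneg zero_le_power2)
  qed auto
  have 5: "(1/5) * E t \<le> (1/4) * (\<epsilon> * (norm (z t))\<^sup>2) + (1/4) * a (w t) (w t) + ((2 * L\<^sup>2 + 1/2) / 5) * (norm (v t))\<^sup>2"
    using E_upper[of t] by argo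
  have 6: "\<epsilon> * (norm (z t))\<^sup>2 \<le> (norm (z t))\<^sup>2" by (rule eps_mult_le) simp
  have 7: "c1 * (norm (v t))\<^sup>2 = 2 * L ^ 4 * (norm (v t))\<^sup>2 + (L\<^sup>2 / 2) * (norm (v t))\<^sup>2
      + ((2 * L\<^sup>2 + 1/2) / 5) * (norm (v t))\<^sup>2"
    by (simp add: c1_def distrib_right)
  have 8: "4 * L\<^sup>2 * (norm (v t))\<^sup>2 * E t = 2 * (L\<^sup>2 * (norm (v t))\<^sup>2 * (2 * E t))" by simp
  show ?thesis unfolding F'_eq 7 8 using 1 2 3 4 5 6 zero_le_power2[of "norm (z t)"] by linarith
qed

lemma E_cont: "continuous_on UNIV E"
proof -
  have "continuous_on UNIV (\<lambda>t. a (w t) (w t))"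
    unfolding continuous_on_def using w_cont w_mem by (auto intro!: a_tendsto simp: continuous_on_def)
  then show ?thesis unfolding E_def[abs_def]
    by (intro continuous_intros z_cont Pw_cont solD)
qed

text \<open>No derivative of \<open>P\<close> in its base point is available. The effect of moving
  it is bounded by \<open>P_lipschitz_weak\<close> through the quotient of \<open>J u\<close>, which
  tends to \<open>v t\<close>; the rest is differentiated with the base point frozen.\<close>

lemma E_dini:
  "\<exists>r. (r \<longlongrightarrow> F' t + L * norm (v t) * a (w t) (w t)) (at_right 0) \<and> (\<forall>\<^sub>F h in at_right 0. E (t + h) \<le> E t + h * r h)"
proof -
  define F where "F s = (\<epsilon> * (norm (z s))\<^sup>2 + a (w s) (w s)) - P (u t) (w s) \<bullet> v s
    + L\<^sup>2 * (norm (v s))\<^sup>2 + (1/2) * (\<epsilon> * (v s \<bullet> z s)) + (1/4) * (norm (v s))\<^sup>2" for s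
  have Ft: "F t = E t" by (simp add: F_def E_def)
  have vsq: "((\<lambda>s. (norm (v s))\<^sup>2) has_real_derivative 2 * (v t \<bullet> z t)) (at t)"
    using bounded_bilinear.has_vector_derivative[OF bounded_bilinear_inner v_deriv v_deriv, of t]
    unfolding power2_norm_eq_inner has_real_derivative_iff_has_vector_derivative by (simp add: inner_commute)
  have F_deriv: "(F has_real_derivative F' t) (at t)"
    unfolding F_def[abs_def] F'_def
    by (intro DERIV_add DERIV_diff DERIV_cmult vsq energy_identity[OF weak_w eps(1)]
        energy_cross[OF weak_w, unfolded J_w] P_form_has_derivative[OF u_mem u_ball w_cont w_mem, unfolded J_w] v_deriv)
  define r where "r h = (F (t + h) - F t) / h + L * norm (J ((u (t + h) - u t) /\<^sub>R h)) * a (w (t + h)) (w (t + h))" for h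
  have "((\<lambda>h. (F (t + h) - F t) / h) \<longlongrightarrow> F' t) (at 0)" using F_deriv by (simp add: DERIV_def)
  moreover have "((\<lambda>h. (u (t + h) - u t) /\<^sub>R h) \<longlongrightarrow> w t) (at 0)"
    using u_deriv by (simp add: has_vector_derivative_quotient)
  ultimately have "(r \<longlongrightarrow> F' t + L * norm (J (w t)) * a (w t) (w t)) (at 0)"
    unfolding r_def
    by (intro tendsto_intros a_tendsto bounded_linear.tendsto[OF J] continuous_on_UNIV_tendsto w_cont w_mem)
  then have "(r \<longlongrightarrow> F' t + L * norm (v t) * a (w t) (w t)) (at_right 0)"
    unfolding J_w by (rule tendsto_within_subset) simp
  moreover have "E (t + h) \<le> E t + h * r h" if h: "h > 0" for h
  proof -
    have "P (u t) (w (t + h)) \<bullet> v (t + h) - P (u (t + h)) (w (t + h)) \<bullet> v (t + h)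
        \<le> \<bar>(P (u (t + h)) (w (t + h)) - P (u t) (w (t + h))) \<bullet> J (w (t + h))\<bar>"
      by (simp add: J_w inner_diff_left)
    also have "\<dots> \<le> L * norm (J (u (t + h) - u t)) * a (w (t + h)) (w (t + h))"
      by (intro P_lipschitz_weak u_mem u_ball w_mem)
    also have "norm (J (u (t + h) - u t)) = h * norm (J ((u (t + h) - u t) /\<^sub>R h))"
      using h by (simp add: J_simps)
    finally have "E (t + h) \<le> F (t + h) + L * (h * norm (J ((u (t + h) - u t) /\<^sub>R h))) * a (w (t + h)) (w (t + h))"
      by (simp add: E_def F_def)
    also have "\<dots> = E t + h * r h" unfolding r_def Ft[symmetric] using h by (simp add: distrib_left)
    finally show ?thesis .
  qed
  then have "\<forall>\<^sub>F h in at_right 0. E (t + h) \<le> E t + h * r h"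
    by (auto simp: eventually_at_right_field intro!: exI[of _ 1])
  ultimately show ?thesis by blast
qed

text \<open>Since \<open>|v|^2\<close> is the derivative of \<open>\<mu>\<close>, the factor
  \<open>exp (- 4 * L\<^sup>2 * \<mu> r)\<close> removes the term in which \<open>|v|^2\<close>
  multiplies \<open>E\<close>. The remaining source is also a multiple of \<open>|v|^2\<close> and
  is balanced by subtracting a multiple of \<open>\<mu>\<close>.\<close>

lemma E_gronwall:
  assumes st: "s \<le> t"
  shows "E t \<le> exp (4 * L\<^sup>2 * (\<mu> t - \<mu> s)) * (E s * exp (- (t - s) / 5) + c1 * (\<mu> t - \<mu> s))"
proof -
  define \<rho> where "\<rho> r = exp (r / 5 - 4 * L\<^sup>2 * \<mu> r)" for r
  \<comment> \<open>\<open>c1\<close> times an upper bound of \<open>\<rho>\<close> on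
    \<open>[s, t]\<close>, valid because \<open>\<mu>\<close> increases. A constant factor makes the
    source integrable in closed form.\<close>
  define k where "k = c1 * exp (t / 5 - 4 * L\<^sup>2 * \<mu> s)"
  define g where "g r = E r * \<rho> r - k * \<mu> r" for r
  have \<rho>_pos: "\<rho> r > 0" for r by (simp add: \<rho>_def)
  have \<rho>_deriv: "(\<rho> has_real_derivative \<rho> r * (1/5 - 4 * L\<^sup>2 * (norm (v r))\<^sup>2)) (at r)" for r
    unfolding \<rho>_def[abs_def] by (auto intro!: derivative_eq_intros \<mu>_deriv simp: algebra_simps)
  have \<mu>_mono: "\<mu> p \<le> \<mu> q" if "p \<le> q" for p q
    by (rule DERIV_nonneg_imp_nondecreasing[OF that]) (use \<mu>_deriv in \<open>auto intro!: exI\<close>)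
  have "g t \<le> g s"
  proof (rule dini_nonincreasing[OF _ st])
    have cont: "continuous_on UNIV \<mu>" "continuous_on UNIV \<rho>"
      using \<mu>_deriv \<rho>_deriv by (auto intro!: continuous_at_imp_continuous_on DERIV_isCont)
    have "continuous_on UNIV g" unfolding g_def[abs_def]
      by (intro continuous_on_diff continuous_on_mult continuous_on_const cont E_cont)
    then show "continuous_on {s..t} g" by (rule continuous_on_subset) simp
    fix r assume r: "s \<le> r" "r < t"
    obtain q where q: "(q \<longlongrightarrow> F' r + L * norm (v r) * a (w r) (w r)) (at_right 0)"
      "\<forall>\<^sub>F h in at_right 0. E (r + h) \<le> E r + h * q h" using E_dini by blast
    define l where "l = (F' r + L * norm (v r) * a (w r) (w r)) * \<rho> r
      + E r * (\<rho> r * (1/5 - 4 * L\<^sup>2 * (norm (v r))\<^sup>2)) - k * (norm (v r))\<^sup>2"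
    define Q where "Q h = q h * \<rho> (r + h) + E r * ((\<rho> (r + h) - \<rho> r) / h) - k * ((\<mu> (r + h) - \<mu> r) / h)" for h
    have "((\<lambda>h. (\<rho> (r + h) - \<rho> r) / h) \<longlongrightarrow> \<rho> r * (1/5 - 4 * L\<^sup>2 * (norm (v r))\<^sup>2)) (at_right 0)"
      "((\<lambda>h. (\<mu> (r + h) - \<mu> r) / h) \<longlongrightarrow> (norm (v r))\<^sup>2) (at_right 0)"
      using \<rho>_deriv[of r] \<mu>_deriv[of r] by (auto simp: DERIV_def intro: tendsto_within_subset)
    moreover have "((\<lambda>h. \<rho> (r + h)) \<longlongrightarrow> \<rho> r) (at_right 0)"
    proof (rule tendsto_within_subset)
      show "((\<lambda>h. \<rho> (r + h)) \<longlongrightarrow> \<rho> r) (at 0)"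
        using DERIV_isCont[OF \<rho>_deriv[of r]] by (simp add: isCont_iff)
    qed simp
    ultimately have "(Q \<longlongrightarrow> l) (at_right 0)" unfolding Q_def l_def by (intro tendsto_intros q)
    moreover have "l \<le> 0"
    proof -
      have "(F' r + L * norm (v r) * a (w r) (w r)) * \<rho> r
          \<le> (- (1/5) * E r + c1 * (norm (v r))\<^sup>2 + 4 * L\<^sup>2 * (norm (v r))\<^sup>2 * E r) * \<rho> r"
        using E_dissipation \<rho>_pos[of r] by (intro mult_right_mono) auto
      then have "l \<le> c1 * (norm (v r))\<^sup>2 * \<rho> r - k * (norm (v r))\<^sup>2"
        by (simp add: l_def algebra_simps)
      also have "\<dots> = c1 * (norm (v r))\<^sup>2 * (\<rho> r - exp (t / 5 - 4 * L\<^sup>2 * \<mu> s))"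
        by (simp add: k_def algebra_simps)
      also have "\<dots> \<le> 0"
      proof (rule mult_nonneg_nonpos)
        have "L\<^sup>2 * \<mu> s \<le> L\<^sup>2 * \<mu> r" using \<mu>_mono[OF r(1)] by (intro mult_left_mono) auto
        then show "\<rho> r - exp (t / 5 - 4 * L\<^sup>2 * \<mu> s) \<le> 0" using r by (simp add: \<rho>_def)
      qed (use c1_nonneg in simp)
      finally show ?thesis .
    qed
    moreover have "\<forall>\<^sub>F h in at_right 0. g (r + h) \<le> g r + h * Q h"
      using q(2) eventually_at_right_less[of 0]
    proof eventually_elim
      case (elim h)
      have "E (r + h) * \<rho> (r + h) \<le> (E r + h * q h) * \<rho> (r + h)"
        using elim \<rho>_pos[of "r + h"] by (intro mult_right_mono) auto
      moreover have "g r + h * Q h = (E r + h * q h) * \<rho> (r + h) - k * \<mu> (r + h)"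
      proof -
        have expand: "h * (x * y + c * ((d - e) / h) - k * ((m - n) / h)) = h * x * y + c * (d - e) - k * (m - n)"
          for x y c d e m n using elim(2) by (simp add: field_simps)
        show ?thesis unfolding g_def Q_def expand by (simp add: algebra_simps)
      qed
      ultimately show ?case by (simp add: g_def)
    qed
    ultimately show "\<exists>r' l. l \<le> 0 \<and> (r' \<longlongrightarrow> l) (at_right 0) \<and> (\<forall>\<^sub>F h in at_right 0. g (r + h) \<le> g r + h * r' h)"
      by blast
  qed
  then have "E t * \<rho> t \<le> E s * \<rho> s + k * (\<mu> t - \<mu> s)" by (simp add: g_def algebra_simps)
  then have "E t * \<rho> t / \<rho> t \<le> (E s * \<rho> s + k * (\<mu> t - \<mu> s)) / \<rho> t"
    using \<rho>_pos[of t] by (intro divide_right_mono) auto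
  also have "\<dots> = E s * (\<rho> s / \<rho> t) + c1 * (exp (t / 5 - 4 * L\<^sup>2 * \<mu> s) / \<rho> t) * (\<mu> t - \<mu> s)"
    by (simp add: k_def add_divide_distrib)
  also have "\<rho> s / \<rho> t = exp (4 * L\<^sup>2 * (\<mu> t - \<mu> s)) * exp (- (t - s) / 5)"
    by (simp add: \<rho>_def exp_diff[symmetric] exp_add[symmetric]) (simp add: algebra_simps diff_divide_distrib)
  also have "exp (t / 5 - 4 * L\<^sup>2 * \<mu> s) / \<rho> t = exp (4 * L\<^sup>2 * (\<mu> t - \<mu> s))"
    by (simp add: \<rho>_def exp_diff[symmetric]) (simp add: algebra_simps)
  finally show ?thesis using \<rho>_pos[of t] by (simp add: algebra_simps)
qed

text \<open>The bound for fixed \<open>\<epsilon>\<close>, in the limit of the difference quotients.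
  It enters the final estimate only through a term that vanishes as the initial time tends to minus
  infinity.\<close>

lemma E_bounded: "\<exists>K. \<forall>t. E t \<le> K"
proof -
  obtain \<tau> M where \<tau>: "\<tau> > 0" and M: "\<And>h t. 0 < h \<Longrightarrow> h \<le> \<tau> \<Longrightarrow>
    \<epsilon> * (norm ((1/h) *\<^sub>R (v (t + h) - v t)))\<^sup>2 +
      a ((1/h) *\<^sub>R (u (t + h) - u t)) ((1/h) *\<^sub>R (u (t + h) - u t)) \<le> M"
    using difference_quotient_bound by metis
  have "\<epsilon> * (norm (z t))\<^sup>2 + a (w t) (w t) \<le> M" for t
  proof (rule tendsto_upperbound)
    have "((\<lambda>h. (1/h) *\<^sub>R (u (t + h) - u t)) \<longlongrightarrow> w t) (at_right 0)" "((\<lambda>h. (1/h) *\<^sub>R (v (t + h) - v t)) \<longlongrightarrow> z t) (at_right 0)"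
      using u_deriv[of t] v_deriv[of t]
      by (auto simp: has_vector_derivative_quotient inverse_eq_divide intro: tendsto_within_subset)
    then show "((\<lambda>h. \<epsilon> * (norm ((1/h) *\<^sub>R (v (t + h) - v t)))\<^sup>2 +
        a ((1/h) *\<^sub>R (u (t + h) - u t)) ((1/h) *\<^sub>R (u (t + h) - u t))) \<longlongrightarrow> \<epsilon> * (norm (z t))\<^sup>2 + a (w t) (w t)) (at_right 0)"
      by (intro tendsto_intros a_tendsto V_intros u_mem w_mem)
    show "\<forall>\<^sub>F h in at_right 0. \<epsilon> * (norm ((1/h) *\<^sub>R (v (t + h) - v t)))\<^sup>2 +
        a ((1/h) *\<^sub>R (u (t + h) - u t)) ((1/h) *\<^sub>R (u (t + h) - u t)) \<le> M"
      using M \<tau> by (auto simp: eventually_at_right_field intro!: exI[of _ \<tau>])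
  qed simp
  moreover have "(norm (v t))\<^sup>2 \<le> (sqrt (R / \<epsilon>))\<^sup>2" for t using v_bound by (intro power_mono) auto
  ultimately have "E t \<le> (5/4) * M + (2 * L\<^sup>2 + 1/2) * (sqrt (R / \<epsilon>))\<^sup>2" for t
    by (intro order_trans[OF E_upper] add_mono mult_left_mono) auto
  then show ?thesis by blast
qed

definition R1 where "R1 = 2 * (exp (4 * L\<^sup>2 * (R / 2 + 2 * (L * sqrt (R / lam)))) * (c1 * (R / 2 + 2 * (L * sqrt (R / lam)))))"

text \<open>The solution exists for all negative times, so the initial time can be sent to minus
  infinity: \<open>\<mu> t - \<mu> (t - \<sigma>)\<close> never exceeds \<open>D\<close>, while the
  initial energy carries the factor \<open>exp (- \<sigma> / 5)\<close>. With it the last dependence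
  on \<open>\<epsilon>\<close> disappears.\<close>

lemma uniform_bound: "\<epsilon> * (norm (z t))\<^sup>2 + a (w t) (w t) \<le> R1"
proof -
  define D where "D = R / 2 + 2 * (L * sqrt (R / lam))"
  obtain K where K: "\<And>t. E t \<le> K" using E_bounded by blast
  have E0: "0 \<le> E t" for t using E_lower[of t] eps a_nonneg[OF w_mem[of t]]
    by (smt (verit) mult_nonneg_nonneg zero_le_power2)
  have \<mu>_mono: "\<mu> p \<le> \<mu> q" if "p \<le> q" for p q
    by (rule DERIV_nonneg_imp_nondecreasing[OF that]) (use \<mu>_deriv in \<open>auto intro!: exI\<close>)
  have K0: "0 \<le> K" using order_trans[OF E0 K] .
  have step: "E t \<le> exp (4 * L\<^sup>2 * D) * (K * exp (- \<sigma> / 5) + c1 * D)" if \<sigma>: "\<sigma> \<ge> 0" for \<sigma>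
  proof -
    have \<mu>D: "0 \<le> \<mu> t - \<mu> (t - \<sigma>)" "\<mu> t - \<mu> (t - \<sigma>) \<le> D"
      using \<mu>_mono[of "t - \<sigma>" t] \<mu>_variation[of t "t - \<sigma>"] \<sigma> by (auto simp: D_def)
    have "E t \<le> exp (4 * L\<^sup>2 * (\<mu> t - \<mu> (t - \<sigma>))) * (E (t - \<sigma>) * exp (- \<sigma> / 5) + c1 * (\<mu> t - \<mu> (t - \<sigma>)))"
      using E_gronwall[of "t - \<sigma>" t] \<sigma> by simp
    also have "\<dots> \<le> exp (4 * L\<^sup>2 * D) * (K * exp (- \<sigma> / 5) + c1 * D)"
      using \<mu>D K E0 K0 c1_nonneg by (intro mult_mono add_mono mult_nonneg_nonneg add_nonneg_nonneg)
        (auto intro!: mult_left_mono)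
    finally show ?thesis .
  qed
  have "E t \<le> exp (4 * L\<^sup>2 * D) * (K * 0 + c1 * D)"
  proof (rule tendsto_lowerbound)
    have "((\<lambda>\<sigma>. exp (- \<sigma> / 5)) \<longlongrightarrow> (0::real)) at_top"
      by (rule filterlim_compose[OF exp_at_bot])
        (auto intro!: filterlim_tendsto_pos_mult_at_bot[of "\<lambda>_. 1/5" "1/5" _ uminus, simplified] filterlim_uminus_at_bot_at_top)
    then show "((\<lambda>\<sigma>. exp (4 * L\<^sup>2 * D) * (K * exp (- \<sigma> / 5) + c1 * D)) \<longlongrightarrow> exp (4 * L\<^sup>2 * D) * (K * 0 + c1 * D)) at_top"
      by (intro tendsto_intros)
    show "\<forall>\<^sub>F \<sigma> in at_top. E t \<le> exp (4 * L\<^sup>2 * D) * (K * exp (- \<sigma> / 5) + c1 * D)"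
      using step by (auto simp: eventually_at_top_linorder)
  qed simp
  then show ?thesis using E_lower[of t] by (simp add: R1_def D_def)
qed

lemma u_dom: "u t \<in> dom" and op_u: "op (u t) = f (u t) - v t - \<epsilon> *\<^sub>R z t"
proof -
  have a_z: "a (u t) \<phi> = (f (u t) - v t - \<epsilon> *\<^sub>R z t) \<bullet> J \<phi>" if "\<phi> \<in> V" for \<phi>
    using z_eq[OF that, of t] eps by (simp add: inner_diff_left inner_add_left field_simps)
  have mem: "f (u t) - v t - \<epsilon> *\<^sub>R z t \<in> H"
    by (intro H_intros f_mem u_mem v_mem z_mem)
  show "u t \<in> dom" unfolding dom_def using u_mem mem a_z by blast
  show "op (u t) = f (u t) - v t - \<epsilon> *\<^sub>R z t" by (rule op_eq[OF mem a_z])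
qed

text \<open>The operator is read off from the equation. \<open>\<epsilon> \<le> 1\<close> absorbs
  the second factor \<open>\<epsilon>\<close> in front of \<open>|z|^2\<close>, and
  \<open>|v|\<close> is now bounded by the energy of \<open>w\<close> through
  \<open>lam\<close>.\<close>

lemma uniform_bound_op:
  "(norm (op (u t)))\<^sup>2 + a (w t) (w t) + \<epsilon> * (norm (z t))\<^sup>2 \<le> 3 * (L\<^sup>2 + R1 / lam + R1) + R1"
proof -
  have aw: "a (w t) (w t) \<le> R1" and z: "\<epsilon> * (norm (z t))\<^sup>2 \<le> R1"
    using uniform_bound[of t] a_nonneg[OF w_mem, of t] mult_nonneg_nonneg[OF less_imp_le[OF eps(1)] zero_le_power2[of "norm (z t)"]]
    by linarith+
  have "norm (op (u t)) \<le> norm (f (u t)) + norm (v t) + norm (\<epsilon> *\<^sub>R z t)"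
    unfolding op_u by (intro order_trans[OF norm_triangle_ineq4] add_mono) (auto intro: norm_triangle_ineq4)
  then have "(norm (op (u t)))\<^sup>2 \<le> (norm (f (u t)) + norm (v t) + norm (\<epsilon> *\<^sub>R z t))\<^sup>2"
    by (intro power_mono) auto
  also have "\<dots> \<le> 3 * ((norm (f (u t)))\<^sup>2 + (norm (v t))\<^sup>2 + (norm (\<epsilon> *\<^sub>R z t))\<^sup>2)"
  proof -
    have "(x + y + q)\<^sup>2 \<le> 3 * (x\<^sup>2 + y\<^sup>2 + q\<^sup>2)" for x y q :: real
    proof -
      have "0 \<le> (x - y)\<^sup>2 + (x - q)\<^sup>2 + (y - q)\<^sup>2" by simp
      then show ?thesis by (simp add: power2_eq_square algebra_simps)
    qed
    then show ?thesis .
  qed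
  also have "\<dots> \<le> 3 * (L\<^sup>2 + R1 / lam + R1)"
  proof (intro mult_left_mono add_mono)
    show "(norm (f (u t)))\<^sup>2 \<le> L\<^sup>2" using f_bound[OF u_mem u_ball] by (intro power_mono) auto
    have "lam * (norm (v t))\<^sup>2 \<le> R1" using a_lower[OF w_mem, of t] aw by (simp add: J_w)
    then show "(norm (v t))\<^sup>2 \<le> R1 / lam" using lam by (simp add: field_simps)
    have "(norm (\<epsilon> *\<^sub>R z t))\<^sup>2 = \<epsilon> * (\<epsilon> * (norm (z t))\<^sup>2)" using eps by (simp add: power_mult_distrib power2_eq_square)
    also have "\<dots> \<le> \<epsilon> * (norm (z t))\<^sup>2" using eps by (intro eps_mult_le) simp
    finally show "(norm (\<epsilon> *\<^sub>R z t))\<^sup>2 \<le> R1" using z by simp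
  qed simp
  finally show ?thesis using uniform_bound[of t] by simp
qed

end

text \<open>The bound in closed form outside the locales, so that it can be fixed before the domain,
  the coefficients and the solution.\<close>

definition wave_bound :: "real \<Rightarrow> real \<Rightarrow> real \<Rightarrow> real" where
  "wave_bound L lam R = (let D = R / 2 + 2 * (L * sqrt (R / lam));
     c = 2 * L ^ 4 + L\<^sup>2 / 2 + (2 * L\<^sup>2 + 1/2) / 5;
     R1 = 2 * (exp (4 * L\<^sup>2 * D) * (c * D))
   in 3 * (L\<^sup>2 + R1 / lam + R1) + R1)"

lemma (in wave_mild) uniform_regularity:
  "u t \<in> dom \<and> (\<exists>w\<in>V. J w = v t \<and> (\<exists>v'. (v has_vector_derivative v') (at t) \<and>
     (norm (op (u t)))\<^sup>2 + a w w + \<epsilon> * (norm v')\<^sup>2 \<le> wave_bound L lam R))"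
proof -
  obtain w z where wz: "\<And>t. w t \<in> V" "\<And>t. J (w t) = v t" "\<And>t. z t \<in> H"
    "continuous_on UNIV w" "continuous_on UNIV z"
    "\<And>t. (u has_vector_derivative w t) (at t)" "\<And>t. (v has_vector_derivative z t) (at t)"
    "\<And>t \<phi>. \<phi> \<in> V \<Longrightarrow> z t \<bullet> J \<phi> = (- (v t \<bullet> J \<phi>) - a (u t) \<phi> + f (u t) \<bullet> J \<phi>) / \<epsilon>"
    using regularity by blast
  interpret W: wave_regular V H J a c0 Ca lam f P R L \<epsilon> u v w z
    by unfold_locales (fact wz)+
  show ?thesis
    using W.u_dom[of t] wz W.uniform_bound_op[of t] unfolding wave_bound_def W.R1_def W.c1_def Let_def by blast
qed

section \<open>Completeness of \<open>L\<^sup>2\<close> and \<open>H\<^sup>1\<close>\<close>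

lemma mk_l2_eq_iff:
  assumes "square_integrable lebesgue f" "square_integrable lebesgue g"
  shows "mk_l2 f = mk_l2 g \<longleftrightarrow> (AE x in lebesgue. f x = g x)"
  using Quotient3_rel[OF Quotient3_l2, of f g] assms by (simp add: mk_l2_def)

lemma mk_l2_add:
  assumes "square_integrable lebesgue f" "square_integrable lebesgue g"
  shows "mk_l2 f + mk_l2 g = mk_l2 (\<lambda>x. f x + g x)"
  using plus_l2.abs_eq[of f g] assms square_integrable_add[OF assms] by (simp add: mk_l2_def)

lemma mk_l2_scale:
  assumes "square_integrable lebesgue f" shows "c *\<^sub>R mk_l2 f = mk_l2 (\<lambda>x. c * f x)"
  using scaleR_l2.abs_eq[of f c] assms square_integrable_scale[OF assms] by (simp add: mk_l2_def)

lemma mk_l2_zero: "mk_l2 (\<lambda>x. 0) = 0"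
  by (simp add: mk_l2_def square_integrable_zero zero_l2_def)

lemma square_integrable_diff:
  "square_integrable M f \<Longrightarrow> square_integrable M g \<Longrightarrow> square_integrable M (\<lambda>x. f x - g x)"
  using square_integrable_add[of M f "\<lambda>x. -1 * g x"] square_integrable_scale[of M g "-1"]
  by (simp only: mult_minus1 add_uminus_conv_diff)

lemma mk_l2_diff:
  assumes "square_integrable lebesgue f" "square_integrable lebesgue g"
  shows "mk_l2 f - mk_l2 g = mk_l2 (\<lambda>x. f x - g x)"
  using mk_l2_add[OF assms(1) square_integrable_scale[OF assms(2), of "-1"]] mk_l2_scale[OF assms(2), of "-1"]
  by (metis (no_types, lifting) add_uminus_conv_diff mult_minus1 scaleR_minus1_left ext)

lemma inner_mk_l2:
  assumes "square_integrable lebesgue f" "square_integrable lebesgue g"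
  shows "inner (mk_l2 f) (mk_l2 g) = (LINT x|lebesgue. f x * g x)"
  using inner_l2.abs_eq[of f g] assms by (simp add: mk_l2_def)

lemma norm_mk_l2:
  assumes "square_integrable lebesgue f" shows "(norm (mk_l2 f))\<^sup>2 = (LINT x|lebesgue. (f x)\<^sup>2)"
  using inner_mk_l2[OF assms assms] unfolding power2_norm_eq_inner by (simp add: power2_eq_square)

lemmas rep_l2_si = mk_l2_rep(1)

lemma norm_rep_l2: "(norm u)\<^sup>2 = (LINT x|lebesgue. (rep_l2 u x)\<^sup>2)"
  using norm_mk_l2[OF rep_l2_si, of u] by (simp add: mk_l2_rep(2))

lemma rep_l2_add: "AE x in lebesgue. rep_l2 (u + v) x = rep_l2 u x + rep_l2 v x"
  using rep_mk_l2[OF square_integrable_add[OF rep_l2_si rep_l2_si, of u v]]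
  unfolding mk_l2_add[OF rep_l2_si rep_l2_si, symmetric] mk_l2_rep(2) .

lemma rep_l2_diff: "AE x in lebesgue. rep_l2 (u - v) x = rep_l2 u x - rep_l2 v x"
  using rep_mk_l2[OF square_integrable_diff[OF rep_l2_si rep_l2_si, of u v]]
  unfolding mk_l2_diff[OF rep_l2_si rep_l2_si, symmetric] mk_l2_rep(2) .

lemma rep_l2_scale:
  fixes u :: l2 and c :: real
  shows "AE x in lebesgue. rep_l2 (c *\<^sub>R u) x = c * rep_l2 u x"
  using rep_mk_l2[OF square_integrable_scale[OF rep_l2_si[of u], of c]]
  unfolding mk_l2_scale[OF rep_l2_si, symmetric] mk_l2_rep(2) .

lemma norm_mk_l2_nn_integral:
  assumes "square_integrable lebesgue f"
  shows "ennreal ((norm (mk_l2 f))\<^sup>2) = (\<integral>\<^sup>+x. ennreal ((f x)\<^sup>2) \<partial>lebesgue)"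
  using assms unfolding norm_mk_l2[OF assms]
  by (subst nn_integral_eq_integral) (auto simp: square_integrable_def)

lemma square_integrable_nn_integral:
  assumes "f \<in> borel_measurable M" "(\<integral>\<^sup>+x. ennreal ((f x)\<^sup>2) \<partial>M) < \<infinity>"
  shows "square_integrable M f"
  using assms by (auto simp: square_integrable_def integrable_iff_bounded)

lemma Cauchy_rapid_subsequence:
  fixes X :: "nat \<Rightarrow> 'a::metric_space" and e :: "nat \<Rightarrow> real"
  assumes "Cauchy X" and e: "\<And>n. e n > 0"
  obtains r where "strict_mono r" "\<And>n p q. p \<ge> r n \<Longrightarrow> q \<ge> r n \<Longrightarrow> dist (X p) (X q) < e n"
proof -
  have "\<forall>n. \<exists>N. \<forall>p\<ge>N. \<forall>q\<ge>N. dist (X p) (X q) < e n"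
    using assms unfolding Cauchy_def by blast
  then obtain N where N: "\<And>n p q. p \<ge> N n \<Longrightarrow> q \<ge> N n \<Longrightarrow> dist (X p) (X q) < e n" by metis
  \<comment> \<open>Summation makes the indices strictly increasing while they stay at least
    \<open>N n\<close>.\<close>
  define r where "r n = (\<Sum>i\<le>n. Suc (N i))" for n
  have "strict_mono r" by (rule strict_monoI_Suc) (simp add: r_def)
  moreover have "N n \<le> r n" for n
  proof -
    have "Suc (N n) \<le> r n" unfolding r_def by (rule member_le_sum) auto
    then show ?thesis by simp
  qed
  ultimately show ?thesis using that N by (meson order_trans)
qed

text \<open>Riesz-Fischer: a rapidly converging subsequence converges almost everywhere, and Fatou's
  lemma makes the pointwise limit a limit in norm.\<close>

instance l2 :: complete_space
proof
  fix X :: "nat \<Rightarrow> l2"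
  assume X: "Cauchy X"
  obtain r where r: "strict_mono r"
    "\<And>n p q. p \<ge> r n \<Longrightarrow> q \<ge> r n \<Longrightarrow> dist (X p) (X q) < (1/2) ^ n"
    by (rule Cauchy_rapid_subsequence[OF X, of "\<lambda>n. (1/2) ^ n"]) auto
  define f where "f n = rep_l2 (X (r n))" for n
  have f_si: "square_integrable lebesgue (f n)" for n by (simp add: f_def rep_l2_si)
  have f_meas [measurable]: "f n \<in> borel_measurable lebesgue" for n
    using f_si by (simp add: square_integrable_def)
  have mk_f: "mk_l2 (f n) = X (r n)" for n by (simp add: f_def mk_l2_rep(2))
  have f_dist: "(\<integral>\<^sup>+x. ennreal ((f m x - f n x)\<^sup>2) \<partial>lebesgue) \<le> ennreal (((1/2) ^ k)\<^sup>2)"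
    if "k \<le> m" "k \<le> n" for m n k
  proof -
    have "(\<integral>\<^sup>+x. ennreal ((f m x - f n x)\<^sup>2) \<partial>lebesgue) = ennreal ((norm (X (r m) - X (r n)))\<^sup>2)"
      using norm_mk_l2_nn_integral[OF square_integrable_diff[OF f_si f_si, of m n]]
      by (simp add: mk_l2_diff[symmetric] f_si mk_f)
    also have "\<dots> \<le> ennreal (((1/2) ^ k)\<^sup>2)"
      using r(2)[of k "r m" "r n"] that strict_mono_less_eq[OF r(1)]
      by (intro ennreal_leI power_mono) (auto simp: dist_norm)
    finally show ?thesis .
  qed
  \<comment> \<open>The weight gives \<open>|d| \<le> 2 ^ n * d^2 + (1/2) ^ n\<close>, so
    convergence of the weighted squares makes the increments themselves summable.\<close>
  define h where "h n x = 2 ^ n * (f (Suc n) x - f n x)\<^sup>2" for n x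
  have h_int: "(\<integral>\<^sup>+x. (\<Sum>n. ennreal (h n x)) \<partial>lebesgue) < \<infinity>"
  proof -
    have "(\<integral>\<^sup>+x. ennreal (h n x) \<partial>lebesgue) \<le> ennreal ((1/2) ^ n)" for n
    proof -
      have "(\<integral>\<^sup>+x. ennreal (h n x) \<partial>lebesgue) = ennreal (2 ^ n) * (\<integral>\<^sup>+x. ennreal ((f (Suc n) x - f n x)\<^sup>2) \<partial>lebesgue)"
        by (subst nn_integral_cmult[symmetric]) (auto simp: h_def ennreal_mult)
      also have "\<dots> \<le> ennreal (2 ^ n) * ennreal (((1/2) ^ n)\<^sup>2)"
        by (intro mult_left_mono f_dist) auto
      also have "\<dots> = ennreal ((1/2) ^ n)"
      proof -
        have "2 ^ n * ((1/2 :: real) ^ n)\<^sup>2 = (1/2) ^ n"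
          by (simp add: power2_eq_square power_divide)
        then show ?thesis by (simp add: ennreal_mult[symmetric] del: ennreal_power)
      qed
      finally show ?thesis .
    qed
    note h_le = this
    have "(\<integral>\<^sup>+x. (\<Sum>n. ennreal (h n x)) \<partial>lebesgue) = (\<Sum>n. \<integral>\<^sup>+x. ennreal (h n x) \<partial>lebesgue)"
      by (rule nn_integral_suminf) (simp add: h_def)
    also have "\<dots> \<le> (\<Sum>n. ennreal ((1/2) ^ n))"
      by (rule suminf_le[OF h_le]) auto
    also have "\<dots> = ennreal (\<Sum>n. (1/2) ^ n)"
      by (rule suminf_ennreal2) (auto intro: summable_geometric)
    finally show ?thesis by (auto intro: le_less_trans)
  qed
  have conv: "AE x in lebesgue. convergent (\<lambda>n. f n x)"
  proof -
    have "AE x in lebesgue. (\<Sum>n. ennreal (h n x)) \<noteq> \<infinity>"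
      using h_int by (intro nn_integral_noteq_infinite) (auto simp: h_def)
    then show ?thesis
    proof eventually_elim
      case (elim x)
      have "summable (\<lambda>n. h n x)"
        using elim by (intro summable_suminf_not_top) (auto simp: h_def)
      moreover have "summable (\<lambda>n. (1/2 :: real) ^ n)" by (rule summable_geometric) simp
      ultimately have "summable (\<lambda>n. h n x + (1/2) ^ n)" by (intro summable_add)
      then have "summable (\<lambda>n. f (Suc n) x - f n x)"
      proof (rule summable_comparison_test'[where N=0])
        fix n :: nat
        define d where "d = f (Suc n) x - f n x"
        have "\<bar>d\<bar> \<le> 2 ^ n * d\<^sup>2 + (1/2) ^ n"
        proof -
          have "0 \<le> 2 ^ n * (\<bar>d\<bar> - (1/2) ^ n)\<^sup>2" by (intro mult_nonneg_nonneg) auto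
          also have "\<dots> = 2 ^ n * d\<^sup>2 - 2 * \<bar>d\<bar> * (2 ^ n * (1/2) ^ n) + 2 ^ n * (1/2) ^ n * (1/2) ^ n"
            by (simp only: power2_diff power2_abs power2_eq_square[of "(1/2) ^ n"]) (simp only: algebra_simps)
          also have "2 ^ n * (1/2) ^ n = (1 :: real)" by (simp flip: power_mult_distrib)
          finally have "2 * \<bar>d\<bar> \<le> 2 ^ n * d\<^sup>2 + (1/2) ^ n" by simp
          then show ?thesis using abs_ge_zero[of d] by linarith
        qed
        then show "norm (f (Suc n) x - f n x) \<le> h n x + (1/2) ^ n" by (simp add: h_def d_def)
      qed
      then have "convergent (\<lambda>n. (\<Sum>i<n. f (Suc i) x - f i x) + f 0 x)"
        using summable_LIMSEQ convergent_def tendsto_add[OF _ tendsto_const] by blast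
      moreover have "(\<Sum>i<n. f (Suc i) x - f i x) + f 0 x = f n x" for n
        using sum_lessThan_telescope[of "\<lambda>i. f i x" n] by simp
      ultimately show ?case by simp
    qed
  qed
  define g where "g x = lim (\<lambda>n. f n x)" for x
  have g_meas [measurable]: "g \<in> borel_measurable lebesgue" unfolding g_def[abs_def] by measurable
  have g_lim: "AE x in lebesgue. (\<lambda>n. f n x) \<longlonglongrightarrow> g x"
    using conv by eventually_elim (simp add: g_def convergent_LIMSEQ_iff)
  have g_dist: "(\<integral>\<^sup>+x. ennreal ((g x - f n x)\<^sup>2) \<partial>lebesgue) \<le> ennreal (((1/2) ^ n)\<^sup>2)" for n
  proof -
    have "(\<integral>\<^sup>+x. ennreal ((g x - f n x)\<^sup>2) \<partial>lebesgue)
        = (\<integral>\<^sup>+x. liminf (\<lambda>m. ennreal ((f m x - f n x)\<^sup>2)) \<partial>lebesgue)"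
    proof (rule nn_integral_cong_AE)
      show "AE x in lebesgue. ennreal ((g x - f n x)\<^sup>2) = liminf (\<lambda>m. ennreal ((f m x - f n x)\<^sup>2))"
        using g_lim
      proof eventually_elim
        case (elim x)
        then have "(\<lambda>m. ennreal ((f m x - f n x)\<^sup>2)) \<longlonglongrightarrow> ennreal ((g x - f n x)\<^sup>2)"
          by (intro tendsto_intros)
        then show ?case by (intro lim_imp_Liminf[symmetric]) auto
      qed
    qed
    also have "\<dots> \<le> liminf (\<lambda>m. \<integral>\<^sup>+x. ennreal ((f m x - f n x)\<^sup>2) \<partial>lebesgue)"
      by (rule nn_integral_liminf) measurable
    also have "\<dots> \<le> ennreal (((1/2) ^ n)\<^sup>2)"
    proof (rule Liminf_le)
      show "\<forall>\<^sub>F m in sequentially. (\<integral>\<^sup>+x. ennreal ((f m x - f n x)\<^sup>2) \<partial>lebesgue) \<le> ennreal (((1/2) ^ n)\<^sup>2)"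
        using f_dist[of n] by (auto simp: eventually_sequentially intro!: exI[of _ n])
    qed simp
    finally show ?thesis .
  qed
  have gf_si: "square_integrable lebesgue (\<lambda>x. g x - f n x)" for n
    by (rule square_integrable_nn_integral) (auto intro: le_less_trans[OF g_dist])
  have g_si: "square_integrable lebesgue g"
    using square_integrable_add[OF gf_si[of 0] f_si[of 0]] by simp
  have "dist ((X \<circ> r) n) (mk_l2 g) \<le> (1/2) ^ n" for n
  proof -
    have "ennreal ((norm (mk_l2 g - mk_l2 (f n)))\<^sup>2) \<le> ennreal (((1/2) ^ n)\<^sup>2)"
      unfolding mk_l2_diff[OF g_si f_si] norm_mk_l2_nn_integral[OF gf_si] by (rule g_dist)
    then have "(norm (mk_l2 g - mk_l2 (f n)))\<^sup>2 \<le> ((1/2) ^ n)\<^sup>2" by simp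
    then have "norm (mk_l2 g - mk_l2 (f n)) \<le> (1/2) ^ n" by (rule power2_le_imp_le) simp
    then show ?thesis by (simp add: mk_f dist_norm norm_minus_commute)
  qed
  then have "(\<lambda>n. dist ((X \<circ> r) n) (mk_l2 g)) \<longlonglongrightarrow> 0"
    by (intro tendsto_sandwich[OF _ _ tendsto_const LIMSEQ_realpow_zero[of "1/2"]]) auto
  then have "(X \<circ> r) \<longlonglongrightarrow> mk_l2 g" by (rule tendsto_dist_iff[THEN iffD2])
  then show "convergent X" using Cauchy_converges_subseq[OF X r(1)] by (auto simp: convergent_def)
qed

instance l2 :: banach ..

lemma dist_h1: "dist u v = dist (Rep_h1 u) (Rep_h1 v)"
  by (simp add: dist_norm norm_h1_def norm_eq_sqrt_inner inner_h1.rep_eq minus_h1.rep_eq)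

text \<open>The identities that define a weak gradient are continuous in the pair, hence pass to
  limits.\<close>

instance h1 :: complete_space
proof
  fix X :: "nat \<Rightarrow> h1"
  assume X: "Cauchy X"
  have "Cauchy (\<lambda>n. Rep_h1 (X n))" using X by (simp add: Cauchy_def dist_h1)
  then obtain p where p: "(\<lambda>n. Rep_h1 (X n)) \<longlonglongrightarrow> p" by (auto simp: Cauchy_convergent_iff convergent_def)
  have "inner (snd p $ i) (mk_l2 \<phi>) = - inner (fst p) (mk_l2 (partial_deriv i \<phi>))" if \<phi>: "test_function UNIV \<phi>" for i \<phi>
  proof (rule LIMSEQ_unique)
    show "(\<lambda>n. inner (snd (Rep_h1 (X n)) $ i) (mk_l2 \<phi>)) \<longlonglongrightarrow> inner (snd p $ i) (mk_l2 \<phi>)"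
      by (intro tendsto_intros p)
    have "inner (snd (Rep_h1 (X n)) $ i) (mk_l2 \<phi>) = - inner (fst (Rep_h1 (X n))) (mk_l2 (partial_deriv i \<phi>))" for n
      using Rep_h1[of "X n"] \<phi> by (auto simp: case_prod_unfold)
    then show "(\<lambda>n. inner (snd (Rep_h1 (X n)) $ i) (mk_l2 \<phi>)) \<longlonglongrightarrow> - inner (fst p) (mk_l2 (partial_deriv i \<phi>))"
      by (simp only:) (intro tendsto_intros p)
  qed
  then have "p \<in> {(u, g). \<forall>i \<phi>. test_function UNIV \<phi> \<longrightarrow>
      inner (g $ i) (mk_l2 \<phi>) = - inner u (mk_l2 (partial_deriv i \<phi>))}" by (auto simp: case_prod_unfold)
  then have Rep: "Rep_h1 (Abs_h1 p) = p" by (rule Abs_h1_inverse)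
  have "(\<lambda>n. dist (X n) (Abs_h1 p)) \<longlonglongrightarrow> 0"
    using p by (simp add: dist_h1 Rep tendsto_dist_iff[symmetric])
  then have "X \<longlonglongrightarrow> Abs_h1 p" by (rule tendsto_dist_iff[THEN iffD2])
  then show "convergent X" by (auto simp: convergent_def)
qed

instance h1 :: banach ..

lemma norm_h1_ge: "norm (h1_l2 u) \<le> norm u" "norm (grad u $ i) \<le> norm u"
proof -
  have "(norm (grad u $ i))\<^sup>2 \<le> (\<Sum>i\<in>UNIV. (norm (grad u $ i))\<^sup>2)"
    by (rule member_le_sum) auto
  then have "(norm (grad u $ i))\<^sup>2 \<le> (norm u)\<^sup>2" "(norm (h1_l2 u))\<^sup>2 \<le> (norm u)\<^sup>2"
    using norm_h1_eq[of u] zero_le_power2[of "norm (h1_l2 u)"] zero_le_power2[of "norm (grad u $ i)"] by linarith+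
  then show "norm (h1_l2 u) \<le> norm u" "norm (grad u $ i) \<le> norm u"
    by (auto intro: power2_le_imp_le)
qed

lemma h1_l2_linear: "h1_l2 (u + v) = h1_l2 u + h1_l2 v" "h1_l2 (c *\<^sub>R u) = c *\<^sub>R h1_l2 u"
  by (simp_all add: h1_l2.rep_eq plus_h1.rep_eq scaleR_h1.rep_eq)

lemma grad_linear: "grad (u + v) = grad u + grad v" "grad (c *\<^sub>R u) = c *\<^sub>R grad u"
  by (simp_all add: grad.rep_eq plus_h1.rep_eq scaleR_h1.rep_eq)

lemma bounded_linear_h1_l2: "bounded_linear h1_l2"
  by (rule bounded_linear_intro[where K=1]) (simp_all add: h1_l2_linear norm_h1_ge)

lemma bounded_linear_grad: "bounded_linear (\<lambda>u. grad u $ i)"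
  by (rule bounded_linear_intro[where K=1]) (simp_all add: grad_linear norm_h1_ge)

section \<open>Restriction to a measurable set\<close>

lemma square_integrable_indicator_mult:
  assumes "square_integrable lebesgue f" "A \<in> sets lebesgue"
  shows "square_integrable lebesgue (\<lambda>x. indicator A x * f x)"
proof -
  have "integrable lebesgue (\<lambda>x. (indicator A x * f x)\<^sup>2)"
    by (rule Bochner_Integration.integrable_bound[of _ "\<lambda>x. (f x)\<^sup>2"])
      (use assms in \<open>auto simp: square_integrable_def indicator_def\<close>)
  then show ?thesis using assms by (auto simp: square_integrable_def)
qed

definition cut_l2 :: "R3 set \<Rightarrow> l2 \<Rightarrow> l2" where
  "cut_l2 A u = mk_l2 (\<lambda>x. indicator A x * rep_l2 u x)"

lemma bounded_linear_cut_l2: assumes A: "A \<in> sets lebesgue" shows "bounded_linear (cut_l2 A)"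
proof (rule bounded_linear_intro[where K=1])
  note si = square_integrable_indicator_mult[OF rep_l2_si A]
  fix u v :: l2 and c :: real
  show "cut_l2 A (u + v) = cut_l2 A u + cut_l2 A v"
    unfolding cut_l2_def mk_l2_add[OF si si]
    by (subst mk_l2_eq_iff[OF si square_integrable_add[OF si si]])
      (use rep_l2_add[of u v] in \<open>eventually_elim, simp add: distrib_left\<close>)
  show "cut_l2 A (c *\<^sub>R u) = c *\<^sub>R cut_l2 A u"
    unfolding cut_l2_def mk_l2_scale[OF si]
    by (subst mk_l2_eq_iff[OF si square_integrable_scale[OF si]])
      (use rep_l2_scale[of c u] in \<open>eventually_elim, simp\<close>)
  have "(norm (cut_l2 A u))\<^sup>2 \<le> (norm u)\<^sup>2"
    unfolding cut_l2_def norm_mk_l2[OF si] norm_rep_l2[of u]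
    by (rule integral_mono)
      (use si[of u] rep_l2_si[of u] in \<open>auto simp: square_integrable_def indicator_def\<close>)
  then have "norm (cut_l2 A u) \<le> norm u" by (rule power2_le_imp_le) simp
  then show "norm (cut_l2 A u) \<le> norm u * 1" by simp
qed

text \<open>Exhibits \<open>L2 \<Omega>\<close> as the kernel of a bounded operator, which makes it
  a closed subspace.\<close>

lemma L2_eq_cut:
  assumes "\<Omega> \<in> sets lebesgue" shows "L2 \<Omega> = {u. cut_l2 (- \<Omega>) u = 0}"
proof -
  have A: "- \<Omega> \<in> sets lebesgue" using assms by (simp add: Compl_in_sets_lebesgue)
  show ?thesis
    unfolding L2_def cut_l2_def mk_l2_zero[symmetric]
      mk_l2_eq_iff[OF square_integrable_indicator_mult[OF rep_l2_si A] square_integrable_zero]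
    by (auto simp: indicator_def elim!: eventually_mono split: if_splits)
qed

lemma subspace_L2: "\<Omega> \<in> sets lebesgue \<Longrightarrow> subspace (L2 \<Omega>)"
  and closed_L2: "\<Omega> \<in> sets lebesgue \<Longrightarrow> closed (L2 \<Omega>)"
proof -
  assume \<Omega>: "\<Omega> \<in> sets lebesgue"
  have lin: "bounded_linear (cut_l2 (- \<Omega>))"
    using \<Omega> by (intro bounded_linear_cut_l2) (simp add: Compl_in_sets_lebesgue)
  show "subspace (L2 \<Omega>)"
    unfolding L2_eq_cut[OF \<Omega>] using linear_subspace_kernel[OF bounded_linear.linear[OF lin]] .
  show "closed (L2 \<Omega>)"
    unfolding L2_eq_cut[OF \<Omega>] by (intro closed_Collect_eq continuous_intros linear_continuous_on lin)
qed

section \<open>Test functions\<close>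

lemma partial_deriv_eq: "(\<phi> has_derivative D) (at x) \<Longrightarrow> partial_deriv i \<phi> x = D (axis i 1)"
  by (simp add: partial_deriv_def frechet_derivative_at[symmetric])

lemma C_k_combination:
  "C_k k \<phi> \<Longrightarrow> C_k k \<psi> \<Longrightarrow> C_k k (\<lambda>x. c * \<phi> x + d * \<psi> x)"
proof (induction k arbitrary: \<phi> \<psi>)
  case 0 then show ?case by (auto intro!: continuous_intros)
next
  case (Suc k)
  have D: "((\<lambda>x. c * \<phi> x + d * \<psi> x) has_derivative
      (\<lambda>h. c * frechet_derivative \<phi> (at x) h + d * frechet_derivative \<psi> (at x) h)) (at x)" for x
    using Suc.prems by (auto intro!: derivative_intros simp: frechet_derivative_works[symmetric])
  have "partial_deriv i (\<lambda>x. c * \<phi> x + d * \<psi> x) = (\<lambda>x. c * partial_deriv i \<phi> x + d * partial_deriv i \<psi> x)" for i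
    using partial_deriv_eq[OF D] by (auto simp: partial_deriv_def)
  moreover have "(\<lambda>x. c * \<phi> x + d * \<psi> x) differentiable (at x)" for x
    using D by (auto simp: differentiable_def)
  ultimately show ?case using Suc by simp
qed

lemma test_function_combination:
  assumes "test_function \<Omega> \<phi>" "test_function \<Omega> \<psi>"
  shows "test_function \<Omega> (\<lambda>x. c * \<phi> x + d * \<psi> x)"
proof -
  let ?S = "closure {x. \<phi> x \<noteq> 0}" and ?T = "closure {x. \<psi> x \<noteq> 0}"
  have sub: "closure {x. c * \<phi> x + d * \<psi> x \<noteq> 0} \<subseteq> ?S \<union> ?T"
    unfolding closure_Un[symmetric] by (rule closure_mono) auto
  have "bounded (?S \<union> ?T)" using assms by (auto simp: test_function_def compact_imp_bounded)
  then have "bounded (closure {x. c * \<phi> x + d * \<psi> x \<noteq> 0})" by (rule bounded_subset[OF _ sub])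
  then have "compact (closure {x. c * \<phi> x + d * \<psi> x \<noteq> 0})" by (simp add: compact_eq_bounded_closed)
  with sub show ?thesis using assms C_k_combination by (auto simp: test_function_def)
qed

lemma test_function_zero: "test_function \<Omega> (\<lambda>x. 0)"
proof -
  have "C_k k (\<lambda>x. 0)" for k
  proof (induction k)
    case (Suc k)
    have "partial_deriv i (\<lambda>x. 0) = (\<lambda>x. 0)" for i
      by (rule ext) (rule partial_deriv_eq[of _ "\<lambda>_. 0"], simp)
    with Suc show ?case by simp
  qed simp
  then show ?thesis by (simp add: test_function_def)
qed

lemma test_function_differentiable: "test_function \<Omega> \<phi> \<Longrightarrow> \<phi> differentiable (at x)"
  unfolding test_function_def by (metis C_k.simps(2))

lemma test_function_continuous: "test_function \<Omega> \<phi> \<Longrightarrow> continuous_on UNIV \<phi>"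
  unfolding test_function_def by (metis C_k.simps(1))

lemma test_function_UNIV: "test_function \<Omega> \<phi> \<Longrightarrow> test_function UNIV \<phi>"
  by (simp add: test_function_def)

lemma partial_deriv_zero_outside:
  assumes "x \<notin> closure {x. \<phi> x \<noteq> 0}" shows "partial_deriv i \<phi> x = 0"
proof -
  have "(\<phi> has_derivative (\<lambda>_. 0)) (at x)"
  proof (rule has_derivative_transform_within_open)
    show "((\<lambda>_. 0) has_derivative (\<lambda>_. 0)) (at x)" by simp
    show "open (- closure {x. \<phi> x \<noteq> 0})" by (intro open_Compl closed_closure)
    show "0 = \<phi> y" if "y \<in> - closure {x. \<phi> x \<noteq> 0}" for y
      using that subsetD[OF closure_subset, of y "{x. \<phi> x \<noteq> 0}"] by (cases "\<phi> y = 0") simp_all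
  qed (use assms in simp)
  then show ?thesis using partial_deriv_eq by fastforce
qed

lemma test_function_partial_deriv:
  assumes "test_function \<Omega> \<phi>" shows "test_function \<Omega> (partial_deriv i \<phi>)"
proof -
  have sub: "closure {x. partial_deriv i \<phi> x \<noteq> 0} \<subseteq> closure {x. \<phi> x \<noteq> 0}"
    using partial_deriv_zero_outside by (intro closure_minimal) auto
  have "C_k k (partial_deriv i \<phi>)" for k
    using assms unfolding test_function_def by (metis C_k.simps(2))
  moreover have "compact (closure {x. partial_deriv i \<phi> x \<noteq> 0})"
    using assms sub unfolding test_function_def
    by (meson bounded_subset closed_closure compact_eq_bounded_closed)
  ultimately show ?thesis using assms sub by (auto simp: test_function_def)
qed

lemma test_function_ball:
  assumes "test_function \<Omega> \<phi>"
  obtains B where "B > 0" "\<And>x. norm x \<ge> B \<Longrightarrow> \<phi> x = 0" "\<And>x i. norm x \<ge> B \<Longrightarrow> partial_deriv i \<phi> x = 0"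
proof -
  have "bounded (closure {x. \<phi> x \<noteq> 0})" using assms by (auto simp: test_function_def compact_imp_bounded)
  then obtain B where B: "\<And>x. x \<in> closure {x. \<phi> x \<noteq> 0} \<Longrightarrow> norm x \<le> B" by (auto simp: bounded_iff)
  show ?thesis
  proof (rule that[of "\<bar>B\<bar> + 1"])
    fix x :: R3 and i assume "norm x \<ge> \<bar>B\<bar> + 1"
    then have "x \<notin> closure {x. \<phi> x \<noteq> 0}" using B[of x] by auto
    then show "\<phi> x = 0" "partial_deriv i \<phi> x = 0"
      using closure_subset[of "{x. \<phi> x \<noteq> 0}"] partial_deriv_zero_outside by auto
  qed simp
qed

lemma integrable_compact_support:
  fixes g :: "R3 \<Rightarrow> real"
  assumes "continuous_on UNIV g" "\<And>x. norm x \<ge> B \<Longrightarrow> g x = 0"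
  shows "integrable lborel g"
proof -
  have "integrable lborel (\<lambda>x. indicator (cball 0 B) x *\<^sub>R g x)"
    by (rule borel_integrable_compact) (auto intro: continuous_on_subset[OF assms(1)])
  also have "(\<lambda>x. indicator (cball 0 B) x *\<^sub>R g x) = g"
    using assms(2) by (auto simp: indicator_def fun_eq_iff)
  finally show ?thesis .
qed

lemma continuous_borel: "continuous_on UNIV (g :: R3 \<Rightarrow> real) \<Longrightarrow> g \<in> borel_measurable borel"
  by (rule borel_measurable_continuous_onI)

lemma square_integrable_compact_support:
  fixes g :: "R3 \<Rightarrow> real"
  assumes "continuous_on UNIV g" "\<And>x. norm x \<ge> B \<Longrightarrow> g x = 0"
  shows "square_integrable lebesgue g"
proof -
  have "integrable lborel (\<lambda>x. (g x)\<^sup>2)"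
    using assms by (intro integrable_compact_support[of _ B] continuous_intros) auto
  then have "integrable lebesgue (\<lambda>x. (g x)\<^sup>2)" by (rule integrable_completion[THEN iffD2, rotated]) 
      (use continuous_borel[OF assms(1)] in measurable)
  then show ?thesis using continuous_borel[OF assms(1)]
    by (auto simp: square_integrable_def intro: measurable_completion)
qed

lemma test_function_si: "test_function \<Omega> \<phi> \<Longrightarrow> square_integrable lebesgue \<phi>"
  by (rule test_function_ball) (auto intro: square_integrable_compact_support test_function_continuous)

lemma line_derivative:
  assumes "\<phi> differentiable (at (x + t *\<^sub>R axis i 1))"
  shows "((\<lambda>t. \<phi> (x + t *\<^sub>R axis i 1)) has_real_derivative partial_deriv i \<phi> (x + t *\<^sub>R axis i 1)) (at t)"
proof -
  have 1: "(\<phi> has_derivative frechet_derivative \<phi> (at (x + t *\<^sub>R axis i 1))) (at (x + t *\<^sub>R axis i 1))"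
    using assms by (simp add: frechet_derivative_works)
  have "((\<lambda>t. x + t *\<^sub>R axis i 1) has_derivative (\<lambda>h. h *\<^sub>R axis i 1)) (at t)"
    by (auto intro!: derivative_eq_intros)
  from has_derivative_compose[OF this 1]
  have "((\<lambda>t. \<phi> (x + t *\<^sub>R axis i 1)) has_derivative (\<lambda>h. frechet_derivative \<phi> (at (x + t *\<^sub>R axis i 1)) (h *\<^sub>R axis i 1))) (at t)" .
  moreover have "frechet_derivative \<phi> (at (x + t *\<^sub>R axis i 1)) (h *\<^sub>R axis i 1) = partial_deriv i \<phi> (x + t *\<^sub>R axis i 1) * h" for h
    using linear_frechet_derivative[OF assms] by (simp add: partial_deriv_def linear_scale)
  ultimately show ?thesis by (simp add: has_field_derivative_def)
qed

text \<open>By translation invariance the difference quotients have vanishing integral.\<close>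

lemma integral_partial_deriv_zero:
  assumes diff: "\<And>x. w differentiable (at x)" and cont: "continuous_on UNIV (partial_deriv i w)"
    and supp: "\<And>x. norm x \<ge> B \<Longrightarrow> w x = 0" "\<And>x. norm x \<ge> B \<Longrightarrow> partial_deriv i w x = 0"
  shows "(LINT x|lborel. partial_deriv i w x) = 0"
proof -
  let ?e = "axis i (1::real) :: R3"
  have w_cont: "continuous_on UNIV w"
    using diff by (intro continuous_at_imp_continuous_on ballI differentiable_imp_continuous_within)
  have w_int: "integrable lborel w" by (rule integrable_compact_support[OF w_cont supp(1)])
  have w_meas [measurable]: "w \<in> borel_measurable borel" by (rule continuous_borel[OF w_cont])
  obtain M where M: "\<And>x. \<bar>partial_deriv i w x\<bar> \<le> M"
  proof -
    have cpt: "compact (partial_deriv i w ` cball 0 B)"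
      by (intro compact_continuous_image continuous_on_subset[OF cont]) auto
    then obtain M where M: "\<forall>y\<in>partial_deriv i w ` cball 0 B. norm y \<le> M"
      using compact_imp_bounded[OF cpt] unfolding bounded_iff by blast
    have "\<bar>partial_deriv i w x\<bar> \<le> \<bar>M\<bar>" for x
    proof (cases "norm x \<le> B")
      case True
      then have "\<bar>partial_deriv i w x\<bar> \<le> M" using M by simp
      then show ?thesis by linarith
    qed (simp add: supp(2))
    then show ?thesis by (rule that)
  qed
  define k :: "nat \<Rightarrow> real" where "k n = inverse (real (Suc n))" for n
  have k: "0 < k n" "k n \<le> 1" for n by (auto simp: k_def field_simps)
  have k_lim: "filterlim k (at 0) sequentially"
    using LIMSEQ_inverse_real_of_nat k(1) by (simp add: filterlim_at less_imp_neq[symmetric] k_def[abs_def])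
  define s where "s n x = (w (k n *\<^sub>R ?e + x) - w x) / k n" for n x
  have s0: "(LINT x|lborel. s n x) = 0" for n
  proof -
    have "integrable lborel (\<lambda>x. w (k n *\<^sub>R ?e + x))" "(LINT x|lborel. w (k n *\<^sub>R ?e + x)) = (LINT x|lborel. w x)"
      using integrable_distr_eq[of "(+) (k n *\<^sub>R ?e)" lborel borel w] integral_distr[of "(+) (k n *\<^sub>R ?e)" lborel borel w]
        w_int lborel_distr_plus[of "k n *\<^sub>R ?e"] by simp_all
    then show ?thesis unfolding s_def using w_int by simp
  qed
  have "(\<lambda>n. LINT x|lborel. s n x) \<longlonglongrightarrow> (LINT x|lborel. partial_deriv i w x)"
  \<comment> \<open>By the mean value theorem the quotients are bounded by a bound of the partial
    derivative; steps of length at most one keep their supports within radius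
    \<open>B + 1\<close>.\<close>
  proof (rule integral_dominated_convergence[where w="\<lambda>x. indicator (cball 0 (B + 1)) x *\<^sub>R M"])
    show "integrable lborel (\<lambda>x. indicator (cball 0 (B + 1)) x *\<^sub>R M)"
      by (rule borel_integrable_compact) auto
    show "AE x in lborel. (\<lambda>n. s n x) \<longlonglongrightarrow> partial_deriv i w x"
    proof (rule AE_I2)
      fix x :: R3
      have "((\<lambda>h. (w (x + h *\<^sub>R ?e) - w x) / h) \<longlongrightarrow> partial_deriv i w x) (at 0)"
        using line_derivative[of w x 0 i] diff[of x] by (simp add: DERIV_def)
      from filterlim_compose[OF this k_lim] show "(\<lambda>n. s n x) \<longlonglongrightarrow> partial_deriv i w x"
        by (simp add: s_def add.commute)
    qed
    show "AE x in lborel. norm (s n x) \<le> indicator (cball 0 (B + 1)) x *\<^sub>R M" for n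
    proof (rule AE_I2)
      fix x :: R3
      show "norm (s n x) \<le> indicator (cball 0 (B + 1)) x *\<^sub>R M"
      proof (cases "norm x \<le> B + 1")
        case True
        obtain \<theta> where "w (x + k n *\<^sub>R ?e) - w (x + 0 *\<^sub>R ?e) = (k n - 0) * partial_deriv i w (x + \<theta> *\<^sub>R ?e)"
          using MVT2[of 0 "k n" "\<lambda>t. w (x + t *\<^sub>R ?e)" "\<lambda>t. partial_deriv i w (x + t *\<^sub>R ?e)"] k(1)[of n]
            line_derivative[OF diff] by blast
        then have "s n x = partial_deriv i w (x + \<theta> *\<^sub>R ?e)" using k(1)[of n] by (simp add: s_def add.commute)
        then show ?thesis using M True by simp
      next
        case False
        have "norm x \<le> norm (k n *\<^sub>R ?e + x) + norm (k n *\<^sub>R ?e)"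
          using norm_triangle_ineq4[of "k n *\<^sub>R ?e + x" "k n *\<^sub>R ?e"] by simp
        then have "norm (k n *\<^sub>R ?e + x) \<ge> B" using False k[of n] by (simp add: norm_axis_1)
        then have "s n x = 0" using supp(1) False by (simp add: s_def)
        then show ?thesis using False by simp
      qed
    qed
    show "s n \<in> borel_measurable lborel" for n unfolding s_def[abs_def] by measurable
    show "partial_deriv i w \<in> borel_measurable lborel" using continuous_borel[OF cont] by simp
  qed
  then show ?thesis unfolding s0 by (simp add: LIMSEQ_const_iff)
qed

lemma integration_by_parts:
  assumes "test_function UNIV \<phi>" "test_function UNIV \<psi>"
  shows "(LINT x|lebesgue. partial_deriv i \<phi> x * \<psi> x) = - (LINT x|lebesgue. \<phi> x * partial_deriv i \<psi> x)"
proof -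
  obtain B where B: "\<And>x. norm x \<ge> B \<Longrightarrow> \<phi> x = 0" "\<And>x i. norm x \<ge> B \<Longrightarrow> partial_deriv i \<phi> x = 0"
    using test_function_ball[OF assms(1)] by metis
  note cont = test_function_continuous[OF assms(1)] test_function_continuous[OF assms(2)]
    test_function_continuous[OF test_function_partial_deriv[OF assms(1), of i]]
    test_function_continuous[OF test_function_partial_deriv[OF assms(2), of i]]
  have D: "((\<lambda>x. \<phi> x * \<psi> x) has_derivative
      (\<lambda>h. \<phi> x * frechet_derivative \<psi> (at x) h + frechet_derivative \<phi> (at x) h * \<psi> x)) (at x)" for x
    using assms by (intro has_derivative_mult) (auto simp: frechet_derivative_works[symmetric] test_function_differentiable)
  have eq: "partial_deriv i (\<lambda>x. \<phi> x * \<psi> x) = (\<lambda>x. \<phi> x * partial_deriv i \<psi> x + partial_deriv i \<phi> x * \<psi> x)"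
    using partial_deriv_eq[OF D] by (auto simp: partial_deriv_def)
  have 0: "(LINT x|lborel. partial_deriv i (\<lambda>x. \<phi> x * \<psi> x) x) = 0"
  proof (rule integral_partial_deriv_zero[where B=B])
    show "(\<lambda>x. \<phi> x * \<psi> x) differentiable (at x)" for x using D by (auto simp: differentiable_def)
    show "continuous_on UNIV (partial_deriv i (\<lambda>x. \<phi> x * \<psi> x))"
      unfolding eq by (intro continuous_intros cont)
  qed (auto simp: B eq)
  have int: "integrable lborel (\<lambda>x. \<phi> x * partial_deriv i \<psi> x)" "integrable lborel (\<lambda>x. partial_deriv i \<phi> x * \<psi> x)"
    by (auto intro!: integrable_compact_support[where B=B] continuous_intros cont simp: B)
  have "(LINT x|lborel. \<phi> x * partial_deriv i \<psi> x) + (LINT x|lborel. partial_deriv i \<phi> x * \<psi> x) = 0"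
    using 0 int unfolding eq by simp
  moreover have "(LINT x|lebesgue. g x) = (LINT x|lborel. g x)" if "continuous_on UNIV g" for g :: "R3 \<Rightarrow> real"
    using continuous_borel[OF that] by (intro integral_completion) simp
  ultimately show ?thesis by (simp add: continuous_on_mult cont)
qed

definition h1_of :: "(R3 \<Rightarrow> real) \<Rightarrow> h1" where
  "h1_of \<phi> = Abs_h1 (mk_l2 \<phi>, \<chi> i. mk_l2 (partial_deriv i \<phi>))"

lemma h1_of:
  assumes "test_function \<Omega> \<phi>"
  shows "h1_l2 (h1_of \<phi>) = mk_l2 \<phi>" "grad (h1_of \<phi>) $ i = mk_l2 (partial_deriv i \<phi>)" "h1_of \<phi> \<in> H10 \<Omega>"
proof -
  have \<phi>: "test_function UNIV \<phi>" by (rule test_function_UNIV[OF assms])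
  have "inner (mk_l2 (partial_deriv i \<phi>)) (mk_l2 \<psi>) = - inner (mk_l2 \<phi>) (mk_l2 (partial_deriv i \<psi>))"
    if "test_function UNIV \<psi>" for i \<psi>
    using integration_by_parts[OF \<phi> that, of i] that \<phi>
    by (simp add: inner_mk_l2 test_function_si[of UNIV] test_function_partial_deriv)
  then have Rep: "Rep_h1 (h1_of \<phi>) = (mk_l2 \<phi>, \<chi> i. mk_l2 (partial_deriv i \<phi>))"
    unfolding h1_of_def by (intro Abs_h1_inverse) auto
  then show "h1_l2 (h1_of \<phi>) = mk_l2 \<phi>" "grad (h1_of \<phi>) $ i = mk_l2 (partial_deriv i \<phi>)"
    by (simp_all add: h1_l2.rep_eq grad.rep_eq)
  then show "h1_of \<phi> \<in> H10 \<Omega>"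
    unfolding H10_def by (intro subsetD[OF closure_subset]) (use assms in auto)
qed

text \<open>At this point \<open>u\<close> is not known to have the classical gradient of
  \<open>\<phi>\<close>, which would require injectivity of \<open>h1_l2\<close>. Testing its weak
  gradient with \<open>partial_deriv i \<phi>\<close> suffices for the inequality.\<close>

lemma norm_partial_deriv_le_grad:
  assumes "test_function UNIV \<phi>" "h1_l2 u = mk_l2 \<phi>"
  shows "norm (mk_l2 (partial_deriv i \<phi>)) \<le> norm (grad u $ i)"
proof -
  have d: "test_function UNIV (partial_deriv i \<phi>)" by (rule test_function_partial_deriv[OF assms(1)])
  have "inner (grad u $ i) (mk_l2 (partial_deriv i \<phi>)) = - inner (h1_l2 u) (mk_l2 (partial_deriv i (partial_deriv i \<phi>)))"
    using Rep_h1[of u] d by (auto simp: h1_l2.rep_eq grad.rep_eq case_prod_unfold)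
  also have "\<dots> = inner (mk_l2 (partial_deriv i \<phi>)) (mk_l2 (partial_deriv i \<phi>))"
    using integration_by_parts[OF assms(1) d, of i] assms d
    by (simp add: inner_mk_l2 test_function_si[of UNIV] test_function_partial_deriv)
  finally have "(norm (mk_l2 (partial_deriv i \<phi>)))\<^sup>2 = inner (grad u $ i) (mk_l2 (partial_deriv i \<phi>))"
    by (simp add: power2_norm_eq_inner)
  also have "\<dots> \<le> norm (grad u $ i) * norm (mk_l2 (partial_deriv i \<phi>))" by (rule norm_cauchy_schwarz)
  finally show ?thesis by (cases "norm (mk_l2 (partial_deriv i \<phi>)) = 0") (auto simp: power2_eq_square)
qed

lemma subspace_closure:
  fixes S :: "'a::real_normed_vector set"
  assumes "subspace S" shows "subspace (closure S)"
  unfolding subspace_def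
proof (intro conjI ballI allI)
  show "0 \<in> closure S" using subspace_0[OF assms] closure_subset by blast
  fix x assume "x \<in> closure S"
  then obtain f where f: "\<And>n. f n \<in> S" "f \<longlonglongrightarrow> x" unfolding closure_sequential by blast
  show "c *\<^sub>R x \<in> closure S" for c
    unfolding closure_sequential
    by (rule exI[of _ "\<lambda>n. c *\<^sub>R f n"]) (auto intro!: tendsto_intros f subspace_scale[OF assms])
  fix y assume "y \<in> closure S"
  then obtain g where g: "\<And>n. g n \<in> S" "g \<longlonglongrightarrow> y" unfolding closure_sequential by blast
  show "x + y \<in> closure S"
    unfolding closure_sequential
    by (rule exI[of _ "\<lambda>n. f n + g n"]) (auto intro!: tendsto_intros f g subspace_add[OF assms])
qed

lemma subspace_H10: "subspace (H10 \<Omega>)"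
  unfolding H10_def
proof (intro subspace_closure)
  let ?S = "{u. \<exists>\<phi>. test_function \<Omega> \<phi> \<and> h1_l2 u = mk_l2 \<phi>}"
  have comb: "c *\<^sub>R u + d *\<^sub>R v \<in> ?S" if uv: "u \<in> ?S" "v \<in> ?S" for u v c d
  proof -
    obtain \<phi> \<psi> where t: "test_function \<Omega> \<phi>" "h1_l2 u = mk_l2 \<phi>" "test_function \<Omega> \<psi>" "h1_l2 v = mk_l2 \<psi>"
      using uv by blast
    have "h1_l2 (c *\<^sub>R u + d *\<^sub>R v) = mk_l2 (\<lambda>x. c * \<phi> x + d * \<psi> x)"
      using t by (simp add: h1_l2_linear mk_l2_scale mk_l2_add test_function_si[of \<Omega>] square_integrable_scale)
    then show ?thesis using test_function_combination[OF t(1,3)] by blast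
  qed
  have "h1_l2 0 = 0" using linear_0[OF bounded_linear.linear[OF bounded_linear_h1_l2]] .
  then have 0: "0 \<in> ?S" using test_function_zero mk_l2_zero by force
  show "subspace ?S"
    unfolding subspace_def
  proof (intro conjI ballI allI 0)
    fix x y and c :: real assume "x \<in> ?S" "y \<in> ?S"
    from comb[OF this, of 1 1] show "x + y \<in> ?S" by (simp only: scaleR_one)
  next
    fix x and c :: real assume "x \<in> ?S"
    from comb[OF this 0, of c 0] show "c *\<^sub>R x \<in> ?S" by (simp only: scaleR_zero_left add_0_right)
  qed
qed

lemma closed_H10: "closed (H10 \<Omega>)" by (simp add: H10_def)

lemma mk_l2_test_L2: assumes "test_function \<Omega> \<phi>" shows "mk_l2 \<phi> \<in> L2 \<Omega>"
proof -
  have "\<phi> x = 0" if "x \<notin> \<Omega>" for x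
    using assms that closure_subset[of "{x. \<phi> x \<noteq> 0}"] by (auto simp: test_function_def)
  then show ?thesis unfolding L2_def using rep_mk_l2[OF test_function_si[OF assms]]
    by (auto elim!: eventually_mono)
qed

lemma H10_L2:
  assumes "\<Omega> \<in> sets lebesgue" "u \<in> H10 \<Omega>" shows "h1_l2 u \<in> L2 \<Omega>"
proof -
  have "closed (h1_l2 -` L2 \<Omega>)"
    by (intro closed_vimage closed_L2 assms linear_continuous_on bounded_linear_h1_l2)
  then have "H10 \<Omega> \<subseteq> h1_l2 -` L2 \<Omega>"
    unfolding H10_def by (intro closure_minimal) (auto simp: mk_l2_test_L2)
  then show ?thesis using assms by auto
qed

text \<open>Injectivity identifies an element with test function \<open>\<phi>\<close> as
  \<open>h1_of \<phi>\<close>, whose gradient is classical and vanishes outside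
  \<open>\<Omega>\<close>; the property passes to the closure.\<close>

lemma H10_grad_L2:
  assumes \<Omega>: "\<Omega> \<in> sets lebesgue" and inj: "inj_on h1_l2 (H10 \<Omega>)" and u: "u \<in> H10 \<Omega>"
  shows "grad u $ i \<in> L2 \<Omega>"
proof -
  have cl: "closed ((\<lambda>u. grad u $ i) -` L2 \<Omega>)"
    by (intro closed_vimage closed_L2 \<Omega> linear_continuous_on bounded_linear_grad)
  have "grad u $ i \<in> L2 \<Omega>" if t: "test_function \<Omega> \<phi>" "h1_l2 u = mk_l2 \<phi>" for u \<phi>
  proof -
    have "u \<in> H10 \<Omega>" unfolding H10_def by (rule subsetD[OF closure_subset]) (use t in auto)
    then have "u = h1_of \<phi>" by (intro inj_onD[OF inj] h1_of[OF t(1)]) (simp add: h1_of(1)[OF t(1)] t(2))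
    then show ?thesis using h1_of(2)[OF t(1)] mk_l2_test_L2[OF test_function_partial_deriv[OF t(1)]] by simp
  qed
  then have "H10 \<Omega> \<subseteq> (\<lambda>u. grad u $ i) -` L2 \<Omega>"
    unfolding H10_def by (intro closure_minimal cl) auto
  then show ?thesis using u by auto
qed

section \<open>The Sobolev inequality\<close>

definition esqrt :: "ennreal \<Rightarrow> ennreal" where
  "esqrt a = (if a = \<infinity> then \<infinity> else ennreal (sqrt (enn2real a)))"

lemma esqrt_square: "(esqrt a)\<^sup>2 = a"
  by (cases a rule: ennreal_cases) (auto simp: esqrt_def ennreal_power power_top_ennreal)

lemma esqrt_of_square: "esqrt (a\<^sup>2) = a"
  by (cases a rule: ennreal_cases) (auto simp: esqrt_def ennreal_power power_top_ennreal)

lemma le_esqrt: assumes "a\<^sup>2 \<le> b" shows "a \<le> esqrt b"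
proof (cases b rule: ennreal_cases)
  case (real r)
  then have "a\<^sup>2 < top" using assms by (auto intro: le_less_trans)
  then have "a \<noteq> top" by (auto simp: power_top_ennreal)
  then obtain s where s: "a = ennreal s" "s \<ge> 0" by (cases a rule: ennreal_cases) auto
  then have "s\<^sup>2 \<le> r" using assms real by (simp add: ennreal_power)
  then have "s \<le> sqrt r" by (rule real_le_rsqrt)
  then show ?thesis using s real by (simp add: esqrt_def)
qed (simp add: esqrt_def)

lemma esqrt_measurable [measurable (raw)]:
  assumes [measurable]: "f \<in> borel_measurable M"
  shows "(\<lambda>x. esqrt (f x)) \<in> borel_measurable M"
proof -
  have "f -` {\<infinity>} \<inter> space M \<in> sets M" by (rule measurable_sets[OF assms]) simp
  then have [measurable]: "{x \<in> space M. f x = \<infinity>} \<in> sets M" by (simp add: vimage_def Int_def conj_commute)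
  show ?thesis unfolding esqrt_def by measurable
qed

text \<open>Cauchy-Schwarz twice: in \<open>z\<close> for \<open>g1\<close> and \<open>g2\<close>,
  which leaves the product of a function of \<open>y\<close> and a function of \<open>x\<close>, and
  then in the plane of \<open>(x, y)\<close> against \<open>g3\<close>.\<close>

lemma loomis_whitney:
  fixes g1 g2 g3 :: "real \<times> real \<Rightarrow> ennreal"
  assumes [measurable]: "g1 \<in> borel_measurable borel" "g2 \<in> borel_measurable borel" "g3 \<in> borel_measurable borel"
  shows "(\<integral>\<^sup>+x. \<integral>\<^sup>+y. \<integral>\<^sup>+z. g1 (y, z) * g2 (x, z) * g3 (x, y) \<partial>lborel \<partial>lborel \<partial>lborel)\<^sup>2 \<le>
    (\<integral>\<^sup>+y. \<integral>\<^sup>+z. (g1 (y, z))\<^sup>2 \<partial>lborel \<partial>lborel) * (\<integral>\<^sup>+x. \<integral>\<^sup>+z. (g2 (x, z))\<^sup>2 \<partial>lborel \<partial>lborel) *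
    (\<integral>\<^sup>+x. \<integral>\<^sup>+y. (g3 (x, y))\<^sup>2 \<partial>lborel \<partial>lborel)"
proof -
  have [measurable]: "g1 \<in> borel_measurable (lborel \<Otimes>\<^sub>M lborel)" "g2 \<in> borel_measurable (lborel \<Otimes>\<^sub>M lborel)"
    "g3 \<in> borel_measurable (lborel \<Otimes>\<^sub>M lborel)"
    by (simp_all add: lborel_prod)
  define A where "A y = esqrt (\<integral>\<^sup>+z. (g1 (y, z))\<^sup>2 \<partial>lborel)" for y
  define B where "B x = esqrt (\<integral>\<^sup>+z. (g2 (x, z))\<^sup>2 \<partial>lborel)" for x
  have [measurable]: "A \<in> borel_measurable borel" "B \<in> borel_measurable borel"
    unfolding A_def[abs_def] B_def[abs_def] by measurable
  have A2: "(A y)\<^sup>2 = (\<integral>\<^sup>+z. (g1 (y, z))\<^sup>2 \<partial>lborel)" and B2: "(B x)\<^sup>2 = (\<integral>\<^sup>+z. (g2 (x, z))\<^sup>2 \<partial>lborel)" for x y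
    by (simp_all add: A_def B_def esqrt_square)
  have 1: "(\<integral>\<^sup>+z. g1 (y, z) * g2 (x, z) * g3 (x, y) \<partial>lborel) \<le> g3 (x, y) * (A y * B x)" for x y
  proof -
    have "(\<integral>\<^sup>+z. g1 (y, z) * g2 (x, z) \<partial>lborel)\<^sup>2 \<le> (A y * B x)\<^sup>2"
      unfolding power_mult_distrib A2 B2 by (rule Cauchy_Schwarz_nn_integral) measurable
    then have "(\<integral>\<^sup>+z. g1 (y, z) * g2 (x, z) \<partial>lborel) \<le> esqrt ((A y * B x)\<^sup>2)" by (rule le_esqrt)
    also have "\<dots> = A y * B x" by (rule esqrt_of_square)
    finally have "(\<integral>\<^sup>+z. g1 (y, z) * g2 (x, z) \<partial>lborel) * g3 (x, y) \<le> (A y * B x) * g3 (x, y)"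
      by (rule mult_right_mono) simp
    moreover have "(\<integral>\<^sup>+z. g1 (y, z) * g2 (x, z) * g3 (x, y) \<partial>lborel) = (\<integral>\<^sup>+z. g1 (y, z) * g2 (x, z) \<partial>lborel) * g3 (x, y)"
      by (rule nn_integral_multc) measurable
    ultimately show ?thesis by (simp add: mult.commute)
  qed
  have "(\<integral>\<^sup>+x. \<integral>\<^sup>+y. \<integral>\<^sup>+z. g1 (y, z) * g2 (x, z) * g3 (x, y) \<partial>lborel \<partial>lborel \<partial>lborel) \<le>
      (\<integral>\<^sup>+x. \<integral>\<^sup>+y. g3 (x, y) * (A y * B x) \<partial>lborel \<partial>lborel)"
    by (intro nn_integral_mono 1)
  also have "\<dots> = (\<integral>\<^sup>+p. g3 p * (A (snd p) * B (fst p)) \<partial>(lborel \<Otimes>\<^sub>M lborel))"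
    by (subst lborel.nn_integral_fst[symmetric]) (auto simp: case_prod_unfold)
  finally have "(\<integral>\<^sup>+x. \<integral>\<^sup>+y. \<integral>\<^sup>+z. g1 (y, z) * g2 (x, z) * g3 (x, y) \<partial>lborel \<partial>lborel \<partial>lborel)\<^sup>2 \<le>
      (\<integral>\<^sup>+p. g3 p * (A (snd p) * B (fst p)) \<partial>(lborel \<Otimes>\<^sub>M lborel))\<^sup>2"
    by (rule power_mono) simp
  also have "\<dots> \<le> (\<integral>\<^sup>+p. (g3 p)\<^sup>2 \<partial>(lborel \<Otimes>\<^sub>M lborel)) * (\<integral>\<^sup>+p. (A (snd p) * B (fst p))\<^sup>2 \<partial>(lborel \<Otimes>\<^sub>M lborel))"
    by (rule Cauchy_Schwarz_nn_integral) measurable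
  also have "(\<integral>\<^sup>+p. (g3 p)\<^sup>2 \<partial>(lborel \<Otimes>\<^sub>M lborel)) = (\<integral>\<^sup>+x. \<integral>\<^sup>+y. (g3 (x, y))\<^sup>2 \<partial>lborel \<partial>lborel)"
    by (subst lborel.nn_integral_fst[symmetric]) auto
  also have "(\<integral>\<^sup>+p. (A (snd p) * B (fst p))\<^sup>2 \<partial>(lborel \<Otimes>\<^sub>M lborel)) = (\<integral>\<^sup>+x. \<integral>\<^sup>+y. (A y)\<^sup>2 * (B x)\<^sup>2 \<partial>lborel \<partial>lborel)"
    by (subst lborel.nn_integral_fst[symmetric]) (auto simp: power_mult_distrib)
  also have "\<dots> = (\<integral>\<^sup>+y. (A y)\<^sup>2 \<partial>lborel) * (\<integral>\<^sup>+x. (B x)\<^sup>2 \<partial>lborel)"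
    by (simp add: nn_integral_multc nn_integral_cmult)
  finally show ?thesis by (simp add: A2 B2 mult_ac)
qed

definition mk3 :: "real \<times> real \<times> real \<Rightarrow> R3" where
  "mk3 p = (\<chi> i. if i = 1 then fst p else if i = 2 then fst (snd p) else snd (snd p))"

lemma mk3_nth [simp]: "mk3 (x, y, z) $ 1 = x" "mk3 (x, y, z) $ 2 = y" "mk3 (x, y, z) $ 3 = z"
  by (simp_all add: mk3_def)

lemma mk3_continuous: "continuous_on UNIV mk3"
proof -
  have "continuous_on UNIV (\<lambda>p :: real \<times> real \<times> real. if i = 1 then fst p else if i = 2 then fst (snd p) else snd (snd p))" for i :: 3
    by (cases "i = 1"; cases "i = 2") (auto intro!: continuous_intros)
  then show ?thesis unfolding mk3_def[abs_def] by (intro continuous_on_vec_lambda)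
qed

lemma mk3_measurable [measurable]: "mk3 \<in> borel_measurable borel"
    "mk3 \<in> borel_measurable (borel \<Otimes>\<^sub>M (borel \<Otimes>\<^sub>M borel))"
  using borel_measurable_continuous_onI[OF mk3_continuous] by (simp_all add: borel_prod)

lemma Basis_R3: "(Basis :: R3 set) = {axis 1 1, axis 2 1, axis 3 1}"
  by (auto simp: Basis_vec_def UNIV_3)

text \<open>\<open>mk3\<close> pulls boxes back to boxes of the same volume. On the product type the
  measure can be integrated coordinate by coordinate.\<close>

lemma lborel_R3: "(lborel :: R3 measure) = distr lborel borel mk3"
proof (rule lborel_eqI)
  fix l u :: R3
  assume le: "\<And>b. b \<in> Basis \<Longrightarrow> l \<bullet> b \<le> u \<bullet> b"
  have le': "l $ i \<le> u $ i" for i using le[of "axis i 1"] by (simp add: inner_axis axis_in_Basis_iff)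
  have pre: "mk3 -` box l u = box (l $ 1, l $ 2, l $ 3) (u $ 1, u $ 2, u $ 3)"
    by (auto simp: box_def Basis_prod_def Basis_R3 inner_axis)
  have "emeasure (distr lborel borel mk3) (box l u) = emeasure lborel (box (l $ 1, l $ 2, l $ 3) (u $ 1, u $ 2, u $ 3))"
    by (subst emeasure_distr) (simp_all add: pre)
  also have "\<dots> = (\<Prod>b\<in>Basis. ((u $ 1, u $ 2, u $ 3) - (l $ 1, l $ 2, l $ 3)) \<bullet> b)"
    by (rule emeasure_lborel_box) (use le' in \<open>auto simp: Basis_prod_def\<close>)
  also have "(\<Prod>b\<in>Basis. ((u $ 1, u $ 2, u $ 3) - (l $ 1, l $ 2, l $ 3)) \<bullet> b) = (u $ 1 - l $ 1) * (u $ 2 - l $ 2) * (u $ 3 - l $ 3)"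
    by (simp add: Basis_prod_def image_Un mult.assoc)
  also have "\<dots> = (\<Prod>b\<in>Basis. (u - l) \<bullet> b)"
    by (simp add: Basis_R3 axis_eq_axis inner_axis inner_diff_left)
  finally show "emeasure (distr lborel borel mk3) (box l u) = (\<Prod>b\<in>Basis. (u - l) \<bullet> b)" .
qed simp

lemma nn_integral_R3:
  fixes f :: "R3 \<Rightarrow> ennreal"
  assumes [measurable]: "f \<in> borel_measurable borel"
  shows "(\<integral>\<^sup>+p. f p \<partial>lborel) = (\<integral>\<^sup>+x. \<integral>\<^sup>+y. \<integral>\<^sup>+z. f (mk3 (x, y, z)) \<partial>lborel \<partial>lborel \<partial>lborel)"
proof -
  have "(\<integral>\<^sup>+p. f p \<partial>lborel) = (\<integral>\<^sup>+p. f (mk3 p) \<partial>lborel)"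
    by (subst lborel_R3) (simp add: nn_integral_distr)
  also have "\<dots> = (\<integral>\<^sup>+p. f (mk3 p) \<partial>(lborel \<Otimes>\<^sub>M (lborel \<Otimes>\<^sub>M lborel)))"
    by (simp add: lborel_prod)
  also have "\<dots> = (\<integral>\<^sup>+x. \<integral>\<^sup>+q. f (mk3 (x, q)) \<partial>(lborel \<Otimes>\<^sub>M lborel) \<partial>lborel)"
    unfolding lborel_prod[where 'a = real and 'b = real]
    by (rule lborel.nn_integral_fst[symmetric]) (simp add: lborel_prod)
  also have "\<dots> = (\<integral>\<^sup>+x. \<integral>\<^sup>+y. \<integral>\<^sup>+z. f (mk3 (x, y, z)) \<partial>lborel \<partial>lborel \<partial>lborel)"
    by (intro nn_integral_cong lborel.nn_integral_fst[symmetric]) measurable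
  finally show ?thesis .
qed

lemma abs_le_integral_abs_deriv:
  fixes p :: "real \<Rightarrow> real"
  assumes deriv: "\<And>t. (p has_real_derivative p' t) (at t)" and cont: "continuous_on UNIV p'"
    and zero: "a \<le> s" "p a = 0"
  shows "ennreal \<bar>p s\<bar> \<le> (\<integral>\<^sup>+t. ennreal \<bar>p' t\<bar> \<partial>lborel)"
proof -
  have [measurable]: "p' \<in> borel_measurable borel" by (rule borel_measurable_continuous_onI[OF cont])
  have int: "integrable lborel (\<lambda>x. indicator {a..s} x *\<^sub>R p' x)"
    by (rule borel_integrable_compact) (auto intro: continuous_on_subset[OF cont])
  have "(LINT x|lborel. indicator {a..s} x *\<^sub>R p' x) = p s - p a"
    by (rule integral_FTC_Icc[OF zero(1)])
      (use deriv in \<open>auto intro: continuous_on_subset[OF cont] has_field_derivative_at_within simp: has_real_derivative_iff_has_vector_derivative[symmetric]\<close>)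
  then have "ennreal \<bar>p s\<bar> = ennreal (norm (LINT x|lborel. indicator {a..s} x *\<^sub>R p' x))" using zero by simp
  also have "\<dots> \<le> (\<integral>\<^sup>+x. ennreal (norm (indicator {a..s} x *\<^sub>R p' x)) \<partial>lborel)"
    by (rule integral_norm_bound_ennreal[OF int])
  also have "\<dots> \<le> (\<integral>\<^sup>+t. ennreal \<bar>p' t\<bar> \<partial>lborel)"
    by (intro nn_integral_mono ennreal_leI) (auto simp: indicator_def)
  finally show ?thesis .
qed

lemma test_function_line_bound:
  assumes u: "test_function UNIV u"
  shows "ennreal ((u (x + s *\<^sub>R axis i 1)) ^ 4) \<le>
    (\<integral>\<^sup>+t. ennreal (4 * \<bar>u (x + t *\<^sub>R axis i 1)\<bar> ^ 3 * \<bar>partial_deriv i u (x + t *\<^sub>R axis i 1)\<bar>) \<partial>lborel)"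
proof -
  obtain B where B: "B > 0" "\<And>x. norm x \<ge> B \<Longrightarrow> u x = 0" using test_function_ball[OF u] by metis
  define p where "p t = (u (x + t *\<^sub>R axis i 1)) ^ 4" for t
  define p' where "p' t = 4 * (u (x + t *\<^sub>R axis i 1)) ^ 3 * partial_deriv i u (x + t *\<^sub>R axis i 1)" for t
  have deriv: "(p has_real_derivative p' t) (at t)" for t
    unfolding p_def[abs_def] p'_def
    using DERIV_power[OF line_derivative[where x = x and t = t and i = i, OF test_function_differentiable[OF u]], where n = 4] by (simp add: mult_ac)
  have cont: "continuous_on UNIV p'"
    unfolding p'_def[abs_def]
    by (intro continuous_intros continuous_on_compose2[OF test_function_continuous[OF u]]
        continuous_on_compose2[OF test_function_continuous[OF test_function_partial_deriv[OF u]]]) auto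
  \<comment> \<open>To the left of \<open>s\<close> and of the support: at \<open>a\<close> the
    point on the line has norm at least \<open>B\<close>.\<close>
  define a where "a = min s (- (B + norm x))"
  have "norm (a *\<^sub>R axis i (1::real) :: R3) \<le> norm (x + a *\<^sub>R axis i 1) + norm x"
    using norm_triangle_ineq4[of "x + a *\<^sub>R axis i 1" x] by simp
  then have "norm (x + a *\<^sub>R axis i 1) \<ge> B" using B(1) by (auto simp: a_def norm_axis_1)
  then have "p a = 0" using B(2) by (simp add: p_def)
  from abs_le_integral_abs_deriv[OF deriv cont _ this, of s]
  show ?thesis by (simp add: a_def p_def p'_def abs_mult power_abs)
qed

lemma nn_integral_lebesgue_square:
  assumes "test_function UNIV \<phi>"
  shows "(\<integral>\<^sup>+x. ennreal ((\<phi> x)\<^sup>2) \<partial>lborel) = ennreal ((norm (mk_l2 \<phi>))\<^sup>2)"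
  using norm_mk_l2_nn_integral[OF test_function_si[OF assms]] by (simp add: nn_integral_completion)

text \<open>The Loomis--Whitney inequality is applied to \<open>u\<^sup>2\<close>, whose square is bounded on a coordinate line
  by the integral of \<open>\<bar>\<partial>\<^sub>i (u\<^sup>4)\<bar> = 4 \<bar>u\<bar>\<^sup>3 \<bar>\<partial>\<^sub>i u\<bar>\<close> along it; by Cauchy--Schwarz the integral of this
  over space involves \<open>\<integral> u\<^sup>6\<close> again, which cancels.\<close>

lemma sobolev_test_function:
  assumes u: "test_function UNIV u"
  shows "(LINT x|lborel. (u x) ^ 6) \<le> 4096 * ((norm (mk_l2 (partial_deriv 1 u)))\<^sup>2 *
    (norm (mk_l2 (partial_deriv 2 u)))\<^sup>2 * (norm (mk_l2 (partial_deriv 3 u)))\<^sup>2)"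
proof -
  note uc = test_function_continuous[OF u] and dc = test_function_continuous[OF test_function_partial_deriv[OF u]]
  have [measurable]: "u \<in> borel_measurable borel" "partial_deriv i u \<in> borel_measurable borel" for i
    by (rule continuous_borel[OF uc], rule continuous_borel[OF dc])
  obtain B where B: "B > 0" "\<And>x. norm x \<ge> B \<Longrightarrow> u x = 0" using test_function_ball[OF u] by metis
  have u6_int: "integrable lborel (\<lambda>x. (u x) ^ 6)"
    by (rule integrable_compact_support[of _ B]) (auto intro!: continuous_intros uc simp: B)
  \<comment> \<open>Finite because of compact support, which later permits cancelling
    \<open>I ^ 3\<close>.\<close>
  define I where "I = (LINT x|lborel. (u x) ^ 6)"
  have I0: "I \<ge> 0" unfolding I_def by (rule integral_nonneg_AE) auto
  have I_eq: "(\<integral>\<^sup>+x. ennreal ((u x) ^ 6) \<partial>lborel) = ennreal I"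
    unfolding I_def by (rule nn_integral_eq_integral[OF u6_int]) simp
  define q where "q i x = 4 * \<bar>u x\<bar> ^ 3 * \<bar>partial_deriv i u x\<bar>" for i x
  have q_meas [measurable]: "q i \<in> borel_measurable borel" for i unfolding q_def[abs_def] by measurable
  define d where "d i = norm (mk_l2 (partial_deriv i u))" for i
  \<comment> \<open>Cauchy-Schwarz separates \<open>4 * \<bar>u x\<bar> ^ 3\<close>, whose square
    integrates to \<open>16 * I\<close>, from the partial derivative.\<close>
  have q_int: "(\<integral>\<^sup>+x. ennreal (q i x) \<partial>lborel)\<^sup>2 \<le> ennreal (16 * I * (d i)\<^sup>2)" for i
  proof -
    have "(\<integral>\<^sup>+x. ennreal (q i x) \<partial>lborel)\<^sup>2 = (\<integral>\<^sup>+x. ennreal (4 * \<bar>u x\<bar> ^ 3) * ennreal \<bar>partial_deriv i u x\<bar> \<partial>lborel)\<^sup>2"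
      by (simp add: q_def ennreal_mult)
    also have "\<dots> \<le> (\<integral>\<^sup>+x. (ennreal (4 * \<bar>u x\<bar> ^ 3))\<^sup>2 \<partial>lborel) * (\<integral>\<^sup>+x. (ennreal \<bar>partial_deriv i u x\<bar>)\<^sup>2 \<partial>lborel)"
      by (rule Cauchy_Schwarz_nn_integral) measurable
    also have "(\<integral>\<^sup>+x. (ennreal (4 * \<bar>u x\<bar> ^ 3))\<^sup>2 \<partial>lborel) = (\<integral>\<^sup>+x. ennreal 16 * ennreal ((u x) ^ 6) \<partial>lborel)"
      by (intro nn_integral_cong) (simp add: ennreal_power ennreal_mult[symmetric] power_mult_distrib
          power_mult[symmetric] power_even_abs del: ennreal_numeral)
    also have "\<dots> = ennreal 16 * ennreal I" by (simp add: nn_integral_cmult I_eq del: ennreal_numeral)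
    also have "(\<integral>\<^sup>+x. (ennreal \<bar>partial_deriv i u x\<bar>)\<^sup>2 \<partial>lborel) = ennreal ((d i)\<^sup>2)"
      using nn_integral_lebesgue_square[OF test_function_partial_deriv[OF u]]
      by (simp add: d_def ennreal_power)
    finally show ?thesis using I0 by (simp add: ennreal_mult[symmetric] mult.assoc del: ennreal_numeral)
  qed
  \<comment> \<open>Square roots of the line integrals: each dominates the square of
    \<open>u\<close> and depends only on the two coordinates that are not integrated.\<close>
  define g1 where "g1 p = esqrt (\<integral>\<^sup>+x. ennreal (q 1 (mk3 (x, p))) \<partial>lborel)" for p
  define g2 where "g2 p = esqrt (\<integral>\<^sup>+y. ennreal (q 2 (mk3 (fst p, y, snd p))) \<partial>lborel)" for p
  define g3 where "g3 p = esqrt (\<integral>\<^sup>+z. ennreal (q 3 (mk3 (fst p, snd p, z))) \<partial>lborel)" for p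
  have g_meas [measurable]: "g1 \<in> borel_measurable borel" "g2 \<in> borel_measurable borel" "g3 \<in> borel_measurable borel"
  proof -
    have "(\<lambda>(p, x). ennreal (q 1 (mk3 (x, p)))) \<in> borel_measurable ((borel \<Otimes>\<^sub>M borel) \<Otimes>\<^sub>M lborel)"
      "(\<lambda>(p, y). ennreal (q 2 (mk3 (fst p, y, snd p)))) \<in> borel_measurable ((borel \<Otimes>\<^sub>M borel) \<Otimes>\<^sub>M lborel)"
      "(\<lambda>(p, z). ennreal (q 3 (mk3 (fst p, snd p, z)))) \<in> borel_measurable ((borel \<Otimes>\<^sub>M borel) \<Otimes>\<^sub>M lborel)"
      by measurable
    from this[THEN lborel.borel_measurable_nn_integral]
    show "g1 \<in> borel_measurable borel" "g2 \<in> borel_measurable borel" "g3 \<in> borel_measurable borel"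
      unfolding g1_def[abs_def] g2_def[abs_def] g3_def[abs_def] by (intro esqrt_measurable; simp add: borel_prod)+
  qed
  have line: "mk3 (x, y, z) = mk3 (0, y, z) + x *\<^sub>R axis 1 1" "mk3 (x, y, z) = mk3 (x, 0, z) + y *\<^sub>R axis 2 1"
    "mk3 (x, y, z) = mk3 (x, y, 0) + z *\<^sub>R axis 3 1" for x y z
    by (simp_all add: vec_eq_iff forall_3 axis_def)
  have u2: "ennreal ((u (mk3 (x, y, z)))\<^sup>2) \<le> g1 (y, z)" "ennreal ((u (mk3 (x, y, z)))\<^sup>2) \<le> g2 (x, z)"
    "ennreal ((u (mk3 (x, y, z)))\<^sup>2) \<le> g3 (x, y)" for x y z
    using test_function_line_bound[OF u, of "mk3 (0, y, z)" x 1] test_function_line_bound[OF u, of "mk3 (x, 0, z)" y 2]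
      test_function_line_bound[OF u, of "mk3 (x, y, 0)" z 3]
    unfolding line[symmetric] g1_def g2_def g3_def q_def
    by (auto intro!: le_esqrt simp: ennreal_power power_mult[symmetric])
  have pt: "ennreal ((u (mk3 (x, y, z))) ^ 6) \<le> g1 (y, z) * g2 (x, z) * g3 (x, y)" for x y z
  proof -
    have "ennreal ((u (mk3 (x, y, z))) ^ 6) = ennreal ((u (mk3 (x, y, z)))\<^sup>2) * ennreal ((u (mk3 (x, y, z)))\<^sup>2) * ennreal ((u (mk3 (x, y, z)))\<^sup>2)"
      by (simp add: ennreal_mult[symmetric] power_add[symmetric])
    also have "\<dots> \<le> g1 (y, z) * g2 (x, z) * g3 (x, y)" by (intro mult_mono u2) auto
    finally show ?thesis .
  qed
  have "ennreal I = (\<integral>\<^sup>+x. \<integral>\<^sup>+y. \<integral>\<^sup>+z. ennreal ((u (mk3 (x, y, z))) ^ 6) \<partial>lborel \<partial>lborel \<partial>lborel)"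
    unfolding I_eq[symmetric] by (rule nn_integral_R3) measurable
  also have "\<dots> \<le> (\<integral>\<^sup>+x. \<integral>\<^sup>+y. \<integral>\<^sup>+z. g1 (y, z) * g2 (x, z) * g3 (x, y) \<partial>lborel \<partial>lborel \<partial>lborel)"
    by (intro nn_integral_mono pt)
  finally have "(ennreal I)\<^sup>2 \<le> (\<integral>\<^sup>+x. \<integral>\<^sup>+y. \<integral>\<^sup>+z. g1 (y, z) * g2 (x, z) * g3 (x, y) \<partial>lborel \<partial>lborel \<partial>lborel)\<^sup>2"
    by (rule power_mono) simp
  also have "\<dots> \<le> (\<integral>\<^sup>+y. \<integral>\<^sup>+z. (g1 (y, z))\<^sup>2 \<partial>lborel \<partial>lborel) * (\<integral>\<^sup>+x. \<integral>\<^sup>+z. (g2 (x, z))\<^sup>2 \<partial>lborel \<partial>lborel) *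
      (\<integral>\<^sup>+x. \<integral>\<^sup>+y. (g3 (x, y))\<^sup>2 \<partial>lborel \<partial>lborel)"
    by (rule loomis_whitney[OF g_meas])
  also have "(\<integral>\<^sup>+x. \<integral>\<^sup>+y. (g3 (x, y))\<^sup>2 \<partial>lborel \<partial>lborel) = (\<integral>\<^sup>+x. ennreal (q 3 x) \<partial>lborel)"
    unfolding g3_def esqrt_square by (subst nn_integral_R3) auto
  also have "(\<integral>\<^sup>+x. \<integral>\<^sup>+z. (g2 (x, z))\<^sup>2 \<partial>lborel \<partial>lborel) = (\<integral>\<^sup>+x. ennreal (q 2 x) \<partial>lborel)"
  proof -
    have "(\<integral>\<^sup>+z. \<integral>\<^sup>+y. ennreal (q 2 (mk3 (x, y, z))) \<partial>lborel \<partial>lborel) = (\<integral>\<^sup>+y. \<integral>\<^sup>+z. ennreal (q 2 (mk3 (x, y, z))) \<partial>lborel \<partial>lborel)" for x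
      by (rule lborel_pair.Fubini[where f = "\<lambda>p. ennreal (q 2 (mk3 (x, fst p, snd p)))", simplified]) measurable
    then show ?thesis unfolding g2_def esqrt_square by (subst nn_integral_R3) auto
  qed
  also have "(\<integral>\<^sup>+y. \<integral>\<^sup>+z. (g1 (y, z))\<^sup>2 \<partial>lborel \<partial>lborel) = (\<integral>\<^sup>+x. ennreal (q 1 x) \<partial>lborel)"
  proof -
    have "(\<integral>\<^sup>+x. ennreal (q 1 x) \<partial>lborel) = (\<integral>\<^sup>+x. \<integral>\<^sup>+y. \<integral>\<^sup>+z. ennreal (q 1 (mk3 (x, y, z))) \<partial>lborel \<partial>lborel \<partial>lborel)"
      by (rule nn_integral_R3) measurable
    also have "\<dots> = (\<integral>\<^sup>+y. \<integral>\<^sup>+x. \<integral>\<^sup>+z. ennreal (q 1 (mk3 (x, y, z))) \<partial>lborel \<partial>lborel \<partial>lborel)"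
      by (rule lborel_pair.Fubini[where f = "\<lambda>p. \<integral>\<^sup>+z. ennreal (q 1 (mk3 (fst p, snd p, z))) \<partial>lborel", simplified, symmetric]) measurable
    also have "\<dots> = (\<integral>\<^sup>+y. \<integral>\<^sup>+z. \<integral>\<^sup>+x. ennreal (q 1 (mk3 (x, y, z))) \<partial>lborel \<partial>lborel \<partial>lborel)"
    proof (rule nn_integral_cong)
      show "(\<integral>\<^sup>+x. \<integral>\<^sup>+z. ennreal (q 1 (mk3 (x, y, z))) \<partial>lborel \<partial>lborel) = (\<integral>\<^sup>+z. \<integral>\<^sup>+x. ennreal (q 1 (mk3 (x, y, z))) \<partial>lborel \<partial>lborel)" for y
        by (rule lborel_pair.Fubini[where f = "\<lambda>p. ennreal (q 1 (mk3 (fst p, y, snd p)))", simplified, symmetric]) measurable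
    qed
    finally show ?thesis unfolding g1_def esqrt_square by simp
  qed
  \<comment> \<open>Squared once more, so that \<open>q_int\<close> bounds each of the three
    factors. \<open>4096\<close> is \<open>16 ^ 3\<close>, and of the four powers of
    \<open>I\<close> on the left one survives the cancellation.\<close>
  finally have "((ennreal I)\<^sup>2)\<^sup>2 \<le> ((\<integral>\<^sup>+x. ennreal (q 1 x) \<partial>lborel) * (\<integral>\<^sup>+x. ennreal (q 2 x) \<partial>lborel) * (\<integral>\<^sup>+x. ennreal (q 3 x) \<partial>lborel))\<^sup>2"
    by (rule power_mono) simp
  also have "\<dots> \<le> ennreal (16 * I * (d 1)\<^sup>2) * ennreal (16 * I * (d 2)\<^sup>2) * ennreal (16 * I * (d 3)\<^sup>2)"
    unfolding power_mult_distrib by (intro mult_mono q_int) auto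
  finally have "(I\<^sup>2)\<^sup>2 \<le> (16 * I * (d 1)\<^sup>2) * (16 * I * (d 2)\<^sup>2) * (16 * I * (d 3)\<^sup>2)"
    using I0 by (simp add: ennreal_power ennreal_mult[symmetric] del: ennreal_numeral)
  moreover have "(I\<^sup>2)\<^sup>2 = I ^ 3 * I" by algebra
  moreover have "(16 * I * (d 1)\<^sup>2) * (16 * I * (d 2)\<^sup>2) * (16 * I * (d 3)\<^sup>2) = I ^ 3 * (4096 * ((d 1)\<^sup>2 * (d 2)\<^sup>2 * (d 3)\<^sup>2))" by algebra
  ultimately have le: "I ^ 3 * I \<le> I ^ 3 * (4096 * ((d 1)\<^sup>2 * (d 2)\<^sup>2 * (d 3)\<^sup>2))" by (simp only:)
  have "I \<le> 4096 * ((d 1)\<^sup>2 * (d 2)\<^sup>2 * (d 3)\<^sup>2)"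
  proof (cases "I = 0")
    case False
    then have "I ^ 3 > 0" using I0 by (intro zero_less_power) simp
    then show ?thesis using le by (rule mult_le_cancel_left_pos[THEN iffD1])
  qed simp
  then show ?thesis unfolding I_def d_def .
qed

text \<open>The bound for test functions passes to the limit by Fatou's lemma along a subsequence
  that converges almost everywhere; the weak gradients of the approximants dominate the classical
  ones in norm.\<close>

lemma sobolev_H10:
  assumes u: "u \<in> H10 \<Omega>"
  shows "integrable lebesgue (\<lambda>x. (h1_fun u x) ^ 6)" "(LINT x|lebesgue. (h1_fun u x) ^ 6) \<le> 4096 * norm u ^ 6"
proof -
  obtain X where X: "\<And>n. \<exists>\<phi>. test_function \<Omega> \<phi> \<and> h1_l2 (X n) = mk_l2 \<phi>" "X \<longlonglongrightarrow> u"
    using u unfolding H10_def closure_sequential by blast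
  then obtain \<phi> where \<phi>: "\<And>n. test_function \<Omega> (\<phi> n)" "\<And>n. h1_l2 (X n) = mk_l2 (\<phi> n)" by metis
  note \<phi>U = test_function_UNIV[OF \<phi>(1)]
  have \<phi>_si: "square_integrable lebesgue (\<phi> n)" for n by (rule test_function_si[OF \<phi>(1)])
  have bound: "(\<integral>\<^sup>+x. ennreal ((\<phi> n x) ^ 6) \<partial>lebesgue) \<le> ennreal (4096 * norm (X n) ^ 6)" for n
  proof -
    obtain B where B: "B > 0" "\<And>x. norm x \<ge> B \<Longrightarrow> \<phi> n x = 0" using test_function_ball[OF \<phi>(1)] by metis
    have "integrable lborel (\<lambda>x. (\<phi> n x) ^ 6)"
      by (rule integrable_compact_support[of _ B])
        (auto intro!: continuous_intros test_function_continuous[OF \<phi>(1)] simp: B)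
    then have "(\<integral>\<^sup>+x. ennreal ((\<phi> n x) ^ 6) \<partial>lebesgue) = ennreal (LINT x|lborel. (\<phi> n x) ^ 6)"
      by (simp add: nn_integral_completion nn_integral_eq_integral)
    also have "\<dots> \<le> ennreal (4096 * ((norm (X n))\<^sup>2 * (norm (X n))\<^sup>2 * (norm (X n))\<^sup>2))"
    proof (intro ennreal_leI order_trans[OF sobolev_test_function[OF \<phi>U]] mult_left_mono mult_mono power_mono)
      have *: "norm (mk_l2 (partial_deriv i (\<phi> n))) \<le> norm (X n)" for i
        using norm_partial_deriv_le_grad[OF \<phi>U \<phi>(2)] norm_h1_ge(2) by (rule order_trans)
      show "norm (mk_l2 (partial_deriv 1 (\<phi> n))) \<le> norm (X n)" "norm (mk_l2 (partial_deriv 2 (\<phi> n))) \<le> norm (X n)"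
        "norm (mk_l2 (partial_deriv 3 (\<phi> n))) \<le> norm (X n)" by (rule *)+
    qed auto
    also have "(norm (X n))\<^sup>2 * (norm (X n))\<^sup>2 * (norm (X n))\<^sup>2 = norm (X n) ^ 6"
      by (simp add: power_add[symmetric])
    finally show ?thesis .
  qed
  define h where "h n x = (\<phi> n x - h1_fun u x)\<^sup>2" for n x
  have d_si: "square_integrable lebesgue (\<lambda>x. \<phi> n x - h1_fun u x)" for n
    by (rule square_integrable_diff[OF \<phi>_si rep_l2_si])
  have "(\<lambda>n. LINT x|lebesgue. norm (h n x)) \<longlonglongrightarrow> 0"
  proof -
    have "(\<lambda>n. (norm (h1_l2 (X n) - h1_l2 u))\<^sup>2) \<longlonglongrightarrow> (norm (h1_l2 u - h1_l2 u))\<^sup>2"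
      by (intro tendsto_intros bounded_linear.tendsto[OF bounded_linear_h1_l2] X)
    moreover have "(norm (h1_l2 (X n) - h1_l2 u))\<^sup>2 = (LINT x|lebesgue. norm (h n x))" for n
    proof -
      have "h1_l2 (X n) - h1_l2 u = mk_l2 (\<lambda>x. \<phi> n x - h1_fun u x)"
        using mk_l2_diff[OF \<phi>_si rep_l2_si, of n "h1_l2 u"] by (simp add: \<phi>(2) mk_l2_rep(2))
      then show ?thesis by (simp add: norm_mk_l2[OF d_si] h_def)
    qed
    ultimately show ?thesis by simp
  qed
  moreover have "integrable lebesgue (h n)" for n using d_si[of n] by (simp add: h_def[abs_def] square_integrable_def)
  ultimately obtain r where r: "strict_mono r" "AE x in lebesgue. (\<lambda>n. h (r n) x) \<longlonglongrightarrow> 0"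
    using tendsto_L1_AE_subseq[of lebesgue h] by auto
  have meas [measurable]: "\<phi> n \<in> borel_measurable lebesgue" "h1_fun u \<in> borel_measurable lebesgue" for n
    using \<phi>_si rep_l2_si by (auto simp: square_integrable_def)
  have "(\<integral>\<^sup>+x. ennreal ((h1_fun u x) ^ 6) \<partial>lebesgue) = (\<integral>\<^sup>+x. liminf (\<lambda>n. ennreal ((\<phi> (r n) x) ^ 6)) \<partial>lebesgue)"
  proof (rule nn_integral_cong_AE)
    show "AE x in lebesgue. ennreal ((h1_fun u x) ^ 6) = liminf (\<lambda>n. ennreal ((\<phi> (r n) x) ^ 6))"
      using r(2)
    proof eventually_elim
      case (elim x)
      then have "(\<lambda>n. sqrt (h (r n) x)) \<longlonglongrightarrow> sqrt 0" by (rule tendsto_real_sqrt)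
      then have "(\<lambda>n. \<phi> (r n) x - h1_fun u x) \<longlonglongrightarrow> 0" by (simp add: h_def tendsto_rabs_zero_iff)
      then have "(\<lambda>n. \<phi> (r n) x) \<longlonglongrightarrow> h1_fun u x" by (rule LIM_zero_cancel)
      then have "(\<lambda>n. ennreal ((\<phi> (r n) x) ^ 6)) \<longlonglongrightarrow> ennreal ((h1_fun u x) ^ 6)" by (intro tendsto_intros)
      then show ?case by (intro lim_imp_Liminf[symmetric]) auto
    qed
  qed
  also have "\<dots> \<le> liminf (\<lambda>n. \<integral>\<^sup>+x. ennreal ((\<phi> (r n) x) ^ 6) \<partial>lebesgue)"
    by (rule nn_integral_liminf) measurable
  also have "\<dots> \<le> liminf (\<lambda>n. ennreal (4096 * norm (X (r n)) ^ 6))"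
    by (intro Liminf_mono always_eventually allI bound)
  also have "\<dots> = ennreal (4096 * norm u ^ 6)"
  proof (rule lim_imp_Liminf)
    have "(\<lambda>n. X (r n)) \<longlonglongrightarrow> u" using LIMSEQ_subseq_LIMSEQ[OF X(2) r(1)] by (simp add: o_def)
    then show "(\<lambda>n. ennreal (4096 * norm (X (r n)) ^ 6)) \<longlonglongrightarrow> ennreal (4096 * norm u ^ 6)"
      by (intro tendsto_intros)
  qed simp
  finally have le: "(\<integral>\<^sup>+x. ennreal ((h1_fun u x) ^ 6) \<partial>lebesgue) \<le> ennreal (4096 * norm u ^ 6)" .
  then show int: "integrable lebesgue (\<lambda>x. (h1_fun u x) ^ 6)"
    by (intro integrableI_bounded) (auto intro: le_less_trans)
  show "(LINT x|lebesgue. (h1_fun u x) ^ 6) \<le> 4096 * norm u ^ 6"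
    using le nn_integral_eq_integral[OF int] by (simp add: ennreal_le_iff)
qed

section \<open>Superposition operators\<close>

text \<open>The conditions on a single section \<open>f x\<close>, with constants uniform in
  \<open>x\<close>; \<open>deriv g\<close> then grows at most quadratically.\<close>

definition cubic_growth :: "real \<Rightarrow> real \<Rightarrow> real \<Rightarrow> (real \<Rightarrow> real) \<Rightarrow> bool" where
  "cubic_growth C K1 K2 g \<longleftrightarrow> C2 g \<and> \<bar>deriv g 0\<bar> \<le> K1 \<and> \<bar>deriv (deriv g) 0\<bar> \<le> K2 \<and>
     (\<forall>s r. \<bar>deriv (deriv g) s - deriv (deriv g) r\<bar> \<le> C * \<bar>s - r\<bar>)"

context
  fixes g :: "real \<Rightarrow> real" and C K1 K2 :: real
  assumes g: "cubic_growth C K1 K2 g" and C: "C \<ge> 0" and K: "K1 \<ge> 0" "K2 \<ge> 0"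
begin

lemma cubic_growth_deriv: "(g has_real_derivative deriv g s) (at s)"
    "(deriv g has_real_derivative deriv (deriv g) s) (at s)"
  using g by (auto simp: cubic_growth_def C2_def DERIV_deriv_iff_field_differentiable)

lemma cubic_growth_deriv_lipschitz: "\<bar>deriv g s - deriv g r\<bar> \<le> \<bar>s - r\<bar> * (K2 + C * (\<bar>s\<bar> + \<bar>r\<bar>))"
proof -
  have "norm (deriv g s - deriv g r) \<le> (K2 + C * (\<bar>s\<bar> + \<bar>r\<bar>)) * norm (s - r)"
  proof (rule field_differentiable_bound[of "{min s r..max s r}"])
    fix z assume z: "z \<in> {min s r..max s r}"
    show "(deriv g has_real_derivative deriv (deriv g) z) (at z within {min s r..max s r})"
      by (rule has_field_derivative_at_within[OF cubic_growth_deriv(2)])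
    have "\<bar>deriv (deriv g) z\<bar> \<le> K2 + C * \<bar>z\<bar>"
      using g[unfolded cubic_growth_def] by (smt (verit) diff_zero)
    also have "\<dots> \<le> K2 + C * (\<bar>s\<bar> + \<bar>r\<bar>)" using z C by (intro add_left_mono mult_left_mono) auto
    finally show "norm (deriv (deriv g) z) \<le> K2 + C * (\<bar>s\<bar> + \<bar>r\<bar>)" by simp
  qed auto
  then show ?thesis by (simp add: mult.commute)
qed

lemma cubic_growth_deriv_bound: "\<bar>deriv g s\<bar> \<le> K1 + \<bar>s\<bar> * (K2 + C * \<bar>s\<bar>)"
proof -
  have "\<bar>deriv g s - deriv g 0\<bar> \<le> \<bar>s\<bar> * (K2 + C * \<bar>s\<bar>)" using cubic_growth_deriv_lipschitz[of s 0] by simp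
  moreover have "\<bar>deriv g 0\<bar> \<le> K1" using g by (simp add: cubic_growth_def)
  ultimately show ?thesis by linarith
qed

text \<open>Mean value theorem for \<open>z \<mapsto> g z - deriv g c * z\<close>; a point between
  \<open>a\<close> and \<open>b\<close> is no farther from \<open>c\<close> than the sum of the
  distances of \<open>a\<close> and \<open>b\<close>.\<close>

lemma cubic_growth_taylor:
  "\<bar>g a - g b - deriv g c * (a - b)\<bar> \<le> \<bar>a - b\<bar> * ((\<bar>a - c\<bar> + \<bar>b - c\<bar>) * (K2 + C * (\<bar>a\<bar> + \<bar>b\<bar> + \<bar>c\<bar>)))"
proof -
  let ?h = "\<lambda>z. g z - deriv g c * z"
  have "norm (?h a - ?h b) \<le> (\<bar>a - c\<bar> + \<bar>b - c\<bar>) * (K2 + C * (\<bar>a\<bar> + \<bar>b\<bar> + \<bar>c\<bar>)) * norm (a - b)"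
  proof (rule field_differentiable_bound[of "{min a b..max a b}"])
    fix z assume z: "z \<in> {min a b..max a b}"
    show "(?h has_real_derivative (deriv g z - deriv g c)) (at z within {min a b..max a b})"
      by (rule has_field_derivative_at_within) (auto intro!: derivative_eq_intros cubic_growth_deriv)
    have "\<bar>deriv g z - deriv g c\<bar> \<le> \<bar>z - c\<bar> * (K2 + C * (\<bar>z\<bar> + \<bar>c\<bar>))" by (rule cubic_growth_deriv_lipschitz)
    also have "\<dots> \<le> (\<bar>a - c\<bar> + \<bar>b - c\<bar>) * (K2 + C * (\<bar>a\<bar> + \<bar>b\<bar> + \<bar>c\<bar>))"
      using z C K by (intro mult_mono add_left_mono mult_left_mono) auto
    finally show "norm (deriv g z - deriv g c) \<le> (\<bar>a - c\<bar> + \<bar>b - c\<bar>) * (K2 + C * (\<bar>a\<bar> + \<bar>b\<bar> + \<bar>c\<bar>))" by simp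
  qed auto
  moreover have "?h a - ?h b = g a - g b - deriv g c * (a - b)" by (simp add: algebra_simps)
  ultimately have "\<bar>g a - g b - deriv g c * (a - b)\<bar> \<le> (\<bar>a - c\<bar> + \<bar>b - c\<bar>) * (K2 + C * (\<bar>a\<bar> + \<bar>b\<bar> + \<bar>c\<bar>)) * \<bar>a - b\<bar>"
    unfolding real_norm_def by (simp only:)
  then show ?thesis by (simp only: mult_ac)
qed

end

section \<open>Products of functions in \<open>L^2\<close> and \<open>L^6\<close>\<close>

definition L2_bound :: "(R3 \<Rightarrow> real) \<Rightarrow> real \<Rightarrow> bool" where
  "L2_bound g b \<longleftrightarrow> b \<ge> 0 \<and> square_integrable lebesgue g \<and> norm (mk_l2 g) \<le> b"

lemma L2_bound_nn_integral:
  "L2_bound g b \<longleftrightarrow> b \<ge> 0 \<and> g \<in> borel_measurable lebesgue \<and> (\<integral>\<^sup>+x. ennreal ((g x)\<^sup>2) \<partial>lebesgue) \<le> ennreal (b\<^sup>2)"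
proof (cases "b \<ge> 0 \<and> g \<in> borel_measurable lebesgue")
  case True
  show ?thesis
  proof (cases "square_integrable lebesgue g")
    case True
    then show ?thesis
      by (auto simp: L2_bound_def square_integrable_def norm_mk_l2_nn_integral[OF True, symmetric] power_mono
          dest: power2_le_imp_le)
  next
    case False
    then have "\<not> (\<integral>\<^sup>+x. ennreal ((g x)\<^sup>2) \<partial>lebesgue) \<le> ennreal (b\<^sup>2)"
      using square_integrable_nn_integral[of g lebesgue] True le_less_trans[of _ "ennreal (b\<^sup>2)" \<infinity>] by auto
    with False show ?thesis by (auto simp: L2_bound_def)
  qed
qed (auto simp: L2_bound_def square_integrable_def)

lemma L2_bound_add: "L2_bound g b \<Longrightarrow> L2_bound h c \<Longrightarrow> L2_bound (\<lambda>x. g x + h x) (b + c)"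
  by (auto simp: L2_bound_def mk_l2_add[symmetric] intro: square_integrable_add norm_triangle_le add_mono)

lemma L2_bound_cmult: "k \<ge> 0 \<Longrightarrow> L2_bound g b \<Longrightarrow> L2_bound (\<lambda>x. k * g x) (k * b)"
  by (auto simp: L2_bound_def mk_l2_scale[symmetric] intro: square_integrable_scale mult_left_mono)

lemma L2_bound_dominated:
  assumes h: "L2_bound h b" and g: "g \<in> borel_measurable lebesgue" "AE x in lebesgue. \<bar>g x\<bar> \<le> h x"
  shows "L2_bound g b"
proof -
  have "(\<integral>\<^sup>+x. ennreal ((g x)\<^sup>2) \<partial>lebesgue) \<le> (\<integral>\<^sup>+x. ennreal ((h x)\<^sup>2) \<partial>lebesgue)"
    using g(2) by (intro nn_integral_mono_AE) (auto elim!: eventually_mono intro!: ennreal_leI intro: abs_le_square_iff[THEN iffD1])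
  then show ?thesis using h g(1) by (auto simp: L2_bound_nn_integral)
qed

text \<open>One number bounds the norms in \<open>L^2\<close> and in \<open>L^6\<close>, so that
  products of one, two and three such functions are all bounded in \<open>L^2\<close>.\<close>

definition L26_bound :: "(R3 \<Rightarrow> real) \<Rightarrow> real \<Rightarrow> bool" where
  "L26_bound g m \<longleftrightarrow> m \<ge> 0 \<and> g \<in> borel_measurable lebesgue \<and>
     (\<integral>\<^sup>+x. ennreal ((g x)\<^sup>2) \<partial>lebesgue) \<le> ennreal (m\<^sup>2) \<and> (\<integral>\<^sup>+x. ennreal ((g x) ^ 6) \<partial>lebesgue) \<le> ennreal (m ^ 6)"

lemma L26_bound_L2: "L26_bound g m \<Longrightarrow> L2_bound g m"
  by (auto simp: L26_bound_def L2_bound_nn_integral)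

lemma L26_bound_abs: "L26_bound g m \<Longrightarrow> L26_bound (\<lambda>x. \<bar>g x\<bar>) m"
  by (auto simp: L26_bound_def power_even_abs)

lemma L26_bound_mono: "L26_bound g m \<Longrightarrow> m \<le> m' \<Longrightarrow> L26_bound g m'"
  unfolding L26_bound_def by (auto intro: order_trans ennreal_leI power_mono)

lemma L26_bound_cong_AE:
  assumes "L26_bound g m" "AE x in lebesgue. g x = h x" shows "L26_bound h m"
proof -
  have "(\<integral>\<^sup>+x. ennreal ((h x)\<^sup>2) \<partial>lebesgue) = (\<integral>\<^sup>+x. ennreal ((g x)\<^sup>2) \<partial>lebesgue)"
    "(\<integral>\<^sup>+x. ennreal ((h x) ^ 6) \<partial>lebesgue) = (\<integral>\<^sup>+x. ennreal ((g x) ^ 6) \<partial>lebesgue)"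
    using assms(2) by (auto intro!: nn_integral_cong_AE elim!: eventually_mono)
  then show ?thesis using assms borel_measurable_AE[of g h] by (auto simp: L26_bound_def)
qed

lemma L26_bound_zero_AE:
  assumes "L26_bound g 0" shows "AE x in lebesgue. g x = 0"
proof -
  have [measurable]: "g \<in> borel_measurable lebesgue" using assms by (simp add: L26_bound_def)
  have "(\<integral>\<^sup>+x. ennreal ((g x)\<^sup>2) \<partial>lebesgue) = 0" using assms by (simp add: L26_bound_def)
  then have "AE x in lebesgue. ennreal ((g x)\<^sup>2) = 0" by (subst (asm) nn_integral_0_iff_AE) auto
  then show ?thesis by eventually_elim (simp add: ennreal_eq_0_iff)
qed

lemma L26_bound_scaled:
  assumes "L26_bound g m" "m > 0"
  shows "(\<integral>\<^sup>+x. ennreal ((g x / m)\<^sup>2) \<partial>lebesgue) \<le> 1" "(\<integral>\<^sup>+x. ennreal ((g x / m) ^ 6) \<partial>lebesgue) \<le> 1"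
proof -
  have [measurable]: "g \<in> borel_measurable lebesgue" using assms by (simp add: L26_bound_def)
  have *: "(\<integral>\<^sup>+x. ennreal ((g x / m) ^ n) \<partial>lebesgue) \<le> 1"
    if n: "even n" and le: "(\<integral>\<^sup>+x. ennreal ((g x) ^ n) \<partial>lebesgue) \<le> ennreal (m ^ n)" for n
  proof -
    have "(\<integral>\<^sup>+x. ennreal ((g x / m) ^ n) \<partial>lebesgue) = (\<integral>\<^sup>+x. ennreal (1 / m ^ n) * ennreal ((g x) ^ n) \<partial>lebesgue)"
      using n \<open>m > 0\<close> by (intro nn_integral_cong) (simp add: power_divide ennreal_mult[symmetric] zero_le_even_power)
    also have "\<dots> = ennreal (1 / m ^ n) * (\<integral>\<^sup>+x. ennreal ((g x) ^ n) \<partial>lebesgue)"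
      by (rule nn_integral_cmult) measurable
    also have "\<dots> \<le> ennreal (1 / m ^ n) * ennreal (m ^ n)" by (intro mult_left_mono le) simp
    also have "\<dots> = 1" using \<open>m > 0\<close> by (simp add: ennreal_mult[symmetric])
    finally show ?thesis .
  qed
  show "(\<integral>\<^sup>+x. ennreal ((g x / m)\<^sup>2) \<partial>lebesgue) \<le> 1" "(\<integral>\<^sup>+x. ennreal ((g x / m) ^ 6) \<partial>lebesgue) \<le> 1"
    using assms(1) by (auto intro!: * simp: L26_bound_def)
qed

lemma L2_bound_of_scaled:
  assumes "m > 0" and [measurable]: "g \<in> borel_measurable lebesgue" and le: "(\<integral>\<^sup>+x. ennreal ((g x / m)\<^sup>2) \<partial>lebesgue) \<le> 1"
  shows "L2_bound g m"
proof -
  have "(\<integral>\<^sup>+x. ennreal ((g x)\<^sup>2) \<partial>lebesgue) = (\<integral>\<^sup>+x. ennreal (m\<^sup>2) * ennreal ((g x / m)\<^sup>2) \<partial>lebesgue)"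
    using \<open>m > 0\<close> by (intro nn_integral_cong) (simp add: power_divide ennreal_mult[symmetric])
  also have "\<dots> = ennreal (m\<^sup>2) * (\<integral>\<^sup>+x. ennreal ((g x / m)\<^sup>2) \<partial>lebesgue)"
    by (rule nn_integral_cmult) measurable
  also have "\<dots> \<le> ennreal (m\<^sup>2) * 1" by (intro mult_left_mono le) simp
  finally show ?thesis using assms by (simp add: L2_bound_nn_integral)
qed

lemma L2_bound_zero_AE:
  assumes "AE x in lebesgue. g x = 0" shows "L2_bound g 0"
proof -
  have "g \<in> borel_measurable lebesgue"
    by (rule borel_measurable_AE[of "\<lambda>x. 0"]) (use assms in \<open>auto elim: eventually_mono\<close>)
  moreover have "(\<integral>\<^sup>+x. ennreal ((g x)\<^sup>2) \<partial>lebesgue) = (\<integral>\<^sup>+x. 0 \<partial>(lebesgue :: R3 measure))"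
    using assms by (intro nn_integral_cong_AE) (auto elim!: eventually_mono)
  ultimately show ?thesis by (simp add: L2_bound_nn_integral)
qed

text \<open>Scaling reduces to \<open>m = n = 1\<close>. The square of the product is at most half
  the sum of the fourth powers, and a fourth power is at most half the sum of the second and the
  sixth because \<open>t * (t - 1)^2 \<ge> 0\<close>.\<close>

lemma L2_bound_mult:
  assumes g: "L26_bound g m" and h: "L26_bound h n"
  shows "L2_bound (\<lambda>x. g x * h x) (m * n)"
proof (cases "m = 0 \<or> n = 0")
  case True
  then have "AE x in lebesgue. g x * h x = 0"
    using L26_bound_zero_AE[of g] L26_bound_zero_AE[of h] g h by (auto elim: eventually_mono)
  then show ?thesis using True L2_bound_zero_AE by auto
next
  case False
  then have mn: "m > 0" "n > 0" using g h by (auto simp: L26_bound_def)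
  have [measurable]: "g \<in> borel_measurable lebesgue" "h \<in> borel_measurable lebesgue"
    using g h by (simp_all add: L26_bound_def)
  let ?I = "\<lambda>g. \<integral>\<^sup>+x. ennreal (g x) \<partial>lebesgue"
  have "?I (\<lambda>x. (g x * h x / (m * n))\<^sup>2) \<le>
      (\<integral>\<^sup>+x. ennreal (1/4) * (ennreal ((g x / m)\<^sup>2) + ennreal ((g x / m) ^ 6) + (ennreal ((h x / n)\<^sup>2) + ennreal ((h x / n) ^ 6))) \<partial>lebesgue)"
  proof (rule nn_integral_mono)
    fix x
    define p q where "p = (g x / m)\<^sup>2" and "q = (h x / n)\<^sup>2"
    have pq: "p \<ge> 0" "q \<ge> 0" by (auto simp: p_def q_def)
    have 1: "2 * t\<^sup>2 \<le> t + t ^ 3" if "t \<ge> 0" for t :: real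
      using mult_nonneg_nonneg[OF that zero_le_power2[of "t - 1"]] by (simp add: power2_eq_square power3_eq_cube algebra_simps)
    have "p * q \<le> 1/4 * (p + p ^ 3 + (q + q ^ 3))"
      using 1[OF pq(1)] 1[OF pq(2)] sum_squares_bound[of p q] by simp
    moreover have "(g x * h x / (m * n))\<^sup>2 = p * q" by (simp add: p_def q_def power_mult_distrib power_divide)
    moreover have "(g x / m) ^ 6 = p ^ 3" "(h x / n) ^ 6 = q ^ 3" by (simp_all add: p_def q_def power_mult[symmetric])
    ultimately have "(g x * h x / (m * n))\<^sup>2 \<le> 1/4 * ((g x / m)\<^sup>2 + (g x / m) ^ 6 + ((h x / n)\<^sup>2 + (h x / n) ^ 6))"
      by (simp only: p_def[symmetric] q_def[symmetric])
    from ennreal_leI[OF this]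
    show "ennreal ((g x * h x / (m * n))\<^sup>2) \<le> ennreal (1/4) * (ennreal ((g x / m)\<^sup>2) + ennreal ((g x / m) ^ 6) + (ennreal ((h x / n)\<^sup>2) + ennreal ((h x / n) ^ 6)))"
      by (subst (asm) ennreal_mult) (auto simp: zero_le_even_power)
  qed
  also have "\<dots> = ennreal (1/4) * (?I (\<lambda>x. (g x / m)\<^sup>2) + ?I (\<lambda>x. (g x / m) ^ 6) + (?I (\<lambda>x. (h x / n)\<^sup>2) + ?I (\<lambda>x. (h x / n) ^ 6)))"
    by (subst nn_integral_cmult, measurable, subst nn_integral_add, measurable, subst nn_integral_add, measurable, subst nn_integral_add, measurable)
  also have "\<dots> \<le> ennreal (1/4) * (1 + 1 + (1 + 1))"
    by (intro mult_left_mono add_mono L26_bound_scaled[OF g mn(1)] L26_bound_scaled[OF h mn(2)]) simp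
  also have "\<dots> = ennreal (1/4) * ennreal 4" by simp
  also have "\<dots> = 1" by (subst ennreal_mult[symmetric]) auto
  finally show ?thesis using mn by (intro L2_bound_of_scaled) auto
qed

lemma cube_root_AM_GM:
  fixes p q r :: real assumes "p \<ge> 0" "q \<ge> 0" "r \<ge> 0"
  shows "p * q * r \<le> 1/3 * (p ^ 3 + q ^ 3 + r ^ 3)"
proof -
  have "0 \<le> (p + q + r) * ((p - q)\<^sup>2 + (q - r)\<^sup>2 + (r - p)\<^sup>2)" using assms by simp
  then show ?thesis by (simp add: power2_eq_square power3_eq_cube algebra_simps)
qed

text \<open>Hoelder's inequality with three exponents six, obtained from the inequality of
  arithmetic and geometric means for the scaled functions.\<close>

lemma L2_bound_mult3:
  assumes g: "L26_bound g m" and h: "L26_bound h n" and k: "L26_bound k l"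
  shows "L2_bound (\<lambda>x. g x * h x * k x) (m * n * l)"
proof (cases "m = 0 \<or> n = 0 \<or> l = 0")
  case True
  then have "AE x in lebesgue. g x * h x * k x = 0"
    using L26_bound_zero_AE[of g] L26_bound_zero_AE[of h] L26_bound_zero_AE[of k] g h k by (auto elim: eventually_mono)
  then show ?thesis using True L2_bound_zero_AE by auto
next
  case False
  then have mn: "m > 0" "n > 0" "l > 0" using g h k by (auto simp: L26_bound_def)
  have [measurable]: "g \<in> borel_measurable lebesgue" "h \<in> borel_measurable lebesgue" "k \<in> borel_measurable lebesgue"
    using g h k by (simp_all add: L26_bound_def)
  let ?I = "\<lambda>g. \<integral>\<^sup>+x. ennreal (g x) \<partial>lebesgue"
  have "?I (\<lambda>x. (g x * h x * k x / (m * n * l))\<^sup>2) \<le>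
      (\<integral>\<^sup>+x. ennreal (1/3) * (ennreal ((g x / m) ^ 6) + ennreal ((h x / n) ^ 6) + ennreal ((k x / l) ^ 6)) \<partial>lebesgue)"
  proof (rule nn_integral_mono)
    fix x
    have "(g x * h x * k x / (m * n * l))\<^sup>2 = (g x / m)\<^sup>2 * (h x / n)\<^sup>2 * (k x / l)\<^sup>2"
      by (simp add: power_mult_distrib power_divide)
    also have "\<dots> \<le> 1/3 * (((g x / m)\<^sup>2) ^ 3 + ((h x / n)\<^sup>2) ^ 3 + ((k x / l)\<^sup>2) ^ 3)"
      by (rule cube_root_AM_GM) auto
    finally have "(g x * h x * k x / (m * n * l))\<^sup>2 \<le> 1/3 * ((g x / m) ^ 6 + (h x / n) ^ 6 + (k x / l) ^ 6)"
      unfolding power_mult[symmetric] by simp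
    from ennreal_leI[OF this]
    show "ennreal ((g x * h x * k x / (m * n * l))\<^sup>2) \<le> ennreal (1/3) * (ennreal ((g x / m) ^ 6) + ennreal ((h x / n) ^ 6) + ennreal ((k x / l) ^ 6))"
      by (subst (asm) ennreal_mult) (auto simp: zero_le_even_power)
  qed
  also have "\<dots> = ennreal (1/3) * (?I (\<lambda>x. (g x / m) ^ 6) + ?I (\<lambda>x. (h x / n) ^ 6) + ?I (\<lambda>x. (k x / l) ^ 6))"
    by (subst nn_integral_cmult, measurable, subst nn_integral_add, measurable, subst nn_integral_add, measurable)
  also have "\<dots> \<le> ennreal (1/3) * (1 + 1 + 1)"
    by (intro mult_left_mono add_mono L26_bound_scaled[OF g mn(1)] L26_bound_scaled[OF h mn(2)] L26_bound_scaled[OF k mn(3)]) simp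
  also have "\<dots> = ennreal (1/3) * ennreal 3" by simp
  also have "\<dots> = 1" by (subst ennreal_mult[symmetric]) auto
  finally show ?thesis using mn by (intro L2_bound_of_scaled) auto
qed

section \<open>Measurability of superpositions\<close>

lemma borel_measurable_lebesgue_limit_AE:
  fixes F :: "nat \<Rightarrow> R3 \<Rightarrow> real"
  assumes [measurable]: "\<And>n. F n \<in> borel_measurable lebesgue" and lim: "AE x in lebesgue. (\<lambda>n. F n x) \<longlonglongrightarrow> G x"
  shows "G \<in> borel_measurable lebesgue"
proof (rule borel_measurable_AE)
  show "(\<lambda>x. lim (\<lambda>n. F n x)) \<in> borel_measurable lebesgue" by measurable
  show "AE x in lebesgue. lim (\<lambda>n. F n x) = G x" using lim by eventually_elim (rule limI)
qed

text \<open>Only the sections \<open>f(\<cdot>, s)\<close> are assumed measurable, so the superposition is reached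
  through piecewise constant approximations of the inner function.\<close>

lemma superposition_measurable:
  fixes f :: "R3 \<Rightarrow> real \<Rightarrow> real"
  assumes \<Omega>: "\<Omega> \<in> sets lebesgue" and f: "\<And>s. (\<lambda>x. f x s) \<in> borel_measurable (lebesgue_on \<Omega>)"
    and cont: "AE x in lebesgue. x \<in> \<Omega> \<longrightarrow> continuous_on UNIV (f x)"
    and g [measurable]: "g \<in> borel_measurable lebesgue"
  shows "(\<lambda>x. if x \<in> \<Omega> then f x (g x) else 0) \<in> borel_measurable lebesgue"
proof (rule borel_measurable_lebesgue_limit_AE)
  define F where "F n x = (if x \<in> \<Omega> then f x (of_int \<lfloor>g x * real (Suc n)\<rfloor> / real (Suc n)) else 0)" for n x
  show "F n \<in> borel_measurable lebesgue" for n
    unfolding F_def[abs_def]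
  proof (rule measurable_compose_countable[where f = "\<lambda>(k :: int) x. if x \<in> \<Omega> then f x (of_int k / real (Suc n)) else 0"])
    show "(\<lambda>x. if x \<in> \<Omega> then f x (of_int k / real (Suc n)) else 0) \<in> borel_measurable lebesgue" for k :: int
      by (rule borel_measurable_if[OF \<Omega>, THEN iffD2, OF f])
    show "(\<lambda>x. \<lfloor>g x * real (Suc n)\<rfloor>) \<in> measurable lebesgue (count_space UNIV)" by measurable
  qed
  show "AE x in lebesgue. (\<lambda>n. F n x) \<longlonglongrightarrow> (if x \<in> \<Omega> then f x (g x) else 0)"
    using cont
  proof eventually_elim
    case (elim x)
    have "(\<lambda>n. of_int \<lfloor>g x * real (Suc n)\<rfloor> / real (Suc n)) \<longlonglongrightarrow> g x"
    proof (rule LIM_zero_cancel, rule Lim_null_comparison)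
      have "\<bar>of_int \<lfloor>g x * real (Suc n)\<rfloor> / real (Suc n) - g x\<bar> \<le> 1 / real (Suc n)" for n
      proof -
        have "\<bar>of_int \<lfloor>g x * real (Suc n)\<rfloor> - g x * real (Suc n)\<bar> \<le> 1" by linarith
        then have "\<bar>of_int \<lfloor>g x * real (Suc n)\<rfloor> - g x * real (Suc n)\<bar> / real (Suc n) \<le> 1 / real (Suc n)"
          by (rule divide_right_mono) simp
        moreover have "of_int \<lfloor>g x * real (Suc n)\<rfloor> / real (Suc n) - g x = (of_int \<lfloor>g x * real (Suc n)\<rfloor> - g x * real (Suc n)) / real (Suc n)"
          by (simp add: diff_divide_distrib del: of_nat_Suc)
        ultimately show ?thesis by (simp only: abs_divide abs_of_nat)
      qed
      then show "\<forall>\<^sub>F n in sequentially. norm (of_int \<lfloor>g x * real (Suc n)\<rfloor> / real (Suc n) - g x) \<le> 1 / real (Suc n)"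
        by simp
      show "(\<lambda>n. 1 / real (Suc n)) \<longlonglongrightarrow> 0" by (rule lim_1_over_n[THEN LIMSEQ_Suc])
    qed
    then have "x \<in> \<Omega> \<Longrightarrow> (\<lambda>n. f x (of_int \<lfloor>g x * real (Suc n)\<rfloor> / real (Suc n))) \<longlonglongrightarrow> f x (g x)"
      using elim by (intro continuous_on_tendsto_compose[of UNIV "f x"]) auto
    then show ?case by (auto simp: F_def)
  qed
qed

text \<open>The derivative is a limit of difference quotients, each formed from two superpositions
  of the kind treated before.\<close>

lemma superposition_deriv_measurable:
  fixes f :: "R3 \<Rightarrow> real \<Rightarrow> real"
  assumes \<Omega>: "\<Omega> \<in> sets lebesgue" and f: "\<And>s. (\<lambda>x. f x s) \<in> borel_measurable (lebesgue_on \<Omega>)"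
    and deriv: "AE x in lebesgue. x \<in> \<Omega> \<longrightarrow> (\<forall>s. (f x has_real_derivative deriv (f x) s) (at s))"
    and g [measurable]: "g \<in> borel_measurable lebesgue"
  shows "(\<lambda>x. if x \<in> \<Omega> then deriv (f x) (g x) else 0) \<in> borel_measurable lebesgue"
proof (rule borel_measurable_lebesgue_limit_AE)
  have cont: "AE x in lebesgue. x \<in> \<Omega> \<longrightarrow> continuous_on UNIV (f x)"
    using deriv by eventually_elim (auto intro!: continuous_at_imp_continuous_on DERIV_isCont)
  note meas [measurable] = superposition_measurable[OF \<Omega> f cont]
  define F where "F n x = ((if x \<in> \<Omega> then f x (g x + inverse (real (Suc n))) else 0) - (if x \<in> \<Omega> then f x (g x) else 0)) / inverse (real (Suc n))" for n x
  show "F n \<in> borel_measurable lebesgue" for n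
    unfolding F_def[abs_def] by (intro borel_measurable_divide borel_measurable_diff meas) measurable
  show "AE x in lebesgue. (\<lambda>n. F n x) \<longlonglongrightarrow> (if x \<in> \<Omega> then deriv (f x) (g x) else 0)"
    using deriv
  proof eventually_elim
    case (elim x)
    have inv: "filterlim (\<lambda>n. inverse (real (Suc n))) (at 0) sequentially"
      unfolding filterlim_at using LIMSEQ_inverse_real_of_nat by auto
    have "x \<in> \<Omega> \<Longrightarrow> ((\<lambda>h. (f x (g x + h) - f x (g x)) / h) \<longlongrightarrow> deriv (f x) (g x)) (at 0)"
      using elim by (auto simp: DERIV_def)
    from filterlim_compose[OF this inv] show ?case by (auto simp: F_def)
  qed
qed

lemma L26_bound_zero: "L26_bound (\<lambda>x. 0) 0"
  by (simp add: L26_bound_def)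

lemma AE_lebesgue_on_iff:
  "\<Omega> \<in> sets lebesgue \<Longrightarrow> (AE x in lebesgue_on \<Omega>. Q x) \<longleftrightarrow> (AE x in lebesgue. x \<in> \<Omega> \<longrightarrow> Q x)"
  by (subst AE_restrict_space_iff) auto

lemma Linf_norm_AE:
  assumes "\<Omega> \<in> sets lebesgue" "Linf_norm \<Omega> g = ennreal K" "K \<ge> 0"
  shows "AE x in lebesgue. x \<in> \<Omega> \<longrightarrow> \<bar>g x\<bar> \<le> K"
  using esssup_AE[of "\<lambda>x. ennreal \<bar>g x\<bar>" "lebesgue_on \<Omega>"] assms
  by (simp add: Linf_norm_def AE_lebesgue_on_iff ennreal_le_iff)

locale cubic_nonlinearity =
  fixes \<Omega> :: "R3 set" and C K0 K1 K2 :: real and f :: "R3 \<Rightarrow> real \<Rightarrow> real"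
  assumes \<Omega>: "\<Omega> \<in> sets lebesgue" and C: "C \<ge> 0" and K: "K0 \<ge> 0" "K1 \<ge> 0" "K2 \<ge> 0"
    and f: "admissible_nonlinearity \<Omega> C K0 K1 K2 f"
begin

definition F :: "(R3 \<Rightarrow> real) \<Rightarrow> R3 \<Rightarrow> real" where
  "F g x = (if x \<in> \<Omega> then f x (g x) else 0)"

definition F' :: "(R3 \<Rightarrow> real) \<Rightarrow> R3 \<Rightarrow> real" where
  "F' g x = (if x \<in> \<Omega> then deriv (f x) (g x) else 0)"

lemma cubic_growth_AE: "AE x in lebesgue. x \<in> \<Omega> \<longrightarrow> cubic_growth C K1 K2 (f x)"
proof -
  have "AE x in lebesgue. x \<in> \<Omega> \<longrightarrow> C2 (f x)"
    "AE x in lebesgue. x \<in> \<Omega> \<longrightarrow> (\<forall>s1 s2. \<bar>deriv (deriv (f x)) s1 - deriv (deriv (f x)) s2\<bar> \<le> C * \<bar>s1 - s2\<bar>)"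
    using f unfolding admissible_nonlinearity_def AE_lebesgue_on_iff[OF \<Omega>] by blast+
  moreover have "AE x in lebesgue. x \<in> \<Omega> \<longrightarrow> \<bar>deriv (f x) 0\<bar> \<le> K1"
    using f K by (intro Linf_norm_AE[OF \<Omega>]) (auto simp: admissible_nonlinearity_def)
  moreover have "AE x in lebesgue. x \<in> \<Omega> \<longrightarrow> \<bar>deriv (deriv (f x)) 0\<bar> \<le> K2"
    using f K by (intro Linf_norm_AE[OF \<Omega>]) (auto simp: admissible_nonlinearity_def)
  ultimately show ?thesis by eventually_elim (simp add: cubic_growth_def)
qed

lemma F_measurable: assumes "g \<in> borel_measurable lebesgue" shows "F g \<in> borel_measurable lebesgue"
  unfolding F_def[abs_def]
proof (rule superposition_measurable[OF \<Omega> _ _ assms])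
  show "(\<lambda>x. f x s) \<in> borel_measurable (lebesgue_on \<Omega>)" for s using f by (simp add: admissible_nonlinearity_def)
  show "AE x in lebesgue. x \<in> \<Omega> \<longrightarrow> continuous_on UNIV (f x)"
    using cubic_growth_AE
    by eventually_elim (auto intro!: continuous_at_imp_continuous_on DERIV_isCont[OF cubic_growth_deriv(1)[OF _ C K(2,3)]])
qed

lemma F'_measurable: assumes "g \<in> borel_measurable lebesgue" shows "F' g \<in> borel_measurable lebesgue"
  unfolding F'_def[abs_def]
proof (rule superposition_deriv_measurable[OF \<Omega> _ _ assms])
  show "(\<lambda>x. f x s) \<in> borel_measurable (lebesgue_on \<Omega>)" for s using f by (simp add: admissible_nonlinearity_def)
  show "AE x in lebesgue. x \<in> \<Omega> \<longrightarrow> (\<forall>s. (f x has_real_derivative deriv (f x) s) (at s))"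
    using cubic_growth_AE by eventually_elim (auto intro: cubic_growth_deriv(1)[OF _ C K(2,3)])
qed

lemma F_zero_bound: "L2_bound (F (\<lambda>x. 0)) K0"
proof -
  have si: "square_integrable (lebesgue_on \<Omega>) (\<lambda>x. f x 0)" and K0: "sqrt (LINT x|lebesgue_on \<Omega>. (f x 0)\<^sup>2) = K0"
    using f by (simp_all add: admissible_nonlinearity_def)
  have meas: "F (\<lambda>x. 0) \<in> borel_measurable lebesgue" by (rule F_measurable) simp
  have "(\<integral>\<^sup>+x. ennreal ((F (\<lambda>x. 0) x)\<^sup>2) \<partial>lebesgue) = (\<integral>\<^sup>+x. ennreal ((f x 0)\<^sup>2) * indicator \<Omega> x \<partial>lebesgue)"
    by (intro nn_integral_cong) (simp add: F_def)
  also have "\<dots> = (\<integral>\<^sup>+x. ennreal ((f x 0)\<^sup>2) \<partial>lebesgue_on \<Omega>)"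
    using \<Omega> by (subst nn_integral_restrict_space) auto
  also have "\<dots> = ennreal (LINT x|lebesgue_on \<Omega>. (f x 0)\<^sup>2)"
    by (rule nn_integral_eq_integral) (use si in \<open>auto simp: square_integrable_def\<close>)
  also have "(LINT x|lebesgue_on \<Omega>. (f x 0)\<^sup>2) = K0\<^sup>2" unfolding K0[symmetric] by simp
  finally show ?thesis using meas K by (simp add: L2_bound_nn_integral)
qed

text \<open>Pointwise the derivative is at most \<open>K1 + K2 |c| + C |c|^2\<close>. Times
  \<open>w\<close> this gives products of one, two and three factors, whence the three terms of the
  bound.\<close>

lemma deriv_mult_bound:
  assumes c: "L26_bound c m" and w: "L26_bound w n"
  shows "L2_bound (\<lambda>x. F' c x * w x) (K1 * n + (K2 * (m * n) + C * (m * m * n)))"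
proof (rule L2_bound_dominated)
  note L26 = L26_bound_abs[OF c] L26_bound_abs[OF w]
  show "L2_bound (\<lambda>x. K1 * \<bar>w x\<bar> + (K2 * (\<bar>c x\<bar> * \<bar>w x\<bar>) + C * (\<bar>c x\<bar> * \<bar>c x\<bar> * \<bar>w x\<bar>))) (K1 * n + (K2 * (m * n) + C * (m * m * n)))"
    by (intro L2_bound_add L2_bound_cmult L2_bound_mult L2_bound_mult3 L26_bound_L2 L26 C K)
  show "(\<lambda>x. F' c x * w x) \<in> borel_measurable lebesgue"
    using c w by (intro borel_measurable_times F'_measurable) (auto simp: L26_bound_def)
  show "AE x in lebesgue. \<bar>F' c x * w x\<bar> \<le> K1 * \<bar>w x\<bar> + (K2 * (\<bar>c x\<bar> * \<bar>w x\<bar>) + C * (\<bar>c x\<bar> * \<bar>c x\<bar> * \<bar>w x\<bar>))"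
    using cubic_growth_AE
  proof eventually_elim
    case (elim x)
    show ?case
    proof (cases "x \<in> \<Omega>")
      case True
      then have "\<bar>F' c x\<bar> * \<bar>w x\<bar> \<le> (K1 + \<bar>c x\<bar> * (K2 + C * \<bar>c x\<bar>)) * \<bar>w x\<bar>"
        using cubic_growth_deriv_bound[of C K1 K2 "f x" "c x"] elim C K by (intro mult_right_mono) (auto simp: F'_def)
      then show ?thesis by (simp add: abs_mult algebra_simps)
    qed (use C K in \<open>simp add: F'_def\<close>)
  qed
qed

lemma deriv_diff_dominated:
  "AE x in lebesgue. \<bar>F' c x * w x - F' d x * w x\<bar> \<le> \<bar>c x - d x\<bar> * \<bar>w x\<bar> * (K2 + C * (\<bar>c x\<bar> + \<bar>d x\<bar>))"
  using cubic_growth_AE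
proof eventually_elim
  case (elim x)
  have eq: "\<bar>F' c x * w x - F' d x * w x\<bar> = \<bar>F' c x - F' d x\<bar> * \<bar>w x\<bar>" by (simp add: abs_mult[symmetric] left_diff_distrib)
  show ?case
  proof (cases "x \<in> \<Omega>")
    case True
    then have "\<bar>F' c x - F' d x\<bar> * \<bar>w x\<bar> \<le> (\<bar>c x - d x\<bar> * (K2 + C * (\<bar>c x\<bar> + \<bar>d x\<bar>))) * \<bar>w x\<bar>"
      using cubic_growth_deriv_lipschitz[of C K1 K2 "f x" "c x" "d x"] elim C K by (intro mult_right_mono) (auto simp: F'_def)
    then show ?thesis unfolding eq by (simp only: mult_ac)
  qed (use C K in \<open>simp add: F'_def\<close>)
qed

lemma deriv_diff_bound:
  assumes c: "L26_bound c m" and d: "L26_bound d m" and e: "L26_bound (\<lambda>x. c x - d x) s" and w: "L26_bound w n"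
  shows "L2_bound (\<lambda>x. F' c x * w x - F' d x * w x) (K2 * (s * n) + (C * (m * s * n) + C * (m * s * n)))"
proof (rule L2_bound_dominated)
  note L26 = L26_bound_abs[OF c] L26_bound_abs[OF d] L26_bound_abs[OF e] L26_bound_abs[OF w]
  show "L2_bound (\<lambda>x. K2 * (\<bar>c x - d x\<bar> * \<bar>w x\<bar>) + (C * (\<bar>c x\<bar> * \<bar>c x - d x\<bar> * \<bar>w x\<bar>) + C * (\<bar>d x\<bar> * \<bar>c x - d x\<bar> * \<bar>w x\<bar>)))
      (K2 * (s * n) + (C * (m * s * n) + C * (m * s * n)))"
    by (intro L2_bound_add L2_bound_cmult L2_bound_mult L2_bound_mult3 L26 C K)
  show "(\<lambda>x. F' c x * w x - F' d x * w x) \<in> borel_measurable lebesgue"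
    using c d w by (intro borel_measurable_diff borel_measurable_times F'_measurable) (auto simp: L26_bound_def)
  show "AE x in lebesgue. \<bar>F' c x * w x - F' d x * w x\<bar> \<le>
      K2 * (\<bar>c x - d x\<bar> * \<bar>w x\<bar>) + (C * (\<bar>c x\<bar> * \<bar>c x - d x\<bar> * \<bar>w x\<bar>) + C * (\<bar>d x\<bar> * \<bar>c x - d x\<bar> * \<bar>w x\<bar>))"
    using deriv_diff_dominated by eventually_elim (simp add: algebra_simps)
qed

text \<open>The factor \<open>c - d\<close> is kept in \<open>L^2\<close>, and the remaining
  \<open>w^2 (K2 + C (|c| + |d|))\<close> is bounded in \<open>L^2\<close> as products of two and
  three functions. Cubic growth is critical here: three factors in \<open>L^6\<close> are all that
  \<open>L^2\<close> admits.\<close>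

lemma deriv_diff_weak_bound:
  assumes c: "L26_bound c m" and d: "L26_bound d m" and e: "L26_bound (\<lambda>x. c x - d x) s" and w: "L26_bound w n"
  shows "\<bar>mk_l2 (\<lambda>x. F' c x * w x - F' d x * w x) \<bullet> mk_l2 w\<bar> \<le>
    norm (mk_l2 (\<lambda>x. c x - d x)) * (K2 * (n * n) + (C * (m * n * n) + C * (m * n * n)))"
proof -
  note L26 = L26_bound_abs[OF c] L26_bound_abs[OF d] L26_bound_abs[OF e] L26_bound_abs[OF w]
  define G where "G x = K2 * (\<bar>w x\<bar> * \<bar>w x\<bar>) + (C * (\<bar>c x\<bar> * \<bar>w x\<bar> * \<bar>w x\<bar>) + C * (\<bar>d x\<bar> * \<bar>w x\<bar> * \<bar>w x\<bar>))" for x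
  have G: "L2_bound G (K2 * (n * n) + (C * (m * n * n) + C * (m * n * n)))"
    unfolding G_def[abs_def] by (intro L2_bound_add L2_bound_cmult L2_bound_mult L2_bound_mult3 L26 C K)
  define p where "p x = F' c x * w x - F' d x * w x" for x
  have p: "square_integrable lebesgue p" and w_si: "square_integrable lebesgue w"
    and e_si: "square_integrable lebesgue (\<lambda>x. \<bar>c x - d x\<bar>)" and e_si': "square_integrable lebesgue (\<lambda>x. c x - d x)"
    and G_si: "square_integrable lebesgue G"
    using deriv_diff_bound[OF assms] L26_bound_L2[OF w] L26_bound_L2[OF e] L26_bound_L2[OF L26(3)] G
    by (auto simp: L2_bound_def p_def[abs_def])
  have e_norm: "norm (mk_l2 (\<lambda>x. \<bar>c x - d x\<bar>)) = norm (mk_l2 (\<lambda>x. c x - d x))"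
    using norm_mk_l2[OF e_si] norm_mk_l2[OF e_si'] by (auto intro: power2_eq_imp_eq)
  have "\<bar>mk_l2 p \<bullet> mk_l2 w\<bar> = \<bar>LINT x|lebesgue. p x * w x\<bar>" by (simp add: inner_mk_l2[OF p w_si])
  also have "\<dots> \<le> (LINT x|lebesgue. \<bar>p x * w x\<bar>)" by (rule integral_abs_bound)
  also have "\<dots> \<le> (LINT x|lebesgue. \<bar>c x - d x\<bar> * G x)"
  proof (rule integral_mono_AE)
    show "AE x in lebesgue. \<bar>p x * w x\<bar> \<le> \<bar>c x - d x\<bar> * G x"
      using deriv_diff_dominated[of c w d]
    proof eventually_elim
      case (elim x)
      then have "\<bar>p x\<bar> * \<bar>w x\<bar> \<le> (\<bar>c x - d x\<bar> * \<bar>w x\<bar> * (K2 + C * (\<bar>c x\<bar> + \<bar>d x\<bar>))) * \<bar>w x\<bar>"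
        by (intro mult_right_mono) (auto simp: p_def)
      also have "\<dots> = \<bar>c x - d x\<bar> * G x" by (simp only: G_def distrib_left distrib_right mult_ac)
      finally show ?case by (simp add: abs_mult)
    qed
  qed (intro integrable_abs square_integrable_mult p w_si e_si G_si)+
  also have "\<dots> = mk_l2 (\<lambda>x. \<bar>c x - d x\<bar>) \<bullet> mk_l2 G" by (simp add: inner_mk_l2[OF e_si G_si])
  also have "\<dots> \<le> norm (mk_l2 (\<lambda>x. \<bar>c x - d x\<bar>)) * norm (mk_l2 G)" by (rule norm_cauchy_schwarz)
  also have "\<dots> \<le> norm (mk_l2 (\<lambda>x. c x - d x)) * (K2 * (n * n) + (C * (m * n * n) + C * (m * n * n)))"
    unfolding e_norm using G by (intro mult_left_mono) (auto simp: L2_bound_def)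
  finally show ?thesis by (simp add: p_def[abs_def])
qed

lemma taylor_bound:
  assumes a: "L26_bound a m" and b: "L26_bound b m" and c: "L26_bound c m"
    and s: "L26_bound (\<lambda>x. a x - b x) s" and p: "L26_bound (\<lambda>x. a x - c x) p" and q: "L26_bound (\<lambda>x. b x - c x) q"
  shows "L2_bound (\<lambda>x. F a x - F b x - F' c x * (a x - b x)) (s * (p + q) * (K2 + 3 * C * m))"
proof (rule L2_bound_dominated)
  note L26 = L26_bound_abs[OF a] L26_bound_abs[OF b] L26_bound_abs[OF c] L26_bound_abs[OF s] L26_bound_abs[OF p] L26_bound_abs[OF q]
  \<comment> \<open>The pointwise Taylor estimate multiplied out: two products of two factors and
    six of three.\<close>
  let ?h = "\<lambda>x. K2 * (\<bar>a x - b x\<bar> * \<bar>a x - c x\<bar>) + (K2 * (\<bar>a x - b x\<bar> * \<bar>b x - c x\<bar>) +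
      (C * (\<bar>a x\<bar> * \<bar>a x - b x\<bar> * \<bar>a x - c x\<bar>) + (C * (\<bar>a x\<bar> * \<bar>a x - b x\<bar> * \<bar>b x - c x\<bar>) +
      (C * (\<bar>b x\<bar> * \<bar>a x - b x\<bar> * \<bar>a x - c x\<bar>) + (C * (\<bar>b x\<bar> * \<bar>a x - b x\<bar> * \<bar>b x - c x\<bar>) +
      (C * (\<bar>c x\<bar> * \<bar>a x - b x\<bar> * \<bar>a x - c x\<bar>) + C * (\<bar>c x\<bar> * \<bar>a x - b x\<bar> * \<bar>b x - c x\<bar>)))))))"
  have "L2_bound ?h (K2 * (s * p) + (K2 * (s * q) + (C * (m * s * p) + (C * (m * s * q) +
      (C * (m * s * p) + (C * (m * s * q) + (C * (m * s * p) + C * (m * s * q))))))))"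
    by (intro L2_bound_add L2_bound_cmult L2_bound_mult L2_bound_mult3 L26 C K)
  then show "L2_bound ?h (s * (p + q) * (K2 + 3 * C * m))" by (simp add: algebra_simps)
  show "(\<lambda>x. F a x - F b x - F' c x * (a x - b x)) \<in> borel_measurable lebesgue"
    using a b c by (intro borel_measurable_diff borel_measurable_times F_measurable F'_measurable) (auto simp: L26_bound_def)
  show "AE x in lebesgue. \<bar>F a x - F b x - F' c x * (a x - b x)\<bar> \<le> ?h x"
    using cubic_growth_AE
  proof eventually_elim
    case (elim x)
    have "\<bar>F a x - F b x - F' c x * (a x - b x)\<bar> \<le>
        \<bar>a x - b x\<bar> * ((\<bar>a x - c x\<bar> + \<bar>b x - c x\<bar>) * (K2 + C * (\<bar>a x\<bar> + \<bar>b x\<bar> + \<bar>c x\<bar>)))"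
    proof (cases "x \<in> \<Omega>")
      case True
      then show ?thesis
        using cubic_growth_taylor[of C K1 K2 "f x" "a x" "b x" "c x"] elim C K by (simp add: F_def F'_def)
    qed (use C K in \<open>simp add: F_def F'_def\<close>)
    also have "\<dots> = ?h x" by (simp add: algebra_simps)
    finally show ?case .
  qed
qed

text \<open>Taylor estimate at the base point zero, where the derivative is bounded by
  \<open>K1\<close>, plus the linear term; \<open>2 * m\<close> bounds the two distances from
  zero.\<close>

lemma F_diff_bound:
  assumes a: "L26_bound a m" and b: "L26_bound b m" and s: "L26_bound (\<lambda>x. a x - b x) s"
  shows "L2_bound (\<lambda>x. F a x - F b x) (s * (K1 + 2 * m * (K2 + 3 * C * m)))"
proof -
  have 0: "L26_bound (\<lambda>x. 0) m" by (rule L26_bound_mono[OF L26_bound_zero]) (use a in \<open>simp add: L26_bound_def\<close>)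
  have "L2_bound (\<lambda>x. (F a x - F b x - F' (\<lambda>x. 0) x * (a x - b x)) + F' (\<lambda>x. 0) x * (a x - b x))
      (s * (m + m) * (K2 + 3 * C * m) + (K1 * s + (K2 * (0 * s) + C * (0 * 0 * s))))"
    by (rule L2_bound_add[OF taylor_bound[OF a b 0 s] deriv_mult_bound[OF L26_bound_zero s]]) (use a b in simp_all)
  then show ?thesis by (simp add: algebra_simps)
qed

lemma F_bound:
  assumes a: "L26_bound a m"
  shows "L2_bound (F a) (K0 + m * (K1 + 2 * m * (K2 + 3 * C * m)))"
proof -
  have 0: "L26_bound (\<lambda>x. 0) m" by (rule L26_bound_mono[OF L26_bound_zero]) (use a in \<open>simp add: L26_bound_def\<close>)
  have "L2_bound (\<lambda>x. F (\<lambda>x. 0) x + (F a x - F (\<lambda>x. 0) x)) (K0 + m * (K1 + 2 * m * (K2 + 3 * C * m)))"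
    by (rule L2_bound_add[OF F_zero_bound F_diff_bound[OF a 0]]) (use a in simp)
  then show ?thesis by simp
qed

end

section \<open>The form on \<open>H\<^sup>1\<^sub>0\<close>\<close>

lemma matrix_vector_inner: "(M *v \<xi>) \<bullet> \<zeta> = (\<Sum>i\<in>UNIV. \<Sum>j\<in>UNIV. M $ i $ j * \<xi> $ j * \<zeta> $ i)"
  for M :: "real^3^3"
  by (simp add: inner_vec_def matrix_vector_mult_def sum_distrib_right)

lemma grad_fun_add: "AE x in lebesgue. grad_fun (u + v) x = grad_fun u x + grad_fun v x"
proof -
  have "AE x in lebesgue. \<forall>i\<in>UNIV. rep_l2 (grad (u + v) $ i) x = rep_l2 (grad u $ i) x + rep_l2 (grad v $ i) x"
    by (rule AE_finite_allI) (simp_all add: grad_linear rep_l2_add)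
  then show ?thesis by eventually_elim (simp add: grad_fun_def vec_eq_iff)
qed

lemma grad_fun_scale: "AE x in lebesgue. grad_fun (c *\<^sub>R u) x = c *\<^sub>R grad_fun u x"
proof -
  have "AE x in lebesgue. \<forall>i\<in>UNIV. rep_l2 (grad (c *\<^sub>R u) $ i) x = c * rep_l2 (grad u $ i) x"
    by (rule AE_finite_allI) (simp_all add: grad_linear rep_l2_scale)
  then show ?thesis by eventually_elim (simp add: grad_fun_def vec_eq_iff)
qed

lemma power2_norm_grad_fun: "(norm (grad_fun u x))\<^sup>2 = (\<Sum>i\<in>UNIV. (rep_l2 (grad u $ i) x)\<^sup>2)"
  by (simp add: power2_norm_eq_inner inner_vec_def grad_fun_def) (simp add: power2_eq_square)

lemma rep_l2_measurable: "rep_l2 w \<in> borel_measurable lebesgue"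
  using rep_l2_si by (simp add: square_integrable_def)

locale wave_coefficients =
  fixes \<Omega> :: "R3 set" and a :: "R3 \<Rightarrow> real^3^3" and \<beta> :: "R3 \<Rightarrow> real" and a0 a1 lam :: real and Cn :: "real \<Rightarrow> real"
  assumes open_\<Omega>: "open \<Omega>" and pos: "a0 > 0" "a1 > 0" "lam > 0" "\<And>\<nu>. \<nu> > 0 \<Longrightarrow> Cn \<nu> > 0"
    and elliptic: "elliptic_coefficients \<Omega> a0 a1 a" and potential: "admissible_potential \<Omega> Cn lam a \<beta>"
begin

lemma \<Omega>: "\<Omega> \<in> sets lebesgue"
  using open_\<Omega> by (simp add: borel_open sets_completionI_sets)

lemma integrable_\<Omega>:
  fixes h :: "R3 \<Rightarrow> real" assumes "integrable lebesgue h" shows "integrable (lebesgue_on \<Omega>) h"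
  using integrable_mult_indicator[OF \<Omega> assms] \<Omega> by (simp add: integrable_restrict_space)

lemma AE_\<Omega>: "AE x in lebesgue. Q x \<Longrightarrow> AE x in lebesgue_on \<Omega>. Q x"
  unfolding AE_lebesgue_on_iff[OF \<Omega>] by (auto elim: eventually_mono)

lemma rep_l2_measurable_\<Omega>: "rep_l2 w \<in> borel_measurable (lebesgue_on \<Omega>)"
  by (rule measurable_restrict_space1[OF rep_l2_measurable])

lemma coefficient_bounded:
  obtains K where "K \<ge> 0" "AE x in lebesgue_on \<Omega>. \<bar>a x $ i $ j\<bar> \<le> K"
proof -
  have "Linf_norm \<Omega> (\<lambda>x. a x $ i $ j) < \<infinity>" using elliptic by (auto simp: elliptic_coefficients_def Linf_def)
  then obtain K where K: "K \<ge> 0" "Linf_norm \<Omega> (\<lambda>x. a x $ i $ j) = ennreal K"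
    by (cases "Linf_norm \<Omega> (\<lambda>x. a x $ i $ j)" rule: ennreal_cases) auto
  show thesis
    using that[OF K(1)] Linf_norm_AE[OF \<Omega> K(2,1)] by (simp add: AE_lebesgue_on_iff[OF \<Omega>])
qed

lemma integrable_principal: "integrable (lebesgue_on \<Omega>) (\<lambda>x. (a x *v grad_fun u x) \<bullet> grad_fun w x)"
  unfolding matrix_vector_inner grad_fun_def vec_lambda_beta
proof (intro Bochner_Integration.integrable_sum)
  fix i j :: 3
  obtain K where K: "K \<ge> 0" "AE x in lebesgue_on \<Omega>. \<bar>a x $ i $ j\<bar> \<le> K" by (rule coefficient_bounded)
  show "integrable (lebesgue_on \<Omega>) (\<lambda>x. a x $ i $ j * rep_l2 (grad u $ j) x * rep_l2 (grad w $ i) x)"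
  proof (rule Bochner_Integration.integrable_bound)
    show "integrable (lebesgue_on \<Omega>) (\<lambda>x. K * (rep_l2 (grad u $ j) x * rep_l2 (grad w $ i) x))"
      by (intro integrable_mult_right integrable_\<Omega> square_integrable_mult rep_l2_si)
    show "(\<lambda>x. a x $ i $ j * rep_l2 (grad u $ j) x * rep_l2 (grad w $ i) x) \<in> borel_measurable (lebesgue_on \<Omega>)"
      using elliptic by (intro borel_measurable_times rep_l2_measurable_\<Omega>) (auto simp: elliptic_coefficients_def Linf_def)
    show "AE x in lebesgue_on \<Omega>. norm (a x $ i $ j * rep_l2 (grad u $ j) x * rep_l2 (grad w $ i) x)
        \<le> norm (K * (rep_l2 (grad u $ j) x * rep_l2 (grad w $ i) x))"
      using K(2)
    proof eventually_elim
      case (elim x)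
      from mult_right_mono[OF this, of "\<bar>rep_l2 (grad u $ j) x * rep_l2 (grad w $ i) x\<bar>"] K(1)
      show ?case by (simp add: abs_mult mult.assoc)
    qed
  qed
qed

lemma potential_bound:
  assumes "u \<in> H10 \<Omega>"
  shows "integrable (lebesgue_on \<Omega>) (\<lambda>x. \<bar>\<beta> x\<bar> * (h1_fun u x)\<^sup>2)"
    "\<nu> > 0 \<Longrightarrow> (LINT x|lebesgue_on \<Omega>. \<bar>\<beta> x\<bar> * (h1_fun u x)\<^sup>2) \<le>
      \<nu> * (LINT x|lebesgue_on \<Omega>. (norm (grad_fun u x))\<^sup>2) + Cn \<nu> * (LINT x|lebesgue_on \<Omega>. (h1_fun u x)\<^sup>2)"
    "form \<Omega> a \<beta> u u \<ge> lam * (LINT x|lebesgue_on \<Omega>. (h1_fun u x)\<^sup>2)"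
  using potential assms zero_less_one unfolding admissible_potential_def by blast+

lemma integrable_potential:
  assumes "u \<in> H10 \<Omega>" "w \<in> H10 \<Omega>"
  shows "integrable (lebesgue_on \<Omega>) (\<lambda>x. \<beta> x * h1_fun u x * h1_fun w x)"
proof (rule Bochner_Integration.integrable_bound)
  show "integrable (lebesgue_on \<Omega>) (\<lambda>x. \<bar>\<beta> x\<bar> * (h1_fun u x)\<^sup>2 + \<bar>\<beta> x\<bar> * (h1_fun w x)\<^sup>2)"
    by (intro Bochner_Integration.integrable_add potential_bound assms)
  show "(\<lambda>x. \<beta> x * h1_fun u x * h1_fun w x) \<in> borel_measurable (lebesgue_on \<Omega>)"
    using potential by (intro borel_measurable_times rep_l2_measurable_\<Omega>) (simp add: admissible_potential_def)
  have "\<bar>p * q\<bar> \<le> p\<^sup>2 + q\<^sup>2" for p q :: real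
    using sum_squares_bound[of "\<bar>p\<bar>" "\<bar>q\<bar>"] abs_ge_zero[of "p * q"] unfolding power2_abs abs_mult by linarith
  from mult_left_mono[OF this, of "\<bar>\<beta> x\<bar>" for x]
  show "AE x in lebesgue_on \<Omega>. norm (\<beta> x * h1_fun u x * h1_fun w x) \<le> norm (\<bar>\<beta> x\<bar> * (h1_fun u x)\<^sup>2 + \<bar>\<beta> x\<bar> * (h1_fun w x)\<^sup>2)"
    by (simp add: abs_mult distrib_left mult.assoc)
qed

lemmas H10_add = subspace_add[OF subspace_H10] and H10_scale = subspace_scale[OF subspace_H10]

lemma form_add:
  assumes "u \<in> H10 \<Omega>" "v \<in> H10 \<Omega>" "w \<in> H10 \<Omega>"
  shows "form \<Omega> a \<beta> (u + v) w = form \<Omega> a \<beta> u w + form \<Omega> a \<beta> v w"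
proof -
  have "AE x in lebesgue_on \<Omega>. (a x *v grad_fun (u + v) x) \<bullet> grad_fun w x =
      (a x *v grad_fun u x) \<bullet> grad_fun w x + (a x *v grad_fun v x) \<bullet> grad_fun w x"
    using AE_\<Omega>[OF grad_fun_add[of u v]] by eventually_elim (simp add: matrix_vector_right_distrib inner_add_left)
  then have "(LINT x|lebesgue_on \<Omega>. (a x *v grad_fun (u + v) x) \<bullet> grad_fun w x) =
      (LINT x|lebesgue_on \<Omega>. (a x *v grad_fun u x) \<bullet> grad_fun w x + (a x *v grad_fun v x) \<bullet> grad_fun w x)"
    by (intro integral_cong_AE borel_measurable_integrable Bochner_Integration.integrable_add integrable_principal)
  moreover have "AE x in lebesgue_on \<Omega>. \<beta> x * h1_fun (u + v) x * h1_fun w x =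
      \<beta> x * h1_fun u x * h1_fun w x + \<beta> x * h1_fun v x * h1_fun w x"
    using AE_\<Omega>[OF rep_l2_add[of "h1_l2 u" "h1_l2 v"]] by eventually_elim (simp add: h1_l2_linear algebra_simps)
  then have "(LINT x|lebesgue_on \<Omega>. \<beta> x * h1_fun (u + v) x * h1_fun w x) =
      (LINT x|lebesgue_on \<Omega>. \<beta> x * h1_fun u x * h1_fun w x + \<beta> x * h1_fun v x * h1_fun w x)"
    by (intro integral_cong_AE borel_measurable_integrable Bochner_Integration.integrable_add integrable_potential H10_add assms)
  ultimately show ?thesis
    unfolding form_def
    by (simp add: Bochner_Integration.integral_add[OF integrable_principal integrable_principal]
        Bochner_Integration.integral_add[OF integrable_potential[OF assms(1,3)] integrable_potential[OF assms(2,3)]])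
qed

lemma form_scale:
  assumes "u \<in> H10 \<Omega>" "w \<in> H10 \<Omega>"
  shows "form \<Omega> a \<beta> (c *\<^sub>R u) w = c * form \<Omega> a \<beta> u w"
proof -
  have "AE x in lebesgue_on \<Omega>. (a x *v grad_fun (c *\<^sub>R u) x) \<bullet> grad_fun w x = c * ((a x *v grad_fun u x) \<bullet> grad_fun w x)"
    using AE_\<Omega>[OF grad_fun_scale[of c u]] by eventually_elim (simp add: matrix_vector_mult_scaleR)
  then have "(LINT x|lebesgue_on \<Omega>. (a x *v grad_fun (c *\<^sub>R u) x) \<bullet> grad_fun w x) =
      (LINT x|lebesgue_on \<Omega>. c * ((a x *v grad_fun u x) \<bullet> grad_fun w x))"
    by (intro integral_cong_AE borel_measurable_integrable integrable_mult_right integrable_principal)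
  moreover have "AE x in lebesgue_on \<Omega>. \<beta> x * h1_fun (c *\<^sub>R u) x * h1_fun w x = c * (\<beta> x * h1_fun u x * h1_fun w x)"
    using AE_\<Omega>[OF rep_l2_scale[of c "h1_l2 u"]] by eventually_elim (simp add: h1_l2_linear)
  then have "(LINT x|lebesgue_on \<Omega>. \<beta> x * h1_fun (c *\<^sub>R u) x * h1_fun w x) =
      (LINT x|lebesgue_on \<Omega>. c * (\<beta> x * h1_fun u x * h1_fun w x))"
    by (intro integral_cong_AE borel_measurable_integrable integrable_mult_right integrable_potential H10_scale assms)
  ultimately show ?thesis unfolding form_def by (simp add: distrib_left)
qed

lemma form_sym: "form \<Omega> a \<beta> u w = form \<Omega> a \<beta> w u"
proof -
  have "AE x in lebesgue_on \<Omega>. \<forall>i\<in>UNIV. \<forall>j\<in>UNIV. a x $ i $ j = a x $ j $ i"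
    using elliptic by (intro AE_finite_allI) (auto simp: elliptic_coefficients_def)
  then have "AE x in lebesgue_on \<Omega>. (a x *v grad_fun u x) \<bullet> grad_fun w x = (a x *v grad_fun w x) \<bullet> grad_fun u x"
  proof eventually_elim
    case (elim x)
    have "(\<Sum>i\<in>UNIV. \<Sum>j\<in>UNIV. a x $ i $ j * grad_fun u x $ j * grad_fun w x $ i) =
        (\<Sum>j\<in>UNIV. \<Sum>i\<in>UNIV. a x $ i $ j * grad_fun u x $ j * grad_fun w x $ i)"
      by (rule sum.swap)
    also have "\<dots> = (\<Sum>j\<in>UNIV. \<Sum>i\<in>UNIV. a x $ j $ i * grad_fun w x $ i * grad_fun u x $ j)"
      by (intro sum.cong refl) (use elim in \<open>simp add: mult_ac\<close>)
    finally show ?case unfolding matrix_vector_inner .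
  qed
  then have "(LINT x|lebesgue_on \<Omega>. (a x *v grad_fun u x) \<bullet> grad_fun w x) = (LINT x|lebesgue_on \<Omega>. (a x *v grad_fun w x) \<bullet> grad_fun u x)"
    by (intro integral_cong_AE borel_measurable_integrable integrable_principal)
  then show ?thesis unfolding form_def by (simp add: mult_ac)
qed

lemma integral_L2:
  assumes "w \<in> L2 \<Omega>" shows "(LINT x|lebesgue_on \<Omega>. (rep_l2 w x)\<^sup>2) = (norm w)\<^sup>2"
proof -
  have "(LINT x|lebesgue_on \<Omega>. (rep_l2 w x)\<^sup>2) = (LINT x|lebesgue. indicator \<Omega> x *\<^sub>R (rep_l2 w x)\<^sup>2)"
    using \<Omega> by (subst integral_restrict_space) auto
  also have "\<dots> = (LINT x|lebesgue. (rep_l2 w x)\<^sup>2)"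
    by (rule integral_cong_AE)
      (use assms \<Omega> rep_l2_measurable in \<open>auto simp: L2_def indicator_def elim!: eventually_mono\<close>)
  finally show ?thesis by (simp add: norm_rep_l2)
qed

lemma form_zero: "w \<in> H10 \<Omega> \<Longrightarrow> form \<Omega> a \<beta> 0 w = 0"
  using form_scale[of 0 w 0] subspace_0[OF subspace_H10] by simp

text \<open>The reciprocal of the factor by which the form dominates the square of the norm,
  computed with \<open>\<nu> = a0 / 2\<close>. Only \<open>a0\<close>, \<open>lam\<close> and
  \<open>Cn\<close> enter.\<close>

definition coercivity :: real where "coercivity = 1 / ((1 + Cn (a0 / 2) / lam) * (2 / a0) + 1 / lam)"

context
  assumes inj: "inj_on h1_l2 (H10 \<Omega>)"
begin

lemma integral_grad:
  assumes "u \<in> H10 \<Omega>"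
  shows "(LINT x|lebesgue_on \<Omega>. (norm (grad_fun u x))\<^sup>2) = (\<Sum>i\<in>UNIV. (norm (grad u $ i))\<^sup>2)"
proof -
  have "integrable (lebesgue_on \<Omega>) (\<lambda>x. (rep_l2 (grad u $ i) x)\<^sup>2)" for i
    using rep_l2_si by (intro integrable_\<Omega>) (simp add: square_integrable_def)
  then show ?thesis
    unfolding power2_norm_grad_fun
    by (simp add: Bochner_Integration.integral_sum integral_L2[OF H10_grad_L2[OF \<Omega> inj assms]])
qed

text \<open>With \<open>\<nu> = a0 / 2\<close> half of the ellipticity survives the potential, up to
  a multiple of the squared \<open>L^2\<close> norm, which \<open>lam\<close> bounds by the form
  itself; the upper bound takes \<open>\<nu> = 1\<close>. Injectivity enters because gradients must
  vanish outside \<open>\<Omega>\<close> for integrals over \<open>\<Omega>\<close> to see the full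
  norm.\<close>

lemma form_estimates:
  assumes u: "u \<in> H10 \<Omega>"
  shows "lam * (norm (h1_l2 u))\<^sup>2 \<le> form \<Omega> a \<beta> u u"
    "coercivity * (norm u)\<^sup>2 \<le> form \<Omega> a \<beta> u u" "form \<Omega> a \<beta> u u \<le> (a1 + 1 + Cn 1) * (norm u)\<^sup>2"
proof -
  define G where "G = (\<Sum>i\<in>UNIV. (norm (grad u $ i))\<^sup>2)"
  define N where "N = (norm (h1_l2 u))\<^sup>2"
  define Q where "Q = (LINT x|lebesgue_on \<Omega>. (a x *v grad_fun u x) \<bullet> grad_fun u x)"
  define B where "B = (LINT x|lebesgue_on \<Omega>. \<beta> x * h1_fun u x * h1_fun u x)"
  define B' where "B' = (LINT x|lebesgue_on \<Omega>. \<bar>\<beta> x\<bar> * (h1_fun u x)\<^sup>2)"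
  have nonneg: "G \<ge> 0" "N \<ge> 0" by (auto simp: G_def N_def intro: sum_nonneg)
  have form: "form \<Omega> a \<beta> u u = Q + B" by (simp add: form_def Q_def B_def)
  have norm: "(norm u)\<^sup>2 = N + G" unfolding norm_h1_eq N_def G_def ..
  have N: "(LINT x|lebesgue_on \<Omega>. (h1_fun u x)\<^sup>2) = N" unfolding N_def by (rule integral_L2[OF H10_L2[OF \<Omega> u]])
  have G: "(LINT x|lebesgue_on \<Omega>. (norm (grad_fun u x))\<^sup>2) = G" unfolding G_def by (rule integral_grad[OF u])
  have G_int: "integrable (lebesgue_on \<Omega>) (\<lambda>x. (norm (grad_fun u x))\<^sup>2)"
    unfolding power2_norm_grad_fun using rep_l2_si
    by (intro Bochner_Integration.integrable_sum integrable_\<Omega>) (simp add: square_integrable_def)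
  have ell: "AE x in lebesgue_on \<Omega>. a0 * (norm (grad_fun u x))\<^sup>2 \<le> (a x *v grad_fun u x) \<bullet> grad_fun u x \<and>
      (a x *v grad_fun u x) \<bullet> grad_fun u x \<le> a1 * (norm (grad_fun u x))\<^sup>2"
  proof -
    have "AE x in lebesgue_on \<Omega>. \<forall>\<xi>. a0 * (norm \<xi>)\<^sup>2 \<le> (\<Sum>i\<in>UNIV. \<Sum>j\<in>UNIV. a x $ i $ j * \<xi> $ i * \<xi> $ j) \<and>
        (\<Sum>i\<in>UNIV. \<Sum>j\<in>UNIV. a x $ i $ j * \<xi> $ i * \<xi> $ j) \<le> a1 * (norm \<xi>)\<^sup>2"
      using elliptic by (simp add: elliptic_coefficients_def)
    then show ?thesis
    proof eventually_elim
      case (elim x)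
      then show ?case using elim[rule_format, of "grad_fun u x"] unfolding matrix_vector_inner by (simp add: mult_ac)
    qed
  qed
  have "(LINT x|lebesgue_on \<Omega>. a0 * (norm (grad_fun u x))\<^sup>2) \<le> Q" "Q \<le> (LINT x|lebesgue_on \<Omega>. a1 * (norm (grad_fun u x))\<^sup>2)"
    unfolding Q_def by (intro integral_mono_AE integrable_mult_right integrable_principal G_int; use ell in \<open>auto elim: eventually_mono\<close>)+
  then have Q: "a0 * G \<le> Q" "Q \<le> a1 * G" by (simp_all add: G)
  have "norm B \<le> (LINT x|lebesgue_on \<Omega>. norm (\<beta> x * h1_fun u x * h1_fun u x))" unfolding B_def by (rule integral_norm_bound)
  also have "\<dots> = B'" unfolding B'_def by (simp add: abs_mult power2_eq_square mult.assoc)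
  finally have B: "\<bar>B\<bar> \<le> B'" by simp
  have B': "B' \<le> \<nu> * G + Cn \<nu> * N" if "\<nu> > 0" for \<nu> using potential_bound(2)[OF u that] by (simp add: B'_def N G)
  show lower: "lam * (norm (h1_l2 u))\<^sup>2 \<le> form \<Omega> a \<beta> u u" using potential_bound(3)[OF u] by (simp add: N N_def)
  define c where "c = Cn (a0 / 2)"
  have c: "c > 0" using pos by (simp add: c_def)
  have N_le: "N \<le> form \<Omega> a \<beta> u u / lam" using lower pos by (simp add: N_def field_simps)
  have "a0 * G - (a0 / 2 * G + c * N) \<le> form \<Omega> a \<beta> u u" 
  proof -
    have "a0 * G = a0 / 2 * G + a0 / 2 * G" by simp
    then show ?thesis using Q(1) B B'[of "a0 / 2"] pos(1) unfolding form c_def by linarith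
  qed
  then have "a0 / 2 * G \<le> form \<Omega> a \<beta> u u + c * N" by (simp add: field_simps)
  also have "\<dots> \<le> form \<Omega> a \<beta> u u + c * (form \<Omega> a \<beta> u u / lam)" using N_le c by (intro add_left_mono mult_left_mono) auto
  also have "\<dots> = (1 + c / lam) * form \<Omega> a \<beta> u u" by (simp add: algebra_simps)
  finally have "G * (a0 / 2) \<le> (1 + c / lam) * form \<Omega> a \<beta> u u" by (simp add: mult.commute)
  then have "G \<le> (1 + c / lam) * (2 / a0) * form \<Omega> a \<beta> u u" using pos by (simp add: field_simps)
  then have "(norm u)\<^sup>2 \<le> ((1 + c / lam) * (2 / a0) + 1 / lam) * form \<Omega> a \<beta> u u"
    using N_le unfolding norm by (simp add: distrib_right)
  moreover have "(1 + c / lam) * (2 / a0) + 1 / lam > 0" using c pos by (intro add_pos_pos mult_pos_pos) auto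
  ultimately show "coercivity * (norm u)\<^sup>2 \<le> form \<Omega> a \<beta> u u"
    unfolding coercivity_def c_def[symmetric] by (simp add: divide_le_eq mult.commute)
  have "form \<Omega> a \<beta> u u \<le> a1 * G + (G + Cn 1 * N)" using Q(2) B B'[of 1] form by simp
  also have "\<dots> \<le> (a1 + 1 + Cn 1) * (norm u)\<^sup>2"
    using pos(2) pos(4)[of 1] nonneg unfolding norm by (simp add: algebra_simps)
  finally show "form \<Omega> a \<beta> u u \<le> (a1 + 1 + Cn 1) * (norm u)\<^sup>2" .
qed

end

lemma coercivity_pos: "coercivity > 0"
proof -
  have "Cn (a0 / 2) > 0" using pos by simp
  then show ?thesis unfolding coercivity_def using pos by (intro divide_pos_pos add_pos_pos mult_pos_pos) auto
qed

section \<open>Embedding properties extracted from the semigroup\<close>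

context
  fixes \<epsilon> :: real and T
  assumes semigroup: "C0_semigroup_on (Z0 \<Omega>) T" and gen: "generator (Z0 \<Omega>) T = op_B \<Omega> a \<beta> \<epsilon>"
begin

text \<open>The generator is single valued, so a first component \<open>v\<close> of its value at \<open>(0, h1_l2 v)\<close> is
  determined by \<open>h1_l2 v\<close>.\<close>

lemma h1_l2_inj_on: "inj_on h1_l2 (H10 \<Omega>)"
proof (rule inj_onI)
  fix v v' assume v: "v \<in> H10 \<Omega>" "v' \<in> H10 \<Omega>" "h1_l2 v = h1_l2 v'"
  have "0 \<in> dom_A \<Omega> a \<beta>"
    unfolding dom_A_def using form_zero subspace_0[OF subspace_H10] subspace_0[OF subspace_L2[OF \<Omega>]]
    by (auto intro!: bexI[of _ 0])
  then have "((0, h1_l2 v), (w, - (1 / \<epsilon>) *\<^sub>R (h1_l2 w + op_A \<Omega> a \<beta> 0))) \<in> generator (Z0 \<Omega>) T"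
    if "w \<in> {v, v'}" for w
    using that v unfolding gen op_B_def by auto
  then have "((\<lambda>h. (T h (0, h1_l2 v) - (0, h1_l2 v)) /\<^sub>R h) \<longlongrightarrow> (w, - (1 / \<epsilon>) *\<^sub>R (h1_l2 w + op_A \<Omega> a \<beta> 0))) (at_right 0)"
    if "w \<in> {v, v'}" for w
    using that unfolding generator_def by blast
  from tendsto_unique[OF _ this[of v] this[of v']] show "v = v'" by (simp add: trivial_limit_at_right_real)
qed

text \<open>Second components of elements in the domain of the generator are in the range of
  \<open>h1_l2\<close>, and the domain is dense.\<close>

lemma L2_subset_closure: "L2 \<Omega> \<subseteq> closure (h1_l2 ` H10 \<Omega>)"
proof
  fix y assume y: "y \<in> L2 \<Omega>"
  interpret c0_semigroup "Z0 \<Omega>" T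
    using semigroup unfolding Z0_def
    by unfold_locales (auto intro: subspace_Times subspace_H10 subspace_L2[OF \<Omega>] closed_Times closed_H10 closed_L2[OF \<Omega>])
  have mem: "(0, y) \<in> Z0 \<Omega>" using y subspace_0[OF subspace_H10] by (simp add: Z0_def)
  show "y \<in> closure (h1_l2 ` H10 \<Omega>)"
    unfolding closure_approachable
  proof (intro allI impI)
    fix e :: real assume "e > 0"
    then obtain z z' where z: "(z, z') \<in> generator (Z0 \<Omega>) T" "dist z (0, y) < e"
      using generator_domain_dense[OF mem] by blast
    then obtain v where v: "v \<in> H10 \<Omega>" "snd z = h1_l2 v" unfolding gen op_B_def by auto
    have "dist (h1_l2 v) y < e" using dist_snd_le[of z "(0, y)"] z(2) v(2) by simp
    then show "\<exists>x\<in>h1_l2 ` H10 \<Omega>. dist x y < e" using v(1) by blast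
  qed
qed

lemma wave_form: "wave_form (H10 \<Omega>) (L2 \<Omega>) h1_l2 (form \<Omega> a \<beta>) coercivity (a1 + 1 + Cn 1) lam"
  by (rule wave_form.intro)
    (use coercivity_pos pos(2,3) pos(4)[of 1] in \<open>auto intro: subspace_H10 closed_H10 subspace_L2[OF \<Omega>] closed_L2[OF \<Omega>] bounded_linear_h1_l2
      h1_l2_inj_on H10_L2[OF \<Omega>] subsetD[OF L2_subset_closure] form_add form_scale form_sym
      form_estimates[OF h1_l2_inj_on]\<close>)

end

end

section \<open>The damped wave equation\<close>

text \<open>\<open>4096\<close> is \<open>4 ^ 6\<close>, and the \<open>L^2\<close> norm is at most
  \<open>norm u\<close>, so the factor \<open>4\<close> serves both exponents.\<close>

lemma L26_bound_H10:
  assumes "u \<in> H10 \<Omega>" shows "L26_bound (h1_fun u) (4 * norm u)"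
proof -
  have "(\<integral>\<^sup>+x. ennreal ((h1_fun u x)\<^sup>2) \<partial>lebesgue) = ennreal ((norm (h1_l2 u))\<^sup>2)"
    using norm_mk_l2_nn_integral[OF rep_l2_si] by (simp add: mk_l2_rep(2))
  also have "\<dots> \<le> ennreal ((4 * norm u)\<^sup>2)"
    by (rule ennreal_leI, rule power_mono) (use norm_h1_ge(1)[of u] norm_ge_zero[of u] in \<open>linarith, simp\<close>)
  finally have "(\<integral>\<^sup>+x. ennreal ((h1_fun u x)\<^sup>2) \<partial>lebesgue) \<le> ennreal ((4 * norm u)\<^sup>2)" .
  moreover have "(\<integral>\<^sup>+x. ennreal ((h1_fun u x) ^ 6) \<partial>lebesgue) \<le> ennreal ((4 * norm u) ^ 6)"
    using sobolev_H10[OF assms] by (subst nn_integral_eq_integral) (auto simp: power_mult_distrib intro!: ennreal_leI)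
  ultimately show ?thesis by (simp add: L26_bound_def rep_l2_measurable)
qed

text \<open>The sum of the constants of all estimates, so that a single \<open>L\<close> serves:
  \<open>K0 + m * A\<close> bounds the operator, \<open>\<kappa> * A\<close> its increments and its
  derivative, and the last term the variation of the derivative and the Taylor error.\<close>

definition nemytskii_lipschitz :: "real \<Rightarrow> real \<Rightarrow> real \<Rightarrow> real \<Rightarrow> real \<Rightarrow> real \<Rightarrow> real" where
  "nemytskii_lipschitz C K0 K1 K2 \<kappa> m =
     (let A = K1 + 2 * m * (K2 + 3 * C * m) in K0 + m * A + \<kappa> * A + \<kappa> * \<kappa> * (K2 + 3 * C * m))"

locale wave_problem = wave_coefficients \<Omega> a \<beta> a0 a1 lam Cn + cubic_nonlinearity \<Omega> C K0 K1 K2 f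
  for \<Omega> a \<beta> a0 a1 lam Cn C K0 K1 K2 f +
  fixes \<epsilon> R :: real and T
  assumes eps: "0 < \<epsilon>" "\<epsilon> \<le> 1"
    and semigroup: "C0_semigroup_on (Z0 \<Omega>) T" and gen: "generator (Z0 \<Omega>) T = op_B \<Omega> a \<beta> \<epsilon>"
begin

sublocale wave_form "H10 \<Omega>" "L2 \<Omega>" h1_l2 "form \<Omega> a \<beta>" coercivity "a1 + 1 + Cn 1" lam
  by (rule wave_form[OF semigroup gen])

abbreviation "E x \<equiv> sqrt (form \<Omega> a \<beta> x x)"

text \<open>Converts the energy norm into the joint bound for \<open>L^2\<close> and
  \<open>L^6\<close>: \<open>4\<close> stems from the Sobolev inequality, the root from coercivity.
  The absolute value in \<open>m\<close> keeps this radius nonnegative for every real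
  \<open>R\<close>.\<close>

definition \<kappa> :: real where "\<kappa> = 4 / sqrt coercivity"
definition m :: real where "m = \<kappa> * sqrt \<bar>R\<bar>"

lemma \<kappa>: "\<kappa> > 0" and m: "m \<ge> 0"
  using coercivity_pos by (auto simp: \<kappa>_def m_def)

lemma L26_form: assumes "u \<in> H10 \<Omega>" shows "L26_bound (h1_fun u) (\<kappa> * E u)"
proof (rule L26_bound_mono[OF L26_bound_H10[OF assms]])
  have "sqrt (coercivity * (norm u)\<^sup>2) \<le> E u" using coercive[OF assms] by (rule real_sqrt_le_mono)
  then have "sqrt coercivity * norm u \<le> E u" by (simp add: real_sqrt_mult)
  then show "4 * norm u \<le> \<kappa> * E u" using coercivity_pos by (simp add: \<kappa>_def field_simps)
qed

lemma L26_ball: assumes "u \<in> H10 \<Omega>" "form \<Omega> a \<beta> u u \<le> R" shows "L26_bound (h1_fun u) m"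
  using L26_bound_mono[OF L26_form[OF assms(1)], of m] \<kappa> assms(2) by (simp add: m_def)

lemma L26_diff: assumes "u \<in> H10 \<Omega>" "v \<in> H10 \<Omega>" shows "L26_bound (\<lambda>x. h1_fun u x - h1_fun v x) (\<kappa> * E (u - v))"
  by (rule L26_bound_cong_AE[OF L26_form[OF V_diff[OF assms]]]) (simp add: J_simps rep_l2_diff)

definition P :: "h1 \<Rightarrow> h1 \<Rightarrow> l2" where
  "P c w = mk_l2 (\<lambda>x. F' (h1_fun c) x * h1_fun w x)"

lemma nemytskii_eq: "nemytskii \<Omega> f u = mk_l2 (F (h1_fun u))"
  by (simp add: nemytskii_def F_def[abs_def])

lemma si:
  assumes "c \<in> H10 \<Omega>" "form \<Omega> a \<beta> c c \<le> R"
  shows "w \<in> H10 \<Omega> \<Longrightarrow> square_integrable lebesgue (\<lambda>x. F' (h1_fun c) x * h1_fun w x)"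
    "square_integrable lebesgue (F (h1_fun c))"
  using deriv_mult_bound[OF L26_ball[OF assms] L26_form, of w] F_bound[OF L26_ball[OF assms]] by (simp_all add: L2_bound_def)

lemma mk_l2_cong: "square_integrable lebesgue g \<Longrightarrow> square_integrable lebesgue h \<Longrightarrow> AE x in lebesgue. g x = h x \<Longrightarrow> mk_l2 g = mk_l2 h"
  by (simp add: mk_l2_eq_iff)

lemma P_diff_right:
  assumes c: "c \<in> H10 \<Omega>" "form \<Omega> a \<beta> c c \<le> R" and w: "w \<in> H10 \<Omega>" "w' \<in> H10 \<Omega>"
  shows "P c (w - w') = mk_l2 (\<lambda>x. F' (h1_fun c) x * (h1_fun w x - h1_fun w' x))"
  unfolding P_def
proof (rule mk_l2_cong)
  show "square_integrable lebesgue (\<lambda>x. F' (h1_fun c) x * h1_fun (w - w') x)" by (intro si c w V_diff)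
  show "square_integrable lebesgue (\<lambda>x. F' (h1_fun c) x * (h1_fun w x - h1_fun w' x))"
    using square_integrable_diff[OF si(1)[OF c w(1)] si(1)[OF c w(2)]] by (simp add: right_diff_distrib)
  show "AE x in lebesgue. F' (h1_fun c) x * h1_fun (w - w') x = F' (h1_fun c) x * (h1_fun w x - h1_fun w' x)"
    using rep_l2_diff[of "h1_l2 w" "h1_l2 w'"] by eventually_elim (simp add: J_simps)
qed

abbreviation "A \<equiv> K1 + 2 * m * (K2 + 3 * C * m)"
abbreviation "B \<equiv> K2 + 3 * C * m"
abbreviation "L \<equiv> nemytskii_lipschitz C K0 K1 K2 \<kappa> m"

lemma AB: "A \<ge> 0" "B \<ge> 0" using C K m by (auto intro!: add_nonneg_nonneg mult_nonneg_nonneg)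

lemma L_ge: "L \<ge> K0 + m * A" "L \<ge> \<kappa> * A" "L \<ge> \<kappa> * \<kappa> * B" "L \<ge> 0"
proof -
  have "m * A \<ge> 0" "\<kappa> * A \<ge> 0" "\<kappa> * \<kappa> * B \<ge> 0" using AB m \<kappa> by (auto intro!: mult_nonneg_nonneg)
  then show "L \<ge> K0 + m * A" "L \<ge> \<kappa> * A" "L \<ge> \<kappa> * \<kappa> * B" "L \<ge> 0"
    using K unfolding nemytskii_lipschitz_def Let_def by linarith+
qed

text \<open>The product estimates are applied with \<open>m\<close> for points of the ball and
  \<open>\<kappa> * E\<close> for increments and directions.\<close>

lemma wave_nonlinearity: "wave_nonlinearity (H10 \<Omega>) (L2 \<Omega>) h1_l2 (form \<Omega> a \<beta>) coercivity (a1 + 1 + Cn 1) lam (nemytskii \<Omega> f) P R L"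
proof
  show "L \<ge> 0" by (rule L_ge)
  fix x y c w w' assume x: "x \<in> H10 \<Omega>"
  show "nemytskii \<Omega> f x \<in> L2 \<Omega>"
  proof -
    have "square_integrable lebesgue (F (h1_fun x))" using F_bound[OF L26_form[OF x]] by (simp add: L2_bound_def)
    from rep_mk_l2[OF this] show ?thesis
      unfolding nemytskii_eq L2_def by (auto simp: F_def elim!: eventually_mono)
  qed
  assume xR: "form \<Omega> a \<beta> x x \<le> R"
  note Lx = L26_ball[OF x xR]
  show "norm (nemytskii \<Omega> f x) \<le> L"
    using F_bound[OF Lx] L_ge(1) by (simp add: nemytskii_eq L2_bound_def)
  {
    assume w: "w \<in> H10 \<Omega>"
    note n = L26_form[OF w]
    have E0: "E w \<ge> 0" using a_nonneg[OF w] by simp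
    show "P x (k *\<^sub>R w) = k *\<^sub>R P x w" for k
      unfolding P_def mk_l2_scale[OF si(1)[OF x xR w]]
      by (rule mk_l2_cong) (use si(1)[OF x xR V_scale[OF w]] square_integrable_scale[OF si(1)[OF x xR w]]
          rep_l2_scale[of k "h1_l2 w"] in \<open>auto simp: J_simps elim!: eventually_mono\<close>)
    have "norm (P x w) \<le> K1 * (\<kappa> * E w) + (K2 * (m * (\<kappa> * E w)) + C * (m * m * (\<kappa> * E w)))"
      using deriv_mult_bound[OF Lx n] by (simp add: P_def L2_bound_def)
    also have "\<dots> \<le> (\<kappa> * A) * E w"
    proof -
      \<comment> \<open>The excess of \<open>A\<close>, which contains \<open>2 * m * K2\<close> and
        \<open>6 * C * m * m\<close>, over the constant just obtained.\<close>
      have "0 \<le> (\<kappa> * E w) * (m * K2 + 5 * (C * m * m))" using \<kappa> E0 m K C by (intro mult_nonneg_nonneg add_nonneg_nonneg) auto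
      then show ?thesis by (simp add: algebra_simps)
    qed
    also have "\<dots> \<le> L * E w" by (intro mult_right_mono L_ge E0)
    finally show "norm (P x w) \<le> L * E w" .
    {
      assume w': "w' \<in> H10 \<Omega>"
      show "P x (w + w') = P x w + P x w'"
        unfolding P_def mk_l2_add[OF si(1)[OF x xR w] si(1)[OF x xR w']]
        by (rule mk_l2_cong) (use si(1)[OF x xR V_add[OF w w']] square_integrable_add[OF si(1)[OF x xR w] si(1)[OF x xR w']]
            rep_l2_add[of "h1_l2 w" "h1_l2 w'"] in \<open>auto simp: J_simps distrib_left elim!: eventually_mono\<close>)
      have "P x z \<bullet> h1_l2 z' = (LINT t|lebesgue. F' (h1_fun x) t * h1_fun z t * h1_fun z' t)" if "z \<in> H10 \<Omega>" for z z'
        using inner_mk_l2[OF si(1)[OF x xR that] rep_l2_si, of "h1_l2 z'"] by (simp add: P_def mk_l2_rep(2))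
      then show "P x w \<bullet> h1_l2 w' = P x w' \<bullet> h1_l2 w" using w w' by (simp add: mult_ac)
    }
  }
  assume y: "y \<in> H10 \<Omega>" and yR: "form \<Omega> a \<beta> y y \<le> R"
  note Ly = L26_ball[OF y yR] and Lxy = L26_diff[OF x y]
  have Exy: "E (x - y) \<ge> 0" using a_nonneg[OF V_diff[OF x y]] by simp
  have "nemytskii \<Omega> f x - nemytskii \<Omega> f y = mk_l2 (\<lambda>t. F (h1_fun x) t - F (h1_fun y) t)"
    unfolding nemytskii_eq by (rule mk_l2_diff[OF si(2)[OF x xR] si(2)[OF y yR]])
  then have "norm (nemytskii \<Omega> f x - nemytskii \<Omega> f y) \<le> \<kappa> * E (x - y) * A"
    using F_diff_bound[OF Lx Ly Lxy] by (simp add: L2_bound_def)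
  also have "\<dots> = (\<kappa> * A) * E (x - y)" by (simp only: mult_ac)
  also have "\<dots> \<le> L * E (x - y)" by (intro mult_right_mono L_ge Exy)
  finally show "norm (nemytskii \<Omega> f x - nemytskii \<Omega> f y) \<le> L * E (x - y)" .
  {
    assume w: "w \<in> H10 \<Omega>"
    note n = L26_form[OF w]
    have E0: "E w \<ge> 0" "form \<Omega> a \<beta> w w \<ge> 0" using a_nonneg[OF w] by simp_all
    have P_diff: "P x w - P y w = mk_l2 (\<lambda>t. F' (h1_fun x) t * h1_fun w t - F' (h1_fun y) t * h1_fun w t)"
      unfolding P_def by (rule mk_l2_diff[OF si(1)[OF x xR w] si(1)[OF y yR w]])
    \<comment> \<open>\<open>B\<close> contains \<open>3 * C * m\<close>, of which two thirds are
      used here.\<close>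
    have le_B: "K2 * (s * t) + (C * (m * s * t) + C * (m * s * t)) \<le> B * (s * t)" if "s * t \<ge> 0" for s t
    proof -
      have "0 \<le> C * m * (s * t)" by (rule mult_nonneg_nonneg[OF mult_nonneg_nonneg[OF C m] that])
      then show ?thesis by (simp add: algebra_simps)
    qed
    have "norm (P x w - P y w) \<le> K2 * ((\<kappa> * E (x - y)) * (\<kappa> * E w)) + (C * (m * (\<kappa> * E (x - y)) * (\<kappa> * E w)) + C * (m * (\<kappa> * E (x - y)) * (\<kappa> * E w)))"
      using deriv_diff_bound[OF Lx Ly Lxy n] unfolding P_diff by (simp add: L2_bound_def)
    also have "\<dots> \<le> B * ((\<kappa> * E (x - y)) * (\<kappa> * E w))"
      by (rule le_B) (intro mult_nonneg_nonneg less_imp_le[OF \<kappa>] E0 Exy)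
    also have "\<dots> = (\<kappa> * \<kappa> * B) * (E (x - y) * E w)" by (simp only: mult_ac)
    also have "\<dots> \<le> L * (E (x - y) * E w)" by (intro mult_right_mono L_ge mult_nonneg_nonneg E0 Exy)
    finally show "norm (P x w - P y w) \<le> L * E (x - y) * E w" by (simp only: mult.assoc)
    have Jxy: "mk_l2 (\<lambda>t. h1_fun x t - h1_fun y t) = h1_l2 (x - y)"
      using mk_l2_diff[OF rep_l2_si rep_l2_si, of "h1_l2 x" "h1_l2 y"] by (simp add: mk_l2_rep(2) J_simps)
    have "\<bar>(P x w - P y w) \<bullet> h1_l2 w\<bar> \<le> norm (h1_l2 (x - y)) *
        (K2 * ((\<kappa> * E w) * (\<kappa> * E w)) + (C * (m * (\<kappa> * E w) * (\<kappa> * E w)) + C * (m * (\<kappa> * E w) * (\<kappa> * E w))))"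
      using deriv_diff_weak_bound[OF Lx Ly Lxy n] unfolding P_diff Jxy by (simp add: mk_l2_rep(2))
    also have "\<dots> \<le> norm (h1_l2 (x - y)) * (B * ((\<kappa> * E w) * (\<kappa> * E w)))"
      by (intro mult_left_mono le_B mult_nonneg_nonneg less_imp_le[OF \<kappa>] E0 norm_ge_zero)
    also have "(\<kappa> * E w) * (\<kappa> * E w) = \<kappa> * \<kappa> * form \<Omega> a \<beta> w w"
      using real_sqrt_mult_self[of "form \<Omega> a \<beta> w w"] E0 by (simp add: mult_ac)
    also have "norm (h1_l2 (x - y)) * (B * (\<kappa> * \<kappa> * form \<Omega> a \<beta> w w)) = (\<kappa> * \<kappa> * B) * (norm (h1_l2 (x - y)) * form \<Omega> a \<beta> w w)"
      by (simp only: mult_ac)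
    also have "\<dots> \<le> L * (norm (h1_l2 (x - y)) * form \<Omega> a \<beta> w w)"
      by (intro mult_right_mono L_ge mult_nonneg_nonneg E0 norm_ge_zero)
    finally show "\<bar>(P x w - P y w) \<bullet> h1_l2 w\<bar> \<le> L * norm (h1_l2 (x - y)) * form \<Omega> a \<beta> w w" by (simp only: mult.assoc)
  }
  assume c: "c \<in> H10 \<Omega>" and cR: "form \<Omega> a \<beta> c c \<le> R"
  have Ec: "E (x - c) + E (y - c) \<ge> 0" using a_nonneg[OF V_diff[OF x c]] a_nonneg[OF V_diff[OF y c]] by simp
  have P_si: "square_integrable lebesgue (\<lambda>t. F' (h1_fun c) t * (h1_fun x t - h1_fun y t))"
    using square_integrable_diff[OF si(1)[OF c cR x] si(1)[OF c cR y]] by (simp add: right_diff_distrib)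
  have "nemytskii \<Omega> f x - nemytskii \<Omega> f y - P c (x - y) =
      mk_l2 (\<lambda>t. F (h1_fun x) t - F (h1_fun y) t - F' (h1_fun c) t * (h1_fun x t - h1_fun y t))"
    unfolding nemytskii_eq P_diff_right[OF c cR x y] mk_l2_diff[OF si(2)[OF x xR] si(2)[OF y yR]]
    by (rule mk_l2_diff[OF square_integrable_diff[OF si(2)[OF x xR] si(2)[OF y yR]] P_si])
  then have "norm (nemytskii \<Omega> f x - nemytskii \<Omega> f y - P c (x - y)) \<le> \<kappa> * E (x - y) * (\<kappa> * E (x - c) + \<kappa> * E (y - c)) * B"
    using taylor_bound[OF Lx Ly L26_ball[OF c cR] Lxy L26_diff[OF x c] L26_diff[OF y c]] by (simp add: L2_bound_def)
  also have "\<dots> = (\<kappa> * \<kappa> * B) * ((E (x - c) + E (y - c)) * E (x - y))" by (simp only: distrib_left[symmetric] mult_ac)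
  also have "\<dots> \<le> L * ((E (x - c) + E (y - c)) * E (x - y))" by (intro mult_right_mono L_ge mult_nonneg_nonneg Ec Exy)
  finally show "norm (nemytskii \<Omega> f x - nemytskii \<Omega> f y - P c (x - y)) \<le> L * (E (x - c) + E (y - c)) * E (x - y)"
    by (simp only: mult.assoc)
qed

lemma dom_eq: "dom = dom_A \<Omega> a \<beta>" and op_eq_op_A: "op x = op_A \<Omega> a \<beta> x"
  by (simp_all add: dom_def dom_A_def op_def op_A_def)

end

theorem theorem2p11:
  fixes R a0 a1 lam C K0 K1 K2 :: real and Cn :: "real \<Rightarrow> real"
  assumes "a0 > 0" and "a1 > 0" and "lam > 0" and "\<And>\<nu>. \<nu> > 0 \<Longrightarrow> Cn \<nu> > 0"
    and "C > 0" and "K0 \<ge> 0" and "K1 \<ge> 0" and "K2 \<ge> 0"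
  shows "\<exists>R'>0. \<forall>(\<Omega> :: R3 set) (a :: R3 \<Rightarrow> real^3^3) (\<beta> :: R3 \<Rightarrow> real) (f :: R3 \<Rightarrow> real \<Rightarrow> real)
      (T :: real \<Rightarrow> real \<Rightarrow> h1 \<times> l2 \<Rightarrow> h1 \<times> l2) (u :: real \<Rightarrow> real \<Rightarrow> h1) (v :: real \<Rightarrow> real \<Rightarrow> l2).
    open \<Omega> \<and>
    elliptic_coefficients \<Omega> a0 a1 a \<and>
    admissible_potential \<Omega> Cn lam a \<beta> \<and>
    admissible_nonlinearity \<Omega> C K0 K1 K2 f \<and>
    (\<forall>\<epsilon>\<in>{0<..1}.
       C0_semigroup_on (Z0 \<Omega>) (T \<epsilon>) \<and> generator (Z0 \<Omega>) (T \<epsilon>) = op_B \<Omega> a \<beta> \<epsilon> \<and>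
       full_solution \<Omega> f \<epsilon> (T \<epsilon>) (u \<epsilon>) (v \<epsilon>) \<and>
       bounded (range (\<lambda>t. (u \<epsilon> t, v \<epsilon> t))) \<and>
       (\<forall>t. form \<Omega> a \<beta> (u \<epsilon> t) (u \<epsilon> t) + \<epsilon> * (norm (v \<epsilon> t))\<^sup>2 \<le> R) \<and>
       uniformly_continuous_on UNIV (u \<epsilon>))
    \<longrightarrow>
    (\<forall>\<epsilon>\<in>{0<..1}. \<forall>t. u \<epsilon> t \<in> dom_A \<Omega> a \<beta> \<and>
       (\<exists>w\<in>H10 \<Omega>. h1_l2 w = v \<epsilon> t \<and>
         (\<exists>v'. (v \<epsilon> has_vector_derivative v') (at t) \<and>
           (norm (op_A \<Omega> a \<beta> (u \<epsilon> t)))\<^sup>2 + form \<Omega> a \<beta> w w + \<epsilon> * (norm v')\<^sup>2 \<le> R')))"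
proof -
  \<comment> \<open>The bound must be fixed before the domain and the solution. The coercivity
    constant is available outside its locale because it is a function of \<open>a0\<close>,
    \<open>lam\<close> and \<open>Cn\<close>.\<close>
  define k where "k = 4 / sqrt (wave_coefficients.coercivity a0 lam Cn)"
  define L where "L = nemytskii_lipschitz C K0 K1 K2 k (k * sqrt \<bar>R\<bar>)"
  \<comment> \<open>The maximum ensures positivity whatever the value of
    \<open>wave_bound\<close>.\<close>
  define R' where "R' = max 1 (wave_bound L lam R)"
  show ?thesis
  proof (intro exI[of _ R'] conjI allI impI ballI)
    show "R' > 0" by (simp add: R'_def)
    fix \<Omega> a \<beta> f T u v \<epsilon> t
    assume *: "open \<Omega> \<and> elliptic_coefficients \<Omega> a0 a1 a \<and> admissible_potential \<Omega> Cn lam a \<beta> \<and>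
      admissible_nonlinearity \<Omega> C K0 K1 K2 f \<and>
      (\<forall>\<epsilon>\<in>{0<..1}.
       C0_semigroup_on (Z0 \<Omega>) (T \<epsilon>) \<and> generator (Z0 \<Omega>) (T \<epsilon>) = op_B \<Omega> a \<beta> \<epsilon> \<and>
       full_solution \<Omega> f \<epsilon> (T \<epsilon>) (u \<epsilon>) (v \<epsilon>) \<and>
       bounded (range (\<lambda>t. (u \<epsilon> t, v \<epsilon> t))) \<and>
       (\<forall>t. form \<Omega> a \<beta> (u \<epsilon> t) (u \<epsilon> t) + \<epsilon> * (norm (v \<epsilon> t))\<^sup>2 \<le> R) \<and>
       uniformly_continuous_on UNIV (u \<epsilon>))" and \<epsilon>: "\<epsilon> \<in> {0<..1::real}"
    interpret wave_coefficients \<Omega> a \<beta> a0 a1 lam Cn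
      using * assms by unfold_locales auto
    interpret wave_problem \<Omega> a \<beta> a0 a1 lam Cn C K0 K1 K2 f \<epsilon> R "T \<epsilon>"
      using * assms \<epsilon> \<Omega> by unfold_locales auto
    have L: "nemytskii_lipschitz C K0 K1 K2 \<kappa> m = L"
      by (simp add: L_def k_def \<kappa>_def m_def)
    have \<epsilon>_sol: "full_solution \<Omega> f \<epsilon> (T \<epsilon>) (u \<epsilon>) (v \<epsilon>)"
      "\<And>t. form \<Omega> a \<beta> (u \<epsilon> t) (u \<epsilon> t) + \<epsilon> * (norm (v \<epsilon> t))\<^sup>2 \<le> R" "uniformly_continuous_on UNIV (u \<epsilon>)"
      using * \<epsilon> by blast+
    interpret W: wave_mild "H10 \<Omega>" "L2 \<Omega>" h1_l2 "form \<Omega> a \<beta>" coercivity "a1 + 1 + Cn 1" lam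
      "nemytskii \<Omega> f" P R L \<epsilon> "T \<epsilon>" "u \<epsilon>" "v \<epsilon>"
    proof (rule wave_mild.intro[OF wave_nonlinearity[unfolded L] wave_mild_axioms.intro])
      show "0 < \<epsilon>" "\<epsilon> \<le> 1" by (rule eps)+
      show "C0_semigroup_on (H10 \<Omega> \<times> L2 \<Omega>) (T \<epsilon>)" using semigroup by (simp add: Z0_def)
      show "generator (H10 \<Omega> \<times> L2 \<Omega>) (T \<epsilon>) =
          {((x, h1_l2 y), (y, - (1 / \<epsilon>) *\<^sub>R (h1_l2 y + op x))) | x y. x \<in> dom \<and> y \<in> H10 \<Omega>}"
        using gen by (simp add: Z0_def op_B_def dom_eq op_eq_op_A)
      show "u \<epsilon> s \<in> H10 \<Omega>" "v \<epsilon> s \<in> L2 \<Omega>" for s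
        using \<epsilon>_sol(1) by (auto simp: full_solution_def Z0_def)
      show "((\<lambda>p. T \<epsilon> (t - p) (0, (1 / \<epsilon>) *\<^sub>R nemytskii \<Omega> f (u \<epsilon> p))) has_integral
          (u \<epsilon> t, v \<epsilon> t) - T \<epsilon> (t - s) (u \<epsilon> s, v \<epsilon> s)) {s..t}" if "s \<le> t" for s t
      proof -
        have "(\<lambda>p. T \<epsilon> (t - p) (0, (1 / \<epsilon>) *\<^sub>R nemytskii \<Omega> f (u \<epsilon> p))) integrable_on {s..t}"
          "(u \<epsilon> t, v \<epsilon> t) = T \<epsilon> (t - s) (u \<epsilon> s, v \<epsilon> s) +
            integral {s..t} (\<lambda>p. T \<epsilon> (t - p) (0, (1 / \<epsilon>) *\<^sub>R nemytskii \<Omega> f (u \<epsilon> p)))"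
          using \<epsilon>_sol(1) that unfolding full_solution_def by blast+
        then show ?thesis by (simp add: has_integral_iff)
      qed
    qed (rule \<epsilon>_sol)+
    have "wave_bound L lam R \<le> R'" by (simp add: R'_def)
    with W.uniform_regularity[of t]
    show "u \<epsilon> t \<in> dom_A \<Omega> a \<beta>"
      "\<exists>w\<in>H10 \<Omega>. h1_l2 w = v \<epsilon> t \<and> (\<exists>v'. (v \<epsilon> has_vector_derivative v') (at t) \<and>
        (norm (op_A \<Omega> a \<beta> (u \<epsilon> t)))\<^sup>2 + form \<Omega> a \<beta> w w + \<epsilon> * (norm v')\<^sup>2 \<le> R')"
      unfolding dom_eq op_eq_op_A by (blast, blast intro: order_trans)
  qed
qed

end
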